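(* Let $(M,c)$ be a conformal manifold of dimension $n$ and let $(E,h,\varphi,\nabla^E,D)$ be a Clifford-Weyl structure of rank $r\ge 2$ on $(M,c)$. (a) If $(n,r)\notin\{(2,2),(4,2),(4,3),(4,4),(8,8),(8,4)\}$, then the Weyl connection $D$ is closed. (b) If $(n,r)=(8,4)$ and the restriction of the Clifford morphism $\varphi$ to $\Lambda^2E$ is not injective, then the Weyl connection $D$ is closed.
   Context: Manifolds are smooth and connected. A conformal manifold $(M,c)$ is a manifold with a conformal class $c$ of Riemannian metrics. Weyl structures. A Weyl structure (or Weyl connection) $D$ on $(M,c)$ is a torsion-free linear connection on $\mathrm{T}M$ preserving $c$. Equivalently, for each metric $g\in c$ there is a 1-form $\theta$ (the Lee form of $D$ with respect to $g$) with $Dg=-2\theta\otimes g$. The 2-form $F=\mathrm{d}\theta$ (the Faraday form) does not depend on the choice of $g\in c$. $D$ is called closed if $F=0$, equivalently if $D$ is locally the Levi-Civita connection of a metric in the conformal class. Locally defined Euclidean bundles. Let $\mathrm{PSO}(k)=\mathrm{SO}(k)$ if $k$ is odd and $\mathrm{PSO}(k)=\mathrm{SO}(k)/\{\pm \mathrm{I}_k\}$ if $k$ is even. A locally defined oriented Euclidean rank $k$ vector bundle $(E,h)$ over $M$ is a principal $\mathrm{PSO}(k)$-bundle over $M$. Over contractible open sets its structure group reduces to $\mathrm{SO}(k)$, so it gives an actual oriented Euclidean rank $k$ vector bundle there. A metric connection $\nabla^E$ on $(E,h)$ is a connection on this principal bundle. Bundles associated with representations of $\mathrm{SO}(k)$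 that descend to $\mathrm{PSO}(k)$, such as $\Lambda^2E$ and the even Clifford algebra bundle $\mathrm{Cl}^0(E,h)$, are globally defined vector bundles with connection induced by $\nabla^E$. The Clifford algebra convention is $\xi\cdot\xi=-h(\xi,\xi)1$, and $\Lambda^2E\subset \mathrm{Cl}^0(E,h)$ via $\xi\wedge\eta\mapsto \xi\cdot\eta+h(\xi,\eta)1$. Clifford-Weyl structures. Let $\mathrm{End}^-(\mathrm{T}M)$ be the bundle of endomorphisms of $\mathrm{T}M$ that are skew-symmetric with respect to one (equivalently any) metric in $c$. A rank $r\ge 2$ Clifford-Weyl structure on a conformal manifold $(M^n,c)$ is a tuple $(E,h,\varphi,\nabla^E,D)$ where: - $(E,h)$ is an oriented locally defined rank $r$ Euclidean bundle over $M$; - $\varphi:\mathrm{Cl}^0(E,h)\to\mathrm{End}(\mathrm{T}M)$ is a (unital, in particular non-vanishing) algebra bundle morphism, called the Clifford morphism, mapping $\Lambda^2E$ into $\mathrm{End}^-(\mathrm{T}M)$; - $\nabla^E$ is a metric connection on $E$; - $D$ is a Weyl connection on $(M,c)$; such that $\varphi$, seen as a section of $\mathrm{Cl}^0(E,h)^*\otimes\mathrm{End}(\mathrm{T}M)$, is parallel with respect to $\nabla^E\otimes D$. *)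

theory Defs
  imports "HOL-Analysis.Analysis" "HOL-Algebra.Coset"
begin

section \<open>Smooth manifolds\<close>

primrec Ck_on :: "nat \<Rightarrow> 'a::euclidean_space set \<Rightarrow> ('a \<Rightarrow> 'b::real_normed_vector) \<Rightarrow> bool" where
  "Ck_on 0 S f \<longleftrightarrow> continuous_on S f"
| "Ck_on (Suc k) S f \<longleftrightarrow>
     (\<forall>x\<in>S. f differentiable (at x)) \<and>
     (\<forall>v. Ck_on k S (\<lambda>x. frechet_derivative f (at x) v))"

text \<open>Only used for open \<open>S\<close>.\<close>
definition smooth_on :: "'a::euclidean_space set \<Rightarrow> ('a \<Rightarrow> 'b::real_normed_vector) \<Rightarrow> bool" where
  "smooth_on S f \<longleftrightarrow> (\<forall>k. Ck_on k S f)"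

type_synonym ('x, 'e) chart = "'x set \<times> ('x \<Rightarrow> 'e)"

definition chart_inv :: "('x, 'e) chart \<Rightarrow> 'e \<Rightarrow> 'x" where
  "chart_inv c = inv_into (fst c) (snd c)"

text \<open>A manifold is a whole type, whose class supplies the Hausdorff and second countability axioms,
  together with a smooth atlas. The total space of a bundle need not be connected, so connectedness
  is required separately.\<close>
definition smooth_atlas :: "('x::{t2_space, second_countable_topology}, 'e::euclidean_space) chart set \<Rightarrow> bool"
  where
  "smooth_atlas A \<longleftrightarrow>
     (\<Union>c\<in>A. fst c) = UNIV \<and>
     (\<forall>c\<in>A. open (fst c) \<and> open (snd c ` fst c) \<and>
             homeomorphism (fst c) (snd c ` fst c) (snd c) (chart_inv c)) \<and>
     (\<forall>c\<in>A. \<forall>d\<in>A. smooth_on (snd c ` (fst c \<inter> fst d)) (snd d \<circ> chart_inv c))"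

definition euclidean_atlas :: "('e, 'e::euclidean_space) chart set" where
  "euclidean_atlas = {(UNIV, id)}"

definition prod_atlas :: "('x, 'e) chart set \<Rightarrow> ('y, 'f) chart set \<Rightarrow> ('x \<times> 'y, 'e \<times> 'f) chart set" where
  "prod_atlas A B = {(fst c \<times> fst d, map_prod (snd c) (snd d)) | c d. c \<in> A \<and> d \<in> B}"

definition smooth_map :: "('x::topological_space, 'e::euclidean_space) chart set \<Rightarrow>
    ('y::topological_space, 'f::euclidean_space) chart set \<Rightarrow> 'x set \<Rightarrow> ('x \<Rightarrow> 'y) \<Rightarrow> bool" where
  "smooth_map A B W f \<longleftrightarrow> open W \<and> continuous_on W f \<and>
     (\<forall>c\<in>A. \<forall>d\<in>B. smooth_on (snd c ` {x \<in> fst c \<inter> W. f x \<in> fst d}) (snd d \<circ> f \<circ> chart_inv c))"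

abbreviation smooth_fun :: "('x::topological_space, 'e::euclidean_space) chart set \<Rightarrow> 'x set \<Rightarrow>
    ('x \<Rightarrow> 'b::euclidean_space) \<Rightarrow> bool" where
  "smooth_fun A W f \<equiv> smooth_map A euclidean_atlas W f"


section \<open>Tangent vectors and tensor fields\<close>

text \<open>At every point \<open>x\<close> one chart around \<open>x\<close> is selected once and for all, and the tangent space at
  \<open>x\<close> is the model space \<open>'e\<close>: a vector of \<open>'e\<close> stands for the tangent vector with these components
  in the selected chart. No continuity of the selection in \<open>x\<close> is assumed; smoothness of a vector
  field \<open>X :: 'x \<Rightarrow> 'e\<close> is tested after conversion, by \<open>tangent_map A euclidean_atlas (snd c) x\<close>,
  to the components in a fixed chart \<open>c\<close>.\<close>
definition chart_at :: "('x, 'e) chart set \<Rightarrow> 'x \<Rightarrow> ('x, 'e) chart" where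
  "chart_at A x = (SOME c. c \<in> A \<and> x \<in> fst c)"

definition tangent_map :: "('x, 'e::euclidean_space) chart set \<Rightarrow> ('y, 'f::euclidean_space) chart set \<Rightarrow>
    ('x \<Rightarrow> 'y) \<Rightarrow> 'x \<Rightarrow> 'e \<Rightarrow> 'f" where
  "tangent_map A B f x =
     frechet_derivative (snd (chart_at B (f x)) \<circ> f \<circ> chart_inv (chart_at A x))
       (at (snd (chart_at A x) x))"

abbreviation dfun :: "('x, 'e::euclidean_space) chart set \<Rightarrow> ('x \<Rightarrow> 'b::euclidean_space) \<Rightarrow> 'x \<Rightarrow> 'e \<Rightarrow> 'b"
  where "dfun A f x v \<equiv> tangent_map A euclidean_atlas f x v"

definition smooth_vector_field :: "('x::topological_space, 'e::euclidean_space) chart set \<Rightarrow> 'x set \<Rightarrow>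
    ('x \<Rightarrow> 'e) \<Rightarrow> bool" where
  "smooth_vector_field A W X \<longleftrightarrow> open W \<and>
     (\<forall>c\<in>A. smooth_fun A (fst c \<inter> W) (\<lambda>x. dfun A (snd c) x (X x)))"

text \<open>The components of \<open>[X, Y]\<close> at \<open>x\<close> in the selected chart at \<open>x\<close> are \<open>X (Y\<^sup>i) - Y (X\<^sup>i)\<close>.\<close>
definition lie_bracket :: "('x, 'e::euclidean_space) chart set \<Rightarrow> ('x \<Rightarrow> 'e) \<Rightarrow> ('x \<Rightarrow> 'e) \<Rightarrow> 'x \<Rightarrow> 'e" where
  "lie_bracket A X Y x =
     (let u = snd (chart_at A x)
      in dfun A (\<lambda>y. dfun A u y (Y y)) x (X x) - dfun A (\<lambda>y. dfun A u y (X y)) x (Y x))"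

definition one_form :: "('x::topological_space, 'e::euclidean_space) chart set \<Rightarrow>
    ('x \<Rightarrow> 'e \<Rightarrow> 'b::euclidean_space) \<Rightarrow> bool" where
  "one_form A \<theta> \<longleftrightarrow> (\<forall>x. linear (\<theta> x)) \<and>
     (\<forall>W X. smooth_vector_field A W X \<longrightarrow> smooth_fun A W (\<lambda>x. \<theta> x (X x)))"

definition ext_deriv :: "('x, 'e::euclidean_space) chart set \<Rightarrow> ('x \<Rightarrow> 'e \<Rightarrow> real) \<Rightarrow>
    ('x \<Rightarrow> 'e) \<Rightarrow> ('x \<Rightarrow> 'e) \<Rightarrow> 'x \<Rightarrow> real" where
  "ext_deriv A \<theta> X Y x =
     dfun A (\<lambda>y. \<theta> y (Y y)) x (X x) - dfun A (\<lambda>y. \<theta> y (X y)) x (Y x) - \<theta> x (lie_bracket A X Y x)"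

definition riemannian_metric :: "('x::topological_space, 'e::euclidean_space) chart set \<Rightarrow>
    ('x \<Rightarrow> 'e \<Rightarrow> 'e \<Rightarrow> real) \<Rightarrow> bool" where
  "riemannian_metric A g \<longleftrightarrow>
     (\<forall>x. bilinear (g x) \<and> (\<forall>u v. g x u v = g x v u) \<and> (\<forall>v. v \<noteq> 0 \<longrightarrow> g x v v > 0)) \<and>
     (\<forall>W X Y. smooth_vector_field A W X \<longrightarrow> smooth_vector_field A W Y \<longrightarrow>
        smooth_fun A W (\<lambda>x. g x (X x) (Y x)))"

definition conformal_class :: "('x::topological_space, 'e::euclidean_space) chart set \<Rightarrow>
    ('x \<Rightarrow> 'e \<Rightarrow> 'e \<Rightarrow> real) set \<Rightarrow> bool" where
  "conformal_class A c \<longleftrightarrow>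
     (\<exists>g. riemannian_metric A g \<and>
        c = {(\<lambda>x u v. exp (2 * f x) * g x u v) | f. smooth_fun A UNIV f})"

definition conformal_manifold :: "('x::{t2_space, second_countable_topology}, 'e::euclidean_space) chart set \<Rightarrow>
    ('x \<Rightarrow> 'e \<Rightarrow> 'e \<Rightarrow> real) set \<Rightarrow> bool" where
  "conformal_manifold A c \<longleftrightarrow> smooth_atlas A \<and> connected (UNIV :: 'x set) \<and> conformal_class A c"


section \<open>Weyl structures\<close>

text \<open>\<open>D Y x v\<close> is the covariant derivative at \<open>x\<close> of the vector field \<open>Y\<close> in the direction \<open>v\<close>. It is
  meaningful as soon as \<open>Y\<close> is smooth near \<open>x\<close>, and depends only on the germ of \<open>Y\<close> at \<open>x\<close>.\<close>
type_synonym ('x, 'e) cov_deriv = "('x \<Rightarrow> 'e) \<Rightarrow> 'x \<Rightarrow> 'e \<Rightarrow> 'e"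

definition linear_connection :: "('x::topological_space, 'e::euclidean_space) chart set \<Rightarrow>
    ('x, 'e) cov_deriv \<Rightarrow> bool" where
  "linear_connection A D \<longleftrightarrow>
     (\<forall>W Y. smooth_vector_field A W Y \<longrightarrow>
        (\<forall>x\<in>W. linear (D Y x)) \<and>
        (\<forall>X. smooth_vector_field A W X \<longrightarrow> smooth_vector_field A W (\<lambda>x. D Y x (X x))) \<and>
        (\<forall>Z. smooth_vector_field A W Z \<longrightarrow>
           (\<forall>x\<in>W. \<forall>v. D (\<lambda>y. Y y + Z y) x v = D Y x v + D Z x v)) \<and>
        (\<forall>f. smooth_fun A W f \<longrightarrow>
           (\<forall>x\<in>W. \<forall>v. D (\<lambda>y. f y *\<^sub>R Y y) x v = dfun A f x v *\<^sub>R Y x + f x *\<^sub>R D Y x v)) \<and>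
        (\<forall>Z. (\<forall>y\<in>W. Z y = Y y) \<longrightarrow> (\<forall>x\<in>W. \<forall>v. D Z x v = D Y x v)))"

definition torsion_free :: "('x::topological_space, 'e::euclidean_space) chart set \<Rightarrow>
    ('x, 'e) cov_deriv \<Rightarrow> bool" where
  "torsion_free A D \<longleftrightarrow>
     (\<forall>W X Y. smooth_vector_field A W X \<longrightarrow> smooth_vector_field A W Y \<longrightarrow>
        (\<forall>x\<in>W. D Y x (X x) - D X x (Y x) = lie_bracket A X Y x))"

text \<open>\<open>D g = -2 \<theta> \<otimes> g\<close>\<close>
definition Lee_form :: "('x::topological_space, 'e::euclidean_space) chart set \<Rightarrow>
    ('x, 'e) cov_deriv \<Rightarrow> ('x \<Rightarrow> 'e \<Rightarrow> 'e \<Rightarrow> real) \<Rightarrow> ('x \<Rightarrow> 'e \<Rightarrow> real) \<Rightarrow> bool" where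
  "Lee_form A D g \<theta> \<longleftrightarrow> one_form A \<theta> \<and>
     (\<forall>W Y Z. smooth_vector_field A W Y \<longrightarrow> smooth_vector_field A W Z \<longrightarrow>
        (\<forall>x\<in>W. \<forall>v. dfun A (\<lambda>y. g y (Y y) (Z y)) x v - g x (D Y x v) (Z x) - g x (Y x) (D Z x v)
                 = - 2 * \<theta> x v * g x (Y x) (Z x)))"

definition Weyl_connection :: "('x::topological_space, 'e::euclidean_space) chart set \<Rightarrow>
    ('x \<Rightarrow> 'e \<Rightarrow> 'e \<Rightarrow> real) set \<Rightarrow> ('x, 'e) cov_deriv \<Rightarrow> bool" where
  "Weyl_connection A c D \<longleftrightarrow> linear_connection A D \<and> torsion_free A D \<and> (\<forall>g\<in>c. \<exists>\<theta>. Lee_form A D g \<theta>)"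

text \<open>The Faraday form \<open>F = d\<theta>\<close> vanishes, for the Lee form with respect to every metric in \<open>c\<close>.\<close>
definition closed_Weyl :: "('x::topological_space, 'e::euclidean_space) chart set \<Rightarrow>
    ('x \<Rightarrow> 'e \<Rightarrow> 'e \<Rightarrow> real) set \<Rightarrow> ('x, 'e) cov_deriv \<Rightarrow> bool" where
  "closed_Weyl A c D \<longleftrightarrow>
     (\<forall>g\<in>c. \<forall>\<theta>. Lee_form A D g \<theta> \<longrightarrow>
        (\<forall>W X Y. smooth_vector_field A W X \<longrightarrow> smooth_vector_field A W Y \<longrightarrow>
           (\<forall>x\<in>W. ext_deriv A \<theta> X Y x = 0)))"


section \<open>The Clifford algebra of Euclidean space\<close>

type_synonym 'r sqmat = "real ^ 'r ^ 'r"

text \<open>The coefficient of \<open>a :: 'r cl\<close> at \<open>S = {i\<^sub>1 < \<dots> < i\<^sub>k}\<close> is the one of \<open>e\<^bsub>i\<^sub>1\<^esub> \<cdots> e\<^bsub>i\<^sub>k\<^esub>\<close>, where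
  \<open>e\<^sub>i\<^sup>2 = -1\<close>. The order of \<open>'r\<close> only serves to select this basis.\<close>
type_synonym 'r cl = "real ^ ('r set)"

definition blade_sign :: "'r::{finite, linorder} set \<Rightarrow> 'r set \<Rightarrow> real" where
  "blade_sign S T = (\<Prod>s\<in>S. \<Prod>t\<in>T. if t \<le> s then -1 else 1)"

definition cl_mult :: "'r::{finite, linorder} cl \<Rightarrow> 'r cl \<Rightarrow> 'r cl" (infixl "\<odot>" 70) where
  "a \<odot> b = (\<Sum>S\<in>UNIV. \<Sum>T\<in>UNIV. (a $ S * b $ T * blade_sign S T) *\<^sub>R axis (sym_diff S T) 1)"

definition cl_one :: "'r::{finite, linorder} cl" where
  "cl_one = axis {} 1"

definition cl_vec :: "real ^ 'r::{finite, linorder} \<Rightarrow> 'r cl" where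
  "cl_vec v = (\<Sum>i\<in>UNIV. (v $ i) *\<^sub>R axis {i} 1)"

definition cl_even :: "'r::{finite, linorder} cl set" where
  "cl_even = {a. \<forall>S. odd (card S) \<longrightarrow> a $ S = 0}"

definition cl_Lambda2 :: "'r::{finite, linorder} cl set" where
  "cl_Lambda2 = span {cl_vec \<xi> \<odot> cl_vec \<eta> + (\<xi> \<bullet> \<eta>) *\<^sub>R cl_one | \<xi> \<eta>. True}"

primrec cl_act_list :: "'r::{finite, linorder} sqmat \<Rightarrow> 'r list \<Rightarrow> 'r cl" where
  "cl_act_list g [] = cl_one"
| "cl_act_list g (i # is) = cl_vec (g *v axis i 1) \<odot> cl_act_list g is"

primrec cl_der_list :: "'r::{finite, linorder} sqmat \<Rightarrow> 'r list \<Rightarrow> 'r cl" where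
  "cl_der_list B [] = 0"
| "cl_der_list B (i # is) =
     cl_vec (B *v axis i 1) \<odot> cl_act_list (mat 1) is + cl_vec (axis i 1) \<odot> cl_der_list B is"

text \<open>The algebra automorphism extending the orthogonal map \<open>g\<close>, and the derivation extending the
  skew-symmetric map \<open>B\<close>, i.e. the induced representations of \<open>SO(r)\<close> and of its Lie algebra.\<close>
definition cl_act :: "'r::{finite, linorder} sqmat \<Rightarrow> 'r cl \<Rightarrow> 'r cl" where
  "cl_act g a = (\<Sum>S\<in>UNIV. (a $ S) *\<^sub>R cl_act_list g (sorted_list_of_set S))"

definition cl_der :: "'r::{finite, linorder} sqmat \<Rightarrow> 'r cl \<Rightarrow> 'r cl" where
  "cl_der B a = (\<Sum>S\<in>UNIV. (a $ S) *\<^sub>R cl_der_list B (sorted_list_of_set S))"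


text \<open>The following facts show that \<open>cl_mult\<close> is the product of the Clifford algebra with
  \<open>\<xi> \<odot> \<xi> = - \<bar>\<xi>\<bar>\<^sup>2\<close>, and that \<open>cl_act\<close> and \<open>cl_der\<close> are the asserted extensions.\<close>
declare sorted_list_of_set_insert_remove [simp del]

lemma prod_sym_diff_involutive:
  fixes f :: "'a::finite \<Rightarrow> real"
  assumes "\<And>x. f x * f x = 1"
  shows "prod f (sym_diff S T) = prod f S * prod f T"
proof -
  have 1: "prod f S = prod f (S - T) * prod f (S \<inter> T)"
    by (metis Diff_Diff_Int Diff_subset finite prod.subset_diff mult.commute)
  have 2: "prod f T = prod f (T - S) * prod f (S \<inter> T)"
    by (metis Diff_Diff_Int Diff_subset finite prod.subset_diff mult.commute Int_commute)
  have 3: "prod f (S \<inter> T) * prod f (S \<inter> T) = 1"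
    by (simp add: assms flip: prod.distrib)
  have "prod f (sym_diff S T) = prod f (S - T) * prod f (T - S)"
    by (rule prod.union_disjoint) auto
  then show ?thesis using 1 2 3 by (simp add: algebra_simps) 
qed

lemma blade_sign_left: "blade_sign (sym_diff S T) U = blade_sign S U * blade_sign T U"
  unfolding blade_sign_def
  by (rule prod_sym_diff_involutive) (simp flip: prod.distrib, rule prod.neutral, auto)

lemma blade_sign_right: "blade_sign S (sym_diff T U) = blade_sign S T * blade_sign S U"
  unfolding blade_sign_def
  by (subst prod_sym_diff_involutive) (auto simp: prod.distrib)

lemma cl_mult_bilinear: "bilinear (\<odot>)"
  unfolding bilinear_def cl_mult_def
  by (auto intro!: linearI simp: algebra_simps sum.distrib scaleR_sum_right)

lemma cl_mult_linear_left: "linear (\<lambda>x. x \<odot> y)" and cl_mult_linear_right: "linear (\<lambda>y. x \<odot> y)"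
  using cl_mult_bilinear unfolding bilinear_def by blast+

lemmas cl_mult_left_simps = linear_sum[OF cl_mult_linear_left] linear_cmul[OF cl_mult_linear_left]
  linear_add[OF cl_mult_linear_left]
lemmas cl_mult_right_simps = linear_sum[OF cl_mult_linear_right] linear_cmul[OF cl_mult_linear_right]
  linear_add[OF cl_mult_linear_right]

lemma cl_mult_minus_left: "(- a) \<odot> b = - (a \<odot> b)"
  using linear_neg[OF cl_mult_linear_left] .

lemma cl_mult_axis: "axis S 1 \<odot> axis T 1 = blade_sign S T *\<^sub>R axis (sym_diff S T) 1"
proof -
  have "axis S 1 \<odot> axis T 1 = (\<Sum>S'\<in>UNIV. if S' = S then \<Sum>T'\<in>UNIV. if T' = T then
          blade_sign S T *\<^sub>R axis (sym_diff S T) 1 else 0 else 0)"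
    unfolding cl_mult_def
    by (rule sum.cong[OF refl], case_tac "x = S") (auto simp: axis_def[of _ 1] simp del: sum.delta intro!: sum.cong)
  then show ?thesis by simp
qed

lemma cl_expand: "(a :: 'r::{finite,linorder} cl) = (\<Sum>S\<in>UNIV. a $ S *\<^sub>R axis S 1)"
  by (simp add: vec_eq_iff axis_def if_distrib cong: if_cong)

lemma cl_mult_assoc: "(a \<odot> b) \<odot> c = a \<odot> (b \<odot> c)"
proof -
  have ax: "(axis S 1 \<odot> axis T 1) \<odot> axis U 1 = axis S 1 \<odot> (axis T 1 \<odot> axis U 1)" for S T U :: "'a set"
  proof -
    have "sym_diff (sym_diff S T) U = sym_diff S (sym_diff T U)" by auto
    then show ?thesis
      by (simp add: cl_mult_axis cl_mult_left_simps cl_mult_right_simps blade_sign_left blade_sign_right)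
  qed
  show ?thesis
    apply (subst (1 2) cl_expand[of a], subst (1 2) cl_expand[of b], subst (1 2) cl_expand[of c])
    by (simp add: cl_mult_left_simps cl_mult_right_simps ax)
qed

lemma cl_mult_one: "cl_one \<odot> a = a" "a \<odot> cl_one = a"
proof -
  show "cl_one \<odot> a = a"
    by (subst (1 2) cl_expand[of a]) (simp add: cl_mult_right_simps cl_one_def cl_mult_axis blade_sign_def)
  show "a \<odot> cl_one = a"
    by (subst (1 2) cl_expand[of a]) (simp add: cl_mult_left_simps cl_one_def cl_mult_axis blade_sign_def)
qed

lemma cl_vec_anticommute: "cl_vec \<xi> \<odot> cl_vec \<eta> + cl_vec \<eta> \<odot> cl_vec \<xi> = (- 2 * (\<xi> \<bullet> \<eta>)) *\<^sub>R cl_one"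
proof -
  have e: "axis {i} 1 \<odot> axis {j} 1 + axis {j} 1 \<odot> axis {i} 1 = (if i = j then - 2 else 0) *\<^sub>R cl_one" 
    for i j :: 'a
    by (auto simp: cl_mult_axis blade_sign_def cl_one_def insert_commute vec_eq_iff insert_Diff_if Un_commute)
  have p: "cl_vec v \<odot> cl_vec w = (\<Sum>i\<in>UNIV. \<Sum>j\<in>UNIV. (v $ i * w $ j) *\<^sub>R (axis {i} 1 \<odot> axis {j} 1))"
    for v w :: "real ^ 'a::{finite,linorder}"
    unfolding cl_vec_def cl_mult_left_simps by (simp add: cl_mult_right_simps scaleR_sum_right)
  have "cl_vec \<xi> \<odot> cl_vec \<eta> + cl_vec \<eta> \<odot> cl_vec \<xi> = 
     (\<Sum>i\<in>UNIV. \<Sum>j\<in>UNIV. (\<xi> $ i * \<eta> $ j) *\<^sub>R (axis {i} 1 \<odot> axis {j} 1 + axis {j} 1 \<odot> axis {i} 1))"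
    unfolding p[of \<xi> \<eta>] p[of \<eta> \<xi>] scaleR_add_right sum.distrib
    by (rule arg_cong2[where f = "(+)", OF refl], subst sum.swap) (simp add: mult.commute)
  also have "\<dots> = (\<Sum>i\<in>UNIV. \<Sum>j\<in>UNIV. if j = i then (- 2 * \<xi> $ i * \<eta> $ i) *\<^sub>R cl_one else 0)"
    unfolding e by (intro sum.cong) auto
  also have "\<dots> = (- 2 * (\<xi> \<bullet> \<eta>)) *\<^sub>R cl_one"
    by (simp add: inner_vec_def scaleR_sum_left sum_distrib_left mult.assoc sum_negf)
  finally show ?thesis .
qed

lemma cl_vec_linear: "linear cl_vec"
  unfolding cl_vec_def by (auto intro!: linearI simp: algebra_simps sum.distrib scaleR_sum_right)

lemma cl_vec_axis: "cl_vec (axis i 1) = axis {i} 1"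
proof -
  have "cl_vec (axis i 1) = (\<Sum>j\<in>UNIV. if j = i then axis {i} 1 else 0)"
    unfolding cl_vec_def by (rule sum.cong) (auto simp: axis_def)
  then show ?thesis by simp
qed

lemma sorted_list_of_set_min:
  fixes i :: "'r::{finite, linorder}"
  assumes "\<And>t. t \<in> T \<Longrightarrow> i < t"
  shows "sorted_list_of_set (insert i T) = i # sorted_list_of_set T"
proof -
  have "i \<notin> T" and "Min (insert i T) = i"
    using assms by (auto intro!: Min_eqI simp: less_imp_le)
  then show ?thesis by (simp add: sorted_list_of_set_nonempty)
qed

lemma linorder_min_induct [case_names empty insert]:
  fixes S :: "'r::{finite, linorder} set"
  assumes "Q {}" and "\<And>m T. (\<And>t. t \<in> T \<Longrightarrow> m < t) \<Longrightarrow> Q T \<Longrightarrow> Q (insert m T)"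
  shows "Q S"
  by (rule finite_linorder_min_induct[OF finite, of Q S]) (use assms in auto)

lemma blade_sign_min: "(\<And>t. t \<in> T \<Longrightarrow> i < t) \<Longrightarrow> blade_sign {i} T = 1"
  unfolding blade_sign_def by (auto intro!: prod.neutral) (meson leD)

lemma blade_sign_insert: "m \<notin> T \<Longrightarrow> blade_sign S (insert m T) = blade_sign S {m} * blade_sign S T"
  unfolding blade_sign_def by (simp add: prod.distrib)

abbreviation blade_act :: "'r::{finite, linorder} sqmat \<Rightarrow> 'r set \<Rightarrow> 'r cl" where
  "blade_act g S \<equiv> cl_act_list g (sorted_list_of_set S)"

abbreviation blade_der :: "'r::{finite, linorder} sqmat \<Rightarrow> 'r set \<Rightarrow> 'r cl" where
  "blade_der B S \<equiv> cl_der_list B (sorted_list_of_set S)"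

lemma blade: "blade_act (mat 1) S = axis S 1"
proof (induction S rule: linorder_min_induct)
  case empty then show ?case by (simp add: cl_one_def)
next
  case (insert m T)
  have "sym_diff {m} T = insert m T" using insert(1) by auto
  then show ?case using insert
    by (simp add: sorted_list_of_set_min cl_vec_axis cl_mult_axis blade_sign_min)
qed

lemma orthogonal_axis:
  fixes g :: "'r::finite sqmat"
  assumes "orthogonal_matrix g"
  shows "(g *v axis i 1) \<bullet> (g *v axis j 1) = (if i = j then 1 else 0)"
proof -
  have "orthogonal_transformation ((*v) g)"
    using assms by (simp add: orthogonal_transformation_matrix matrix_of_matrix_vector_mul)
  then have "(g *v axis i 1) \<bullet> (g *v axis j 1) = axis i 1 \<bullet> axis j (1::real)"
    unfolding orthogonal_transformation_def by blast
  then show ?thesis by (simp add: inner_axis_axis)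
qed

lemma blade_act_step:
  assumes g: "orthogonal_matrix g"
  shows "cl_vec (g *v axis i 1) \<odot> blade_act g T = blade_sign {i} T *\<^sub>R blade_act g (sym_diff {i} T)"
proof (induction T rule: linorder_min_induct)
  case empty then show ?case by (simp add: blade_sign_def)
next
  case (insert m T)
  let ?G = "\<lambda>i. cl_vec (g *v axis i 1)"
  have mT: "m \<notin> T" using insert(1) by blast
  have ac: "?G j \<odot> ?G k = - (?G k \<odot> ?G j)" if "j \<noteq> k" for j k
    using cl_vec_anticommute[of "g *v axis j 1" "g *v axis k 1"] orthogonal_axis[OF g, of j k] that
    by (simp add: eq_neg_iff_add_eq_0)
  consider "i < m" | "i = m" | "m < i" by fastforce
  then show ?case
  proof cases
    case 1
    have lt: "\<And>t. t \<in> insert m T \<Longrightarrow> i < t" using 1 insert(1) by (metis insertE less_trans)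
    then have "sym_diff {i} (insert m T) = insert i (insert m T)" by auto
    then show ?thesis using sorted_list_of_set_min[of "insert m T" i, OF lt] blade_sign_min[of "insert m T" i, OF lt] by simp
  next
    case 2
    have "(2::real) *\<^sub>R (?G m \<odot> ?G m) = 2 *\<^sub>R (- cl_one)"
      using cl_vec_anticommute[of "g *v axis m 1" "g *v axis m 1"] orthogonal_axis[OF g, of m m]
      by (simp add: scaleR_2)
    then have G2: "?G m \<odot> ?G m = - cl_one"
      unfolding scaleR_cancel_left by simp
    have "sym_diff {i} (insert m T) = T" using 2 mT by auto
    moreover have "blade_sign {i} (insert m T) = - 1"
    proof -
      have "blade_sign {m} T = 1" using insert(1) by (rule blade_sign_min)
      then show ?thesis unfolding 2 blade_sign_insert[OF mT] by (simp add: blade_sign_def)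
    qed
    moreover have "?G m \<odot> (?G m \<odot> blade_act g T) = - blade_act g T"
      unfolding cl_mult_assoc[symmetric] G2
      by (simp add: cl_mult_one cl_mult_minus_left)
    ultimately show ?thesis using 2 insert(1) by (simp add: sorted_list_of_set_min)
  next
    case 3
    have lt: "\<And>t. t \<in> sym_diff {i} T \<Longrightarrow> m < t" using 3 insert(1) by auto
    have sd: "sym_diff {i} (insert m T) = insert m (sym_diff {i} T)" using 3 mT by auto
    have sg: "blade_sign {i} (insert m T) = - blade_sign {i} T"
      unfolding blade_sign_insert[OF mT] using 3 by (simp add: blade_sign_def)
    have "?G i \<odot> (?G m \<odot> blade_act g T) = - (?G m \<odot> (?G i \<odot> blade_act g T))"
      unfolding cl_mult_assoc[symmetric] using ac[of i m] 3
      by (simp add: linear_neg[OF cl_mult_linear_left])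
    also have "\<dots> = - (blade_sign {i} T *\<^sub>R (?G m \<odot> blade_act g (sym_diff {i} T)))"
      unfolding insert(2) cl_mult_right_simps ..
    finally show ?thesis
      using sorted_list_of_set_min[of "sym_diff {i} T" m] lt
      unfolding sd sg by (simp add: sorted_list_of_set_min[OF insert(1)])
  qed
qed

lemma blade_act_mult:
  assumes g: "orthogonal_matrix g"
  shows "blade_act g S \<odot> blade_act g T = blade_sign S T *\<^sub>R blade_act g (sym_diff S T)"
proof (induction S rule: linorder_min_induct)
  case empty then show ?case by (simp add: blade_sign_def cl_mult_one)
next
  case (insert m S)
  have e: "insert m S = sym_diff {m} S" using insert(1) by auto
  have a: "sym_diff {m} (sym_diff S T) = sym_diff (insert m S) T" using insert(1) by auto
  have "blade_act g (insert m S) \<odot> blade_act g T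
      = blade_sign S T *\<^sub>R (cl_vec (g *v axis m 1) \<odot> blade_act g (sym_diff S T))"
    by (simp add: sorted_list_of_set_min[OF insert(1)] cl_mult_assoc insert(2) cl_mult_right_simps)
  also have "\<dots> = (blade_sign S T * blade_sign {m} (sym_diff S T)) *\<^sub>R blade_act g (sym_diff (insert m S) T)"
    unfolding blade_act_step[OF g] a by simp
  also have "blade_sign S T * blade_sign {m} (sym_diff S T) = blade_sign (insert m S) T"
    unfolding e blade_sign_left blade_sign_right by (simp add: blade_sign_min[of S m, OF insert(1)])
  finally show ?case .
qed

lemma cl_act_linear: "linear (cl_act g)"
  unfolding cl_act_def by (auto intro!: linearI simp: algebra_simps sum.distrib scaleR_sum_right)

lemma cl_der_linear: "linear (cl_der B)"
  unfolding cl_der_def by (auto intro!: linearI simp: algebra_simps sum.distrib scaleR_sum_right)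

lemma cl_act_axis: "cl_act g (axis S 1) = blade_act g S"
proof -
  have "cl_act g (axis S 1) = (\<Sum>T\<in>UNIV. if T = S then blade_act g S else 0)"
    unfolding cl_act_def by (rule sum.cong) (auto simp: axis_def)
  then show ?thesis by simp
qed

lemma cl_der_axis: "cl_der B (axis S 1) = blade_der B S"
proof -
  have "cl_der B (axis S 1) = (\<Sum>T\<in>UNIV. if T = S then blade_der B S else 0)"
    unfolding cl_der_def by (rule sum.cong) (auto simp: axis_def)
  then show ?thesis by simp
qed

lemma cl_act_one: "cl_act g cl_one = cl_one"
  unfolding cl_one_def cl_act_axis by (simp add: cl_one_def)

lemma cl_act_vec: "cl_act g (cl_vec v) = cl_vec (g *v v)"
proof -
  have "(\<Sum>i\<in>UNIV. v $ i *\<^sub>R axis i 1) = v"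
    using basis_expansion[of v] by (simp add: scalar_mult_eq_scaleR)
  then have "cl_vec (g *v v) = cl_vec (g *v (\<Sum>i\<in>UNIV. v $ i *\<^sub>R axis i 1))"
    by simp
  also have "\<dots> = (\<Sum>i\<in>UNIV. v $ i *\<^sub>R cl_vec (g *v axis i 1))"
    by (simp add: linear_sum[OF matrix_vector_mul_linear] linear_cmul[OF matrix_vector_mul_linear]
        linear_sum[OF cl_vec_linear] linear_cmul[OF cl_vec_linear])
  finally show ?thesis
    by (simp add: cl_vec_def[of v] linear_sum[OF cl_act_linear] linear_cmul[OF cl_act_linear]
        cl_act_axis cl_mult_one)
qed

lemma cl_der_vec: "cl_der B (cl_vec v) = cl_vec (B *v v)"
proof -
  have "(\<Sum>i\<in>UNIV. v $ i *\<^sub>R axis i 1) = v"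
    using basis_expansion[of v] by (simp add: scalar_mult_eq_scaleR)
  then have "cl_vec (B *v v) = cl_vec (B *v (\<Sum>i\<in>UNIV. v $ i *\<^sub>R axis i 1))"
    by simp
  also have "\<dots> = (\<Sum>i\<in>UNIV. v $ i *\<^sub>R cl_vec (B *v axis i 1))"
    by (simp add: linear_sum[OF matrix_vector_mul_linear] linear_cmul[OF matrix_vector_mul_linear]
        linear_sum[OF cl_vec_linear] linear_cmul[OF cl_vec_linear])
  finally show ?thesis
    by (simp add: cl_vec_def[of v] linear_sum[OF cl_der_linear] linear_cmul[OF cl_der_linear]
        cl_der_axis cl_mult_one linear_0[OF cl_mult_linear_right])
qed

lemma cl_act_mult:
  assumes "orthogonal_matrix g"
  shows "cl_act g (a \<odot> b) = cl_act g a \<odot> cl_act g b"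
  apply (subst cl_expand[of a], subst cl_expand[of b], subst (2) cl_expand[of a], subst (2) cl_expand[of b])
  by (simp add: cl_mult_left_simps cl_mult_right_simps linear_sum[OF cl_act_linear]
      linear_cmul[OF cl_act_linear] cl_act_axis blade_act_mult[OF assms] cl_mult_axis)

lemma blade_der_step:
  assumes B: "transpose B = - B"
  shows "cl_vec (B *v axis i 1) \<odot> axis T 1 + axis {i} 1 \<odot> blade_der B T
           = blade_sign {i} T *\<^sub>R blade_der B (sym_diff {i} T)"
proof (induction T rule: linorder_min_induct)
  case empty then show ?case
    by (simp add: blade_sign_def linear_0[OF cl_mult_linear_right] cl_vec_axis cl_one_def)
next
  case (insert m T)
  let ?E = "\<lambda>i. axis {i} 1" let ?B = "\<lambda>i. cl_vec (B *v axis i 1)"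
  have mT: "m \<notin> T" using insert(1) by blast
  have comp: "(B *v axis j 1) \<bullet> axis k 1 = B $ k $ j" for j k
    by (simp add: inner_axis matrix_vector_mult_basis column_def)
  have skew: "B $ k $ j = - B $ j $ k" for j k
    using arg_cong[OF B, of "\<lambda>M. M $ j $ k"] by (simp add: transpose_def)
  have EE: "?E j \<odot> ?E k + ?E k \<odot> ?E j = (if j = k then - 2 else 0) *\<^sub>R cl_one" for j k :: 'a
    using cl_vec_anticommute[of "axis j 1" "axis k 1"] by (simp add: cl_vec_axis inner_axis_axis)
  have BE: "(?B j \<odot> ?E k + ?E k \<odot> ?B j) + (?B k \<odot> ?E j + ?E j \<odot> ?B k) = 0" for j k
    using cl_vec_anticommute[of "B *v axis j 1" "axis k 1"] cl_vec_anticommute[of "B *v axis k 1" "axis j 1"]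
      skew[of j k] by (simp add: cl_vec_axis comp flip: scaleR_left.add)
  have ins: "axis (insert m T) 1 = ?E m \<odot> axis T 1"
  proof -
    have "sym_diff {m} T = insert m T" using mT by auto
    then show ?thesis by (simp add: cl_mult_axis blade_sign_min[of T m, OF insert(1)])
  qed
  have der: "blade_der B (insert m T) = ?B m \<odot> axis T 1 + ?E m \<odot> blade_der B T"
    by (simp add: sorted_list_of_set_min[OF insert(1)] blade cl_vec_axis)
  consider "i < m" | "i = m" | "m < i" by fastforce
  then show ?case
  proof cases
    case 1
    have lt: "\<And>t. t \<in> insert m T \<Longrightarrow> i < t" using 1 insert(1) by (metis insertE less_trans)
    then have "sym_diff {i} (insert m T) = insert i (insert m T)" by auto
    then show ?thesis using sorted_list_of_set_min[of "insert m T" i, OF lt] blade_sign_min[of "insert m T" i, OF lt]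
      by (simp add: blade cl_vec_axis)
  next
    case 2
    have E2: "?E m \<odot> ?E m = - cl_one"
      by (simp add: cl_mult_axis blade_sign_def cl_one_def)
    have BE0: "?B m \<odot> ?E m + ?E m \<odot> ?B m = 0"
      using BE[of m m] by (simp flip: scaleR_2)
    have "sym_diff {i} (insert m T) = T" using 2 mT by auto
    moreover have "blade_sign {i} (insert m T) = - 1"
    proof -
      have "blade_sign {m} T = 1" using insert(1) by (rule blade_sign_min)
      then show ?thesis unfolding 2 blade_sign_insert[OF mT] by (simp add: blade_sign_def)
    qed
    moreover have "?B m \<odot> (?E m \<odot> axis T 1) + ?E m \<odot> (?B m \<odot> axis T 1 + ?E m \<odot> blade_der B T)
        = (?B m \<odot> ?E m + ?E m \<odot> ?B m) \<odot> axis T 1 + (?E m \<odot> ?E m) \<odot> blade_der B T"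
      by (simp add: cl_mult_left_simps cl_mult_right_simps cl_mult_assoc)
    moreover have "\<dots> = - blade_der B T"
      unfolding BE0 E2
      by (simp add: cl_mult_one cl_mult_minus_left linear_0[OF cl_mult_linear_left])
    ultimately show ?thesis using 2 unfolding ins der by simp
  next
    case 3
    have lt: "\<And>t. t \<in> sym_diff {i} T \<Longrightarrow> m < t" using 3 insert(1) by auto
    have sd: "sym_diff {i} (insert m T) = insert m (sym_diff {i} T)" using 3 mT by auto
    have sg: "blade_sign {i} (insert m T) = - blade_sign {i} T"
      unfolding blade_sign_insert[OF mT] using 3 by (simp add: blade_sign_def)
    have E: "?E i \<odot> ?E m = - (?E m \<odot> ?E i)"
      using EE[of i m] 3 by (simp add: eq_neg_iff_add_eq_0)
    have BB: "?B i \<odot> ?E m + ?E i \<odot> ?B m = - (?E m \<odot> ?B i) - ?B m \<odot> ?E i"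
    proof -
      have eq: "x + w = - y - z" if "(x + y) + (z + w) = 0" for x y z w :: "'a cl"
      proof -
        have "x + w = ((x + y) + (z + w)) - y - z" by simp
        then show ?thesis using that by simp
      qed
      show ?thesis by (rule eq[OF BE])
    qed
    have "?B i \<odot> axis (insert m T) 1 + ?E i \<odot> blade_der B (insert m T)
        = (?B i \<odot> ?E m + ?E i \<odot> ?B m) \<odot> axis T 1 + (?E i \<odot> ?E m) \<odot> blade_der B T"
      unfolding ins der by (simp add: cl_mult_left_simps cl_mult_right_simps cl_mult_assoc)
    also have "\<dots> = - (?E m \<odot> (?B i \<odot> axis T 1 + ?E i \<odot> blade_der B T)) - ?B m \<odot> (?E i \<odot> axis T 1)"
      unfolding BB E
      by (simp add: cl_mult_left_simps cl_mult_right_simps cl_mult_assoc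
          linear_neg[OF cl_mult_linear_left] linear_diff[OF cl_mult_linear_left])
    also have "\<dots> = - (blade_sign {i} T *\<^sub>R
        (?B m \<odot> axis (sym_diff {i} T) 1 + ?E m \<odot> blade_der B (sym_diff {i} T)))"
      unfolding insert(2) cl_mult_axis cl_mult_right_simps by (simp add: algebra_simps)
    finally show ?thesis
      unfolding sd sg using sorted_list_of_set_min[of "sym_diff {i} T" m] lt
      by (auto simp: blade cl_vec_axis)
  qed
qed

lemma blade_der_mult:
  assumes B: "transpose B = - B"
  shows "blade_der B S \<odot> axis T 1 + axis S 1 \<odot> blade_der B T = blade_sign S T *\<^sub>R blade_der B (sym_diff S T)"
proof (induction S rule: linorder_min_induct)
  case empty then show ?case
    by (simp add: blade_sign_def cl_mult_one linear_0[OF cl_mult_linear_left] flip: cl_one_def)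
next
  case (insert m S)
  let ?E = "axis {m} 1" let ?B = "cl_vec (B *v axis m 1)"
  have e: "insert m S = sym_diff {m} S" using insert(1) by auto
  have a: "sym_diff {m} (sym_diff S T) = sym_diff (insert m S) T" using insert(1) by auto
  have ins: "axis (insert m S) 1 = ?E \<odot> axis S 1"
  proof -
    have "blade_sign {m} S = 1" using insert(1) by (rule blade_sign_min)
    then show ?thesis unfolding cl_mult_axis e[symmetric] by simp
  qed
  have "blade_der B (insert m S) \<odot> axis T 1 + axis (insert m S) 1 \<odot> blade_der B T
      = ?B \<odot> (axis S 1 \<odot> axis T 1) + ?E \<odot> (blade_der B S \<odot> axis T 1 + axis S 1 \<odot> blade_der B T)"
    unfolding ins
    by (simp add: sorted_list_of_set_min[OF insert(1)] cl_mult_left_simps cl_mult_right_simps cl_mult_assoc blade cl_vec_axis)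
  also have "\<dots> = blade_sign S T *\<^sub>R
      (?B \<odot> axis (sym_diff S T) 1 + ?E \<odot> blade_der B (sym_diff S T))"
    unfolding insert(2) cl_mult_axis cl_mult_right_simps by (simp add: algebra_simps)
  also have "\<dots> = (blade_sign S T * blade_sign {m} (sym_diff S T)) *\<^sub>R blade_der B (sym_diff (insert m S) T)"
    unfolding blade_der_step[OF B] a by simp
  also have "blade_sign S T * blade_sign {m} (sym_diff S T) = blade_sign (insert m S) T"
    unfolding e blade_sign_left blade_sign_right by (simp add: blade_sign_min[of S m, OF insert(1)])
  finally show ?case .
qed

lemma cl_der_mult:
  assumes "transpose B = - B"
  shows "cl_der B (a \<odot> b) = cl_der B a \<odot> b + a \<odot> cl_der B b"
proof -
  have e: "(\<beta> * (\<alpha> * blade_sign S T)) *\<^sub>R blade_der B (sym_diff S T)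
      = (\<beta> * \<alpha>) *\<^sub>R (blade_der B S \<odot> axis T 1) + (\<beta> * \<alpha>) *\<^sub>R (axis S 1 \<odot> blade_der B T)" for \<alpha> \<beta> S T
    using arg_cong[OF blade_der_mult[OF assms, of S T], of "\<lambda>x. (\<beta> * \<alpha>) *\<^sub>R x"]
    by (simp add: scaleR_add_right mult.assoc)
  show ?thesis
    apply (subst (1 2 3) cl_expand[of a], subst (1 2 3) cl_expand[of b])
    by (simp add: cl_mult_left_simps cl_mult_right_simps linear_sum[OF cl_der_linear]
      linear_cmul[OF cl_der_linear] cl_der_axis e cl_mult_axis
      scaleR_sum_right sum.distrib)
qed

declare sorted_list_of_set_insert_remove [simp]


section \<open>Locally defined oriented Euclidean bundles\<close>

definition SO :: "'r::finite sqmat monoid" where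
  "SO = \<lparr>carrier = {g. orthogonal_matrix g \<and> det g = 1}, monoid.mult = (**), one = mat 1\<rparr>"

definition SO_pm :: "'r::finite sqmat set" where
  "SO_pm = (if even CARD('r) then {mat 1, - mat 1} else {mat 1})"

definition PSO :: "'r::finite sqmat set monoid" where
  "PSO = SO Mod SO_pm"

definition PSO_class :: "'r::finite sqmat \<Rightarrow> 'r sqmat set" where
  "PSO_class g = SO_pm #>\<^bsub>SO\<^esub> g"

text \<open>Smoothness with respect to the Lie group structure of \<open>PSO\<close>, the one for which
  \<open>PSO_class :: SO \<Rightarrow> PSO\<close> is a covering: a map into \<open>PSO\<close> is smooth if it has local smooth lifts to
  \<open>SO\<close>; a map on \<open>W \<times> PSO\<close> is smooth if its pullback to \<open>W \<times> SO\<close> is, where \<open>SO\<close> is regarded as a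
  submanifold of the space of matrices.\<close>
definition smooth_into_PSO :: "('x::topological_space, 'e::euclidean_space) chart set \<Rightarrow> 'x set \<Rightarrow>
    ('x \<Rightarrow> 'r::finite sqmat set) \<Rightarrow> bool" where
  "smooth_into_PSO A W \<gamma> \<longleftrightarrow> open W \<and>
     (\<forall>x\<in>W. \<exists>N g. x \<in> N \<and> N \<subseteq> W \<and> smooth_fun A N g \<and>
        (\<forall>y\<in>N. g y \<in> carrier SO \<and> \<gamma> y = PSO_class (g y)))"

definition smooth_from_PSO :: "('x::topological_space, 'e::euclidean_space) chart set \<Rightarrow>
    ('y::topological_space, 'f::euclidean_space) chart set \<Rightarrow> 'x set \<Rightarrow>
    ('x \<Rightarrow> 'r::finite sqmat set \<Rightarrow> 'y) \<Rightarrow> bool" where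
  "smooth_from_PSO A B W \<Psi> \<longleftrightarrow> open W \<and>
     (\<forall>x\<in>W. \<forall>g \<in> carrier SO. \<exists>N \<Psi>'. (x, g) \<in> N \<and>
        smooth_map (prod_atlas A euclidean_atlas) B N \<Psi>' \<and>
        (\<forall>(y, h)\<in>N. y \<in> W \<and> h \<in> carrier SO \<longrightarrow> \<Psi>' (y, h) = \<Psi> y (PSO_class h)))"

definition smooth_section :: "('x::topological_space, 'e::euclidean_space) chart set \<Rightarrow>
    ('p::topological_space, 'f::euclidean_space) chart set \<Rightarrow> ('p \<Rightarrow> 'x) \<Rightarrow> 'x set \<Rightarrow> ('x \<Rightarrow> 'p) \<Rightarrow> bool" where
  "smooth_section A P \<pi> W s \<longleftrightarrow> smooth_map A P W s \<and> (\<forall>x\<in>W. \<pi> (s x) = x)"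

text \<open>\<open>P\<close> is the atlas of the total space \<open>'p\<close> and \<open>act p k\<close> is the right action of \<open>k \<in> PSO\<close>. The last
  clause says that \<open>(x, k) \<mapsto> act (s x) k\<close> is a diffeomorphism from \<open>W \<times> PSO\<close> onto \<open>\<pi> -` W\<close>,
  with inverse \<open>p \<mapsto> (\<pi> p, \<tau> p)\<close>.\<close>
definition principal_PSO_bundle :: "('x::{t2_space, second_countable_topology}, 'e::euclidean_space) chart set \<Rightarrow>
    ('p::{t2_space, second_countable_topology}, 'f::euclidean_space) chart set \<Rightarrow> ('p \<Rightarrow> 'x) \<Rightarrow>
    ('p \<Rightarrow> 'r::finite sqmat set \<Rightarrow> 'p) \<Rightarrow> bool" where
  "principal_PSO_bundle A P \<pi> act \<longleftrightarrow>
     smooth_atlas P \<and> smooth_map P A UNIV \<pi> \<and>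
     (\<forall>p. act p \<one>\<^bsub>PSO\<^esub> = p) \<and>
     (\<forall>p. \<forall>k \<in> carrier PSO. \<forall>l \<in> carrier PSO. act (act p k) l = act p (k \<otimes>\<^bsub>PSO\<^esub> l)) \<and>
     (\<forall>p. \<forall>k \<in> carrier PSO. \<pi> (act p k) = \<pi> p) \<and>
     (\<forall>p q. \<pi> p = \<pi> q \<longrightarrow> (\<exists>!k. k \<in> carrier PSO \<and> q = act p k)) \<and>
     (\<forall>x. \<exists>W s \<tau>. x \<in> W \<and> smooth_section A P \<pi> W s \<and>
        smooth_from_PSO A P W (\<lambda>y k. act (s y) k) \<and>
        smooth_into_PSO P (\<pi> -` W) \<tau> \<and> (\<forall>p\<in>\<pi> -` W. p = act (s (\<pi> p)) (\<tau> p)))"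

text \<open>Connection form on the total space, with values in the skew-symmetric matrices. The third
  clause is \<open>\<omega> (B\<^sup>#) = B\<close> for the fundamental vector field \<open>B\<^sup>#\<close>, the velocity of
  \<open>t \<mapsto> act p [\<gamma> t]\<close> for any smooth curve \<open>\<gamma>\<close> in \<open>SO\<close> with \<open>\<gamma> 0 = 1\<close> and \<open>\<gamma>' 0 = B\<close>.\<close>
definition principal_connection :: "('p::topological_space, 'f::euclidean_space) chart set \<Rightarrow>
    ('p \<Rightarrow> 'r::finite sqmat set \<Rightarrow> 'p) \<Rightarrow> ('p \<Rightarrow> 'f \<Rightarrow> 'r sqmat) \<Rightarrow> bool" where
  "principal_connection P act \<omega> \<longleftrightarrow>
     one_form P \<omega> \<and>
     (\<forall>p v. transpose (\<omega> p v) = - \<omega> p v) \<and>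
     (\<forall>p \<gamma> B. smooth_on UNIV \<gamma> \<and> (\<forall>t::real. \<gamma> t \<in> carrier SO) \<and> \<gamma> 0 = mat 1 \<and>
        (\<gamma> has_vector_derivative B) (at 0) \<longrightarrow>
        \<omega> p (tangent_map euclidean_atlas P (\<lambda>t. act p (PSO_class (\<gamma> t))) 0 1) = B) \<and>
     (\<forall>p v. \<forall>g \<in> carrier SO.
        \<omega> (act p (PSO_class g)) (tangent_map P P (\<lambda>q. act q (PSO_class g)) p v)
          = transpose g ** \<omega> p v ** g)"


section \<open>Clifford-Weyl structures\<close>

text \<open>The element \<open>[p, a]\<close> of the associated bundle \<open>Cl\<^sup>0(E, h)\<close>, whose fibre at \<open>x\<close> consists of the
  \<open>[p, a]\<close> with \<open>\<pi> p = x\<close> and \<open>a \<in> cl_even\<close>. For each such \<open>p\<close> the map \<open>a \<mapsto> [p, a]\<close> is an algebra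
  isomorphism from \<open>cl_even\<close> to the fibre.\<close>
definition assoc_cl :: "('p \<Rightarrow> 'r::{finite, linorder} sqmat set \<Rightarrow> 'p) \<Rightarrow> 'p \<Rightarrow> 'r cl \<Rightarrow>
    ('p \<times> 'r cl) set" where
  "assoc_cl act p a = {(act p (PSO_class g), cl_act (transpose g) a) | g. g \<in> carrier SO}"

definition Clifford_morphism :: "('x::topological_space, 'e::euclidean_space) chart set \<Rightarrow>
    ('x \<Rightarrow> 'e \<Rightarrow> 'e \<Rightarrow> real) set \<Rightarrow>
    ('p::topological_space, 'f::euclidean_space) chart set \<Rightarrow> ('p \<Rightarrow> 'x) \<Rightarrow>
    ('p \<Rightarrow> 'r::{finite, linorder} sqmat set \<Rightarrow> 'p) \<Rightarrow>
    (('p \<times> 'r cl) set \<Rightarrow> 'e \<Rightarrow> 'e) \<Rightarrow> bool" where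
  "Clifford_morphism A c P \<pi> act \<phi> \<longleftrightarrow>
     (\<forall>p. \<forall>a \<in> cl_even. linear (\<phi> (assoc_cl act p a))) \<and>
     (\<forall>p. \<forall>a \<in> cl_even. \<forall>b \<in> cl_even. \<forall>v.
        \<phi> (assoc_cl act p (a + b)) v = \<phi> (assoc_cl act p a) v + \<phi> (assoc_cl act p b) v) \<and>
     (\<forall>p. \<forall>a \<in> cl_even. \<forall>t v. \<phi> (assoc_cl act p (t *\<^sub>R a)) v = t *\<^sub>R \<phi> (assoc_cl act p a) v) \<and>
     (\<forall>p v. \<phi> (assoc_cl act p cl_one) v = v) \<and>
     (\<forall>p. \<forall>a \<in> cl_even. \<forall>b \<in> cl_even. \<forall>v.
        \<phi> (assoc_cl act p (a \<odot> b)) v = \<phi> (assoc_cl act p a) (\<phi> (assoc_cl act p b) v)) \<and>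
     (\<forall>p. \<forall>a \<in> cl_Lambda2. \<forall>g\<in>c. \<forall>u v.
        g (\<pi> p) (\<phi> (assoc_cl act p a) u) v = - g (\<pi> p) u (\<phi> (assoc_cl act p a) v)) \<and>
     (\<forall>W s a X. smooth_section A P \<pi> W s \<longrightarrow> smooth_fun A W a \<longrightarrow> a ` W \<subseteq> cl_even \<longrightarrow>
        smooth_vector_field A W X \<longrightarrow>
        smooth_vector_field A W (\<lambda>x. \<phi> (assoc_cl act (s x) (a x)) (X x)))"

text \<open>For a section \<open>x \<mapsto> [s x, a x]\<close> of \<open>Cl\<^sup>0(E, h)\<close>, its covariant derivative in the direction \<open>v\<close>
  is \<open>[s x, da (v) + (s\<^sup>*\<omega>) (v) a]\<close>.\<close>
definition nabla_cl :: "('x, 'e::euclidean_space) chart set \<Rightarrow> ('p, 'f::euclidean_space) chart set \<Rightarrow>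
    ('p \<Rightarrow> 'f \<Rightarrow> 'r::{finite, linorder} sqmat) \<Rightarrow> ('x \<Rightarrow> 'p) \<Rightarrow> ('x \<Rightarrow> 'r cl) \<Rightarrow> 'x \<Rightarrow> 'e \<Rightarrow> 'r cl" where
  "nabla_cl A P \<omega> s a x v = dfun A a x v + cl_der (\<omega> (s x) (tangent_map A P s x v)) (a x)"

text \<open>\<open>D (\<phi> (\<sigma>) Y) - \<phi> (\<sigma>) (D Y) = \<phi> (\<nabla> \<sigma>) Y\<close> for all local sections \<open>\<sigma>\<close> of \<open>Cl\<^sup>0(E, h)\<close> and \<open>Y\<close> of \<open>TM\<close>.\<close>
definition parallel_morphism :: "('x::topological_space, 'e::euclidean_space) chart set \<Rightarrow>
    ('p::topological_space, 'f::euclidean_space) chart set \<Rightarrow> ('p \<Rightarrow> 'x) \<Rightarrow>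
    ('p \<Rightarrow> 'r::{finite, linorder} sqmat set \<Rightarrow> 'p) \<Rightarrow>
    (('p \<times> 'r cl) set \<Rightarrow> 'e \<Rightarrow> 'e) \<Rightarrow>
    ('p \<Rightarrow> 'f \<Rightarrow> 'r sqmat) \<Rightarrow> ('x, 'e) cov_deriv \<Rightarrow> bool" where
  "parallel_morphism A P \<pi> act \<phi> \<omega> D \<longleftrightarrow>
     (\<forall>W s a Y. smooth_section A P \<pi> W s \<longrightarrow> smooth_fun A W a \<longrightarrow> a ` W \<subseteq> cl_even \<longrightarrow>
        smooth_vector_field A W Y \<longrightarrow>
        (\<forall>x\<in>W. \<forall>v.
           D (\<lambda>y. \<phi> (assoc_cl act (s y) (a y)) (Y y)) x v - \<phi> (assoc_cl act (s x) (a x)) (D Y x v)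
             = \<phi> (assoc_cl act (s x) (nabla_cl A P \<omega> s a x v)) (Y x)))"

definition Clifford_Weyl_structure ::
   "('x::{t2_space, second_countable_topology}, 'e::euclidean_space) chart set \<Rightarrow>
    ('x \<Rightarrow> 'e \<Rightarrow> 'e \<Rightarrow> real) set \<Rightarrow>
    ('p::{t2_space, second_countable_topology}, 'f::euclidean_space) chart set \<Rightarrow> ('p \<Rightarrow> 'x) \<Rightarrow>
    ('p \<Rightarrow> 'r::{finite, linorder} sqmat set \<Rightarrow> 'p) \<Rightarrow>
    (('p \<times> 'r cl) set \<Rightarrow> 'e \<Rightarrow> 'e) \<Rightarrow>
    ('p \<Rightarrow> 'f \<Rightarrow> 'r sqmat) \<Rightarrow> ('x, 'e) cov_deriv \<Rightarrow> bool" where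
  "Clifford_Weyl_structure A c P \<pi> act \<phi> \<omega> D \<longleftrightarrow>
     principal_PSO_bundle A P \<pi> act \<and> principal_connection P act \<omega> \<and>
     Weyl_connection A c D \<and>
     Clifford_morphism A c P \<pi> act \<phi> \<and> parallel_morphism A P \<pi> act \<phi> \<omega> D"

text \<open>Injectivity on \<open>\<Lambda>\<^sup>2E\<close> as a bundle morphism, i.e. on every fibre.\<close>
definition injective_on_Lambda2 :: "('p \<Rightarrow> 'r::{finite, linorder} sqmat set \<Rightarrow> 'p) \<Rightarrow>
    (('p \<times> 'r cl) set \<Rightarrow> 'e \<Rightarrow> 'e) \<Rightarrow> bool" where
  "injective_on_Lambda2 act \<phi> \<longleftrightarrow> (\<forall>p. inj_on (\<lambda>a. \<phi> (assoc_cl act p a)) cl_Lambda2)"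

end

theory Submission
  imports Defs
begin

text \<open>Let \<open>J\<^sub>i\<^sub>j\<close> be the image under the Clifford morphism of \<open>e\<^sub>i \<cdot> e\<^sub>j\<close>, for a local orthonormal frame of \<open>E\<close>. These
endomorphisms satisfy \<open>J\<^sub>i\<^sub>j J\<^sub>j\<^sub>k = - J\<^sub>i\<^sub>k\<close> and \<open>J\<^sub>i\<^sub>i = - 1\<close>, and they are skew for \<open>i \<noteq> j\<close>. Since the
morphism is parallel, the curvature \<open>R\<close> of \<open>D\<close> and the curvature \<open>\<Omega>\<close> of the connection on \<open>E\<close> are tied by
  \<open>[R, J\<^sub>i\<^sub>j] = \<Sum>k. \<Omega>\<^sub>k\<^sub>i J\<^sub>k\<^sub>j + \<Omega>\<^sub>k\<^sub>j J\<^sub>i\<^sub>k\<close>  (\<open>Riem_bracket\<close>),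
while \<open>R\<close> satisfies the first Bianchi identity and \<open>R - F\<close> is skew (\<open>Riem_bianchi\<close>, \<open>Riem_metric\<close>).
Antisymmetrising the bracket identity in all four arguments removes \<open>R\<close> by the Bianchi identity and
leaves an equation of four-forms
  \<open>2 F \<and> \<omega>\<^sub>i\<^sub>j = \<Sum>k. \<Omega>\<^sub>k\<^sub>i \<and> \<omega>\<^sub>k\<^sub>j + \<Omega>\<^sub>k\<^sub>j \<and> \<omega>\<^sub>i\<^sub>k\<close>  where \<open>\<omega>\<^sub>i\<^sub>j = g (J\<^sub>i\<^sub>j _) _\<close>  (\<open>wedge_from_bracket\<close>).
Contracting it with every \<open>J\<^sub>p\<^sub>q\<close> gives a linear system for the endomorphisms \<open>f\<close>, \<open>\<Omega>\<^sub>i\<^sub>j\<close> that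
represent the two-forms, and the theorem becomes the statement that this system forces \<open>f = 0\<close>.

The system is analysed in an arbitrary real algebra with a trace (\<open>faraday_system\<close>). Modulo the span
\<open>L\<close> of the \<open>J\<^sub>i\<^sub>j\<close> its unknowns are so rigid that \<open>f\<close> lies in \<open>L\<close>; then the traces \<open>tr (f J\<^sub>i\<^sub>j)\<close> satisfy a
linear system whose determinant is \<open>m (m - 2) - 8 (r - 2)\<close> up to a factor, \<open>m\<close> being the trace of the
unit (\<open>corner_vanishes\<close>). With \<open>m = n\<close> this settles rank \<open>3\<close> for \<open>n \<noteq> 4\<close>, and every rank \<open>r \<ge> 5\<close>: in the latter
case a vector with its images under the \<open>J\<^sub>i\<^sub>j\<close> yields eight orthogonal vectors, so \<open>n \<ge> 8\<close>, and also
\<open>r \<le> n\<close> (\<open>dim_ge_8\<close>, \<open>rank_le_dim\<close>), which leaves only \<open>n = r = 8\<close> as an exception. In rank \<open>2\<close>,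
where there is a single \<open>J\<close>, the system is a multiple of \<open>f\<close> equated to a multiple of \<open>J\<close> (\<open>rank_2\<close>).

Rank \<open>4\<close> differs because \<open>so(4)\<close> is not simple. The volume element \<open>S = J\<^sub>a\<^sub>b J\<^sub>c\<^sub>d\<close> is a parallel symmetric
involution, and on each of its eigenspaces the family reduces to a family of rank \<open>3\<close>. The rank \<open>3\<close>
analysis on an eigenspace of dimension different from \<open>0\<close> and \<open>4\<close>, completed by the blocks of \<open>f\<close>
that involve the other eigenspace (\<open>mixed_block\<close>, \<open>complement_block\<close>), gives \<open>f = 0\<close>. This fails to apply
only if \<open>n = 4\<close>, or if \<open>n = 8\<close> and \<open>tr S = 0\<close>.

If the morphism has a kernel on \<open>\<Lambda>\<^sup>2E\<close> at some point and \<open>r = 4\<close>, then \<open>S = \<plusminus>1\<close> there, so that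
\<open>(tr S)\<^sup>2 = n\<^sup>2\<close>; conversely this equation forces a kernel. Since \<open>tr S\<close> is locally constant and the
manifold is connected, non-injectivity at one point spreads to all points (\<open>degenerate_everywhere\<close>),
and the case \<open>n = 8\<close>, \<open>tr S = 0\<close> is then excluded.

The remaining work translates the bundle language into a coordinate domain: a chart of the base and a
local section of the principal bundle turn a Clifford-Weyl structure into the functions of the locale
\<open>clifford_weyl_coordinates\<close> (\<open>coordinates\<close>).\<close>

section \<open>Smooth functions on open subsets of Euclidean space\<close>

lemma frechet_derivative_eq: "(f has_derivative f') (at x) \<Longrightarrow> frechet_derivative f (at x) = f'"
  using frechet_derivative_at by metis

lemma frechet_derivative_cong_open:
  assumes "open S" "x \<in> S" "\<And>y. y \<in> S \<Longrightarrow> f y = g y"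
  shows "frechet_derivative f (at x) = frechet_derivative g (at x)"
proof -
  have "(f has_derivative D) (at x) \<longleftrightarrow> (g has_derivative D) (at x)" for D
    using assms has_derivative_transform_within_open[of f D x UNIV S g] has_derivative_transform_within_open[of g D x UNIV S f] by auto
  then show ?thesis unfolding frechet_derivative_def by simp
qed

lemma Ck_on_cong:
  assumes "open S" "\<And>x. x \<in> S \<Longrightarrow> f x = g x" "Ck_on k S f"
  shows "Ck_on k S g"
  using assms(2,3)
proof (induction k arbitrary: f g)
  case 0 then show ?case using continuous_on_cong[of S S f g] by auto
next
  case (Suc k)
  have d: "g differentiable (at x)" if "x \<in> S" for x
    using Suc.prems that assms(1) has_derivative_transform_within_open[of f _ x UNIV S g]
    unfolding differentiable_def by (metis Ck_on.simps(2) differentiable_def)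
  have "Ck_on k S (\<lambda>x. frechet_derivative g (at x) v)" for v
    by (rule Suc.IH[of "\<lambda>x. frechet_derivative f (at x) v"])
      (use Suc.prems frechet_derivative_cong_open[OF assms(1), of _ f g] in auto)
  then show ?case using d by simp
qed

lemma Ck_on_subset: "Ck_on k S f \<Longrightarrow> T \<subseteq> S \<Longrightarrow> Ck_on k T f"
  by (induction k arbitrary: f) (auto intro: continuous_on_subset)

lemma Ck_on_SucD: "Ck_on (Suc k) S f \<Longrightarrow> Ck_on k S f"
proof (induction k arbitrary: f)
  case 0 then show ?case
    by (auto intro!: differentiable_imp_continuous_on simp: differentiable_on_def differentiable_at_withinI)
qed auto

lemma Ck_on_const: "Ck_on k S (\<lambda>x. c)"
  by (induction k arbitrary: c) (simp_all add: frechet_derivative_const)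

lemma Ck_on_bounded_linear:
  assumes L: "bounded_linear L"
  shows "open S \<Longrightarrow> Ck_on k S f \<Longrightarrow> Ck_on k S (\<lambda>x. L (f x))"
proof (induction k arbitrary: f)
  case 0 then show ?case using bounded_linear.continuous_on[OF L] by simp
next
  case (Suc k)
  have D: "((\<lambda>x. L (f x)) has_derivative (\<lambda>v. L (frechet_derivative f (at x) v))) (at x)" if "x \<in> S" for x
    using Suc.prems that by (intro bounded_linear.has_derivative[OF L]) (simp add: frechet_derivative_works)
  have "Ck_on k S (\<lambda>x. frechet_derivative (\<lambda>x. L (f x)) (at x) v)" for v
    by (rule Ck_on_cong[OF Suc.prems(1), of "\<lambda>x. L (frechet_derivative f (at x) v)"])
      (use Suc frechet_derivative_eq[OF D] in auto)
  then show ?case using D by (auto intro: differentiableI)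
qed

lemma Ck_on_add: "open S \<Longrightarrow> Ck_on k S f \<Longrightarrow> Ck_on k S g \<Longrightarrow> Ck_on k S (\<lambda>x. f x + g x)"
proof (induction k arbitrary: f g)
  case 0 then show ?case by (simp add: continuous_on_add)
next
  case (Suc k)
  have D: "((\<lambda>x. f x + g x) has_derivative (\<lambda>v. frechet_derivative f (at x) v + frechet_derivative g (at x) v)) (at x)" if "x \<in> S" for x
    using Suc.prems that by (intro has_derivative_add) (simp_all add: frechet_derivative_works)
  have "Ck_on k S (\<lambda>x. frechet_derivative (\<lambda>x. f x + g x) (at x) v)" for v
    by (rule Ck_on_cong[OF Suc.prems(1), of "\<lambda>x. frechet_derivative f (at x) v + frechet_derivative g (at x) v"])
      (use Suc frechet_derivative_eq[OF D] in auto)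
  then show ?case using D by (auto intro: differentiableI)
qed

lemma Ck_on_scaleR:
  fixes f :: "'a::euclidean_space \<Rightarrow> real"
  shows "open S \<Longrightarrow> Ck_on k S f \<Longrightarrow> Ck_on k S g \<Longrightarrow> Ck_on k S (\<lambda>x. f x *\<^sub>R g x)"
proof (induction k arbitrary: f g)
  case 0 then show ?case by (simp add: continuous_on_scaleR)
next
  case (Suc k)
  let ?D = "\<lambda>x v. f x *\<^sub>R frechet_derivative g (at x) v + frechet_derivative f (at x) v *\<^sub>R g x"
  have D: "((\<lambda>x. f x *\<^sub>R g x) has_derivative ?D x) (at x)" if "x \<in> S" for x
    using Suc.prems that by (intro has_derivative_scaleR) (simp_all add: frechet_derivative_works)
  have "Ck_on k S (\<lambda>x. frechet_derivative (\<lambda>x. f x *\<^sub>R g x) (at x) v)" for v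
  proof (rule Ck_on_cong[OF Suc.prems(1)])
    have "Ck_on k S (\<lambda>x. f x *\<^sub>R frechet_derivative g (at x) v)"
      using Suc.prems Ck_on_SucD[OF Suc.prems(2)] by (intro Suc.IH) auto
    moreover have "Ck_on k S (\<lambda>x. frechet_derivative f (at x) v *\<^sub>R g x)"
      using Suc.prems Ck_on_SucD[OF Suc.prems(3)] by (intro Suc.IH) auto
    ultimately show "Ck_on k S (\<lambda>x. ?D x v)" by (intro Ck_on_add Suc.prems(1))
  qed (use frechet_derivative_eq[OF D] in auto)
  then show ?case using D by (auto intro: differentiableI)
qed

lemma Ck_on_sum: "open S \<Longrightarrow> (\<And>i. i \<in> A \<Longrightarrow> Ck_on k S (f i)) \<Longrightarrow> Ck_on k S (\<lambda>x. \<Sum>i\<in>A. f i x)"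
  by (induction A rule: infinite_finite_induct) (simp_all add: Ck_on_const Ck_on_add)

text \<open>Composite derivatives have the form \<open>D g (f x) (D f x v)\<close>, with both arguments varying. Expanding the
second in a basis writes them as sums of products, to which the induction on \<open>k\<close> applies.\<close>
lemma frechet_derivative_expand:
  fixes f :: "'a::euclidean_space \<Rightarrow> 'b::real_normed_vector"
  assumes "f differentiable (at x)"
  shows "frechet_derivative f (at x) h = (\<Sum>b\<in>Basis. (h \<bullet> b) *\<^sub>R frechet_derivative f (at x) b)"
proof -
  have l: "linear (frechet_derivative f (at x))"
    using assms by (simp add: linear_frechet_derivative)
  have "frechet_derivative f (at x) h = frechet_derivative f (at x) (\<Sum>b\<in>Basis. (h \<bullet> b) *\<^sub>R b)"
    by (simp add: euclidean_representation)
  then show ?thesis by (simp add: linear_sum[OF l] linear_scale[OF l])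
qed

lemma Ck_on_compose:
  fixes f :: "'a::euclidean_space \<Rightarrow> 'b::euclidean_space" and g :: "'b \<Rightarrow> 'c::real_normed_vector"
  assumes S: "open S" and T: "open T"
  shows "Ck_on k S f \<Longrightarrow> Ck_on k T g \<Longrightarrow> f ` S \<subseteq> T \<Longrightarrow> Ck_on k S (\<lambda>x. g (f x))"
proof (induction k arbitrary: f g)
  case 0 then show ?case using continuous_on_compose2 by auto
next
  case (Suc k)
  let ?D = "\<lambda>x v. frechet_derivative g (at (f x)) (frechet_derivative f (at x) v)"
  have D: "((\<lambda>x. g (f x)) has_derivative ?D x) (at x)" if "x \<in> S" for x
  proof -
    have "(f has_derivative frechet_derivative f (at x)) (at x)"
      using Suc.prems that by (simp add: frechet_derivative_works)
    moreover have "(g has_derivative frechet_derivative g (at (f x))) (at (f x))"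
      using Suc.prems that by (auto simp: frechet_derivative_works)
    ultimately show ?thesis using diff_chain_at[of f _ x g] by (simp add: o_def)
  qed
  have "Ck_on k S (\<lambda>x. frechet_derivative (\<lambda>x. g (f x)) (at x) v)" for v
  proof (rule Ck_on_cong[OF S])
    show "(\<Sum>b\<in>Basis. (frechet_derivative f (at x) v \<bullet> b) *\<^sub>R frechet_derivative g (at (f x)) b)
       = frechet_derivative (\<lambda>x. g (f x)) (at x) v" if "x \<in> S" for x
      unfolding frechet_derivative_eq[OF D[OF that]]
      using that Suc.prems by (intro frechet_derivative_expand[symmetric]) auto
    have "Ck_on k S (\<lambda>x. frechet_derivative g (at (f x)) b)" for b
      using Suc.prems Ck_on_SucD[OF Suc.prems(1)] by (intro Suc.IH) auto
    moreover have "Ck_on k S (\<lambda>x. frechet_derivative f (at x) v \<bullet> b)" for b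
      using Suc.prems by (intro Ck_on_bounded_linear[OF bounded_linear_inner_left S]) simp
    ultimately show "Ck_on k S (\<lambda>x. \<Sum>b\<in>Basis. (frechet_derivative f (at x) v \<bullet> b) *\<^sub>R frechet_derivative g (at (f x)) b)"
      by (intro Ck_on_sum Ck_on_scaleR S)
  qed
  then show ?case using D by (auto intro: differentiableI)
qed

lemma smooth_on_cong: "open S \<Longrightarrow> (\<And>x. x \<in> S \<Longrightarrow> f x = g x) \<Longrightarrow> smooth_on S f \<Longrightarrow> smooth_on S g"
  unfolding smooth_on_def using Ck_on_cong by blast

lemma smooth_on_subset: "smooth_on S f \<Longrightarrow> T \<subseteq> S \<Longrightarrow> smooth_on T f"
  unfolding smooth_on_def using Ck_on_subset by blast

lemma smooth_on_const: "smooth_on S (\<lambda>x. c)"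
  unfolding smooth_on_def by (simp add: Ck_on_const)

lemma smooth_on_bounded_linear: "bounded_linear L \<Longrightarrow> open S \<Longrightarrow> smooth_on S f \<Longrightarrow> smooth_on S (\<lambda>x. L (f x))"
  unfolding smooth_on_def using Ck_on_bounded_linear by blast

lemma smooth_on_scaleR: "open S \<Longrightarrow> smooth_on S f \<Longrightarrow> smooth_on S g \<Longrightarrow> smooth_on S (\<lambda>x. f x *\<^sub>R g x)"
  for f :: "'a::euclidean_space \<Rightarrow> real"
  unfolding smooth_on_def using Ck_on_scaleR by blast

lemma smooth_on_sum: "open S \<Longrightarrow> (\<And>i. i \<in> A \<Longrightarrow> smooth_on S (f i)) \<Longrightarrow> smooth_on S (\<lambda>x. \<Sum>i\<in>A. f i x)"
  unfolding smooth_on_def by (intro allI Ck_on_sum) simp_all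

lemma smooth_on_compose:
  fixes f :: "'a::euclidean_space \<Rightarrow> 'b::euclidean_space"
  shows "open S \<Longrightarrow> open T \<Longrightarrow> smooth_on S f \<Longrightarrow> smooth_on T g \<Longrightarrow> f ` S \<subseteq> T \<Longrightarrow> smooth_on S (\<lambda>x. g (f x))"
  unfolding smooth_on_def using Ck_on_compose by blast

lemma smooth_on_differentiable: "smooth_on S f \<Longrightarrow> x \<in> S \<Longrightarrow> f differentiable (at x)"
  unfolding smooth_on_def using Ck_on.simps(2) by blast

lemma smooth_on_has_derivative: "smooth_on S f \<Longrightarrow> x \<in> S \<Longrightarrow> (f has_derivative frechet_derivative f (at x)) (at x)"
  using smooth_on_differentiable frechet_derivative_works by blast

lemma smooth_on_continuous: "smooth_on S f \<Longrightarrow> continuous_on S f"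
  unfolding smooth_on_def using Ck_on.simps(1) by blast

lemma smooth_on_frechet_derivative: "smooth_on S f \<Longrightarrow> smooth_on S (\<lambda>x. frechet_derivative f (at x) v)"
  unfolding smooth_on_def using Ck_on.simps(2) by blast

lemma smooth_on_frechet_derivative_apply:
  fixes f :: "'a::euclidean_space \<Rightarrow> 'b::real_normed_vector"
  assumes S: "open S" and f: "smooth_on S f" and h: "smooth_on S h"
  shows "smooth_on S (\<lambda>x. frechet_derivative f (at x) (h x))"
proof (rule smooth_on_cong[OF S])
  show "(\<Sum>b\<in>Basis. (h x \<bullet> b) *\<^sub>R frechet_derivative f (at x) b) = frechet_derivative f (at x) (h x)" if "x \<in> S" for x
    by (rule frechet_derivative_expand[OF smooth_on_differentiable[OF f that], symmetric])
  show "smooth_on S (\<lambda>x. \<Sum>b\<in>Basis. (h x \<bullet> b) *\<^sub>R frechet_derivative f (at x) b)"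
    by (rule smooth_on_sum[OF S], rule smooth_on_scaleR[OF S
        smooth_on_bounded_linear[OF bounded_linear_inner_left S h] smooth_on_frechet_derivative[OF f]])
qed

lemma smooth_on_exp: "smooth_on UNIV (exp :: real \<Rightarrow> real)"
proof -
  have D: "frechet_derivative exp (at x) = (\<lambda>v. exp x * v)" for x :: real
    using DERIV_exp[of x] unfolding has_field_derivative_def by (rule frechet_derivative_eq)
  have "Ck_on k UNIV (exp :: real \<Rightarrow> real)" for k
  proof (induction k)
    case 0 show ?case using continuous_on_exp[OF continuous_on_id, of UNIV] by simp
  next
    case (Suc k)
    have "exp differentiable (at x)" for x :: real
      using DERIV_exp[of x] unfolding has_field_derivative_def by (rule differentiableI)
    moreover have "Ck_on k UNIV (\<lambda>x::real. frechet_derivative exp (at x) v)" for v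
      unfolding D by (rule Ck_on_bounded_linear[OF bounded_linear_mult_left open_UNIV Suc.IH])
    ultimately show ?case by simp
  qed
  then show ?thesis unfolding smooth_on_def by blast
qed

text \<open>The proof of Schwarz's theorem that needs differentiability of the first derivatives only at the point
itself: the mean value theorem in the direction \<open>v\<close> turns the second difference quotient into a
difference of first derivatives. The quotient is symmetric in \<open>v\<close> and \<open>w\<close>, so both iterated derivatives
agree.\<close>
lemma second_difference_limit:
  fixes f :: "'a::real_normed_vector \<Rightarrow> real"
  assumes S: "open S" "x \<in> S" and diff: "\<And>y. y \<in> S \<Longrightarrow> f differentiable (at y)"
    and G: "((\<lambda>y. frechet_derivative f (at y) v) has_derivative G) (at x)"
  shows "((\<lambda>t. (f (x + t *\<^sub>R v + t *\<^sub>R w) - f (x + t *\<^sub>R v) - f (x + t *\<^sub>R w) + f x) / t\<^sup>2) \<longlongrightarrow> G w) (at_right 0)"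
proof (rule tendstoI)
  fix e :: real assume e: "e > 0"
  define g where "g y = frechet_derivative f (at y) v" for y
  \<comment> \<open>\<open>t * C\<close> bounds every increment of the argument that occurs below.\<close>
  define C where "C = 2 * norm v + norm w + 1"
  have C: "C > 0" unfolding C_def by (simp add: add_nonneg_pos)
  have lin: "bounded_linear G" using G by (rule has_derivative_bounded_linear)
  obtain d where d: "d > 0" and dG: "\<And>h. norm h < d \<Longrightarrow> norm (g (x + h) - g x - G h) \<le> (e / (2 * C)) * norm h"
  proof -
    from G e C obtain d where "d > 0" "\<And>y. norm (y - x) < d \<Longrightarrow> norm (g y - g x - G (y - x)) \<le> (e / (2 * C)) * norm (y - x)"
      unfolding has_derivative_at_alt g_def by (metis divide_pos_pos mult_pos_pos zero_less_numeral)
    from this(1) this(2)[of "x + _"] show ?thesis using that by simp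
  qed
  obtain r where r: "r > 0" "ball x r \<subseteq> S" using S open_contains_ball by blast
  define \<delta> where "\<delta> = min d r / C"
  have "\<delta> > 0" using d r C unfolding \<delta>_def by simp
  moreover have "dist ((f (x + t *\<^sub>R v + t *\<^sub>R w) - f (x + t *\<^sub>R v) - f (x + t *\<^sub>R w) + f x) / t\<^sup>2) (G w) < e"
    if t: "0 < t" "t < \<delta>" for t
  proof -
    have tC: "t * C < min d r" using t C unfolding \<delta>_def by (simp add: pos_less_divide_eq)
    have small: "norm (s *\<^sub>R v) \<le> t * norm v" "norm (s *\<^sub>R v + t *\<^sub>R w) \<le> t * norm v + t * norm w"
      if "0 \<le> s" "s \<le> t" for s
    proof -
      show a: "norm (s *\<^sub>R v) \<le> t * norm v" using that by (simp add: mult_right_mono)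
      show "norm (s *\<^sub>R v + t *\<^sub>R w) \<le> t * norm v + t * norm w"
        using norm_triangle_ineq[of "s *\<^sub>R v" "t *\<^sub>R w"] a t by simp
    qed
    have lt: "norm (s *\<^sub>R v) < min d r" "norm (s *\<^sub>R v + t *\<^sub>R w) < min d r" if "0 \<le> s" "s \<le> t" for s
    proof -
      have "t * norm v + t * norm w \<le> t * C" "t * norm v \<le> t * C"
        unfolding distrib_left[symmetric] using t unfolding C_def by (intro mult_left_mono; simp)+
      then show "norm (s *\<^sub>R v) < min d r" "norm (s *\<^sub>R v + t *\<^sub>R w) < min d r"
        using small[OF that] tC by linarith+
    qed
    define \<phi> where "\<phi> s = f (x + s *\<^sub>R v + t *\<^sub>R w) - f (x + s *\<^sub>R v)" for s
    have D\<phi>: "(\<phi> has_real_derivative (g (x + s *\<^sub>R v + t *\<^sub>R w) - g (x + s *\<^sub>R v))) (at s)" if s: "0 \<le> s" "s \<le> t" for s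
    proof -
      have inS: "x + s *\<^sub>R v + t *\<^sub>R w \<in> S" "x + s *\<^sub>R v \<in> S"
      proof -
        have "x + h \<in> S" if "norm h < r" for h
          using that by (intro subsetD[OF r(2)]) (simp add: dist_norm)
        then show "x + s *\<^sub>R v + t *\<^sub>R w \<in> S" "x + s *\<^sub>R v \<in> S"
          using lt[OF s] by (simp_all add: add.assoc)
      qed
      have line: "((\<lambda>s. f (x + s *\<^sub>R v + c)) has_derivative (\<lambda>h. frechet_derivative f (at (x + s *\<^sub>R v + c)) (h *\<^sub>R v))) (at s)"
        if "x + s *\<^sub>R v + c \<in> S" for c
      proof -
        have "(f has_derivative frechet_derivative f (at (x + s *\<^sub>R v + c))) (at (x + s *\<^sub>R v + c))"
          using diff[OF that] by (simp add: frechet_derivative_works)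
        moreover have "((\<lambda>s. x + s *\<^sub>R v + c) has_derivative (\<lambda>h. h *\<^sub>R v)) (at s)"
          by (auto intro!: derivative_eq_intros)
        ultimately show ?thesis using diff_chain_at[of "\<lambda>s. x + s *\<^sub>R v + c" _ s f] by (simp add: o_def)
      qed
      have sc: "frechet_derivative f (at y) (h *\<^sub>R v) = g y * h" if "y \<in> S" for y h
        using linear_scale[OF linear_frechet_derivative[OF diff[OF that]]] by (simp add: g_def mult.commute)
      have "(\<phi> has_derivative (\<lambda>h. g (x + s *\<^sub>R v + t *\<^sub>R w) * h - g (x + s *\<^sub>R v) * h)) (at s)"
        unfolding \<phi>_def[abs_def]
        using has_derivative_diff[OF line[OF inS(1)] line[of 0]] inS sc by simp
      then show ?thesis unfolding has_field_derivative_def by (simp add: left_diff_distrib[abs_def])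
    qed
    obtain \<xi> where \<xi>: "0 < \<xi>" "\<xi> < t" "\<phi> t - \<phi> 0 = t * (g (x + \<xi> *\<^sub>R v + t *\<^sub>R w) - g (x + \<xi> *\<^sub>R v))"
      using MVT2[of 0 t \<phi>, OF t(1) D\<phi>] by auto
    let ?A = "g (x + (\<xi> *\<^sub>R v + t *\<^sub>R w)) - g x - G (\<xi> *\<^sub>R v + t *\<^sub>R w)" and ?B = "g (x + \<xi> *\<^sub>R v) - g x - G (\<xi> *\<^sub>R v)"
    have \<xi>': "0 \<le> \<xi>" "\<xi> \<le> t" using \<xi> by auto
    have AB: "norm ?A + norm ?B \<le> (e / (2 * C)) * (t * C)"
    proof -
      have "norm ?A \<le> (e / (2 * C)) * (t * norm v + t * norm w)"
      proof -
        have "norm (g (x + (\<xi> *\<^sub>R v + t *\<^sub>R w)) - g x - G (\<xi> *\<^sub>R v + t *\<^sub>R w)) \<le> e / (2 * C) * norm (\<xi> *\<^sub>R v + t *\<^sub>R w)"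
          using lt(2)[OF \<xi>'] by (intro dG) simp
        also have "\<dots> \<le> e / (2 * C) * (t * norm v + t * norm w)"
          using small(2)[OF \<xi>'] e C by (intro mult_left_mono) auto
        finally show ?thesis .
      qed
      moreover have "norm ?B \<le> (e / (2 * C)) * (t * norm v)"
      proof -
        have "norm (g (x + (\<xi> *\<^sub>R v)) - g x - G (\<xi> *\<^sub>R v)) \<le> e / (2 * C) * norm (\<xi> *\<^sub>R v)"
          using lt(1)[OF \<xi>'] by (intro dG) simp
        also have "\<dots> \<le> e / (2 * C) * (t * norm v)"
          using small(1)[OF \<xi>'] e C by (intro mult_left_mono) auto
        finally show ?thesis .
      qed
      moreover have "(e / (2 * C)) * (t * norm v + t * norm w) + (e / (2 * C)) * (t * norm v) \<le> (e / (2 * C)) * (t * C)"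
        unfolding distrib_left[symmetric] using e C t by (intro mult_left_mono) (auto simp: C_def algebra_simps)
      ultimately show ?thesis by linarith
    qed
    have "\<phi> t - \<phi> 0 - t\<^sup>2 * G w = t * (?A - ?B)"
      unfolding \<xi>(3) using bounded_linear.linear[OF lin]
      by (simp add: linear_add linear_scale algebra_simps power2_eq_square)
    moreover have "(\<phi> t - \<phi> 0) / t\<^sup>2 - G w = (\<phi> t - \<phi> 0 - t\<^sup>2 * G w) / t\<^sup>2"
      using t by (simp add: diff_divide_distrib)
    ultimately have "(\<phi> t - \<phi> 0) / t\<^sup>2 - G w = (?A - ?B) / t"
      using t by (simp only: power2_eq_square) simp
    then have "norm ((\<phi> t - \<phi> 0) / t\<^sup>2 - G w) \<le> ((e / (2 * C)) * (t * C)) / t"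
      using AB norm_triangle_ineq4[of ?A ?B] t by (simp add: divide_right_mono)
    also have "\<dots> < e" using e C t by simp
    finally show ?thesis unfolding dist_norm \<phi>_def by (simp add: algebra_simps)
  qed
  ultimately show "\<forall>\<^sub>F t in at_right 0. dist ((f (x + t *\<^sub>R v + t *\<^sub>R w) - f (x + t *\<^sub>R v) - f (x + t *\<^sub>R w) + f x) / t\<^sup>2) (G w) < e"
    unfolding eventually_at_right_field by (intro exI[of _ \<delta>]) auto
qed

lemma symmetric_second_derivative:
  fixes f :: "'a::euclidean_space \<Rightarrow> 'b::euclidean_space"
  assumes S: "open S" "x \<in> S" and f: "smooth_on S f"
  shows "frechet_derivative (\<lambda>y. frechet_derivative f (at y) v) (at x) w
       = frechet_derivative (\<lambda>y. frechet_derivative f (at y) w) (at x) v"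
proof -
  have real: "frechet_derivative (\<lambda>y. frechet_derivative h (at y) v) (at x) w
       = frechet_derivative (\<lambda>y. frechet_derivative h (at y) w) (at x) v" if h: "smooth_on S h" for h :: "'a \<Rightarrow> real"
  proof (rule tendsto_unique)
    have d: "h differentiable (at y)" if "y \<in> S" for y using smooth_on_differentiable[OF h that] .
    have D: "((\<lambda>y. frechet_derivative h (at y) u) has_derivative frechet_derivative (\<lambda>y. frechet_derivative h (at y) u) (at x)) (at x)" for u
      using smooth_on_has_derivative[OF smooth_on_frechet_derivative[OF h] S(2)] .
    show "((\<lambda>t. (h (x + t *\<^sub>R v + t *\<^sub>R w) - h (x + t *\<^sub>R v) - h (x + t *\<^sub>R w) + h x) / t\<^sup>2)
        \<longlongrightarrow> frechet_derivative (\<lambda>y. frechet_derivative h (at y) v) (at x) w) (at_right 0)"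
      by (rule second_difference_limit[OF S d D])
    show "((\<lambda>t. (h (x + t *\<^sub>R v + t *\<^sub>R w) - h (x + t *\<^sub>R v) - h (x + t *\<^sub>R w) + h x) / t\<^sup>2)
        \<longlongrightarrow> frechet_derivative (\<lambda>y. frechet_derivative h (at y) w) (at x) v) (at_right 0)"
    proof -
      have "h (x + t *\<^sub>R w + t *\<^sub>R v) - h (x + t *\<^sub>R w) - h (x + t *\<^sub>R v) + h x
         = h (x + t *\<^sub>R v + t *\<^sub>R w) - h (x + t *\<^sub>R v) - h (x + t *\<^sub>R w) + h x" for t
        by (simp only: add.assoc add.commute[of "t *\<^sub>R v"])
      then show ?thesis using second_difference_limit[OF S d D, of w v] by (simp only:)
    qed
  qed simp
  have comp: "frechet_derivative (\<lambda>y. frechet_derivative f (at y) v) (at x) w \<bullet> b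
      = frechet_derivative (\<lambda>y. frechet_derivative (\<lambda>y. f y \<bullet> b) (at y) v) (at x) w" for b v w
  proof -
    have 1: "frechet_derivative f (at y) v \<bullet> b = frechet_derivative (\<lambda>y. f y \<bullet> b) (at y) v" if "y \<in> S" for y
      using frechet_derivative_eq[OF has_derivative_inner_left[OF smooth_on_has_derivative[OF f that]]] by simp
    have "frechet_derivative (\<lambda>y. frechet_derivative f (at y) v) (at x) w \<bullet> b
       = frechet_derivative (\<lambda>y. frechet_derivative f (at y) v \<bullet> b) (at x) w"
      using frechet_derivative_eq[OF has_derivative_inner_left[OF smooth_on_has_derivative[OF smooth_on_frechet_derivative[OF f] S(2)]]] by simp
    also have "\<dots> = frechet_derivative (\<lambda>y. frechet_derivative (\<lambda>y. f y \<bullet> b) (at y) v) (at x) w"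
      using frechet_derivative_cong_open[OF S 1] by simp
    finally show ?thesis .
  qed
  show ?thesis
    by (rule euclidean_eqI) (simp only: comp real[OF smooth_on_bounded_linear[OF bounded_linear_inner_left S(1) f]])
qed

section \<open>The linear system for the Faraday form\<close>

locale trace_form =
  fixes tr :: "'a::real_algebra_1 \<Rightarrow> real"
  assumes tr_linear: "linear tr" and tr_commute: "tr (x * y) = tr (y * x)"
begin

lemmas tr_simps = linear_add[OF tr_linear] linear_diff[OF tr_linear] linear_neg[OF tr_linear]
  linear_cmul[OF tr_linear] linear_sum[OF tr_linear] linear_0[OF tr_linear]

text \<open>When \<open>a\<close> and \<open>b\<close> are the endomorphisms of two-forms and \<open>J\<close> is skew, this is the contraction of
\<open>a \<and> b\<close> with the bivector of \<open>J\<close>; see \<open>wedge_contract\<close>.\<close>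
definition contr :: "'a \<Rightarrow> 'a \<Rightarrow> 'a \<Rightarrow> 'a" where
  "contr a b J = 2 *\<^sub>R (a * J * b + b * J * a) - tr (a * J) *\<^sub>R b - tr (b * J) *\<^sub>R a"

end

text \<open>The products \<open>e\<^sub>i e\<^sub>j\<close> of generators in a corner \<open>P a P\<close> of an algebra. The unit of the corner is kept
as a parameter because in rank four it is a proper idempotent, the projection to half of the tangent space.\<close>
locale even_clifford_family = trace_form tr for tr :: "'a::real_algebra_1 \<Rightarrow> real" +
  fixes I :: "'i set" and J :: "'i \<Rightarrow> 'i \<Rightarrow> 'a" and P :: 'a
  assumes fin: "finite I"
    and mul: "i \<in> I \<Longrightarrow> j \<in> I \<Longrightarrow> k \<in> I \<Longrightarrow> J i j * J j k = - J i k"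
    and anti: "i \<in> I \<Longrightarrow> j \<in> I \<Longrightarrow> i \<noteq> j \<Longrightarrow> J j i = - J i j"
    and diag: "i \<in> I \<Longrightarrow> J i i = - P"
begin

lemma mul_diag: "i \<in> I \<Longrightarrow> j \<in> I \<Longrightarrow> P * J i j = J i j" "i \<in> I \<Longrightarrow> j \<in> I \<Longrightarrow> J i j * P = J i j"
  using mul[of i i j] mul[of i j j] diag[of i] diag[of j] by auto

lemma square: "i \<in> I \<Longrightarrow> j \<in> I \<Longrightarrow> i \<noteq> j \<Longrightarrow> J i j * J i j = - P"
  using mul[of i j i] anti[of i j] diag[of i] by auto

lemma mul_last: "i \<in> I \<Longrightarrow> j \<in> I \<Longrightarrow> k \<in> I \<Longrightarrow> j \<noteq> k \<Longrightarrow> J i j * J k j = J i k"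
  using mul[of i j k] anti[of j k] by auto

lemma mul_first: "i \<in> I \<Longrightarrow> j \<in> I \<Longrightarrow> k \<in> I \<Longrightarrow> i \<noteq> j \<Longrightarrow> J i j * J i k = J j k"
  using mul[of j i k] anti[of i j] by auto

lemma mul_outer: "i \<in> I \<Longrightarrow> j \<in> I \<Longrightarrow> k \<in> I \<Longrightarrow> i \<noteq> j \<Longrightarrow> j \<noteq> k \<Longrightarrow> i \<noteq> k \<Longrightarrow> J i j * J k i = J k j"
  using mul_first[of i j k] anti[of i k] anti[of j k] by auto

lemma commute_disjoint:
  assumes "i \<in> I" "j \<in> I" "k \<in> I" "l \<in> I" "i \<noteq> j" "k \<noteq> l" "i \<noteq> k" "i \<noteq> l" "j \<noteq> k" "j \<noteq> l"
  shows "J i j * J k l = J k l * J i j"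
proof -
  have "J i j * J k l = - (J i k * (J k j * J k l))"
    using mul[of i k j] assms by (simp flip: mult.assoc)
  moreover have "J k l * J i j = - (J k i * (J i l * J i j))"
    using mul[of k i l] assms by (simp flip: mult.assoc)
  moreover have "J k j * J k l = J j l" "J i l * J i j = - J j l" "J k i = - J i k"
    using mul_first[of k j l] mul_first[of i l j] anti[of j l] anti[of i k] assms by simp_all
  ultimately show ?thesis by simp
qed

text \<open>\<open>J\<^sub>i\<^sub>j\<close> is a commutator as soon as there is a third index.\<close>
lemma tr_J: 
  assumes "i \<in> I" "j \<in> I" "k \<in> I" "i \<noteq> j" "j \<noteq> k" "i \<noteq> k"
  shows "tr (J i j) = 0"
proof -
  have "tr (J i k * J k j) = tr (J k j * J i k)" by (rule tr_commute)
  moreover have "J i k * J k j = - J i j" using mul assms by auto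
  moreover have "J k j * J i k = J i j" using mul_outer[of k j i]  assms by auto
  ultimately show ?thesis by (simp add: tr_simps)
qed

text \<open>The \<open>J\<^sub>i\<^sub>j\<close> with \<open>i < j\<close> are orthogonal for the trace form, up to pairs with disjoint indices. Those pairs
have to be assumed orthogonal; for rank four this can fail.\<close>
lemma tr_J_J:
  assumes big: "card I \<ge> 3"
    and disj: "\<And>i j k l. i \<in> I \<Longrightarrow> j \<in> I \<Longrightarrow> k \<in> I \<Longrightarrow> l \<in> I \<Longrightarrow> distinct [i,j,k,l] \<Longrightarrow> tr (J i j * J k l) = 0"
    and ij: "i \<in> I" "j \<in> I" "k \<in> I" "l \<in> I" "i \<noteq> j" "k \<noteq> l"
  shows "tr (J i j * J k l) = (if i = k \<and> j = l then - tr P else if i = l \<and> j = k then tr P else 0)"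
proof -
  have t: "tr (J a b) = 0" if "a \<in> I" "b \<in> I" "a \<noteq> b" for a b
  proof -
    have "\<not> I \<subseteq> {a, b}"
    proof
      assume "I \<subseteq> {a, b}"
      then have "card I \<le> card {a, b}" by (intro card_mono) auto
      also have "\<dots> \<le> 2" by (simp add: card_insert_if)
      finally show False using big by simp
    qed
    then obtain c where "c \<in> I" "c \<noteq> a" "c \<noteq> b" by blast
    then show ?thesis using tr_J[of a b c] that by auto
  qed
  consider "i = k" "j = l" | "i = l" "j = k" | "i = k" "j \<noteq> l" | "j = l" "i \<noteq> k" | "j = k" "i \<noteq> l" | "i = l" "j \<noteq> k"
    | "distinct [i,j,k,l]" using ij by auto
  then show ?thesis
  proof cases
    case 1 then show ?thesis using ij square by (auto simp: tr_simps)
  next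
    case 2 then show ?thesis using ij mul[of i j i] diag by (auto simp: tr_simps)
  next
    case 3 then show ?thesis using ij mul_first[of i j l] t[of j l] by (auto simp: tr_simps)
  next
    case 4 then show ?thesis using ij mul_last[of i j k] t[of i k] by (auto simp: tr_simps)
  next
    case 5 then show ?thesis using ij mul[of i j l] t[of i l] by (auto simp: tr_simps)
  next
    case 6 then show ?thesis using ij mul_outer[of i j k] t[of k j] by (auto simp: tr_simps)
  next
    case 7 then show ?thesis using ij disj by auto
  qed
qed

definition (in trace_form) comm :: "'a \<Rightarrow> 'a \<Rightarrow> 'a" where "comm x y = x * y - y * x"

lemma contr_self:
  assumes "i \<in> I" "j \<in> I" "i \<noteq> j"
  shows "contr f (J i j) (J i j) = tr P *\<^sub>R f - 2 *\<^sub>R (f * P + P * f) - tr (f * J i j) *\<^sub>R J i j"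
  unfolding contr_def using square[OF assms] assms
  by (simp add: mult.assoc tr_simps algebra_simps)

lemma contr_pair:
  assumes "i \<in> I" "j \<in> I" "k \<in> I" "i \<noteq> j" "j \<noteq> k" "i \<noteq> k"
  shows "contr x (J k j) (J i j) = 2 *\<^sub>R comm (J k i) x - tr (x * J i j) *\<^sub>R J k j"
    and "contr x (J i k) (J i j) = 2 *\<^sub>R comm (J k j) x - tr (x * J i j) *\<^sub>R J i k"
proof -
  have a: "J i j * J k j = J i k" "J k j * J i j = J k i" "J i j * J i k = J j k" "J i k * J i j = J k j"
    using assms mul_last[of i j k] mul_last[of k j i] mul_first[of i j k] mul_first[of i k j] by auto
  have b: "J i k = - J k i" "J j k = - J k j" "tr (J k i) = 0" "tr (J k j) = 0"
    using assms anti[of k i] anti[of k j] tr_J[of k i j] tr_J[of k j i] by auto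
  show "contr x (J k j) (J i j) = 2 *\<^sub>R comm (J k i) x - tr (x * J i j) *\<^sub>R J k j"
    unfolding contr_def comm_def mult.assoc a(1) mult.assoc[symmetric, of "J k j"] a(2) b(1) by (simp add: b(3))
  show "contr x (J i k) (J i j) = 2 *\<^sub>R comm (J k j) x - tr (x * J i j) *\<^sub>R J i k"
    unfolding contr_def comm_def mult.assoc a(3) mult.assoc[symmetric, of "J i k"] a(4) b(2) by (simp add: b(4))
qed

end

text \<open>The identity \<open>2 F \<and> \<omega>\<^sub>i\<^sub>j = \<Sum>k. \<Omega>\<^sub>k\<^sub>i \<and> \<omega>\<^sub>k\<^sub>j + \<Omega>\<^sub>k\<^sub>j \<and> \<omega>\<^sub>i\<^sub>k\<close>, contracted with \<open>J\<^sub>p\<^sub>q\<close>. Here \<open>f\<close> and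
\<open>Om i j\<close> stand for the two-forms \<open>F\<close> and \<open>\<Omega>\<^sub>i\<^sub>j\<close>.\<close>
locale faraday_system = even_clifford_family +
  fixes f :: 'a and Om :: "'b \<Rightarrow> 'b \<Rightarrow> 'a"
  assumes Om_anti: "i \<in> I \<Longrightarrow> j \<in> I \<Longrightarrow> Om j i = - Om i j"
    and eq: "i \<in> I \<Longrightarrow> j \<in> I \<Longrightarrow> i \<noteq> j \<Longrightarrow> p \<in> I \<Longrightarrow> q \<in> I \<Longrightarrow> p \<noteq> q \<Longrightarrow> 2 *\<^sub>R contr f (J i j) (J p q) =
       (\<Sum>k\<in>I - {i, j}. contr (Om k i) (J k j) (J p q) + contr (Om k j) (J i k) (J p q))"
begin

definition v where "v i j = comm (J i j) (Om i j)"

lemma v_sym: "i \<in> I \<Longrightarrow> j \<in> I \<Longrightarrow> v i j = v j i"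
  by (cases "i = j") (simp_all add: anti[of i j] Om_anti[of i j] v_def comm_def)

text \<open>For \<open>(p, q) = (i, j)\<close> every contraction on the right is a commutator with some \<open>J\<close> up to multiples of
the \<open>J\<close>s, because \<open>J\<^sub>k\<^sub>j\<close> and \<open>J\<^sub>i\<^sub>k\<close> anticommute with \<open>J\<^sub>i\<^sub>j\<close>.\<close>
lemma self_equation:
  assumes "i \<in> I" "j \<in> I" "i \<noteq> j"
  shows "tr P *\<^sub>R f - 2 *\<^sub>R (f * P + P * f) - tr (f * J i j) *\<^sub>R J i j =
    (\<Sum>k\<in>I - {i, j}. v k i + v k j - (tr (Om k i * J i j) / 2) *\<^sub>R J k j - (tr (Om k j * J i j) / 2) *\<^sub>R J i k)"
  (is "?l = (\<Sum>k\<in>_. ?r k)")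
proof -
  have "2 *\<^sub>R ?l = (\<Sum>k\<in>I - {i, j}. contr (Om k i) (J k j) (J i j) + contr (Om k j) (J i k) (J i j))"
    unfolding contr_self[OF assms, symmetric] by (rule eq[OF assms assms])
  also have "\<dots> = (\<Sum>k\<in>I - {i, j}. 2 *\<^sub>R ?r k)"
  proof (rule sum.cong[OF refl])
    fix k assume "k \<in> I - {i, j}"
    then have k: "k \<in> I" "j \<noteq> k" "i \<noteq> k" by auto
    show "contr (Om k i) (J k j) (J i j) + contr (Om k j) (J i k) (J i j) = 2 *\<^sub>R ?r k"
      unfolding contr_pair[OF assms(1,2) k(1) assms(3) k(2,3)] v_def scaleR_add_right scaleR_diff_right scaleR_scaleR
      by simp
  qed
  also have "\<dots> = 2 *\<^sub>R (\<Sum>k\<in>I - {i, j}. ?r k)" by (simp add: scaleR_sum_right)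
  finally have "2 *\<^sub>R ?l = 2 *\<^sub>R (\<Sum>k\<in>I - {i, j}. ?r k)" .
  then show ?thesis by (rule scaleR_left_imp_eq[rotated]) simp
qed

definition u where "u i = (\<Sum>k\<in>I. v k i)"

definition L where "L = span {J i j | i j. i \<in> I \<and> j \<in> I \<and> i \<noteq> j}"

lemma J_L: "i \<in> I \<Longrightarrow> j \<in> I \<Longrightarrow> i \<noteq> j \<Longrightarrow> J i j \<in> L"
  unfolding L_def by (rule span_base) blast

lemmas L_intros = span_add[where S = "{J i j | i j. i \<in> I \<and> j \<in> I \<and> i \<noteq> j}", folded L_def]
  span_diff[where S = "{J i j | i j. i \<in> I \<and> j \<in> I \<and> i \<noteq> j}", folded L_def]
  span_neg[where S = "{J i j | i j. i \<in> I \<and> j \<in> I \<and> i \<noteq> j}", folded L_def]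
  span_scale[where S = "{J i j | i j. i \<in> I \<and> j \<in> I \<and> i \<noteq> j}", folded L_def]
  span_sum[where S = "{J i j | i j. i \<in> I \<and> j \<in> I \<and> i \<noteq> j}", folded L_def]

lemma L_cancel_scale: "c *\<^sub>R x \<in> L \<Longrightarrow> c \<noteq> 0 \<Longrightarrow> x \<in> L"
  using L_intros(4)[of "c *\<^sub>R x" "inverse c"] by simp

text \<open>Conjugation by \<open>J\<^sub>i\<^sub>j\<close> permutes the \<open>J\<^sub>k\<^sub>l\<close> up to sign.\<close>
lemma conj_L:
  assumes ij: "i \<in> I" "j \<in> I" "i \<noteq> j" and x: "x \<in> L"
  shows "J i j * x * J j i \<in> L"
proof -
  have gen: "J i j * J k l * J j i \<in> L" if kl: "k \<in> I" "l \<in> I" "k \<noteq> l" for k l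
  proof -
    consider "i = k" "j = l" | "i = l" "j = k" | "i = k" "j \<noteq> l" | "j = l" "i \<noteq> k" | "j = k" "i \<noteq> l" | "i = l" "j \<noteq> k"
    | "distinct [i,j,k,l]" using ij kl by auto
    then show ?thesis
    proof cases
      case 1
      then have "J i j * J k l * J j i = - J j i"
        using ij square[of i j] mul_diag[of j i] by simp
      then show ?thesis using ij kl 1 by (simp add: J_L L_intros(3))
    next
      case 2
      then have "J i j * J k l * J j i = J j i"
        using ij mul[of i j i] mul_diag[of j i] diag[of i] by simp
      then show ?thesis using ij kl 2 by (simp add: J_L L_intros(3))
    next
      case 3
      then have "J i j * J k l * J j i = J l i"
        using ij kl mul_first[of i j l] mul_outer[of j l i] mul_first[of j l i] by auto
      then show ?thesis using ij kl 3 by (simp add: J_L L_intros(3))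
    next
      case 4
      then have "J i j * J k l * J j i = J j k"
        using ij kl mul_last[of i j k] mul_outer[of i k j] by auto
      then show ?thesis using ij kl 4 by (simp add: J_L L_intros(3))
    next
      case 5
      then have "J i j * J k l * J j i = - J j l"
        using ij kl mul[of i j l] mul_outer[of i l j] by auto
      then show ?thesis using ij kl 5 by (simp add: J_L L_intros(3))
    next
      case 6
      then have "J i j * J k l * J j i = - J k i"
        using ij kl mul_outer[of i j k] mul[of k j i] by auto
      then show ?thesis using ij kl 6 by (simp add: J_L L_intros(3))
    next
      case 7
      then have "J i j * J k l * J j i = J k l * (J i j * J j i)"
        using commute_disjoint[of i j k l] ij kl by (simp add: mult.assoc)
      also have "\<dots> = J k l" using ij kl mul[of i j i] diag mul_diag(2)[of k l] by simp
      finally show ?thesis using kl by (simp add: J_L)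
    qed
  qed
  have "subspace {a. J i j * a * J j i \<in> L}"
  proof (rule subspaceI)
    show "0 \<in> {a. J i j * a * J j i \<in> L}" by (simp add: L_def span_zero)
    show "x + y \<in> {a. J i j * a * J j i \<in> L}" if "x \<in> {a. J i j * a * J j i \<in> L}" "y \<in> {a. J i j * a * J j i \<in> L}" for x y
      using that L_intros(1)[of "J i j * x * J j i" "J i j * y * J j i"] by (simp add: distrib_left distrib_right)
    show "c *\<^sub>R x \<in> {a. J i j * a * J j i \<in> L}" if "x \<in> {a. J i j * a * J j i \<in> L}" for c x
      using that L_intros(4)[of "J i j * x * J j i" c] by simp
  qed
  then have "span {J i j | i j. i \<in> I \<and> j \<in> I \<and> i \<noteq> j} \<subseteq> {a. J i j * a * J j i \<in> L}"
    using gen by (intro span_minimal) auto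
  then show ?thesis using x unfolding L_def by blast
qed

lemma v_self: "i \<in> I \<Longrightarrow> v i i = 0"
proof -
  assume "i \<in> I"
  then have "2 *\<^sub>R Om i i = 0" using Om_anti[of i i] by (metis add.right_inverse scaleR_2)
  then show ?thesis by (simp add: v_def comm_def)
qed

context
  assumes card_ge: "card I \<ge> 3" and card_4: "card I \<noteq> 4"
    and tr_disj: "\<And>i j k l. i \<in> I \<Longrightarrow> j \<in> I \<Longrightarrow> k \<in> I \<Longrightarrow> l \<in> I \<Longrightarrow> distinct [i,j,k,l] \<Longrightarrow> tr (J i j * J k l) = 0"
    and corner: "f * P = f" "P * f = f" "\<And>i j. i \<in> I \<Longrightarrow> j \<in> I \<Longrightarrow> Om i j * P = Om i j"
      "\<And>i j. i \<in> I \<Longrightarrow> j \<in> I \<Longrightarrow> P * Om i j = Om i j"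
    and m4: "tr P \<noteq> 4"
begin

lemma self_equation_mod:
  assumes ij: "i \<in> I" "j \<in> I" "i \<noteq> j"
  shows "(tr P - 4) *\<^sub>R f - (u i + u j - 2 *\<^sub>R v i j) \<in> L"
proof -
  have s: "(\<Sum>k\<in>I - {i, j}. v k i + v k j) = u i + u j - 2 *\<^sub>R v i j"
  proof -
    have "(\<Sum>k\<in>I. g k) = g i + g j + (\<Sum>k\<in>I - {i, j}. g k)" for g :: "'b \<Rightarrow> 'a"
      using ij fin sum.remove[of I i g] sum.remove[of "I - {i}" j g] by (simp add: Diff_insert2[of I i "{j}"] add.assoc)
    from this[of "\<lambda>k. v k i + v k j"] show ?thesis
      unfolding u_def sum.distrib using v_self v_sym[of i j] ij by (simp add: algebra_simps scaleR_2)
  qed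
  have quad: "2 *\<^sub>R f + 2 *\<^sub>R f = 4 *\<^sub>R f" by (simp flip: scaleR_left.add)
  have "(tr P - 4) *\<^sub>R f - (u i + u j - 2 *\<^sub>R v i j)
      = tr (f * J i j) *\<^sub>R J i j - (\<Sum>k\<in>I - {i, j}. (tr (Om k i * J i j) / 2) *\<^sub>R J k j + (tr (Om k j * J i j) / 2) *\<^sub>R J i k)"
    using self_equation[OF ij]
    unfolding corner s[symmetric] diff_diff_eq sum_subtractf by (simp add: algebra_simps quad)
  also have "\<dots> \<in> L" using ij by (intro L_intros J_L) auto
  finally show ?thesis .
qed

lemma conj_v:
  assumes ij: "i \<in> I" "j \<in> I" "i \<noteq> j"
  shows "J i j * v i j * J j i = - v i j"
proof -
  let ?J = "J i j" and ?O = "Om i j"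
  have "?J * v i j * J j i = - ((?J * ?J) * ?O * ?J) + ?J * ?O * (?J * ?J)"
    unfolding v_def comm_def anti[OF ij] by (simp add: algebra_simps)
  also have "\<dots> = P * ?O * ?J - ?J * (?O * P)" unfolding square[OF ij] by (simp add: algebra_simps)
  also have "\<dots> = - v i j" using corner ij by (simp add: v_def comm_def)
  finally show ?thesis .
qed

text \<open>The equations \<open>(m - 4) f = u i + u j - 2 v i j\<close> modulo \<open>L\<close>, summed over \<open>j\<close>, show that the differences
\<open>u i - u j\<close> lie in \<open>L\<close>, because the rank is not \<open>4\<close>. So all \<open>v i j\<close> agree modulo \<open>L\<close> with one element \<open>w\<close>.
Conjugation by each \<open>J\<^sub>i\<^sub>j\<close> sends \<open>w\<close> to \<open>- w\<close> modulo \<open>L\<close>; but the conjugations by \<open>J\<^sub>a\<^sub>b\<close> and \<open>J\<^sub>b\<^sub>c\<close> compose to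
the one by \<open>J\<^sub>a\<^sub>c\<close>, so \<open>w = - w\<close> modulo \<open>L\<close>.\<close>
lemma f_in_L: "f \<in> L"
proof -
  let ?r = "real (card I)" and ?U = "\<Sum>j\<in>I. u j" and ?m = "tr P - 4"
  have sum_eq: "((?r - 1) * ?m) *\<^sub>R f - ((?r - 4) *\<^sub>R u i + ?U) \<in> L" if i: "i \<in> I" for i
  proof -
    have "(\<Sum>j\<in>I-{i}. ?m *\<^sub>R f - (u i + u j - 2 *\<^sub>R v i j)) \<in> L"
      using self_equation_mod i by (intro L_intros(5)) auto
    also have "(\<Sum>j\<in>I-{i}. ?m *\<^sub>R f - (u i + u j - 2 *\<^sub>R v i j))
       = ((?r - 1) * ?m) *\<^sub>R f - ((?r - 1) *\<^sub>R u i + (?U - u i) - 2 *\<^sub>R u i)"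
    proof -
      have "(\<Sum>j\<in>I-{i}. v i j) = u i" 
        unfolding u_def using i fin v_self v_sym by (simp add: sum.remove[of I i])
      moreover have "(\<Sum>j\<in>I-{i}. u j) = ?U - u i" using i fin by (simp add: sum.remove[of I i])
      moreover have "real (card (I - {i})) = ?r - 1"
        using i fin card_ge by (simp add: card_Diff_singleton of_nat_diff)
      ultimately show ?thesis
        by (simp add: sum_subtractf sum.distrib sum_constant_scaleR scaleR_sum_right[symmetric] mult.commute del: sum_constant)
    qed
    also have "\<dots> = ((?r - 1) * ?m) *\<^sub>R f - ((?r - 4) *\<^sub>R u i + ?U)"
    proof -
      have "(?r - 4) *\<^sub>R u i = (?r - 1) *\<^sub>R u i - u i - 2 *\<^sub>R u i" 
        using scaleR_left.diff[of "?r - 1" 3 "u i"] scaleR_left.add[of 1 2 "u i"] by simp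
      then show ?thesis by simp
    qed
    finally show ?thesis .
  qed
  have u_eq: "u i - u j \<in> L" if "i \<in> I" "j \<in> I" for i j
  proof (rule L_cancel_scale)
    show "(4 - ?r) *\<^sub>R (u i - u j) \<in> L"
      using L_intros(2)[OF sum_eq[OF that(1)] sum_eq[OF that(2)]] by (simp add: algebra_simps)
    show "4 - ?r \<noteq> 0" using card_4 by auto
  qed
  obtain a where a: "a \<in> I" using card_ge by fastforce
  have "\<not> I \<subseteq> {a}" using card_ge card_mono[of "{a}" I] by auto
  then obtain b where b: "b \<in> I" "a \<noteq> b" by blast
  have "\<not> I \<subseteq> {a, b}" using card_ge card_mono[of "{a, b}" I] b by auto
  then obtain c where c: "c \<in> I" "a \<noteq> c" "b \<noteq> c" by blast
  \<comment> \<open>The common value of all \<open>v i j\<close> modulo \<open>L\<close>, found by solving the displayed equation with \<open>u i = u j = u a\<close>.\<close>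
  define w where "w = u a - (?m / 2) *\<^sub>R f"
  have vw: "v i j - w \<in> L" if ij: "i \<in> I" "j \<in> I" "i \<noteq> j" for i j
  proof -
    have "(?m *\<^sub>R f - (u i + u j - 2 *\<^sub>R v i j)) + (u i - u a) + (u j - u a) \<in> L"
      by (rule L_intros(1)[OF L_intros(1)[OF self_equation_mod[OF ij] u_eq[OF ij(1) a]] u_eq[OF ij(2) a]])
    also have "(?m *\<^sub>R f - (u i + u j - 2 *\<^sub>R v i j)) + (u i - u a) + (u j - u a) = 2 *\<^sub>R (v i j - w)"
    proof -
      have e: "2 *\<^sub>R (v i j - w) = 2 *\<^sub>R v i j - (u a + u a) + ?m *\<^sub>R f"
        unfolding w_def scaleR_diff_right scaleR_2[of "u a"] by simp
      show ?thesis unfolding e by (simp only: algebra_simps)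
    qed
    finally show ?thesis by (rule L_cancel_scale) simp
  qed
  have cw: "J i j * w * J j i + w \<in> L" if ij: "i \<in> I" "j \<in> I" "i \<noteq> j" for i j
  proof -
    have "- (J i j * (v i j - w) * J j i) - (v i j - w) \<in> L"
      by (rule L_intros(2)[OF L_intros(3)[OF conj_L[OF ij vw[OF ij]]] vw[OF ij]])
    then show ?thesis using conj_v[OF ij] by (simp add: algebra_simps)
  qed
  have "J a b * (J b c * w * J c b + w) * J b a \<in> L"
    by (rule conj_L[OF a b cw[OF b(1) c(1,3)]])
  also have "J a b * (J b c * w * J c b + w) * J b a = (J a b * J b c) * w * (J c b * J b a) + J a b * w * J b a"
    by (simp add: algebra_simps)
  also have "\<dots> = J a c * w * J c a + J a b * w * J b a"
    using a b c by (simp add: mul)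
  finally have 1: "J a c * w * J c a + J a b * w * J b a \<in> L" .
  have "(J a c * w * J c a + w) + (J a b * w * J b a + w) - (J a c * w * J c a + J a b * w * J b a) \<in> L"
    by (rule L_intros(2)[OF L_intros(1)[OF cw[OF a c(1,2)] cw[OF a b]] 1])
  then have "2 *\<^sub>R w \<in> L" by (simp add: scaleR_2 algebra_simps)
  then have w: "w \<in> L" by (rule L_cancel_scale) simp
  have v: "v i j \<in> L" if ij: "i \<in> I" "j \<in> I" for i j
    using L_intros(1)[OF vw[of i j] w] v_self[of i] ij L_intros(4)[OF w, of 0] by (cases "i = j") auto
  have "u a \<in> L" unfolding u_def using v a by (intro L_intros(5)) auto
  then have "u a - w \<in> L" using w by (rule L_intros(2))
  then have "(?m / 2) *\<^sub>R f \<in> L" unfolding w_def by simp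
  then show ?thesis using m4 by (auto dest: L_cancel_scale)
qed

lemma tr_comm_mult: "tr (comm x y * z) = tr (y * comm z x)"
  using tr_commute[of x "y * z"] by (simp add: comm_def algebra_simps tr_simps)

lemma tr_v:
  assumes "i \<in> I" "j \<in> I" "k \<in> I" "i \<noteq> j" "j \<noteq> k" "i \<noteq> k"
  shows "tr (v k i * J i j) = 2 * tr (Om k i * J k j)"
    and "tr (v k j * J i j) = - 2 * tr (Om k j * J k i)"
proof -
  have *: "tr (v k i * J i j) = 2 * tr (Om k i * J k j)"
    if "i \<in> I" "j \<in> I" "k \<in> I" "i \<noteq> j" "j \<noteq> k" "i \<noteq> k" for i j k
  proof -
    have "comm (J i j) (J k i) = 2 *\<^sub>R J k j"
      using mul_outer[of i j k] mul[of k i j] that by (simp add: comm_def scaleR_2)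
    then show ?thesis unfolding v_def tr_comm_mult by (simp add: tr_simps)
  qed
  show "tr (v k i * J i j) = 2 * tr (Om k i * J k j)" using *[OF assms] .
  show "tr (v k j * J i j) = - 2 * tr (Om k j * J k i)"
    using *[of j i k] anti[of j i] assms by (simp add: tr_simps)
qed

text \<open>The equations for the traces come from multiplying \<open>self_equation\<close> with \<open>J\<^sub>i\<^sub>j\<close>, here, and with \<open>J\<^sub>k\<^sub>j\<close>, in
\<open>trace_other\<close>. They involve only the traces \<open>tr (Om k i * J k j)\<close>.\<close>
lemma trace_self:
  assumes ij: "i \<in> I" "j \<in> I" "i \<noteq> j"
  shows "(tr P - 2) * tr (f * J i j) = (\<Sum>k\<in>I-{i,j}. tr (Om k i * J k j) - tr (Om k j * J k i))"
proof -
  have "tr ((tr P *\<^sub>R f - 2 *\<^sub>R (f * P + P * f) - tr (f * J i j) *\<^sub>R J i j) * J i j) =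
    (\<Sum>k\<in>I-{i,j}. tr ((v k i + v k j - (tr (Om k i * J i j) / 2) *\<^sub>R J k j - (tr (Om k j * J i j) / 2) *\<^sub>R J i k) * J i j))"
    unfolding self_equation[OF ij] by (simp add: sum_distrib_right tr_simps)
  also have "\<dots> = (\<Sum>k\<in>I-{i,j}. 2 * (tr (Om k i * J k j) - tr (Om k j * J k i)))"
  proof (rule sum.cong[OF refl])
    fix k assume "k \<in> I - {i,j}"
    then have k: "k \<in> I" "j \<noteq> k" "i \<noteq> k" by auto
    have "tr (J k j * J i j) = 0" "tr (J i k * J i j) = 0"
      using tr_J_J[OF card_ge tr_disj] ij k by auto
    then show "tr ((v k i + v k j - (tr (Om k i * J i j) / 2) *\<^sub>R J k j - (tr (Om k j * J i j) / 2) *\<^sub>R J i k) * J i j)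
       = 2 * (tr (Om k i * J k j) - tr (Om k j * J k i))"
      using tr_v[OF ij(1,2) k(1) ij(3) k(2,3)] by (simp add: algebra_simps tr_simps)
  qed
  also have "tr ((tr P *\<^sub>R f - 2 *\<^sub>R (f * P + P * f) - tr (f * J i j) *\<^sub>R J i j) * J i j) = 2 * ((tr P - 2) * tr (f * J i j))"
    unfolding corner using square[OF ij] by (simp add: algebra_simps tr_simps)
  finally have "2 * ((tr P - 2) * tr (f * J i j)) = 2 * (\<Sum>k\<in>I-{i,j}. tr (Om k i * J k j) - tr (Om k j * J k i))"
    unfolding sum_distrib_left[symmetric] .
  then show ?thesis by simp
qed

lemma trace_other:
  assumes ij: "i \<in> I" "j \<in> I" "k \<in> I" "i \<noteq> j" "j \<noteq> k" "i \<noteq> k"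
  shows "(tr P - 4) * tr (f * J k j) = (2 - tr P / 2) * tr (Om i k * J i j) - 2 * (\<Sum>l\<in>I-{i,j,k}. tr (Om l j * J l k))"
proof -
  let ?t = "\<lambda>l. tr ((v l i + v l j - (tr (Om l i * J i j) / 2) *\<^sub>R J l j - (tr (Om l j * J i j) / 2) *\<^sub>R J i l) * J k j)"
  have "(tr P - 4) * tr (f * J k j) = tr ((tr P *\<^sub>R f - 2 *\<^sub>R (f * P + P * f) - tr (f * J i j) *\<^sub>R J i j) * J k j)"
  proof -
    have "tr (J i j * J k j) = 0" using tr_J_J[OF card_ge tr_disj] ij by auto
    then show ?thesis unfolding corner by (simp add: algebra_simps tr_simps)
  qed
  also have "\<dots> = (\<Sum>l\<in>I-{i,j}. ?t l)"
    unfolding self_equation[OF ij(1,2,4)] by (simp add: sum_distrib_right tr_simps)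
  also have "\<dots> = ?t k + (\<Sum>l\<in>I-{i,j}-{k}. ?t l)"
    using ij fin by (intro sum.remove) auto
  also have "?t k = (2 - tr P / 2) * tr (Om i k * J i j)"
  proof -
    have "tr (J k j * J k j) = - tr P" "tr (J i k * J k j) = 0"
      using tr_J_J[OF card_ge tr_disj, of k j k j] tr_J_J[OF card_ge tr_disj, of i k k j] ij by auto
    moreover have "tr (v k i * J k j) = 2 * tr (Om i k * J i j)"
      using tr_v(1)[of k j i] v_sym[of i k] ij by simp
    moreover have "tr (v k j * J k j) = 0" unfolding v_def tr_comm_mult by (simp add: comm_def tr_simps)
    moreover have "tr (Om k i * J i j) = - tr (Om i k * J i j)" using Om_anti[of i k] ij by (simp add: tr_simps)
    ultimately show ?thesis by (simp add: algebra_simps tr_simps)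
  qed
  also have "(\<Sum>l\<in>I-{i,j}-{k}. ?t l) = (\<Sum>l\<in>I-{i,j,k}. - 2 * tr (Om l j * J l k))"
  proof (rule sum.cong)
    show "I-{i,j}-{k} = I-{i,j,k}" by auto
    fix l assume "l \<in> I-{i,j,k}"
    then have l: "l \<in> I" "l \<noteq> i" "l \<noteq> j" "l \<noteq> k" by auto
    have "tr (J l j * J k j) = 0" "tr (J i l * J k j) = 0"
      using tr_J_J[OF card_ge tr_disj, of l j k j] tr_J_J[OF card_ge tr_disj, of i l k j] ij l by auto
    moreover have "tr (v l i * J k j) = 0"
    proof -
      have "comm (J k j) (J l i) = 0"
        using commute_disjoint[of k j l i] ij l by (simp add: comm_def)
      then show ?thesis unfolding v_def tr_comm_mult by (simp add: tr_simps)
    qed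
    moreover have "tr (v l j * J k j) = - 2 * tr (Om l j * J l k)"
      using tr_v(2)[of k j l] ij l by auto
    ultimately show "?t l = - 2 * tr (Om l j * J l k)" by (simp add: algebra_simps tr_simps)
  qed
  finally show ?thesis by (simp add: sum_distrib_left sum_negf)
qed

text \<open>Write \<open>a i\<close> and \<open>b i\<close> for the two traces that occur in the equations for \<open>J\<^sub>k\<^sub>j\<close>. Subtracting
from \<open>trace_other\<close> its image under exchanging \<open>j\<close> and \<open>k\<close> relates \<open>\<phi>\<close> to \<open>a i - b i\<close> and to the total
\<open>S - T\<close>. Its sum over \<open>i\<close> and the equation \<open>(m - 2) \<phi> = S - T\<close> leave a multiple of \<open>\<phi>\<close>, and the
factor is \<open>m (m - 2) - 8 (r - 2)\<close>.\<close>
lemma tr_f_J: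
  assumes dim: "tr P * (tr P - 2) \<noteq> 8 * (real (card I) - 2)"
    and jk: "j \<in> I" "k \<in> I" "j \<noteq> k"
  shows "tr (f * J k j) = 0"
proof -
  define K where "K = I - {j, k}"
  define a where "a = (\<lambda>i. tr (Om i k * J i j))"
  define b where "b = (\<lambda>i. tr (Om i j * J i k))"
  define \<phi> where "\<phi> = tr (f * J k j)"
  define m where "m = tr P"
  define S where "S = sum a K"
  define T where "T = sum b K"
  have cardK: "real (card K) = real (card I) - 2"
    unfolding K_def using fin jk card_ge by (simp add: card_Diff_subset of_nat_diff)
  have K: "finite K" unfolding K_def using fin by simp
  have 1: "(m - 2) * \<phi> = S - T"
    using trace_self[of k j] jk unfolding S_def T_def K_def \<phi>_def m_def a_def b_def
    by (simp add: sum_subtractf insert_commute)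
  have 2: "2 * ((m - 4) * \<phi>) = 2 * (S - T) - (m / 2) * (a i - b i)" if i: "i \<in> K" for i
  proof -
    have i': "i \<in> I" "i \<noteq> j" "i \<noteq> k" using i unfolding K_def by auto
    have e: "I - {i, j, k} = K - {i}" "I - {i, k, j} = K - {i}" unfolding K_def by auto
    have neg: "tr (f * J j k) = - \<phi>" unfolding \<phi>_def using anti[of k j] jk by (simp add: tr_simps)
    have "(m - 4) * \<phi> = (2 - m / 2) * a i - 2 * sum b (K - {i})"
      using trace_other[of i j k] i' jk unfolding e a_def b_def \<phi>_def m_def by simp
    moreover have "(m - 4) * (- \<phi>) = (2 - m / 2) * b i - 2 * sum a (K - {i})"
      using trace_other[of i k j] i' jk unfolding e neg a_def b_def m_def by simp
    moreover have "sum b (K - {i}) = T - b i" "sum a (K - {i}) = S - a i"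
      unfolding S_def T_def using i K by (simp_all add: sum.remove[of K i])
    moreover have "(2 - m / 2) * a i = 2 * a i - m / 2 * a i" "(2 - m / 2) * b i = 2 * b i - m / 2 * b i"
      "m / 2 * (a i - b i) = m / 2 * a i - m / 2 * b i" "(m - 4) * (- \<phi>) = - ((m - 4) * \<phi>)"
      by (simp_all only: left_diff_distrib right_diff_distrib minus_mult_right)
    moreover have "2 * X = 2 * (S - T) - (p - q)"
      if "X = 2 * x - p - 2 * (T - y)" "- X = 2 * y - q - 2 * (S - x)" for X x y p q :: real
      using that by argo
    ultimately show ?thesis by metis
  qed
  have "(\<Sum>i\<in>K. 2 * ((m - 4) * \<phi>)) = (\<Sum>i\<in>K. 2 * (S - T) - (m / 2) * (a i - b i))"
    using 2 by (intro sum.cong refl)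
  then have "real (card K) * (2 * ((m - 4) * \<phi>)) = real (card K) * (2 * (S - T)) - (m / 2) * (S - T)"
    unfolding S_def T_def
    by (simp add: sum_subtractf sum_distrib_left[symmetric] right_diff_distrib sum_divide_distrib[symmetric])
  moreover have "(m * (m - 2) - 8 * real (card K)) * \<phi>
     = 2 * (real (card K) * (2 * ((m - 4) * \<phi>)) - (real (card K) * (2 * ((m - 2) * \<phi>)) - (m / 2) * ((m - 2) * \<phi>)))"
    by (simp add: algebra_simps)
  ultimately have "(m * (m - 2) - 8 * real (card K)) * \<phi> = 0"
    unfolding 1 by simp
  then show ?thesis using dim unfolding cardK m_def \<phi>_def by simp
qed

text \<open>Expansion in an orthogonal basis. The factor \<open>2\<close> arises since the sum runs over ordered pairs.\<close>
lemma reproduce_L: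
  assumes "x \<in> L"
  shows "(\<Sum>(i,j)\<in>{(i,j). i \<in> I \<and> j \<in> I \<and> i \<noteq> j}. tr (x * J i j) *\<^sub>R J i j) = (- 2 * tr P) *\<^sub>R x"
proof -
  let ?N = "{(i,j). i \<in> I \<and> j \<in> I \<and> i \<noteq> j}"
  define h where "h x = (\<Sum>(i,j)\<in>?N. tr (x * J i j) *\<^sub>R J i j) - (- 2 * tr P) *\<^sub>R x" for x
  have finN: "finite ?N" by (rule finite_subset[of _ "I \<times> I"]) (use fin in auto)
  have lin: "linear h"
    unfolding h_def by (rule linearI) (simp_all add: algebra_simps tr_simps sum.distrib scaleR_sum_right split_def)
  have gen: "h (J k l) = 0" if kl: "k \<in> I" "l \<in> I" "k \<noteq> l" for k l
  proof -
    have "(\<Sum>(i,j)\<in>?N. tr (J k l * J i j) *\<^sub>R J i j) = (\<Sum>q\<in>?N. (if q = (k,l) then - tr P *\<^sub>R J k l else 0) + (if q = (l,k) then tr P *\<^sub>R J l k else 0))"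
    proof (rule sum.cong[OF refl])
      fix q assume q: "q \<in> ?N"
      obtain i j where ij: "q = (i, j)" by fastforce
      then have "i \<in> I" "j \<in> I" "i \<noteq> j" using q by auto
      from tr_J_J[OF card_ge tr_disj kl(1,2) this(1,2) kl(3) this(3)]
      show "(case q of (i,j) \<Rightarrow> tr (J k l * J i j) *\<^sub>R J i j) = (if q = (k,l) then - tr P *\<^sub>R J k l else 0) + (if q = (l,k) then tr P *\<^sub>R J l k else 0)"
        using kl(3) unfolding ij by (simp split: if_splits)
    qed
    also have "\<dots> = - tr P *\<^sub>R J k l + tr P *\<^sub>R J l k"
      unfolding sum.distrib using finN kl by (simp add: sum.delta)
    also have "\<dots> = (- 2 * tr P) *\<^sub>R J k l"
      using anti[of k l] kl scaleR_left.add[of "- tr P" "- tr P" "J k l"] by simp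
    finally show ?thesis unfolding h_def by simp
  qed
  have "h x = 0"
    by (rule linear_eq_0_on_span[OF lin _ assms[unfolded L_def]]) (use gen in auto)
  then show ?thesis unfolding h_def by (rule eq_iff_diff_eq_0[THEN iffD2])
qed

theorem corner_vanishes:
  assumes "tr P * (tr P - 2) \<noteq> 8 * (real (card I) - 2)" "tr P \<noteq> 0"
  shows "f = 0"
proof -
  have "(\<Sum>(i,j)\<in>{(i,j). i \<in> I \<and> j \<in> I \<and> i \<noteq> j}. tr (f * J i j) *\<^sub>R J i j) = 0"
    using tr_f_J[OF assms(1)] by (intro sum.neutral) auto
  then show ?thesis using reproduce_L[OF f_in_L] assms(2) by simp
qed

end

lemma P_idem: assumes "i \<in> I" shows "P * P = P"
  using mul_diag(1)[of i i] diag[of i] assms by simp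

text \<open>All terms of \<open>self_equation\<close> other than \<open>tr P *\<^sub>R f\<close> contain a factor that \<open>1 - P\<close> annihilates.\<close>
lemma complement_block:
  assumes ij: "i \<in> I" "j \<in> I" "i \<noteq> j" and "tr P \<noteq> 0"
  shows "(1 - P) * f * (1 - P) = 0"
proof -
  define Q where "Q = 1 - P"
  have PP: "P * P = P" using P_idem ij(1) .
  have J0: "J k l * Q = 0" "Q * J k l = 0" if "k \<in> I" "l \<in> I" for k l
    using mul_diag that by (simp_all add: algebra_simps Q_def)
  have v0: "Q * v k l * Q = 0" if "k \<in> I" "l \<in> I" for k l
  proof -
    have "Q * v k l * Q = (Q * J k l) * Om k l * Q - Q * Om k l * (J k l * Q)"
      unfolding v_def comm_def by (simp only: right_diff_distrib left_diff_distrib mult.assoc)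
    then show ?thesis using J0 that by simp
  qed
  have "Q * (tr P *\<^sub>R f - 2 *\<^sub>R (f * P + P * f) - tr (f * J i j) *\<^sub>R J i j) * Q = tr P *\<^sub>R (Q * f * Q)"
  proof -
    have "Q * (tr P *\<^sub>R f - 2 *\<^sub>R (f * P + P * f) - tr (f * J i j) *\<^sub>R J i j) * Q
       = tr P *\<^sub>R (Q * f * Q) - 2 *\<^sub>R (Q * f * (P * Q) + (Q * P) * f * Q) - tr (f * J i j) *\<^sub>R ((Q * J i j) * Q)"
      by (simp only: right_diff_distrib left_diff_distrib distrib_left distrib_right mult_scaleR_right mult_scaleR_left mult.assoc scaleR_diff_right scaleR_add_right)
    moreover have "P * Q = 0" "Q * P = 0" using PP by (simp_all add: algebra_simps Q_def)
    ultimately show ?thesis using J0 ij by simp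
  qed
  moreover have "Q * (v k i + v k j - (tr (Om k i * J i j) / 2) *\<^sub>R J k j - (tr (Om k j * J i j) / 2) *\<^sub>R J i k) * Q = 0"
    if "k \<in> I - {i,j}" for k
  proof -
    have "Q * (v k i + v k j - (tr (Om k i * J i j) / 2) *\<^sub>R J k j - (tr (Om k j * J i j) / 2) *\<^sub>R J i k) * Q
      = Q * v k i * Q + Q * v k j * Q - (tr (Om k i * J i j) / 2) *\<^sub>R (Q * J k j * Q) - (tr (Om k j * J i j) / 2) *\<^sub>R (Q * J i k * Q)"
      by (simp only: right_diff_distrib left_diff_distrib distrib_left distrib_right mult_scaleR_right mult_scaleR_left mult.assoc)
    then show ?thesis using v0 J0 that ij by simp
  qed
  ultimately have "tr P *\<^sub>R (Q * f * Q) = 0"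
    using self_equation[OF ij] by (simp add: sum_distrib_left sum_distrib_right)
  then show ?thesis using assms(4) by (simp add: Q_def)
qed

text \<open>Let \<open>x = P f (1 - P)\<close> and \<open>z = J\<^sub>a\<^sub>b Om\<^sub>a\<^sub>b (1 - P)\<close>. Contraction of the equation for \<open>J\<^sub>i\<^sub>j\<close> with \<open>J\<^sub>i\<^sub>j\<close> gives
\<open>(m - 2) x = 2 z\<close>, with the same \<open>z\<close> for all three pairs, and contraction with \<open>J\<^sub>k\<^sub>j\<close> gives \<open>4 x = m z\<close>.\<close>
lemma mixed_block:
  assumes I: "I = {i, j, k}" "i \<noteq> j" "j \<noteq> k" "i \<noteq> k" and dim: "tr P * (tr P - 2) \<noteq> 8"
  shows "P * f * (1 - P) = 0"
proof -
  define Q where "Q = 1 - P"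
  define x where "x = P * f * Q"
  define z where "z a b = J a b * Om a b * Q" for a b
  have PP: "P * P = P" using P_idem[of i] I by simp
  have PQ: "P * Q = 0" using PP by (simp add: algebra_simps Q_def)
  have J0: "J a b * Q = 0" if "a \<in> I" "b \<in> I" for a b
    using mul_diag that by (simp add: algebra_simps Q_def)
  have z_sym: "z a b = z b a" if "a \<in> I" "b \<in> I" for a b
    using that by (cases "a = b") (simp_all add: anti[of a b] Om_anti[of a b] z_def)
  have vz: "P * v a b * Q = z a b" if "a \<in> I" "b \<in> I" for a b
  proof -
    have "P * v a b * Q = (P * J a b) * Om a b * Q - P * Om a b * (J a b * Q)"
      unfolding v_def comm_def by (simp only: right_diff_distrib left_diff_distrib mult.assoc)
    then show ?thesis using J0 mul_diag that by (simp add: z_def)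
  qed
  have self: "(tr P - 2) *\<^sub>R x = z c a + z c b" if abc: "I = {a,b,c}" "a \<noteq> b" "b \<noteq> c" "a \<noteq> c" for a b c
  proof -
    have ab: "a \<in> I" "b \<in> I" "c \<in> I" using abc by auto
    have one: "I - {a, b} = {c}" using abc by auto
    have "P * (tr P *\<^sub>R f - 2 *\<^sub>R (f * P + P * f) - tr (f * J a b) *\<^sub>R J a b) * Q
       = tr P *\<^sub>R (P * f * Q) - 2 *\<^sub>R (P * f * (P * Q) + (P * P) * f * Q) - tr (f * J a b) *\<^sub>R (P * (J a b * Q))"
      by (simp only: right_diff_distrib left_diff_distrib distrib_left distrib_right mult_scaleR_right mult_scaleR_left mult.assoc scaleR_diff_right scaleR_add_right)
    also have "\<dots> = (tr P - 2) *\<^sub>R x" using PP PQ J0 ab by (simp add: x_def scaleR_left_diff_distrib)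
    finally have l: "P * (tr P *\<^sub>R f - 2 *\<^sub>R (f * P + P * f) - tr (f * J a b) *\<^sub>R J a b) * Q = (tr P - 2) *\<^sub>R x" .
    have "P * (v c a + v c b - (tr (Om c a * J a b) / 2) *\<^sub>R J c b - (tr (Om c b * J a b) / 2) *\<^sub>R J a c) * Q
      = P * v c a * Q + P * v c b * Q - (tr (Om c a * J a b) / 2) *\<^sub>R (P * (J c b * Q)) - (tr (Om c b * J a b) / 2) *\<^sub>R (P * (J a c * Q))"
      by (simp only: right_diff_distrib left_diff_distrib distrib_left distrib_right mult_scaleR_right mult_scaleR_left mult.assoc)
    also have "\<dots> = z c a + z c b" using vz J0 ab by simp
    finally show ?thesis using self_equation[OF ab(1,2) abc(2)] l unfolding one by simp
  qed
  have perm: "I = {j, k, i}" "I = {i, k, j}" using I by auto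
  have mem: "i \<in> I" "j \<in> I" "k \<in> I" using I by auto
  have e1: "(tr P - 2) *\<^sub>R x = z k i + z k j" using self[of i j k] I by simp
  have e2: "(tr P - 2) *\<^sub>R x = z i j + z i k" using self[OF perm(1)] I by simp
  have e3: "(tr P - 2) *\<^sub>R x = z j i + z j k" using self[OF perm(2)] I by simp
  have zz: "z k i = z k j"
  proof -
    have "z k j = z i j" using e1 e2 z_sym mem by simp
    moreover have "z k i = z i j" using e1 e3 z_sym mem by simp
    ultimately show ?thesis by simp
  qed
  define w where "w = z k i"
  have half: "(tr P - 2) *\<^sub>R x = 2 *\<^sub>R w" using e1 zz by (simp add: w_def scaleR_2)
  have "4 *\<^sub>R x = tr P *\<^sub>R w"
  proof -
    have one: "I - {i, j} = {k}" using I by auto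
    have eqn: "2 *\<^sub>R contr f (J i j) (J k j) = contr (Om k i) (J k j) (J k j) + contr (Om k j) (J i k) (J k j)"
      using eq[of i j k j] mem I unfolding one by simp
    have m1: "J i j * J k j = J i k" "J i k * J k j = - J i j" "J k i * J i k = P" "J k i * J i j = - J k j" "J k i * P = J k i"
      using mul_last[of i j k] mul[of i k j] mul[of k i k] diag[of k] mul[of k i j] mul_diag mem I by auto
    have t1: "tr (J i j * J k j) = 0" "tr (J i k * J k j) = 0"
      using m1 tr_J[of i k j] tr_J[of i j k] mem I by (auto simp: tr_simps)
    have a: "J k i * contr f (J i j) (J k j) * Q = 2 *\<^sub>R x"
    proof -
      have "J k i * contr f (J i j) (J k j) * Q = 2 *\<^sub>R (J k i * f * J k j * (J i j * Q) + (J k i * (J i j * J k j)) * f * Q)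
          - tr (f * J k j) *\<^sub>R (J k i * (J i j * Q))"
        unfolding contr_def t1 by (simp add: mult.assoc distrib_left distrib_right left_diff_distrib right_diff_distrib)
      then show ?thesis unfolding m1 using J0 mem by (simp add: x_def)
    qed
    have b: "J k i * contr (Om k i) (J k j) (J k j) * Q = (tr P - 2) *\<^sub>R w"
    proof -
      have "J k i * contr (Om k i) (J k j) (J k j) * Q = tr P *\<^sub>R (J k i * Om k i * Q)
         - 2 *\<^sub>R (J k i * Om k i * (P * Q) + (J k i * P) * Om k i * Q) - tr (Om k i * J k j) *\<^sub>R (J k i * (J k j * Q))"
        unfolding contr_self[OF mem(3,2) I(3)[symmetric]]
        by (simp only: right_diff_distrib left_diff_distrib distrib_left distrib_right mult_scaleR_right mult_scaleR_left mult.assoc scaleR_diff_right scaleR_add_right)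
      then show ?thesis unfolding PQ m1 using J0 mem by (simp add: w_def z_def scaleR_left_diff_distrib)
    qed
    have c: "J k i * contr (Om k j) (J i k) (J k j) * Q = 2 *\<^sub>R w"
    proof -
      have "J k i * contr (Om k j) (J i k) (J k j) * Q = 2 *\<^sub>R (J k i * Om k j * J k j * (J i k * Q) + (J k i * (J i k * J k j)) * Om k j * Q)
          - tr (Om k j * J k j) *\<^sub>R (J k i * (J i k * Q))"
        unfolding contr_def t1 by (simp add: mult.assoc distrib_left distrib_right left_diff_distrib right_diff_distrib)
      also have "J k i * (J i k * J k j) = J k j" unfolding m1(2) using m1(4) by simp
      finally show ?thesis using J0 mem zz by (simp add: w_def z_def)
    qed
    have "J k i * (2 *\<^sub>R contr f (J i j) (J k j)) * Q = J k i * contr (Om k i) (J k j) (J k j) * Q + J k i * contr (Om k j) (J i k) (J k j) * Q"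
      unfolding eqn by (simp only: distrib_left distrib_right)
    then show ?thesis unfolding b c using a by (simp add: scaleR_left_diff_distrib)
  qed
  then have quad: "tr P *\<^sub>R w = 4 *\<^sub>R x" by simp
  have "(tr P * (tr P - 2)) *\<^sub>R x = tr P *\<^sub>R ((tr P - 2) *\<^sub>R x)" by simp
  also have "\<dots> = 2 *\<^sub>R (tr P *\<^sub>R w)" unfolding half by (simp add: mult.commute)
  also have "\<dots> = 8 *\<^sub>R x" unfolding quad by simp
  finally have "(tr P * (tr P - 2)) *\<^sub>R x = 8 *\<^sub>R x" .
  then have "(tr P * (tr P - 2) - 8) *\<^sub>R x = 0" by (simp add: scaleR_left_diff_distrib)
  then show ?thesis using dim by (simp add: x_def Q_def)
qed

end

section \<open>Curvature tensors that normalise a Clifford family\<close>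

text \<open>Linear endomorphisms as a type, so that they form a \<open>real_algebra_1\<close> and the system above can be
instantiated with them.\<close>
typedef (overloaded) 'e endo = "{f :: 'e::euclidean_space \<Rightarrow> 'e. linear f}"
  by (rule exI[of _ id]) (simp add: linear_id)

setup_lifting type_definition_endo

instantiation endo :: (euclidean_space) real_algebra_1
begin

lift_definition zero_endo :: "'a endo" is "\<lambda>x. 0" by (simp add: linear_zero)
lift_definition one_endo :: "'a endo" is "\<lambda>x. x" by (simp add: linear_ident)
lift_definition plus_endo :: "'a endo \<Rightarrow> 'a endo \<Rightarrow> 'a endo" is "\<lambda>f g x. f x + g x" by (simp add: linear_compose_add)
lift_definition minus_endo :: "'a endo \<Rightarrow> 'a endo \<Rightarrow> 'a endo" is "\<lambda>f g x. f x - g x" by (simp add: linear_compose_sub)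
lift_definition uminus_endo :: "'a endo \<Rightarrow> 'a endo" is "\<lambda>f x. - f x" by (simp add: linear_compose_neg)
lift_definition times_endo :: "'a endo \<Rightarrow> 'a endo \<Rightarrow> 'a endo" is "\<lambda>f g x. f (g x)"
  using linear_compose unfolding o_def by blast
lift_definition scaleR_endo :: "real \<Rightarrow> 'a endo \<Rightarrow> 'a endo" is "\<lambda>c f x. c *\<^sub>R f x" by (simp add: linear_compose_scale_right)

instance
proof
  show "(0::'a endo) \<noteq> 1"
  proof
    assume "(0::'a endo) = 1"
    then have "Rep_endo (0::'a endo) b = Rep_endo (1::'a endo) b" for b by simp
    then have "(b::'a) = 0" for b unfolding zero_endo.rep_eq one_endo.rep_eq by metis
    then show False using nonempty_Basis nonzero_Basis by blast
  qed
qed (transfer; simp add: fun_eq_iff algebra_simps linear_add linear_scale)+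

end

lemma linear_Rep: "linear (Rep_endo f)" using Rep_endo by simp

lemmas endo_simps = zero_endo.rep_eq one_endo.rep_eq plus_endo.rep_eq minus_endo.rep_eq
  uminus_endo.rep_eq times_endo.rep_eq scaleR_endo.rep_eq

lemma endo_eqI: "(\<And>x. Rep_endo f x = Rep_endo g x) \<Longrightarrow> f = g"
  by (metis Rep_endo_inject ext)

lemma Rep_endo_sum: "Rep_endo (sum f A) x = (\<Sum>a\<in>A. Rep_endo (f a) x)"
  by (induction A rule: infinite_finite_induct) (simp_all add: endo_simps)

definition endo_tr :: "'e::euclidean_space endo \<Rightarrow> real" where
  "endo_tr f = (\<Sum>b\<in>Basis. Rep_endo f b \<bullet> b)"

lemma endo_expand: "Rep_endo f v = (\<Sum>b\<in>Basis. (v \<bullet> b) *\<^sub>R Rep_endo f b)"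
proof -
  have "Rep_endo f v = Rep_endo f (\<Sum>b\<in>Basis. (v \<bullet> b) *\<^sub>R b)" by (simp add: euclidean_representation)
  then show ?thesis by (simp add: linear_sum[OF linear_Rep] linear_scale[OF linear_Rep])
qed

lemma endo_tr_mult: "endo_tr (f * g) = (\<Sum>b\<in>Basis. \<Sum>c\<in>Basis. (Rep_endo g b \<bullet> c) * (Rep_endo f c \<bullet> b))"
  unfolding endo_tr_def times_endo.rep_eq
proof (rule sum.cong[OF refl])
  fix b
  show "Rep_endo f (Rep_endo g b) \<bullet> b = (\<Sum>c\<in>Basis. (Rep_endo g b \<bullet> c) * (Rep_endo f c \<bullet> b))"
    by (subst endo_expand[of f "Rep_endo g b"]) (simp add: inner_sum_left)
qed

interpretation endo: trace_form "endo_tr :: 'e::euclidean_space endo \<Rightarrow> real"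
proof (rule trace_form.intro)
  show "linear (endo_tr :: 'e endo \<Rightarrow> real)"
    by (rule linearI) (simp_all add: endo_tr_def endo_simps inner_add_left sum.distrib sum_distrib_left)
  show "endo_tr (x * y) = endo_tr (y * x)" for x y :: "'e endo"
    unfolding endo_tr_mult by (subst sum.swap) (simp add: mult.commute)
qed

lemma endo_tr_one: "endo_tr (1 :: 'e::euclidean_space endo) = real DIM('e)"
  by (simp add: endo_tr_def endo_simps)

definition skew :: "'e::euclidean_space endo \<Rightarrow> bool" where
  "skew f \<longleftrightarrow> (\<forall>u v. Rep_endo f u \<bullet> v = - (u \<bullet> Rep_endo f v))"

definition symm :: "'e::euclidean_space endo \<Rightarrow> bool" where
  "symm f \<longleftrightarrow> (\<forall>u v. Rep_endo f u \<bullet> v = u \<bullet> Rep_endo f v)"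

text \<open>The endomorphism \<open>a\<close> with \<open>\<alpha> u v = \<langle>a u, v\<rangle>\<close>.\<close>
definition form_endo :: "('e \<Rightarrow> 'e \<Rightarrow> real) \<Rightarrow> 'e::euclidean_space endo" where
  "form_endo \<alpha> = Abs_endo (\<lambda>u. \<Sum>b\<in>Basis. \<alpha> u b *\<^sub>R b)"

lemma form_endo:
  assumes "bilinear \<alpha>" shows "Rep_endo (form_endo \<alpha>) u \<bullet> v = \<alpha> u v"
proof -
  have "linear (\<lambda>u. \<Sum>b\<in>Basis. \<alpha> u b *\<^sub>R b)"
    by (intro linearI) (simp_all add: bilinear_ladd[OF assms] bilinear_lmul[OF assms] algebra_simps sum.distrib scaleR_sum_right)
  then have "Rep_endo (form_endo \<alpha>) u \<bullet> v = (\<Sum>b\<in>Basis. (v \<bullet> b) * \<alpha> u b)"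
    unfolding form_endo_def by (simp add: Abs_endo_inverse inner_sum_left mult.commute inner_commute[of v])
  also have "\<dots> = \<alpha> u (\<Sum>b\<in>Basis. (v \<bullet> b) *\<^sub>R b)"
  proof -
    have "linear (\<alpha> u)" using assms unfolding bilinear_def by blast
    then show ?thesis by (simp add: linear_sum linear_cmul)
  qed
  finally show ?thesis by (simp add: euclidean_representation)
qed

text \<open>The four-form \<open>\<alpha> \<and> \<kappa>\<close> for \<open>\<kappa> u v = \<langle>K u, v\<rangle>\<close>, expanded for skew \<open>\<alpha>\<close> and \<open>\<kappa>\<close>.\<close>
definition wedge :: "('e \<Rightarrow> 'e \<Rightarrow> real) \<Rightarrow> 'e::euclidean_space endo \<Rightarrow> 'e \<Rightarrow> 'e \<Rightarrow> 'e \<Rightarrow> 'e \<Rightarrow> real" where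
  "wedge \<alpha> K X Y Z T = \<alpha> X Y * (Rep_endo K Z \<bullet> T) - \<alpha> X Z * (Rep_endo K Y \<bullet> T) + \<alpha> X T * (Rep_endo K Y \<bullet> Z)
     + \<alpha> Y Z * (Rep_endo K X \<bullet> T) - \<alpha> Y T * (Rep_endo K X \<bullet> Z) + \<alpha> Z T * (Rep_endo K X \<bullet> Y)"

lemma endo_contract: "(\<Sum>e\<in>Basis. (e \<bullet> w) * (Rep_endo f e \<bullet> T)) = Rep_endo f w \<bullet> T"
  by (subst endo_expand[of f w]) (simp add: inner_sum_left inner_commute[of w])

text \<open>Each of the six terms of the wedge product contracts either to a trace, when the two contracted
arguments meet in the same factor, or to a triple product.\<close>
lemma wedge_contract:
  assumes a: "skew a" and b: "skew b" and J: "skew J" and \<alpha>: "\<And>u v. \<alpha> u v = Rep_endo a u \<bullet> v"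
  shows "(\<Sum>e\<in>Basis. wedge \<alpha> b e (Rep_endo J e) Z T) = Rep_endo (endo.contr a b J) Z \<bullet> T"
proof -
  note sk = a[unfolded skew_def, rule_format] b[unfolded skew_def, rule_format] J[unfolded skew_def, rule_format]
  have t: "(\<Sum>e\<in>Basis. Rep_endo x e \<bullet> Rep_endo J e) = - endo_tr (x * J)" for x
  proof -
    have "endo_tr (x * J) = (\<Sum>e\<in>Basis. Rep_endo J (Rep_endo x e) \<bullet> e)"
      unfolding endo.tr_commute[of x J] by (simp add: endo_tr_def times_endo.rep_eq)
    then show ?thesis by (simp add: sum_negf sk(3))
  qed
  have 1: "(\<Sum>e\<in>Basis. \<alpha> e (Rep_endo J e) * (Rep_endo b Z \<bullet> T)) = - endo_tr (a * J) * (Rep_endo b Z \<bullet> T)"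
    unfolding \<alpha> by (simp flip: sum_distrib_right add: t)
  have 2: "(\<Sum>e\<in>Basis. \<alpha> e Z * (Rep_endo b (Rep_endo J e) \<bullet> T)) = - (Rep_endo (b * J * a) Z \<bullet> T)"
    using endo_contract[of "Rep_endo a Z" "b * J" T] unfolding \<alpha> by (simp add: sk(1) times_endo.rep_eq sum_negf)
  have 3: "(\<Sum>e\<in>Basis. \<alpha> e T * (Rep_endo b (Rep_endo J e) \<bullet> Z)) = Rep_endo (a * J * b) Z \<bullet> T"
  proof -
    have "(\<Sum>e\<in>Basis. \<alpha> e T * (Rep_endo b (Rep_endo J e) \<bullet> Z)) = - (Rep_endo (b * J) (Rep_endo a T) \<bullet> Z)"
      using endo_contract[of "Rep_endo a T" "b * J" Z] unfolding \<alpha> by (simp add: sk(1) times_endo.rep_eq sum_negf)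
    also have "\<dots> = Rep_endo (a * J * b) Z \<bullet> T"
      unfolding times_endo.rep_eq by (simp add: sk inner_commute[of T])
    finally show ?thesis .
  qed
  have 4: "(\<Sum>e\<in>Basis. \<alpha> (Rep_endo J e) Z * (Rep_endo b e \<bullet> T)) = Rep_endo (b * J * a) Z \<bullet> T"
  proof -
    have "\<alpha> (Rep_endo J e) Z = e \<bullet> Rep_endo J (Rep_endo a Z)" for e
      unfolding \<alpha> by (simp add: sk)
    then show ?thesis using endo_contract[of "Rep_endo J (Rep_endo a Z)" b T] by (simp add: times_endo.rep_eq)
  qed
  have 5: "(\<Sum>e\<in>Basis. \<alpha> (Rep_endo J e) T * (Rep_endo b e \<bullet> Z)) = - (Rep_endo (a * J * b) Z \<bullet> T)"
  proof -
    have "\<alpha> (Rep_endo J e) T = e \<bullet> Rep_endo J (Rep_endo a T)" for e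
      unfolding \<alpha> by (simp add: sk)
    then have "(\<Sum>e\<in>Basis. \<alpha> (Rep_endo J e) T * (Rep_endo b e \<bullet> Z)) = Rep_endo b (Rep_endo J (Rep_endo a T)) \<bullet> Z"
      using endo_contract[of "Rep_endo J (Rep_endo a T)" b Z] by simp
    also have "\<dots> = - (Rep_endo (a * J * b) Z \<bullet> T)"
      unfolding times_endo.rep_eq by (simp add: sk inner_commute[of T])
    finally show ?thesis .
  qed
  have 6: "(\<Sum>e\<in>Basis. \<alpha> Z T * (Rep_endo b e \<bullet> Rep_endo J e)) = - endo_tr (b * J) * (Rep_endo a Z \<bullet> T)"
    unfolding \<alpha> by (simp flip: sum_distrib_left add: t)
  show ?thesis unfolding wedge_def sum.distrib sum_subtractf 1 2 3 4 5 6 endo.contr_def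
    by (simp add: endo_simps inner_add_left inner_diff_left algebra_simps)
qed

text \<open>Algebraic curvature tensors of a Weyl connection: the part of \<open>R X Y\<close> that is not skew is \<open>F X Y\<close> times
the identity.\<close>
locale weyl_curvature =
  fixes R :: "'e::euclidean_space \<Rightarrow> 'e \<Rightarrow> 'e endo" and F :: "'e \<Rightarrow> 'e \<Rightarrow> real"
  assumes R_anti: "R Y X = - R X Y"
    and bianchi: "Rep_endo (R X Y) Z + Rep_endo (R Y Z) X + Rep_endo (R Z X) Y = 0"
    and R_conf: "Rep_endo (R X Y) u \<bullet> v + u \<bullet> Rep_endo (R X Y) v = 2 * F X Y * (u \<bullet> v)"
    and F_bilinear: "bilinear F"
begin

lemma F_anti: "F Y X = - F X Y"
proof -
  obtain b :: 'e where b: "b \<in> Basis" using nonempty_Basis by blast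
  have "2 * F Y X * (b \<bullet> b) = - (2 * F X Y * (b \<bullet> b))"
    unfolding R_conf[symmetric] R_anti[of Y X] by (simp add: endo_simps)
  then show ?thesis using b by simp
qed

text \<open>Express \<open>2 F (x, y) \<langle>K z, t\<rangle>\<close> by \<open>R\<close> and the bracket. In the alternating sum over the six
splittings of \<open>X, Y, Z, T\<close> the terms with \<open>R\<close> cancel by the Bianchi identity, applied to each
triple of the four vectors.\<close>
lemma wedge_from_bracket:
  assumes K: "skew K" and br: "\<And>X Y. endo.comm (R X Y) K = (\<Sum>a\<in>S. c a X Y *\<^sub>R Ka a)"
  shows "2 * wedge F K X Y Z T = (\<Sum>a\<in>S. wedge (c a) (Ka a) X Y Z T)"
proof -
  note sk = K[unfolded skew_def, rule_format]
  have base: "2 * F x y * (Rep_endo K z \<bullet> t) = (Rep_endo (R x y) t \<bullet> Rep_endo K z) - (Rep_endo (R x y) z \<bullet> Rep_endo K t)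
       + (\<Sum>a\<in>S. c a x y * (Rep_endo (Ka a) z \<bullet> t))" for x y z t
  proof -
    have "Rep_endo (R x y) (Rep_endo K z) = Rep_endo K (Rep_endo (R x y) z) + (\<Sum>a\<in>S. c a x y *\<^sub>R Rep_endo (Ka a) z)"
      using arg_cong[OF br[of x y], of "\<lambda>f. Rep_endo f z"]
      by (simp add: endo.comm_def Rep_endo_sum endo_simps algebra_simps)
    then show ?thesis
      unfolding R_conf[symmetric] by (simp add: inner_add_left inner_sum_left sk inner_commute[of z] inner_commute[of "Rep_endo K z"])
  qed
  have an: "Rep_endo (R y x) z = - Rep_endo (R x y) z" for x y z
    using R_anti[of y x] by (simp add: endo_simps)
  have bi: "Rep_endo (R x y) z \<bullet> w - Rep_endo (R x z) y \<bullet> w + Rep_endo (R y z) x \<bullet> w = 0" for x y z w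
  proof -
    have "(Rep_endo (R x y) z + Rep_endo (R y z) x + Rep_endo (R z x) y) \<bullet> w = 0"
      unfolding bianchi by simp
    then show ?thesis using an[of z x y] by (simp add: inner_add_left inner_diff_left)
  qed
  have "2 * wedge F K X Y Z T = 2 * F X Y * (Rep_endo K Z \<bullet> T) - 2 * F X Z * (Rep_endo K Y \<bullet> T)
     + 2 * F X T * (Rep_endo K Y \<bullet> Z) + 2 * F Y Z * (Rep_endo K X \<bullet> T) - 2 * F Y T * (Rep_endo K X \<bullet> Z)
     + 2 * F Z T * (Rep_endo K X \<bullet> Y)"
    unfolding wedge_def by (simp add: algebra_simps)
  also have "\<dots> = (\<Sum>a\<in>S. wedge (c a) (Ka a) X Y Z T)"
    unfolding base wedge_def sum.distrib sum_subtractf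
    using bi[of X Y Z "Rep_endo K T"] bi[of X Y T "Rep_endo K Z"] bi[of X Z T "Rep_endo K Y"] bi[of Y Z T "Rep_endo K X"]
    by argo
  finally show ?thesis .
qed

definition f where "f = form_endo F"

lemma f_rep: "Rep_endo f u \<bullet> v = F u v" unfolding f_def by (rule form_endo[OF F_bilinear])

lemma f_skew: "skew f"
  unfolding skew_def by (metis F_anti f_rep inner_commute)

text \<open>The four-form identity, contracted with the \<open>J\<^sub>p\<^sub>q\<close>. The index set and the unit \<open>P\<close> are arbitrary in order
to cover the reduced families in rank four as well.\<close>
lemma curvature_faraday_system:
  assumes cf: "even_clifford_family endo_tr I J P"
    and J_skew: "\<And>i j. i \<in> I \<Longrightarrow> j \<in> I \<Longrightarrow> i \<noteq> j \<Longrightarrow> skew (J i j)"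
    and Om: "\<And>i j. i \<in> I \<Longrightarrow> j \<in> I \<Longrightarrow> bilinear (Om i j)"
    and Om_sk: "\<And>i j X Y. i \<in> I \<Longrightarrow> j \<in> I \<Longrightarrow> Om i j Y X = - Om i j X Y"
    and Om_anti: "\<And>i j X Y. i \<in> I \<Longrightarrow> j \<in> I \<Longrightarrow> Om j i X Y = - Om i j X Y"
    and br: "\<And>i j X Y. i \<in> I \<Longrightarrow> j \<in> I \<Longrightarrow> i \<noteq> j \<Longrightarrow> endo.comm (R X Y) (J i j) =
        (\<Sum>k\<in>I - {i,j}. Om k i X Y *\<^sub>R J k j + Om k j X Y *\<^sub>R J i k)"
  shows "faraday_system endo_tr I J P f (\<lambda>i j. form_endo (Om i j))"
proof -
  interpret even_clifford_family endo_tr I J P by (rule cf)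
  have Or: "Rep_endo (form_endo (Om i j)) u \<bullet> v = Om i j u v" if "i \<in> I" "j \<in> I" for i j u v
    using form_endo[OF Om[OF that]] .
  have Os: "skew (form_endo (Om i j))" if "i \<in> I" "j \<in> I" for i j
    unfolding skew_def using Or[OF that] Om_sk[OF that] by (metis inner_commute)
  show ?thesis
  proof
    show "form_endo (Om j i) = - form_endo (Om i j)" if ij: "i \<in> I" "j \<in> I" for i j
    proof (rule endo_eqI)
      fix x
      have "Rep_endo (form_endo (Om j i)) x \<bullet> y = Rep_endo (- form_endo (Om i j)) x \<bullet> y" for y
        using Or ij Om_anti[OF ij] by (simp add: endo_simps)
      then show "Rep_endo (form_endo (Om j i)) x = Rep_endo (- form_endo (Om i j)) x"
        by (rule vector_eq_rdot[THEN iffD1, rule_format])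
    qed
    show "2 *\<^sub>R endo.contr f (J i j) (J p q) =
       (\<Sum>k\<in>I - {i, j}. endo.contr (form_endo (Om k i)) (J k j) (J p q) + endo.contr (form_endo (Om k j)) (J i k) (J p q))"
      if ij: "i \<in> I" "j \<in> I" "i \<noteq> j" and pq: "p \<in> I" "q \<in> I" "p \<noteq> q" for i j p q
    proof (rule endo_eqI)
      fix Z
      let ?rhs = "\<Sum>k\<in>I - {i, j}. endo.contr (form_endo (Om k i)) (J k j) (J p q) + endo.contr (form_endo (Om k j)) (J i k) (J p q)"
      have w: "2 * wedge F (J i j) X Y Z' T = (\<Sum>k\<in>I - {i,j}. wedge (Om k i) (J k j) X Y Z' T + wedge (Om k j) (J i k) X Y Z' T)"
        for X Y Z' T
      proof -
        \<comment> \<open>The two summands for each \<open>k\<close> are indexed by a Boolean, to use a single sum of wedge products.\<close>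
        define c where "c k X Y = (case k of (l, True) \<Rightarrow> Om l i X Y | (l, False) \<Rightarrow> Om l j X Y)" for k X Y
        define Ka where "Ka k = (case k of (l, True) \<Rightarrow> J l j | (l, False) \<Rightarrow> J i l)" for k
        have split: "(\<Sum>k\<in>(I - {i,j}) \<times> UNIV. g k) = (\<Sum>k\<in>I - {i,j}. g (k, True) + g (k, False))"
          for g :: "_ \<Rightarrow> 'z::comm_monoid_add"
          unfolding sum.cartesian_product' by (simp add: UNIV_bool add.commute)
        have "endo.comm (R X Y) (J i j) = (\<Sum>k\<in>(I - {i,j}) \<times> UNIV. c k X Y *\<^sub>R Ka k)" for X Y
          unfolding split br[OF ij] by (simp add: c_def Ka_def)
        from wedge_from_bracket[OF J_skew[OF ij] this]
        have "2 * wedge F (J i j) X Y Z' T = (\<Sum>k\<in>(I - {i,j}) \<times> UNIV. wedge (c k) (Ka k) X Y Z' T)" .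
        moreover have "c (k, True) = Om k i" "c (k, False) = Om k j" for k by (auto simp: c_def fun_eq_iff)
        ultimately show ?thesis unfolding split by (simp add: Ka_def)
      qed
      have "Rep_endo (2 *\<^sub>R endo.contr f (J i j) (J p q)) Z \<bullet> T = Rep_endo ?rhs Z \<bullet> T" for T
      proof -
        have "Rep_endo (2 *\<^sub>R endo.contr f (J i j) (J p q)) Z \<bullet> T = (\<Sum>e\<in>Basis. 2 * wedge F (J i j) e (Rep_endo (J p q) e) Z T)"
          using wedge_contract[OF f_skew J_skew[OF ij] J_skew[OF pq] f_rep[symmetric], of Z T]
          by (simp only: scaleR_endo.rep_eq inner_scaleR_left sum_distrib_left[symmetric])
        also have "\<dots> = (\<Sum>k\<in>I - {i,j}. (\<Sum>e\<in>Basis. wedge (Om k i) (J k j) e (Rep_endo (J p q) e) Z T)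
              + (\<Sum>e\<in>Basis. wedge (Om k j) (J i k) e (Rep_endo (J p q) e) Z T))"
          unfolding w by (subst sum.swap) (simp add: sum.distrib)
        also have "\<dots> = (\<Sum>k\<in>I - {i,j}. Rep_endo (endo.contr (form_endo (Om k i)) (J k j) (J p q)) Z \<bullet> T
              + Rep_endo (endo.contr (form_endo (Om k j)) (J i k) (J p q)) Z \<bullet> T)"
        proof (rule sum.cong[OF refl])
          fix k assume "k \<in> I - {i,j}"
          then have k: "k \<in> I" "k \<noteq> i" "k \<noteq> j" by auto
          show "(\<Sum>e\<in>Basis. wedge (Om k i) (J k j) e (Rep_endo (J p q) e) Z T)
              + (\<Sum>e\<in>Basis. wedge (Om k j) (J i k) e (Rep_endo (J p q) e) Z T)
              = Rep_endo (endo.contr (form_endo (Om k i)) (J k j) (J p q)) Z \<bullet> T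
              + Rep_endo (endo.contr (form_endo (Om k j)) (J i k) (J p q)) Z \<bullet> T"
            using wedge_contract[OF Os[OF k(1) ij(1)] J_skew[OF k(1) ij(2) k(3)] J_skew[OF pq] Or[OF k(1) ij(1), symmetric], of Z T]
             wedge_contract[OF Os[OF k(1) ij(2)] J_skew[OF ij(1) k(1) k(2)[symmetric]] J_skew[OF pq] Or[OF k(1) ij(2), symmetric], of Z T]
            by simp
        qed
        also have "\<dots> = Rep_endo ?rhs Z \<bullet> T"
          by (simp add: Rep_endo_sum inner_sum_left endo_simps inner_add_left)
        finally show ?thesis .
      qed
      then show "Rep_endo (2 *\<^sub>R endo.contr f (J i j) (J p q)) Z = Rep_endo ?rhs Z"
        by (rule vector_eq_rdot[THEN iffD1, rule_format])
    qed
  qed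
qed

end

text \<open>All \<open>J\<close> live in the corner of \<open>P\<close>, so contractions commute with \<open>a \<mapsto> P a P\<close>.\<close>
lemma (in faraday_system) compression:
  assumes "i0 \<in> I"
  shows "faraday_system tr I J P (P * f * P) (\<lambda>i j. P * Om i j * P)"
proof
  have PP: "P * P = P" using P_idem assms .
  have c: "contr (P * x * P) K K' = P * contr x K K' * P" if "P * K = K" "K * P = K" "P * K' = K'" "K' * P = K'" for x K K'
  proof -
    have 1: "tr (P * x * P * K') = tr (x * K')"
    proof -
      have "tr (P * x * P * K') = tr ((P * x) * (P * K'))" by (simp add: mult.assoc)
      also have "\<dots> = tr ((P * x) * K')" using that by simp
      also have "\<dots> = tr (K' * (P * x))" by (rule tr_commute)
      also have "\<dots> = tr ((K' * P) * x)" by (simp add: mult.assoc)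
      also have "\<dots> = tr (x * K')" using that tr_commute by simp
      finally show ?thesis .
    qed
    have 2: "P * x * P * K' * K = P * (x * K' * K) * P" "K * K' * (P * x * P) = P * (K * K' * x) * P"
      using that by (metis mult.assoc)+
    have 3: "P * K * P = K" using that by simp
    show ?thesis unfolding contr_def 1 2
      by (simp only: distrib_left distrib_right left_diff_distrib right_diff_distrib mult_scaleR_left mult_scaleR_right 3)
  qed
  show "P * Om j i * P = - (P * Om i j * P)" if "i \<in> I" "j \<in> I" for i j
    using Om_anti[OF that] by simp
  show "2 *\<^sub>R contr (P * f * P) (J i j) (J p q) =
       (\<Sum>k\<in>I - {i, j}. contr (P * Om k i * P) (J k j) (J p q) + contr (P * Om k j * P) (J i k) (J p q))"
    if ij: "i \<in> I" "j \<in> I" "i \<noteq> j" "p \<in> I" "q \<in> I" "p \<noteq> q" for i j p q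
  proof -
    have "2 *\<^sub>R contr (P * f * P) (J i j) (J p q) = P * (2 *\<^sub>R contr f (J i j) (J p q)) * P"
      using c mul_diag ij by simp
    also have "\<dots> = (\<Sum>k\<in>I - {i, j}. P * contr (Om k i) (J k j) (J p q) * P + P * contr (Om k j) (J i k) (J p q) * P)"
      unfolding eq[OF ij] by (simp add: sum_distrib_left sum_distrib_right distrib_left distrib_right)
    also have "\<dots> = (\<Sum>k\<in>I - {i, j}. contr (P * Om k i * P) (J k j) (J p q) + contr (P * Om k j * P) (J i k) (J p q))"
      using c mul_diag ij by (intro sum.cong refl) simp
    finally show ?thesis .
  qed
qed

text \<open>The four blocks of \<open>f\<close> with respect to \<open>P\<close> vanish one by one. The assumption \<open>sym\<close> links the two
off-diagonal blocks; it holds when \<open>f\<close> is skew and \<open>P\<close> is symmetric.\<close>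
lemma (in faraday_system) vanishes_of_corner:
  assumes I: "I = {i, j, k}" "i \<noteq> j" "j \<noteq> k" "i \<noteq> k"
    and m: "tr P \<noteq> 0" "tr P \<noteq> 4" "tr P * (tr P - 2) \<noteq> 8"
    and sym: "P * f * (1 - P) = 0 \<Longrightarrow> (1 - P) * f * P = 0"
  shows "f = 0"
proof -
  have ij: "i \<in> I" "j \<in> I" using I by auto
  have PP: "P * P = P" using P_idem ij(1) .
  have card: "card I = 3" using I by auto
  interpret c: faraday_system tr I J P "P * f * P" "\<lambda>i j. P * Om i j * P" by (rule compression[OF ij(1)])
  have "P * f * P = 0"
  proof (rule c.corner_vanishes)
    show "card I \<ge> 3" "card I \<noteq> 4" using card by auto
    show "tr (J a b * J p q) = 0" if "a \<in> I" "b \<in> I" "p \<in> I" "q \<in> I" "distinct [a,b,p,q]" for a b p q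
      using that I by auto
    show "P * f * P * P = P * f * P" "P * (P * f * P) = P * f * P"
      using PP by (simp_all add: mult.assoc) (simp add: mult.assoc[symmetric])
    show "P * Om a b * P * P = P * Om a b * P" "P * (P * Om a b * P) = P * Om a b * P" for a b
      using PP by (simp_all add: mult.assoc) (simp add: mult.assoc[symmetric])
    show "tr P * (tr P - 2) \<noteq> 8 * (real (card I) - 2)" unfolding card using m by simp
  qed (use m in auto)
  moreover have "(1 - P) * f * (1 - P) = 0" using complement_block[OF ij I(2) m(1)] .
  moreover have mx: "P * f * (1 - P) = 0" using mixed_block[OF I m(3)] .
  moreover have "(1 - P) * f * P = 0" using sym[OF mx] .
  moreover have "f = P * f * P + P * f * (1 - P) + (1 - P) * f * P + (1 - P) * f * (1 - P)"
    by (simp add: algebra_simps)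
  ultimately show ?thesis by simp
qed

lemma orthogonal_family_card:
  fixes g :: "'i \<Rightarrow> 'e::euclidean_space"
  assumes fin: "finite A" and nz: "\<And>i. i \<in> A \<Longrightarrow> g i \<noteq> 0"
    and orth: "\<And>i j. i \<in> A \<Longrightarrow> j \<in> A \<Longrightarrow> i \<noteq> j \<Longrightarrow> g i \<bullet> g j = 0"
  shows "card A \<le> DIM('e)"
proof -
  have "inj_on g A"
    by (rule inj_onI) (metis inner_eq_zero_iff nz orth)
  then have "card A = card (g ` A)" by (simp add: card_image)
  moreover have "pairwise orthogonal (g ` A)"
    using orth unfolding pairwise_def orthogonal_def by auto
  moreover have "0 \<notin> g ` A" using nz by auto
  ultimately show ?thesis using pairwise_orthogonal_independent independent_bound by metis
qed

locale clifford_endos = even_clifford_family endo_tr UNIV J 1 for J :: "'r::finite \<Rightarrow> 'r \<Rightarrow> 'e::euclidean_space endo" +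
  assumes J_skew: "i \<noteq> j \<Longrightarrow> skew (J i j)"
begin

lemma J_J: "i \<noteq> j \<Longrightarrow> Rep_endo (J i j) (Rep_endo (J i j) w) = - w"
proof -
  assume "i \<noteq> j"
  then have "Rep_endo (J i j * J i j) w = Rep_endo (- 1) w" using square[of i j] by simp
  then show ?thesis by (simp add: endo_simps)
qed

lemma J_nz: "w \<noteq> 0 \<Longrightarrow> Rep_endo (J i j) w \<noteq> 0"
  using J_J[of i j w] diag[of i] by (cases "i = j") (auto simp: endo_simps linear_0[OF linear_Rep])

text \<open>\<open>\<langle>J\<^sub>k\<^sub>i w, J\<^sub>k\<^sub>j w\<rangle> = - \<langle>w, J\<^sub>i\<^sub>j w\<rangle>\<close>, and \<open>J\<^sub>i\<^sub>j\<close> is skew.\<close>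
lemma orbit_orthogonal:
  assumes "i \<noteq> j"
  shows "Rep_endo (J k i) w \<bullet> Rep_endo (J k j) w = 0"
proof -
  have z: "Rep_endo (J a b) w \<bullet> w = 0" if "a \<noteq> b" for a b
  proof -
    have "Rep_endo (J a b) w \<bullet> w = - (w \<bullet> Rep_endo (J a b) w)"
      using J_skew[OF that] unfolding skew_def by blast
    then show ?thesis by (simp add: inner_commute)
  qed
  consider "k = i" | "k = j" | "k \<noteq> i" "k \<noteq> j" by blast
  then show ?thesis
  proof cases
    case 1 then show ?thesis using z[of i j] diag[of i] assms by (simp add: endo_simps inner_commute)
  next
    case 2 then show ?thesis using z[of j i] diag[of j] assms by (simp add: endo_simps)
  next
    case 3
    have "Rep_endo (J k i) w \<bullet> Rep_endo (J k j) w = - (w \<bullet> Rep_endo (J k i * J k j) w)"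
      using J_skew[of k i] 3 unfolding skew_def by (simp add: times_endo.rep_eq)
    also have "J k i * J k j = J i j" using mul_first[of k i j] 3 by simp
    finally show ?thesis using z[OF assms] by (simp add: inner_commute)
  qed
qed

lemma rank_le_dim: "CARD('r) \<le> DIM('e)"
proof -
  obtain w :: 'e where "w \<in> Basis" using nonempty_Basis by blast
  then have w: "w \<noteq> 0" using nonzero_Basis by blast
  show ?thesis
    by (rule orthogonal_family_card[of UNIV "\<lambda>i. Rep_endo (J undefined i) w"])
      (use J_nz[OF w] orbit_orthogonal in auto)
qed

lemma anticommute:
  fixes i j k :: 'r
  assumes "distinct [i, j, k]"
  shows "J i j * J i k = - (J i k * J i j)"
  using mul_first[of i j k] mul_first[of i k j] anti[of j k] assms by simp

lemma volume_square:
  fixes a b c d :: 'r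
  assumes "distinct [a, b, c, d]"
  shows "(J a b * J c d) * (J a b * J c d) = 1"
proof -
  have "(J a b * J c d) * (J a b * J c d) = J a b * (J c d * J a b) * J c d" by (simp add: mult.assoc)
  also have "J c d * J a b = J a b * J c d" using commute_disjoint[of c d a b] assms by auto
  also have "J a b * (J a b * J c d) * J c d = (J a b * J a b) * (J c d * J c d)" by (simp add: mult.assoc)
  finally show ?thesis using square[of a b] square[of c d] assms by simp
qed

lemma volume_symm:
  fixes a b c d :: 'r
  assumes "distinct [a, b, c, d]"
  shows "symm (J a b * J c d)"
  unfolding symm_def
proof (intro allI)
  fix u v
  have "Rep_endo (J a b * J c d) u \<bullet> v = u \<bullet> Rep_endo (J c d * J a b) v"
    using J_skew[of a b] J_skew[of c d] assms unfolding skew_def by (simp add: times_endo.rep_eq)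
  then show "Rep_endo (J a b * J c d) u \<bullet> v = u \<bullet> Rep_endo (J a b * J c d) v"
    using commute_disjoint[of a b c d] assms by simp
qed

lemma volume_pass:
  assumes "J a b * K = s *\<^sub>R (K * J a b)" "J c d * K = t *\<^sub>R (K * J c d)"
  shows "(J a b * J c d) * K = (s * t) *\<^sub>R (K * (J a b * J c d))"
proof -
  have "(J a b * J c d) * K = t *\<^sub>R ((J a b * K) * J c d)" using assms(2) by (simp add: mult.assoc)
  then show ?thesis using assms(1) by (simp add: mult.assoc mult.commute)
qed

lemma volume_commute_first:
  fixes a b c d x :: 'r
  assumes d: "distinct [a, b, c, d]" and x: "x \<in> {a, b, c, d}"
  shows "(J a b * J c d) * J a x = J a x * (J a b * J c d)"
proof -
  consider "x = a" | "x = b" | "x = c \<or> x = d" using x by blast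
  then show ?thesis
  proof cases
    case 1 then show ?thesis using diag[of a] by simp
  next
    case 2
    have "J c d * J a b = 1 *\<^sub>R (J a b * J c d)" using commute_disjoint[of c d a b] d by auto
    then show ?thesis using 2 volume_pass[of a b "J a b" 1 c d 1] by simp
  next
    case 3
    have "J a b * J a x = - 1 *\<^sub>R (J a x * J a b)"
      using 3 anticommute[of a b x] d by auto
    moreover have "J c d * J a x = - 1 *\<^sub>R (J a x * J c d)"
      using 3 mul_outer[of c d a] mul[of a c d] mul_last[of c d a] mul_last[of a d c] anti[of c a] d by auto
    ultimately show ?thesis using volume_pass[of a b "J a x" "- 1" c d "- 1"] by simp
  qed
qed

lemma volume_commute:
  fixes a b c d i j :: 'r
  assumes d: "distinct [a, b, c, d]" and U: "UNIV = {a, b, c, d}"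
  shows "(J a b * J c d) * J i j = J i j * (J a b * J c d)"
proof -
  let ?S = "J a b * J c d"
  have c: "?S * J a x = J a x * ?S" for x using volume_commute_first[OF d] U by blast
  have c': "?S * J x a = J x a * ?S" for x
    using c[of x] anti[of a x] by (cases "x = a") auto
  have "J i j = - (J i a * J a j)" using mul[of i a j] by simp
  moreover have "?S * (J i a * J a j) = (J i a * J a j) * ?S"
  proof -
    have "?S * (J i a * J a j) = (?S * J i a) * J a j" by (simp only: mult.assoc)
    also have "\<dots> = J i a * (?S * J a j)" unfolding c' by (simp only: mult.assoc)
    also have "\<dots> = (J i a * J a j) * ?S" unfolding c by (simp only: mult.assoc)
    finally show ?thesis .
  qed
  ultimately show ?thesis by simp
qed

text \<open>With \<open>S = J\<^sub>a\<^sub>b J\<^sub>c\<^sub>d\<close>, a vector \<open>w\<close> with \<open>S w = w\<close> has the images \<open>J\<^sub>a\<^sub>x w\<close> for \<open>x\<close> in \<open>{a, b, c, d}\<close> in the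
\<open>1\<close>-eigenspace of \<open>S\<close> and the images \<open>J\<^sub>e\<^sub>x w\<close> in the \<open>-1\<close>-eigenspace. The eight vectors are orthogonal.\<close>
lemma dim_ge_8:
  fixes a b c d e :: 'r
  assumes d: "distinct [a, b, c, d, e]"
  shows "DIM('e) \<ge> 8"
proof -
  define S where "S = J a b * J c d"
  note swap = anti[OF UNIV_I UNIV_I]
  have acomm: "S * J e x = - (J e x * S)" if x: "x \<in> {a, b, c, d}" for x
  proof -
    consider "x = a \<or> x = b" | "x = c \<or> x = d" using x by blast
    then show ?thesis
    proof cases
      case 1
      have "J a b * J e x = - 1 *\<^sub>R (J e x * J a b)"
        using 1 mul_outer[of a b e] mul[of e a b] mul_last[of a b e] mul_last[of e b a] anti[of a e] d by auto
      moreover have "J c d * J e x = 1 *\<^sub>R (J e x * J c d)"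
        using 1 commute_disjoint[of c d e x] d by auto
      ultimately show ?thesis using volume_pass[of a b "J e x" "- 1" c d 1] by (simp add: S_def)
    next
      case 2
      have "J c d * J e x = - 1 *\<^sub>R (J e x * J c d)"
        using 2 mul_outer[of c d e] mul[of e c d] mul_last[of c d e] mul_last[of e d c] anti[of c e] d by auto
      moreover have "J a b * J e x = 1 *\<^sub>R (J e x * J a b)"
        using 2 commute_disjoint[of a b e x] d by auto
      ultimately show ?thesis using volume_pass[of a b "J e x" 1 c d "- 1"] by (simp add: S_def)
    qed
  qed
  have comm: "S * J a x = J a x * S" if x: "x \<in> {a, b, c, d}" for x
    unfolding S_def using volume_commute_first d x by auto
  have S2: "S * S = 1" unfolding S_def using volume_square d by auto
  have S_sym: "Rep_endo S u \<bullet> v = u \<bullet> Rep_endo S v" for u v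
    using volume_symm[of a b c d] d unfolding S_def symm_def by auto
  obtain v0 :: 'e where "v0 \<in> Basis" using nonempty_Basis by blast
  then have v0: "v0 \<noteq> 0" using nonzero_Basis by blast
  \<comment> \<open>The projection of any vector to the eigenspace works; if it vanishes, \<open>J\<^sub>e\<^sub>a\<close> moves the vector into the eigenspace.\<close>
  obtain w where w: "w \<noteq> 0" "Rep_endo S w = w"
  proof (cases "v0 + Rep_endo S v0 = 0")
    case True
    then have "Rep_endo S v0 = - v0" by (simp add: eq_neg_iff_add_eq_0 add.commute)
    then have "Rep_endo S (Rep_endo (J e a) v0) = Rep_endo (J e a) v0"
      using arg_cong[OF acomm[of a], of "\<lambda>f. Rep_endo f v0"] by (simp add: endo_simps linear_neg[OF linear_Rep])
    then show ?thesis using that J_nz[OF v0] by blast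
  next
    case False
    have "Rep_endo S (v0 + Rep_endo S v0) = v0 + Rep_endo S v0"
      using arg_cong[OF S2, of "\<lambda>f. Rep_endo f v0"] by (simp add: endo_simps linear_add[OF linear_Rep] add.commute)
    then show ?thesis using that False by blast
  qed
  define g where "g q = Rep_endo (J (fst q) (snd q)) w" for q
  define X where "X = {a, b, c, d}"
  have "card ({a, e} \<times> X) \<le> DIM('e)"
  proof (rule orthogonal_family_card)
    show "finite ({a, e} \<times> X)" by (simp add: X_def)
    show "g q \<noteq> 0" for q using J_nz[OF w(1)] by (simp add: g_def)
    have pm: "Rep_endo S (g (a, x)) = g (a, x)" "Rep_endo S (g (e, x)) = - g (e, x)" if "x \<in> X" for x
      using arg_cong[OF comm[OF that[unfolded X_def]], of "\<lambda>f. Rep_endo f w"]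
        arg_cong[OF acomm[OF that[unfolded X_def]], of "\<lambda>f. Rep_endo f w"] w(2)
      by (simp_all add: g_def endo_simps)
    have cross: "g (a, x) \<bullet> g (e, y) = 0" if "x \<in> X" "y \<in> X" for x y
    proof -
      have "g (a, x) \<bullet> g (e, y) = Rep_endo S (g (a, x)) \<bullet> g (e, y)" using pm that by simp
      also have "\<dots> = - (g (a, x) \<bullet> g (e, y))" unfolding S_sym using pm that by simp
      finally show ?thesis by simp
    qed
    show "g q \<bullet> g q' = 0" if "q \<in> {a, e} \<times> X" "q' \<in> {a, e} \<times> X" "q \<noteq> q'" for q q'
    proof -
      obtain s x s' y where q: "q = (s, x)" "q' = (s', y)" by fastforce
      show ?thesis
      proof (cases "s = s'")
        case True
        then show ?thesis using orbit_orthogonal[of x y s w] that q by (auto simp: g_def)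
      next
        case False
        then show ?thesis using that q cross inner_commute[of "g q" "g q'"] by auto
      qed
    qed
  qed
  moreover have "card ({a, e} \<times> X) = 8" using d by (auto simp: X_def card_cartesian_product)
  ultimately show ?thesis by simp
qed

text \<open>\<open>J\<^sub>i\<^sub>j J\<^sub>k\<^sub>l\<close> anticommutes with the complex structure \<open>J\<^sub>i\<^sub>m\<close>. This requires a fifth index.\<close>
lemma tr_disjoint:
  fixes i j k l m :: 'r
  assumes "distinct [i, j, k, l, m]"
  shows "endo_tr (J i j * J k l) = 0"
proof -
  let ?T = "J i j * J k l" and ?K = "J i m"
  have "?T * ?K = - (?K * ?T)"
  proof -
    have "?T * ?K = J i j * (?K * J k l)"
      using commute_disjoint[of k l i m] assms by (auto simp: mult.assoc)
    also have "\<dots> = - (?K * J i j * J k l)"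
      using anticommute[of i j m] assms by (simp flip: mult.assoc)
    finally show ?thesis by (simp add: mult.assoc)
  qed
  then have "?K * (?T * ?K) = - ((?K * ?K) * ?T)" by (simp add: mult.assoc)
  moreover have "?K * ?K = - 1" using square[of i m] assms by simp
  ultimately have 1: "?K * ?T * ?K = ?T" by (simp only: mult.assoc[of ?K ?T ?K]) simp
  have "endo_tr ?T = endo_tr (?K * ?T * ?K)" using 1 by simp
  also have "\<dots> = endo_tr (?K * ?K * ?T)"
    using endo.tr_commute[of "?K * ?T" ?K] by (simp add: mult.assoc)
  also have "\<dots> = - endo_tr ?T" using \<open>?K * ?K = - 1\<close> by (simp add: endo.tr_simps)
  finally show ?thesis by simp
qed

end

text \<open>The volume element of rank four is invariant under \<open>so(4)\<close>, stated as the Leibniz rule: the action of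
a skew matrix \<open>\<kappa>\<close> on \<open>J\<^sub>a\<^sub>b\<close> and \<open>J\<^sub>c\<^sub>d\<close> annihilates the product.\<close>
lemma (in even_clifford_family) volume_derivation:
  assumes d: "distinct [a, b, c, d]" and I: "I = {a, b, c, d}"
    and c: "\<And>i j. i \<in> I \<Longrightarrow> j \<in> I \<Longrightarrow> \<kappa> j i = - (\<kappa> i j :: real)"
  shows "(\<Sum>k\<in>I - {a, b}. \<kappa> k a *\<^sub>R J k b + \<kappa> k b *\<^sub>R J a k) * J c d
       + J a b * (\<Sum>k\<in>I - {c, d}. \<kappa> k c *\<^sub>R J k d + \<kappa> k d *\<^sub>R J c k) = 0"
proof -
  have m: "a \<in> I" "b \<in> I" "c \<in> I" "d \<in> I" using I by auto
  have s: "I - {a, b} = {c, d}" "I - {c, d} = {a, b}" using I d by auto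
  have p: "J c b * J c d = J b d" "J a c * J c d = - J a d" "J d b * J c d = - J b c" "J a d * J c d = J a c"
    "J a b * J a d = J b d" "J a b * J c a = J c b" "J a b * J b d = - J a d" "J a b * J c b = J a c"
    using mul_first[of c b d] mul[of a c d] mul_outer[of d b c] mul_last[of a d c] mul_first[of a b d] mul_outer[of a b c]
      mul[of a b d] mul_last[of a b c] d anti[of b c] m by auto
  have o: "\<kappa> a c = - \<kappa> c a" "\<kappa> a d = - \<kappa> d a" "\<kappa> b c = - \<kappa> c b" "\<kappa> b d = - \<kappa> d b"
    using c m by blast+
  have cb: "J c b = - J b c" using anti[of b c] d m by auto
  have cd: "c \<noteq> d" "a \<noteq> b" using d by auto
  have t: "(\<Sum>k\<in>{x, y}. h k) = h x + h y" if "x \<noteq> y" for h :: "'b \<Rightarrow> 'a" and x y using that by simp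
  show ?thesis
    unfolding s t[OF cd(1)] t[OF cd(2)] distrib_left distrib_right mult_scaleR_left mult_scaleR_right p o by (simp add: cb)
qed

text \<open>The trace of an orthogonal projection is the squared norm of its matrix.\<close>
lemma tr_projection:
  assumes "symm P" "P * P = P"
  shows "endo_tr P \<ge> 0" and "endo_tr P = 0 \<Longrightarrow> P = 0"
proof -
  have e: "Rep_endo P b \<bullet> b = Rep_endo P b \<bullet> Rep_endo P b" for b
    using assms unfolding symm_def by (metis times_endo.rep_eq)
  show "endo_tr P \<ge> 0" unfolding endo_tr_def by (subst e) (simp add: sum_nonneg)
  assume "endo_tr P = 0"
  then have "(\<Sum>b\<in>Basis. Rep_endo P b \<bullet> Rep_endo P b) = 0" unfolding endo_tr_def using e by simp
  then have "Rep_endo P b = 0" if "b \<in> Basis" for b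
    using that by (subst (asm) sum_nonneg_eq_0_iff) auto
  then show "P = 0"
    by (intro endo_eqI) (subst endo_expand, simp add: endo_simps)
qed

lemma bilinear_combine:
  assumes "bilinear \<alpha>" "bilinear \<beta>"
  shows "bilinear (\<lambda>X Y. \<alpha> X Y + (s::real) * \<beta> X Y)"
  unfolding bilinear_def
  by (auto intro!: linearI simp: algebra_simps bilinear_ladd[OF assms(1)] bilinear_ladd[OF assms(2)]
    bilinear_radd[OF assms(1)] bilinear_radd[OF assms(2)] bilinear_lmul[OF assms(1)] bilinear_lmul[OF assms(2)]
    bilinear_rmul[OF assms(1)] bilinear_rmul[OF assms(2)])

lemma bilinear_zero_form: "bilinear (\<lambda>X Y. 0::real)"
  unfolding bilinear_def by (simp add: linear_zero)

lemma (in trace_form) comm_simps: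
  "comm x (y * z) = comm x y * z + y * comm x z"
  "comm x (y + z) = comm x y + comm x z"
  "comm x (c *\<^sub>R y) = c *\<^sub>R comm x y"
  "comm x 1 = 0"
  by (simp_all add: comm_def algebra_simps)

text \<open>What remains of a Clifford-Weyl structure at one point, in a frame of the tangent space that is
orthonormal for some metric of the conformal class.\<close>
locale clifford_weyl_curvature = weyl_curvature R F + clifford_endos J
  for R :: "'e::euclidean_space \<Rightarrow> 'e \<Rightarrow> 'e endo" and F and J :: "'r::finite \<Rightarrow> 'r \<Rightarrow> 'e endo" +
  fixes Om :: "'r \<Rightarrow> 'r \<Rightarrow> 'e \<Rightarrow> 'e \<Rightarrow> real"
  assumes Om_bilinear: "bilinear (Om i j)"
    and Om_skew: "Om i j Y X = - Om i j X Y"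
    and Om_anti: "Om j i X Y = - Om i j X Y"
    and bracket: "i \<noteq> j \<Longrightarrow> endo.comm (R X Y) (J i j) =
        (\<Sum>k\<in>UNIV - {i,j}. Om k i X Y *\<^sub>R J k j + Om k j X Y *\<^sub>R J i k)"
begin

lemma F_zero: "f = 0 \<Longrightarrow> F X Y = 0"
  using f_rep[of X Y] by (simp add: endo_simps)

lemma full_system: "faraday_system endo_tr UNIV J 1 f (\<lambda>i j. form_endo (Om i j))"
  by (rule curvature_faraday_system)
    (auto intro: even_clifford_family_axioms J_skew Om_bilinear Om_skew Om_anti bracket)

text \<open>There is one \<open>J\<close>, and the system reads \<open>(n - 4) f = tr (f J) J\<close>. Taking the trace with \<open>J\<close> gives
\<open>(2 n - 4) tr (f J) = 0\<close>.\<close>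
lemma rank_2:
  assumes r: "CARD('r) = 2" and n: "DIM('e) \<noteq> 2" "DIM('e) \<noteq> 4"
  shows "F X Y = 0"
proof -
  interpret faraday_system endo_tr UNIV J 1 f "\<lambda>i j. form_endo (Om i j)" by (rule full_system)
  obtain i j :: 'r where ij: "UNIV = {i, j}" "i \<noteq> j" using r by (auto simp: card_2_iff)
  let ?n = "real DIM('e)"
  have none: "UNIV - {i, j} = {}" using ij by simp
  have e: "?n *\<^sub>R f - 4 *\<^sub>R f - endo_tr (f * J i j) *\<^sub>R J i j = 0"
    using self_equation[of i j] ij(2) unfolding none endo_tr_one
    by (simp flip: scaleR_2)
  have "endo_tr ((?n *\<^sub>R f - 4 *\<^sub>R f - endo_tr (f * J i j) *\<^sub>R J i j) * J i j) = 0"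
    unfolding e by (simp add: endo.tr_simps)
  then have "(2 * ?n - 4) * endo_tr (f * J i j) = 0"
    using square[of i j] ij(2) by (simp add: left_diff_distrib endo.tr_simps endo_tr_one algebra_simps)
  moreover have "2 * ?n - 4 \<noteq> 0" using n by auto
  ultimately have "endo_tr (f * J i j) = 0" by simp
  then have "(?n - 4) *\<^sub>R f = 0" using e by (simp add: scaleR_left_diff_distrib)
  then show ?thesis using n F_zero by simp
qed

text \<open>The numerical hypotheses of \<open>corner_vanishes\<close> for \<open>P = 1\<close>. For \<open>r = 3\<close> the exceptional dimensions
solve \<open>(n - 4) (n + 2) = 0\<close>. For \<open>r \<ge> 5\<close> the bounds \<open>n \<ge> 8\<close> and \<open>r \<le> n\<close> turn the exceptional
equation into \<open>(n - 8) (n - 2) \<le> 0\<close>, so \<open>n = 8\<close> and \<open>r = 8\<close>.\<close>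
lemma rank_not_4:
  assumes r: "CARD('r) \<ge> 3" "CARD('r) \<noteq> 4" and n: "(DIM('e), CARD('r)) \<noteq> (4, 3)" "(DIM('e), CARD('r)) \<noteq> (8, 8)"
  shows "F X Y = 0"
proof (rule F_zero)
  interpret faraday_system endo_tr UNIV J 1 f "\<lambda>i j. form_endo (Om i j)" by (rule full_system)
  have fifth: "\<exists>m. m \<notin> set [i,j,k,l]" if "CARD('r) \<ge> 5" for i j k l :: 'r
  proof (rule ccontr)
    assume "\<nexists>m. m \<notin> set [i,j,k,l]"
    then have "UNIV \<subseteq> set [i,j,k,l]" by blast
    then have "CARD('r) \<le> card (set [i,j,k,l])" by (intro card_mono) auto
    also have "\<dots> \<le> 4" using card_length[of "[i,j,k,l]"] by simp
    finally show False using that by simp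
  qed
  obtain xs :: "'r list" where xs: "set xs = UNIV" "distinct xs" "length xs = CARD('r)"
    using finite_distinct_list[of "UNIV :: 'r set"] by (metis distinct_card finite)
  have n8: "DIM('e) \<ge> 8" if "CARD('r) \<ge> 5"
  proof -
    have "Suc (Suc (Suc (Suc (Suc 0)))) \<le> length xs" using that xs(3) by simp
    then obtain a b c d e ys where "xs = a # b # c # d # e # ys"
      by (auto simp: Suc_le_length_iff)
    then have "distinct [a, b, c, d, e]" using xs(2) by auto
    then show ?thesis by (rule dim_ge_8)
  qed
  show "f = 0"
  proof (rule corner_vanishes)
    show "card (UNIV :: 'r set) \<ge> 3" "card (UNIV :: 'r set) \<noteq> 4" using r by auto
    show "endo_tr (J i j * J k l) = 0" if "distinct [i, j, k, l]" for i j k l :: 'r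
    proof -
      have "card (set [i,j,k,l]) = 4" using distinct_card[OF that] by simp
      then have "CARD('r) \<ge> 4" using card_mono[of UNIV "set [i,j,k,l]"] by simp
      then have "CARD('r) \<ge> 5" using r by simp
      then obtain m where "m \<notin> set [i,j,k,l]" using fifth by blast
      then show ?thesis using tr_disjoint[of i j k l m] that by auto
    qed
    have ne: "DIM('e) \<noteq> 4" "DIM('e) * DIM('e) \<noteq> 2 * DIM('e) + 8 * (CARD('r) - 2)"
    proof -
      have "CARD('r) = 3 \<or> CARD('r) \<ge> 5" using r by auto
      then show "DIM('e) \<noteq> 4" using n n8 by auto
      show "DIM('e) * DIM('e) \<noteq> 2 * DIM('e) + 8 * (CARD('r) - 2)"
      proof (cases "CARD('r) = 3")
        case True
        have "n * n \<noteq> 2 * n + 8" if "n \<noteq> 4" for n :: nat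
        proof
          assume "n * n = 2 * n + 8"
          then have "(int n - 4) * (int n + 2) = 0" by (simp add: algebra_simps flip: of_nat_mult)
          then show False using that by auto
        qed
        then show ?thesis using True \<open>DIM('e) \<noteq> 4\<close> by simp
      next
        case False
        then have "CARD('r) \<ge> 5" using r by simp
        then have n8: "DIM('e) \<ge> 8" using n8 by blast
        show ?thesis
        proof
          assume e: "DIM('e) * DIM('e) = 2 * DIM('e) + 8 * (CARD('r) - 2)"
          have "8 * (CARD('r) - 2) \<le> 8 * (DIM('e) - 2)" using rank_le_dim by simp
          then have "DIM('e) * DIM('e) + 16 \<le> 10 * DIM('e)" using e n8 by simp
          then have "(int DIM('e) - 8) * (int DIM('e) - 2) \<le> 0"
            by (simp add: algebra_simps flip: of_nat_mult)
          then have "DIM('e) = 8" using n8 by (auto simp: mult_le_0_iff)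
          then show False using e n r by auto
        qed
      qed
    qed
    then show "endo_tr (1 :: 'e endo) \<noteq> 4" unfolding endo_tr_one by simp
    show "endo_tr (1 :: 'e endo) * (endo_tr (1 :: 'e endo) - 2) \<noteq> 8 * (real CARD('r) - 2)"
    proof
      assume "endo_tr (1 :: 'e endo) * (endo_tr (1 :: 'e endo) - 2) = 8 * (real CARD('r) - 2)"
      then have "real (DIM('e) * DIM('e)) = real (2 * DIM('e) + 8 * (CARD('r) - 2))"
        unfolding endo_tr_one using r by (simp add: algebra_simps of_nat_diff)
      then show False using ne(2) of_nat_eq_iff by blast
    qed
    show "endo_tr (1 :: 'e endo) \<noteq> 0" unfolding endo_tr_one by simp
  qed auto
qed

lemma volume_parallel:
  fixes a b c d :: 'r
  assumes d: "distinct [a, b, c, d]" and U: "UNIV = {a, b, c, d}"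
  shows "endo.comm (R X Y) (J a b * J c d) = 0"
proof -
  have ne: "a \<noteq> b" "c \<noteq> d" using d by auto
  show ?thesis unfolding endo.comm_simps(1) bracket[OF ne(1)] bracket[OF ne(2)]
    by (rule volume_derivation[OF d U, of "\<lambda>i j. Om i j X Y"]) (rule Om_anti)
qed

text \<open>On the eigenspace \<open>im P\<close> the volume element \<open>J\<^sub>a\<^sub>b J\<^sub>c\<^sub>d\<close> is the scalar \<open>s\<close>, so each \<open>P J\<^sub>d\<^sub>i\<close> is \<open>s\<close> times one
of the three endomorphisms \<open>K i j = P J\<^sub>i\<^sub>j\<close> with \<open>i\<close> and \<open>j\<close> different from \<open>d\<close>. The terms of the bracket that
involve \<open>d\<close> can therefore be absorbed into the coefficients, and what results is a family of rank three
with two-forms \<open>\<Omega>\<^sub>i\<^sub>j + s \<Omega>\<^sub>d\<^sub>k\<close> for cyclic \<open>i, j, k\<close>.\<close>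
lemma rank_4_half:
  fixes a b c d :: 'r
  assumes d: "distinct [a, b, c, d]" and U: "UNIV = {a, b, c, d}"
    and s: "s * s = (1::real)" and P: "P = (1/2) *\<^sub>R (1 + s *\<^sub>R (J a b * J c d))"
    and m: "endo_tr P \<noteq> 0" "endo_tr P \<noteq> 4"
  shows "F X Y = 0"
proof (rule F_zero)
  define S where "S = J a b * J c d"
  have S2: "S * S = 1" unfolding S_def by (rule volume_square[OF d])
  have PS: "P * S = s *\<^sub>R P"
    unfolding P S_def[symmetric] by (simp add: algebra_simps S2 s)
  have PP: "P * P = P"
  proof -
    have "P * P = (1/2) *\<^sub>R (P + s *\<^sub>R (P * S))" by (subst (2) P) (simp add: distrib_left S_def)
    also have "\<dots> = P" unfolding PS using s by (simp add: scaleR_2[symmetric])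
    finally show ?thesis .
  qed
  have P_symm: "symm P"
    using volume_symm[OF d] unfolding symm_def P S_def[symmetric]
    by (simp add: endo_simps inner_add_left inner_add_right)
  have S_comm: "S * J i j = J i j * S" for i j
    unfolding S_def by (rule volume_commute[OF d U])
  have P_comm: "P * J i j = J i j * P" for i j
    unfolding P S_def[symmetric] using S_comm by (simp add: algebra_simps)
  have R_P: "endo.comm (R X Y) P = 0" for X Y
    unfolding P endo.comm_simps(2-4) volume_parallel[OF d U] by simp
  define K where "K i j = P * J i j" for i j
  have K_mul: "K i j * K j k = - K i k" for i j k
  proof -
    have "K i j * K j k = P * (J i j * P) * J j k" by (simp add: K_def mult.assoc)
    also have "\<dots> = (P * P) * (J i j * J j k)" by (simp add: P_comm[symmetric] mult.assoc)
    finally show ?thesis using PP mul[of i j k] by (simp add: K_def)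
  qed
  have K_anti: "K j i = - K i j" if "i \<noteq> j" for i j using anti[of i j] that by (simp add: K_def)
  have fam: "even_clifford_family endo_tr {a, b, c} K P"
  proof
    show "K i j * K j k = - K i k" for i j k by (rule K_mul)
    show "K j i = - K i j" if "i \<noteq> j" for i j by (rule K_anti[OF that])
    show "K i i = - P" for i using diag[of i] by (simp add: K_def)
  qed simp
  have K_skew: "skew (K i j)" if "i \<noteq> j" for i j
    unfolding skew_def K_def
  proof (intro allI)
    fix u v
    have "Rep_endo (P * J i j) u \<bullet> v = Rep_endo (J i j) u \<bullet> Rep_endo P v"
      using P_symm unfolding symm_def by (simp add: times_endo.rep_eq)
    also have "\<dots> = - (u \<bullet> Rep_endo (J i j * P) v)"
      using J_skew[OF that] unfolding skew_def by (simp add: times_endo.rep_eq)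
    finally show "Rep_endo (P * J i j) u \<bullet> v = - (u \<bullet> Rep_endo (P * J i j) v)" unfolding P_comm .
  qed
  have dual: "K d c = s *\<^sub>R K a b" "K d a = s *\<^sub>R K b c" "K d b = s *\<^sub>R K c a"
  proof -
    have *: "K i j = s *\<^sub>R K k l" if "S * J i j = J k l" for i j k l
    proof -
      have "P * (S * J i j) = s *\<^sub>R (P * J i j)" using PS by (simp add: mult.assoc[symmetric])
      then have "s *\<^sub>R (P * J k l) = (s * s) *\<^sub>R (P * J i j)" using that by simp
      then show ?thesis using s by (simp add: K_def)
    qed
    have "J c d * J d c = 1" "J c d * J d a = - J c a" "J c d * J d b = - J c b"
      using mul[of c d c] diag[of c] mul[of c d a] mul[of c d b] by auto
    then have "S * J d c = J a b" "S * J d a = - (J a b * J c a)" "S * J d b = - (J a b * J c b)"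
      by (simp_all add: S_def mult.assoc)
    moreover have "J a b * J c a = - J b c" "J a b * J c b = - J c a"
      using mul_outer[of a b c] anti[of b c] mul_last[of a b c] anti[of c a] d by auto
    ultimately show "K d c = s *\<^sub>R K a b" "K d a = s *\<^sub>R K b c" "K d b = s *\<^sub>R K c a"
      using *[of d c a b] *[of d a b c] *[of d b c a] by simp_all
  qed
  \<comment> \<open>\<open>g i j\<close> is \<open>\<Omega>\<^sub>d\<^sub>k\<close> for \<open>(i, j, k)\<close> a cyclic permutation of \<open>(a, b, c)\<close>, extended antisymmetrically.\<close>
  define g where "g i j = (if i = a \<and> j = b then Om d c else if i = b \<and> j = a then Om c d else
     if i = b \<and> j = c then Om d a else if i = c \<and> j = b then Om a d else
     if i = c \<and> j = a then Om d b else if i = a \<and> j = c then Om b d else (\<lambda>X Y. 0))" for i j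
  define Om' where "Om' i j X Y = Om i j X Y + s * g i j X Y" for i j X Y
  have g_vals: "g a b = Om d c" "g b a = Om c d" "g b c = Om d a" "g c b = Om a d" "g c a = Om d b" "g a c = Om b d"
    using d unfolding g_def by auto
  have br: "endo.comm (R X Y) (K x y) = Om' z x X Y *\<^sub>R K z y + Om' z y X Y *\<^sub>R K x z"
    if xyz: "distinct [x, y, z, d]" "UNIV = {x, y, z, d}"
      and dl: "K d z = s *\<^sub>R K x y" "K d x = s *\<^sub>R K y z" "K d y = s *\<^sub>R K z x"
      and gg: "g z x = Om d y" "g z y = Om x d" for x y z X Y
  proof -
    have rest: "UNIV - {x, y} = {z, d}" using xyz by auto
    have "endo.comm (R X Y) (K x y) = P * endo.comm (R X Y) (J x y)"
      unfolding K_def endo.comm_simps R_P by simp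
    also have "endo.comm (R X Y) (J x y) = Om z x X Y *\<^sub>R J z y + Om z y X Y *\<^sub>R J x z
         + (Om d x X Y *\<^sub>R J d y + Om d y X Y *\<^sub>R J x d)"
      using bracket[of x y] xyz unfolding rest by simp
    also have "P * \<dots> = Om z x X Y *\<^sub>R K z y + Om z y X Y *\<^sub>R K x z
         + (Om d x X Y *\<^sub>R K d y + Om d y X Y *\<^sub>R K x d)"
      by (simp add: K_def distrib_left)
    also have "K x d = - (s *\<^sub>R K y z)" using K_anti[of d x] xyz dl(2) by auto
    also have "K d y = s *\<^sub>R K z x" by (rule dl(3))
    also have "K z x = - K x z" using K_anti[of x z] xyz by auto
    also have "K y z = - K z y" using K_anti[of z y] xyz by auto
    finally show ?thesis
      using Om_anti[of x d] unfolding Om'_def gg by (simp add: algebra_simps)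
  qed
  have br_cyc: "endo.comm (R X Y) (K a b) = Om' c a X Y *\<^sub>R K c b + Om' c b X Y *\<^sub>R K a c"
    "endo.comm (R X Y) (K b c) = Om' a b X Y *\<^sub>R K a c + Om' a c X Y *\<^sub>R K b a"
    "endo.comm (R X Y) (K c a) = Om' b c X Y *\<^sub>R K b a + Om' b a X Y *\<^sub>R K c b" for X Y
  proof -
    have U': "UNIV = {b, c, a, d}" "UNIV = {c, a, b, d}" unfolding U by blast+
    have d': "distinct [b, c, a, d]" "distinct [c, a, b, d]" using d by auto
    show "endo.comm (R X Y) (K a b) = Om' c a X Y *\<^sub>R K c b + Om' c b X Y *\<^sub>R K a c"
      by (rule br[OF d U dual(1,2,3) g_vals(5,4)])
    show "endo.comm (R X Y) (K b c) = Om' a b X Y *\<^sub>R K a c + Om' a c X Y *\<^sub>R K b a"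
      by (rule br[OF d'(1) U'(1) dual(2,3,1) g_vals(1,6)])
    show "endo.comm (R X Y) (K c a) = Om' b c X Y *\<^sub>R K b a + Om' b a X Y *\<^sub>R K c b"
      by (rule br[OF d'(2) U'(2) dual(3,1,2) g_vals(3,2)])
  qed
  have Om'_anti: "Om' j i X Y = - Om' i j X Y" if ij: "i \<in> {a,b,c}" "j \<in> {a,b,c}" for i j X Y
  proof -
    have "g i i = (\<lambda>X Y. 0)"
      unfolding g_def using d by (cases "i = a"; cases "i = b"; cases "i = c"; simp)
    then have "g i i X Y = 0" by simp
    note gii = this
    have Od: "Om c d X Y = - Om d c X Y" "Om a d X Y = - Om d a X Y" "Om b d X Y = - Om d b X Y"
      by (rule Om_anti)+
    consider "i = j" | "i = a" "j = b" | "i = b" "j = a" | "i = b" "j = c" | "i = c" "j = b" | "i = c" "j = a" | "i = a" "j = c"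
      using ij by blast
    then have "g j i X Y = - g i j X Y" by cases (use gii in \<open>simp_all add: g_vals Od\<close>)
    then show ?thesis unfolding Om'_def using Om_anti[of i j X Y] by simp
  qed
  have br_all: "endo.comm (R X Y) (K i j) = (\<Sum>k\<in>{a,b,c} - {i,j}. Om' k i X Y *\<^sub>R K k j + Om' k j X Y *\<^sub>R K i k)"
    if ij: "i \<in> {a,b,c}" "j \<in> {a,b,c}" "i \<noteq> j" for i j X Y
  proof -
    have flip: "endo.comm (R X Y) (K y x) = Om' z y X Y *\<^sub>R K z x + Om' z x X Y *\<^sub>R K y z"
      if "endo.comm (R X Y) (K x y) = Om' z x X Y *\<^sub>R K z y + Om' z y X Y *\<^sub>R K x z" "distinct [x,y,z]" for x y z
    proof -
      have k: "K y x = - K x y" "K z x = - K x z" "K y z = - K z y"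
        using K_anti[of x y] K_anti[of x z] K_anti[of z y] that(2) by auto
      have "endo.comm (R X Y) (- K x y) = - endo.comm (R X Y) (K x y)" by (simp add: endo.comm_def)
      then show ?thesis unfolding k that(1) by simp
    qed
    have sets: "{a,b,c} - {a,b} = {c}" "{a,b,c} - {b,a} = {c}" "{a,b,c} - {b,c} = {a}" "{a,b,c} - {c,b} = {a}"
      "{a,b,c} - {c,a} = {b}" "{a,b,c} - {a,c} = {b}" using d by auto
    consider "i = a" "j = b" | "i = b" "j = a" | "i = b" "j = c" | "i = c" "j = b" | "i = c" "j = a" | "i = a" "j = c"
      using ij by blast
    then show ?thesis
    proof cases
      case 1 show ?thesis unfolding 1 sets using br_cyc(1) by simp
    next
      case 2 show ?thesis unfolding 2 sets using flip[OF br_cyc(1)] d by auto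
    next
      case 3 show ?thesis unfolding 3 sets using br_cyc(2) by simp
    next
      case 4 show ?thesis unfolding 4 sets using flip[OF br_cyc(2)] d by auto
    next
      case 5 show ?thesis unfolding 5 sets using br_cyc(3) by simp
    next
      case 6 show ?thesis unfolding 6 sets using flip[OF br_cyc(3)] d by auto
    qed
  qed
  have g_bil: "bilinear (g i j)" for i j
    unfolding g_def by (simp add: Om_bilinear bilinear_zero_form)
  have g_skew: "g i j Y X = - g i j X Y" for i j X Y
    unfolding g_def by (simp add: Om_skew[of _ _ Y X])
  have sys: "faraday_system endo_tr {a,b,c} K P f (\<lambda>i j. form_endo (Om' i j))"
  proof (rule curvature_faraday_system[OF fam])
    show "bilinear (Om' i j)" for i j
      using bilinear_combine[OF Om_bilinear[of i j] g_bil[of i j], of s] by (simp add: Om'_def[abs_def])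
    show "Om' i j Y X = - Om' i j X Y" for i j X Y
      using Om_skew[of i j Y X] g_skew[of i j Y X] by (simp add: Om'_def)
    show "skew (K i j)" if "i \<noteq> j" for i j by (rule K_skew[OF that])
  qed (fact Om'_anti br_all)+
  interpret sys: faraday_system endo_tr "{a,b,c}" K P f "\<lambda>i j. form_endo (Om' i j)" by (rule sys)
  show "f = 0"
  proof (rule sys.vanishes_of_corner[OF refl])
    show "a \<noteq> b" "b \<noteq> c" "a \<noteq> c" using d by auto
    show "endo_tr P \<noteq> 0" "endo_tr P \<noteq> 4" by fact+
    show "endo_tr P * (endo_tr P - 2) \<noteq> 8"
    proof
      assume "endo_tr P * (endo_tr P - 2) = 8"
      then have "(endo_tr P - 4) * (endo_tr P + 2) = 0" by (simp add: algebra_simps)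
      then show False using m(2) tr_projection(1)[OF P_symm PP] by auto
    qed
    assume z: "P * f * (1 - P) = 0"
    have symQ: "symm (1 - P)" using P_symm unfolding symm_def by (simp add: endo_simps inner_diff_left inner_diff_right)
    show "(1 - P) * f * P = 0"
    proof (rule endo_eqI)
      fix u
      have "Rep_endo ((1 - P) * f * P) u \<bullet> v = 0" for v
      proof -
        have "Rep_endo ((1 - P) * f * P) u \<bullet> v = - (u \<bullet> Rep_endo (P * f * (1 - P)) v)"
          using P_symm symQ f_skew unfolding symm_def skew_def by (simp add: times_endo.rep_eq)
        then show ?thesis unfolding z by (simp add: endo_simps)
      qed
      then have "Rep_endo ((1 - P) * f * P) u \<bullet> v = 0 \<bullet> v" for v by simp
      then show "Rep_endo ((1 - P) * f * P) u = Rep_endo 0 u"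
        unfolding zero_endo.rep_eq by (rule vector_eq_rdot[THEN iffD1, rule_format])
    qed
  qed
qed

text \<open>The eigenspaces of \<open>S\<close> have dimensions \<open>(n + tr S) / 2\<close> and \<open>(n - tr S) / 2\<close>. If neither half yields
the claim, both dimensions lie in \<open>{0, 4}\<close>.\<close>
lemma rank_4:
  fixes a b c d :: 'r
  assumes d: "distinct [a, b, c, d]" and U: "UNIV = {a, b, c, d}"
    and n: "DIM('e) \<noteq> 4" "DIM('e) \<noteq> 8 \<or> endo_tr (J a b * J c d) \<noteq> 0"
  shows "F X Y = 0"
proof -
  let ?t = "endo_tr (J a b * J c d)" and ?n = "real DIM('e)"
  have t: "endo_tr ((1/2) *\<^sub>R (1 + s *\<^sub>R (J a b * J c d))) = (?n + s * ?t) / 2" for s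
    by (simp add: endo.tr_simps endo_tr_one)
  show ?thesis
  proof (rule ccontr)
    assume F: "F X Y \<noteq> 0"
    have "(?n + s * ?t) / 2 \<in> {0, 4}" if "s * s = 1" for s
      using rank_4_half[OF d U that refl, of X Y] F unfolding t by auto
    from this[of 1] this[of "-1"] have "?n + ?t \<in> {0, 8}" "?n - ?t \<in> {0, 8}" by auto
    then have "(?n = 0 \<or> ?n = 4) \<or> (?n = 8 \<and> ?t = 0)" by auto
    then show False using n by auto
  qed
qed

theorem faraday_zero:
  assumes r: "CARD('r) \<ge> 2"
    and n: "(DIM('e), CARD('r)) \<notin> {(2,2), (4,2), (4,3), (4,4), (8,8), (8,4)} \<or>
      (DIM('e), CARD('r)) = (8, 4) \<and> (\<exists>a b c d. distinct [a, b, c, d] \<and> endo_tr (J a b * J c d) \<noteq> 0)"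
  shows "F X Y = 0"
proof -
  consider "CARD('r) = 2" | "CARD('r) = 4" | "CARD('r) \<ge> 3" "CARD('r) \<noteq> 4" using r by linarith
  then show ?thesis
  proof cases
    case 1 then show ?thesis using rank_2 n by auto
  next
    case 3 then show ?thesis using rank_not_4 n by auto
  next
    case 2
    have full: "UNIV = {a, b, c, d}" if "distinct [a, b, c, d]" for a b c d :: 'r
    proof -
      have "card {a, b, c, d} = CARD('r)" using distinct_card[OF that] 2 by simp
      then show ?thesis using card_subset_eq[of UNIV "{a,b,c,d}"] by simp
    qed
    obtain xs :: "'r list" where xs: "distinct xs" "length xs = 4"
      using finite_distinct_list[of "UNIV :: 'r set"] 2 by (metis distinct_card finite)
    then obtain a b c d where "xs = [a, b, c, d]" by (auto simp: length_Suc_conv numeral_eq_Suc)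
    then have abcd: "distinct [a, b, c, d]" using xs by simp
    show ?thesis
    proof (cases "DIM('e) = 8")
      case True
      then obtain a b c d where "distinct [a, b, c, d]" "endo_tr (J a b * J c d) \<noteq> 0" using n 2 by auto
      then show ?thesis using rank_4[OF _ full] True by auto
    next
      case False
      then show ?thesis using rank_4[OF abcd full[OF abcd]] n 2 by auto
    qed
  qed
qed

end

text \<open>Take the trace of the relation with \<open>J\<^sub>k\<^sub>l\<close> and with \<open>J\<^sub>m\<^sub>p\<close>. By orthogonality only the coefficients of
these two survive, and the \<open>2 \<times> 2\<close> system between \<open>c k l\<close> and \<open>c m p\<close> has a nonzero solution only if
\<open>n\<^sup>2 = (tr (J\<^sub>k\<^sub>l J\<^sub>m\<^sub>p))\<^sup>2\<close>.\<close>
lemma (in clifford_endos) volume_trace_of_relation: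
  fixes c :: "'r \<Rightarrow> 'r \<Rightarrow> real"
  assumes r: "CARD('r) = 4" and rel: "(\<Sum>i\<in>UNIV. \<Sum>j\<in>UNIV. c i j *\<^sub>R J i j) = 0"
    and anti_c: "\<And>i j. c j i = - c i j" and nz: "c k l \<noteq> 0"
  shows "\<exists>m p. distinct [k, l, m, p] \<and> (endo_tr (J k l * J m p))\<^sup>2 = (real DIM('e))\<^sup>2"
proof -
  have kl: "k \<noteq> l" using anti_c[of k k] nz by auto
  have "card (UNIV - {k, l}) = 2" using r kl by (simp add: card_Diff_subset)
  then obtain m p where mp: "UNIV - {k, l} = {m, p}" "m \<noteq> p" by (auto simp: card_2_iff)
  have d: "distinct [k, l, m, p]" using kl mp by auto
  have U: "UNIV = {k, l, m, p}" using mp by auto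
  have T: "endo_tr (J i j) = 0" if "i \<noteq> j" for i j :: 'r
  proof -
    have "\<exists>q. q \<noteq> i \<and> q \<noteq> j"
    proof (rule ccontr)
      assume "\<nexists>q. q \<noteq> i \<and> q \<noteq> j"
      then have "(UNIV :: 'r set) \<subseteq> {i, j}" by blast
      then have "CARD('r) \<le> card {i, j}" by (intro card_mono) auto
      also have "\<dots> \<le> 2" by (simp add: card_insert_if)
      finally show False using r by simp
    qed
    then obtain q where "q \<noteq> i" "q \<noteq> j" by blast
    then show ?thesis using tr_J[of i j q] that by auto
  qed
  define n where "n = real DIM('e)"
  have key: "n * c x y = endo_tr (J z w * J x y) * c z w" if d: "distinct [x, y, z, w]" and U: "UNIV = {x, y, z, w}" for x y z w
  proof -
    have diag0: "c i i = 0" for i using anti_c[of i i] by simp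
    have ne: "x \<noteq> y" "x \<noteq> z" "x \<noteq> w" "y \<noteq> z" "y \<noteq> w" "z \<noteq> w" using d by auto
    have sum4: "(\<Sum>i\<in>UNIV. h i) = h x + h y + h z + h w" for h :: "'r \<Rightarrow> real"
      unfolding U using ne by simp
    have v: "endo_tr (J x y * J x y) = - n" "endo_tr (J x z * J x y) = 0" "endo_tr (J x w * J x y) = 0"
      "endo_tr (J y z * J x y) = 0" "endo_tr (J y w * J x y) = 0"
    proof -
      show "endo_tr (J x y * J x y) = - n" using square[of x y] ne by (simp add: endo.tr_simps endo_tr_one n_def)
      show "endo_tr (J x z * J x y) = 0" "endo_tr (J x w * J x y) = 0"
        using mul_first[of x z y] mul_first[of x w y] T[of z y] T[of w y] ne by auto
      show "endo_tr (J y z * J x y) = 0" "endo_tr (J y w * J x y) = 0"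
        using mul_outer[of y z x] mul_outer[of y w x] T[of x z] T[of x w] ne by auto
    qed
    have fl: "J y x = - J x y" "J z x = - J x z" "J w x = - J x w" "J z y = - J y z" "J w y = - J y w" "J w z = - J z w"
      using anti[of x y] anti[of x z] anti[of x w] anti[of y z] anti[of y w] anti[of z w] ne by auto
    have fc: "c y x = - c x y" "c z x = - c x z" "c w x = - c x w" "c z y = - c y z" "c w y = - c y w" "c w z = - c z w"
      using anti_c by blast+
    have "0 = endo_tr ((\<Sum>i\<in>UNIV. \<Sum>j\<in>UNIV. c i j *\<^sub>R J i j) * J x y)" unfolding rel by (simp add: endo.tr_simps)
    also have "\<dots> = (\<Sum>i\<in>UNIV. \<Sum>j\<in>UNIV. c i j * endo_tr (J i j * J x y))"
      by (simp add: sum_distrib_right endo.tr_simps)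
    also have "\<dots> = 2 * (endo_tr (J z w * J x y) * c z w - n * c x y)"
      unfolding sum4 diag0 fl fc by (simp add: v endo.tr_simps)
    finally show ?thesis by simp
  qed
  have "distinct [m, p, k, l]" "UNIV = {m, p, k, l}" using d U by auto
  note 2 = key[OF this]
  note 1 = key[OF d U]
  have comm: "J m p * J k l = J k l * J m p" using commute_disjoint[of m p k l] d by auto
  have "n\<^sup>2 * c k l = n * (n * c k l)" by (simp add: power2_eq_square)
  also have "\<dots> = endo_tr (J k l * J m p) * (n * c m p)" unfolding 1 comm by simp
  also have "\<dots> = (endo_tr (J k l * J m p))\<^sup>2 * c k l" unfolding 2 by (simp add: power2_eq_square)
  finally have "(endo_tr (J k l * J m p))\<^sup>2 = n\<^sup>2" using nz by simp
  then show ?thesis using d unfolding n_def by blast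
qed

text \<open>One of the spectral projections of the involution \<open>J\<^sub>a\<^sub>b J\<^sub>c\<^sub>d\<close> has trace zero and so vanishes, and the
involution is \<open>\<plusminus>1\<close>.\<close>
lemma (in clifford_endos) relation_of_volume_trace:
  assumes d: "distinct [a, b, c, d]" and t: "(endo_tr (J a b * J c d))\<^sup>2 = (real DIM('e))\<^sup>2"
  shows "\<exists>s. s\<^sup>2 = 1 \<and> J c d + s *\<^sub>R J a b = 0"
proof -
  define S where "S = J a b * J c d"
  obtain s where s: "s\<^sup>2 = (1::real)" "endo_tr S = s * real DIM('e)"
  proof -
    have "endo_tr S = real DIM('e) \<or> endo_tr S = - real DIM('e)"
      using t unfolding S_def by (simp add: power2_eq_iff)
    then show ?thesis using that[of 1] that[of "- 1"] by auto
  qed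
  have ss: "s * s = 1" using s by (simp add: power2_eq_square)
  define P where "P = (1/2) *\<^sub>R (1 - s *\<^sub>R S)"
  have S2: "S * S = 1" unfolding S_def by (rule volume_square[OF d])
  have PS: "P * S = - (s *\<^sub>R P)"
    unfolding P_def by (simp add: algebra_simps S2 ss)
  have PP: "P * P = P"
  proof -
    have "P * P = (1/2) *\<^sub>R (P - s *\<^sub>R (P * S))" by (subst (2) P_def) (simp add: right_diff_distrib)
    also have "\<dots> = P" unfolding PS using ss by (simp add: scaleR_2[symmetric])
    finally show ?thesis .
  qed
  have "symm P"
    using volume_symm[OF d] unfolding symm_def P_def S_def[symmetric]
    by (simp add: endo_simps inner_diff_left inner_diff_right)
  moreover have "endo_tr P = 0" unfolding P_def using s ss by (simp add: endo.tr_simps endo_tr_one)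
  ultimately have "P = 0" using tr_projection PP by blast
  then have "s *\<^sub>R S = 1" unfolding P_def by simp
  then have "J a b * (s *\<^sub>R S) = J a b" by simp
  then have "s *\<^sub>R ((J a b * J a b) * J c d) = J a b" unfolding S_def by (simp add: mult.assoc)
  then have "- (s *\<^sub>R J c d) = J a b" using square[of a b] d by simp
  then have "s *\<^sub>R (- (s *\<^sub>R J c d)) = s *\<^sub>R J a b" by simp
  then have e: "s *\<^sub>R J a b = - J c d" using ss by simp
  have "J c d + s *\<^sub>R J a b = 0" unfolding e by simp
  then show ?thesis using s(1) by blast
qed

section \<open>Clifford-Weyl structures in coordinates\<close>

text \<open>Gram-Schmidt for an inner product \<open>G\<close> on a Euclidean space, with the result given as an isometry \<open>B\<close>
from the standard inner product and its inverse \<open>B'\<close>.\<close>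
lemma orthonormal_frame:
  fixes G :: "'e::euclidean_space \<Rightarrow> 'e \<Rightarrow> real"
  assumes bil: "bilinear G" and sym: "\<And>u v. G u v = G v u" and pos: "\<And>v. v \<noteq> 0 \<Longrightarrow> G v v > 0"
  obtains B B' :: "'e \<Rightarrow> 'e" where "linear B" "linear B'" "\<And>x. B (B' x) = x" "\<And>x. B' (B x) = x" "\<And>u v. G (B u) (B v) = u \<bullet> v"
proof -
  note bl = bilinear_ladd[OF bil] bilinear_radd[OF bil] bilinear_lmul[OF bil] bilinear_rmul[OF bil]
    bilinear_lsub[OF bil] bilinear_rsub[OF bil]
  have suml: "G (sum h A) v = (\<Sum>a\<in>A. G (h a) v)" for h :: "'e \<Rightarrow> 'e" and A v
    using linear_sum[of "\<lambda>u. G u v" h A] bil unfolding bilinear_def by blast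
  have sumr: "G v (sum h A) = (\<Sum>a\<in>A. G v (h a))" for h :: "'e \<Rightarrow> 'e" and A v
    using linear_sum[of "G v" h A] bil unfolding bilinear_def by blast
  have ex: "\<exists>S. finite S \<and> card S = k \<and> (\<forall>x\<in>S. \<forall>y\<in>S. G x y = (if x = y then 1 else 0))" if "k \<le> DIM('e)" for k
    using that
  proof (induction k)
    case 0 show ?case by (rule exI[of _ "{}"]) simp
  next
    case (Suc k)
    then obtain S where S: "finite S" "card S = k" "\<And>x y. x \<in> S \<Longrightarrow> y \<in> S \<Longrightarrow> G x y = (if x = y then 1 else 0)"
      by auto
    have "span S \<noteq> UNIV"
    proof
      assume "span S = UNIV"
      then have "DIM('e) \<le> card S" using dim_le_card[of UNIV S] S(1) by simp
      then show False using S(2) Suc.prems by simp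
    qed
    then obtain v where v: "v \<notin> span S" by blast
    define w where "w = v - (\<Sum>s\<in>S. G v s *\<^sub>R s)"
    have "w \<noteq> 0"
    proof
      assume "w = 0"
      then have "v = (\<Sum>s\<in>S. G v s *\<^sub>R s)" unfolding w_def by simp
      also have "\<dots> \<in> span S" by (intro span_sum span_scale span_base)
      finally show False using v by blast
    qed
    then have gw: "G w w > 0" by (rule pos)
    define e where "e = (1 / sqrt (G w w)) *\<^sub>R w"
    have ee: "G e e = 1" unfolding e_def bl using gw by (simp add: field_simps)
    have ws: "G w s = 0" if "s \<in> S" for s
    proof -
      have "G w s = G v s - (\<Sum>t\<in>S. G v t * (if t = s then 1 else 0))"
        unfolding w_def bl suml using S(3) that by simp
      also have "(\<Sum>t\<in>S. G v t * (if t = s then 1 else 0)) = (\<Sum>t\<in>S. if t = s then G v s else 0)"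
        by (intro sum.cong) auto
      also have "G v s - \<dots> = 0" using S(1) that by simp
      finally show ?thesis .
    qed
    have es: "G e s = 0" if "s \<in> S" for s unfolding e_def bl using ws that by simp
    have "e \<notin> S" using es ee by fastforce
    moreover have "G s e = 0" if "s \<in> S" for s using es[OF that] sym[of s e] by simp
    ultimately show ?case using S ee es
      by (intro exI[of _ "insert e S"]) auto
  qed
  obtain S where S: "finite S" "card S = DIM('e)" "\<And>x y. x \<in> S \<Longrightarrow> y \<in> S \<Longrightarrow> G x y = (if x = y then 1 else 0)"
    using ex[of "DIM('e)"] by auto
  obtain h where h: "bij_betw h (Basis :: 'e set) S" using S(1,2) finite_same_card_bij[of Basis S] by auto
  define B where "B u = (\<Sum>b\<in>Basis. (u \<bullet> b) *\<^sub>R h b)" for u :: 'e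
  have lin: "linear B" unfolding B_def by (rule linearI) (simp_all add: inner_add_left algebra_simps sum.distrib scaleR_sum_right)
  have hh: "G (h b) (h c) = (if b = c then 1 else 0)" if "b \<in> Basis" "c \<in> Basis" for b c
    using h that S(3)[of "h b" "h c"] unfolding bij_betw_def inj_on_def by auto
  have iso: "G (B u) (B v) = u \<bullet> v" for u v
  proof -
    have 1: "G (B u) y = (\<Sum>b\<in>Basis. (u \<bullet> b) * G (h b) y)" for y
      unfolding B_def suml bl by simp
    have 2: "G y (B v) = (\<Sum>b\<in>Basis. (v \<bullet> b) * G y (h b))" for y
      unfolding B_def sumr bl by simp
    have "G (B u) (B v) = (\<Sum>b\<in>Basis. (u \<bullet> b) * (\<Sum>c\<in>Basis. (v \<bullet> c) * G (h b) (h c)))"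
      by (subst 1) (simp only: 2)
    also have "\<dots> = (\<Sum>b\<in>Basis. (u \<bullet> b) * (v \<bullet> b))"
    proof (rule sum.cong[OF refl])
      fix b :: 'e assume b: "b \<in> Basis"
      have "(\<Sum>c\<in>Basis. (v \<bullet> c) * G (h b) (h c)) = (\<Sum>c\<in>Basis. if c = b then v \<bullet> b else 0)"
        using hh b by (intro sum.cong) auto
      then show "(u \<bullet> b) * (\<Sum>c\<in>Basis. (v \<bullet> c) * G (h b) (h c)) = (u \<bullet> b) * (v \<bullet> b)" using b by simp
    qed
    also have "\<dots> = u \<bullet> v" by (rule euclidean_inner[symmetric])
    finally show ?thesis .
  qed
  have "inj B"
  proof (rule linear_injective_0[OF lin, THEN iffD2], intro allI impI)
    fix x assume "B x = 0"
    then have "x \<bullet> x = 0" using iso[of x x] bl(3)[of 0 x] bilinear_lzero[OF bil] by simp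
    then show "x = 0" by simp
  qed
  then obtain B' where B': "linear B'" "\<forall>x. B' (B x) = x" "\<forall>x. B (B' x) = x"
    using linear_injective_isomorphism[OF lin] by blast
  show ?thesis by (rule that[of B B']) (use lin B' iso in simp_all)
qed

text \<open>The product rule for a family of linear maps applied to a vector function. It is stated with
smoothness of each \<open>B z a\<close> in \<open>z\<close> because metrics, connection coefficients and endomorphism fields are
all given in this form.\<close>
lemma has_derivative_linear_family:
  fixes B :: "'a::euclidean_space \<Rightarrow> 'e::euclidean_space \<Rightarrow> 'b::real_normed_vector"
  assumes U: "open U" "z0 \<in> U" and lin: "\<And>z. z \<in> U \<Longrightarrow> linear (B z)"
    and sm: "\<And>a. smooth_on U (\<lambda>z. B z a)" and h: "(h has_derivative h') (at z0)"
  shows "((\<lambda>z. B z (h z)) has_derivative (\<lambda>v. frechet_derivative (\<lambda>z. B z (h z0)) (at z0) v + B z0 (h' v))) (at z0)"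
proof -
  have ex: "B z x = (\<Sum>b\<in>Basis. (x \<bullet> b) *\<^sub>R B z b)" if "z \<in> U" for z x
  proof -
    have "B z x = B z (\<Sum>b\<in>Basis. (x \<bullet> b) *\<^sub>R b)" by (simp add: euclidean_representation)
    then show ?thesis by (simp add: linear_sum[OF lin[OF that]] linear_scale[OF lin[OF that]])
  qed
  let ?D = "\<lambda>b. frechet_derivative (\<lambda>z. B z b) (at z0)"
  have Db: "((\<lambda>z. B z b) has_derivative ?D b) (at z0)" for b
    by (rule smooth_on_has_derivative[OF sm U(2)])
  have D: "((\<lambda>z. B z (k z)) has_derivative (\<lambda>v. \<Sum>b\<in>Basis. (k z0 \<bullet> b) *\<^sub>R ?D b v + (k' v \<bullet> b) *\<^sub>R B z0 b)) (at z0)"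
    if "(k has_derivative k') (at z0)" for k k'
  proof (rule has_derivative_transform_within_open[OF _ U])
    show "((\<lambda>z. \<Sum>b\<in>Basis. (k z \<bullet> b) *\<^sub>R B z b) has_derivative
       (\<lambda>v. \<Sum>b\<in>Basis. (k z0 \<bullet> b) *\<^sub>R ?D b v + (k' v \<bullet> b) *\<^sub>R B z0 b)) (at z0)"
      by (rule has_derivative_sum, rule has_derivative_scaleR[OF has_derivative_inner_left[OF that] Db])
    show "(\<Sum>b\<in>Basis. (k z \<bullet> b) *\<^sub>R B z b) = B z (k z)" if "z \<in> U" for z
      by (rule ex[OF that, symmetric])
  qed
  have "frechet_derivative (\<lambda>z. B z (h z0)) (at z0) = (\<lambda>v. \<Sum>b\<in>Basis. (h z0 \<bullet> b) *\<^sub>R ?D b v)"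
    using frechet_derivative_eq[OF D[OF has_derivative_const[of "h z0"]]] by simp
  then show ?thesis using D[OF h] by (simp add: sum.distrib ex[OF U(2), of "h' _"])
qed

lemma linear_derivative_of_family:
  fixes B :: "'a::euclidean_space \<Rightarrow> 'e::euclidean_space \<Rightarrow> 'b::real_normed_vector"
  assumes U: "open U" "z0 \<in> U" and lin: "\<And>z. z \<in> U \<Longrightarrow> linear (B z)"
    and sm: "\<And>a. smooth_on U (\<lambda>z. B z a)"
  shows "linear (\<lambda>a. frechet_derivative (\<lambda>z. B z a) (at z0) v)"
proof (rule linearI)
  have D: "((\<lambda>z. B z b) has_derivative frechet_derivative (\<lambda>z. B z b) (at z0)) (at z0)" for b
    by (rule smooth_on_has_derivative[OF sm U(2)])
  fix x y c
  have "frechet_derivative (\<lambda>z. B z (x + y)) (at z0) = frechet_derivative (\<lambda>z. B z x + B z y) (at z0)"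
    by (rule frechet_derivative_cong_open[OF U]) (simp add: linear_add lin)
  then show "frechet_derivative (\<lambda>z. B z (x + y)) (at z0) v = frechet_derivative (\<lambda>z. B z x) (at z0) v + frechet_derivative (\<lambda>z. B z y) (at z0) v"
    using frechet_derivative_eq[OF has_derivative_add[OF D D]] by simp
  have "frechet_derivative (\<lambda>z. B z (c *\<^sub>R x)) (at z0) = frechet_derivative (\<lambda>z. c *\<^sub>R B z x) (at z0)"
    by (rule frechet_derivative_cong_open[OF U]) (simp add: linear_scale lin)
  then show "frechet_derivative (\<lambda>z. B z (c *\<^sub>R x)) (at z0) v = c *\<^sub>R frechet_derivative (\<lambda>z. B z x) (at z0) v"
    using frechet_derivative_eq[OF has_derivative_scaleR_right[OF D]] by simp
qed

text \<open>The components of a Clifford-Weyl structure on a coordinate domain \<open>U\<close>: a metric \<open>g\<close> of the conformal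
class, the Christoffel symbols \<open>\<Gamma>\<close> of the Weyl connection, its Lee form \<open>\<theta>\<close>, the endomorphisms \<open>J i j\<close>
that represent \<open>e\<^sub>i \<cdot> e\<^sub>j\<close> in a local frame of \<open>E\<close>, and the connection matrix \<open>w\<close> of that frame.\<close>
locale clifford_weyl_coordinates =
  fixes U :: "'e::euclidean_space set"
    and g :: "'e \<Rightarrow> 'e \<Rightarrow> 'e \<Rightarrow> real" and \<Gamma> :: "'e \<Rightarrow> 'e \<Rightarrow> 'e \<Rightarrow> 'e" and \<theta> :: "'e \<Rightarrow> 'e \<Rightarrow> real"
    and J :: "'r::finite \<Rightarrow> 'r \<Rightarrow> 'e \<Rightarrow> 'e \<Rightarrow> 'e" and w :: "'e \<Rightarrow> 'e \<Rightarrow> 'r \<Rightarrow> 'r \<Rightarrow> real"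
  assumes U: "open U"
    and g_smooth: "smooth_on U (\<lambda>z. g z a b)" and g_bil: "z \<in> U \<Longrightarrow> bilinear (g z)"
    and g_sym: "z \<in> U \<Longrightarrow> g z a b = g z b a" and g_pos: "z \<in> U \<Longrightarrow> a \<noteq> 0 \<Longrightarrow> g z a a > 0"
    and \<Gamma>_smooth: "smooth_on U (\<lambda>z. \<Gamma> z v a)" and \<Gamma>_bil: "z \<in> U \<Longrightarrow> bilinear (\<Gamma> z)"
    and \<Gamma>_sym: "z \<in> U \<Longrightarrow> \<Gamma> z v a = \<Gamma> z a v"
    and \<theta>_smooth: "smooth_on U (\<lambda>z. \<theta> z v)" and \<theta>_lin: "z \<in> U \<Longrightarrow> linear (\<theta> z)"
    and J_smooth: "smooth_on U (\<lambda>z. J i j z a)" and J_lin: "z \<in> U \<Longrightarrow> linear (J i j z)"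
    and J_mul: "z \<in> U \<Longrightarrow> J i j z (J j k z a) = - J i k z a" and J_diag: "z \<in> U \<Longrightarrow> J i i z a = - a"
    and J_anti: "z \<in> U \<Longrightarrow> i \<noteq> j \<Longrightarrow> J j i z a = - J i j z a"
    and J_skew: "z \<in> U \<Longrightarrow> i \<noteq> j \<Longrightarrow> g z (J i j z a) b = - g z a (J i j z b)"
    and w_smooth: "smooth_on U (\<lambda>z. w z v i j)" and w_lin: "z \<in> U \<Longrightarrow> linear (\<lambda>v. w z v i j)"
    and w_anti: "z \<in> U \<Longrightarrow> w z v j i = - w z v i j"
    and metric: "z \<in> U \<Longrightarrow> frechet_derivative (\<lambda>z. g z a b) (at z) v
        = g z (\<Gamma> z v a) b + g z a (\<Gamma> z v b) - 2 * \<theta> z v * g z a b"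
    and parallel: "z \<in> U \<Longrightarrow> frechet_derivative (\<lambda>z. J i j z a) (at z) v + \<Gamma> z v (J i j z a) - J i j z (\<Gamma> z v a)
        = (\<Sum>k\<in>UNIV. w z v k i *\<^sub>R J k j z a + w z v k j *\<^sub>R J i k z a)"
begin

definition d\<Gamma> where "d\<Gamma> z u v a = frechet_derivative (\<lambda>z. \<Gamma> z v a) (at z) u"
definition d\<theta> where "d\<theta> z u v = frechet_derivative (\<lambda>z. \<theta> z v) (at z) u - frechet_derivative (\<lambda>z. \<theta> z u) (at z) v"
definition Riem where "Riem z u v a = d\<Gamma> z u v a - d\<Gamma> z v u a + \<Gamma> z u (\<Gamma> z v a) - \<Gamma> z v (\<Gamma> z u a)"
definition dw where "dw z u v i j = frechet_derivative (\<lambda>z. w z v i j) (at z) u"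
definition \<Omega> where "\<Omega> z i j u v = dw z u v i j - dw z v u i j + (\<Sum>k\<in>UNIV. w z u i k * w z v k j - w z v i k * w z u k j)"

lemma \<Gamma>_lin: "z \<in> U \<Longrightarrow> linear (\<Gamma> z v)" "z \<in> U \<Longrightarrow> linear (\<lambda>v. \<Gamma> z v a)"
  using \<Gamma>_bil unfolding bilinear_def by blast+

lemma g_lin: "z \<in> U \<Longrightarrow> linear (g z v)" "z \<in> U \<Longrightarrow> linear (\<lambda>v. g z v a)"
  using g_bil unfolding bilinear_def by blast+

lemma d\<Gamma>_lin: "z \<in> U \<Longrightarrow> linear (d\<Gamma> z u v)" "z \<in> U \<Longrightarrow> linear (\<lambda>v. d\<Gamma> z u v a)" "z \<in> U \<Longrightarrow> linear (\<lambda>u. d\<Gamma> z u v a)"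
  unfolding d\<Gamma>_def[abs_def]
  using linear_derivative_of_family[OF U, of z "\<lambda>z. \<Gamma> z v"] linear_derivative_of_family[OF U, of z "\<lambda>z v. \<Gamma> z v a"]
   \<Gamma>_lin \<Gamma>_smooth linear_frechet_derivative[OF smooth_on_differentiable[OF \<Gamma>_smooth]] by blast+

lemma d\<Gamma>_sym: "z \<in> U \<Longrightarrow> d\<Gamma> z u v a = d\<Gamma> z u a v"
  unfolding d\<Gamma>_def using frechet_derivative_cong_open[OF U, of z "\<lambda>z. \<Gamma> z v a" "\<lambda>z. \<Gamma> z a v"] \<Gamma>_sym by auto

lemma Riem_lin: "z \<in> U \<Longrightarrow> linear (Riem z u v)"
  unfolding Riem_def[abs_def]
  by (rule linearI) (simp_all add: linear_add[OF d\<Gamma>_lin(1)] linear_scale[OF d\<Gamma>_lin(1)] linear_add[OF \<Gamma>_lin(1)]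
     linear_scale[OF \<Gamma>_lin(1)] algebra_simps)

lemma Riem_anti: "Riem z v u a = - Riem z u v a"
  by (simp add: Riem_def)

lemma Riem_bianchi: "z \<in> U \<Longrightarrow> Riem z x y a + Riem z y a x + Riem z a x y = 0"
  unfolding Riem_def using d\<Gamma>_sym[of z x y a] d\<Gamma>_sym[of z y a x] d\<Gamma>_sym[of z a x y]
    \<Gamma>_sym[of z y a] \<Gamma>_sym[of z a x] \<Gamma>_sym[of z x y] by (simp add: algebra_simps)

lemma \<Gamma>_deriv: "z \<in> U \<Longrightarrow> ((\<lambda>z. \<Gamma> z v a) has_derivative (\<lambda>u. d\<Gamma> z u v a)) (at z)"
  unfolding d\<Gamma>_def by (rule smooth_on_has_derivative[OF \<Gamma>_smooth])

text \<open>Differentiate the Weyl condition once more; the second derivatives of \<open>g\<close> are symmetric, and what is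
left of the antisymmetric part is this identity.\<close>
lemma Riem_metric:
  assumes z: "z \<in> U"
  shows "g z (Riem z u v a) b + g z a (Riem z u v b) = 2 * d\<theta> z u v * g z a b"
proof -
  define E where "E u v = (g z (\<Gamma> z u (\<Gamma> z v a)) b + g z (\<Gamma> z v a) (\<Gamma> z u b) - 2 * \<theta> z u * g z (\<Gamma> z v a) b + g z (d\<Gamma> z u v a) b)
      + (g z (\<Gamma> z u a) (\<Gamma> z v b) + g z a (\<Gamma> z u (\<Gamma> z v b)) - 2 * \<theta> z u * g z a (\<Gamma> z v b) + g z a (d\<Gamma> z u v b))
      - (2 * frechet_derivative (\<lambda>z. \<theta> z v) (at z) u * g z a b
         + 2 * \<theta> z v * (g z (\<Gamma> z u a) b + g z a (\<Gamma> z u b) - 2 * \<theta> z u * g z a b))" for u v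
  have second: "frechet_derivative (\<lambda>z. frechet_derivative (\<lambda>z. g z a b) (at z) v) (at z) u = E u v" for u v
  proof -
    have D1: "((\<lambda>z. g z (\<Gamma> z v a) b) has_derivative
        (\<lambda>u. g z (\<Gamma> z u (\<Gamma> z v a)) b + g z (\<Gamma> z v a) (\<Gamma> z u b) - 2 * \<theta> z u * g z (\<Gamma> z v a) b + g z (d\<Gamma> z u v a) b)) (at z)"
      using has_derivative_linear_family[OF U z g_lin(2) g_smooth \<Gamma>_deriv[OF z]] unfolding metric[OF z] .
    have D2: "((\<lambda>z. g z a (\<Gamma> z v b)) has_derivative
        (\<lambda>u. g z (\<Gamma> z u a) (\<Gamma> z v b) + g z a (\<Gamma> z u (\<Gamma> z v b)) - 2 * \<theta> z u * g z a (\<Gamma> z v b) + g z a (d\<Gamma> z u v b))) (at z)"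
      using has_derivative_linear_family[OF U z g_lin(1) g_smooth \<Gamma>_deriv[OF z]] unfolding metric[OF z] .
    have D3: "((\<lambda>z. 2 * \<theta> z v * g z a b) has_derivative (\<lambda>u. 2 * \<theta> z v * (g z (\<Gamma> z u a) b + g z a (\<Gamma> z u b) - 2 * \<theta> z u * g z a b)
         + 2 * frechet_derivative (\<lambda>z. \<theta> z v) (at z) u * g z a b)) (at z)"
      using has_derivative_mult[OF has_derivative_mult_right[OF smooth_on_has_derivative[OF \<theta>_smooth z], of 2]
         smooth_on_has_derivative[OF g_smooth z]] unfolding metric[OF z] .
    have "frechet_derivative (\<lambda>z. frechet_derivative (\<lambda>z. g z a b) (at z) v) (at z)
        = frechet_derivative (\<lambda>z. g z (\<Gamma> z v a) b + g z a (\<Gamma> z v b) - 2 * \<theta> z v * g z a b) (at z)"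
      by (rule frechet_derivative_cong_open[OF U z metric])
    then show ?thesis
      unfolding frechet_derivative_eq[OF has_derivative_diff[OF has_derivative_add[OF D1 D2] D3]] by (simp add: E_def)
  qed
  have "E u v = E v u"
    unfolding second[symmetric] by (rule symmetric_second_derivative[OF U z g_smooth])
  then show ?thesis
    unfolding E_def Riem_def d\<theta>_def
    by (simp add: bilinear_ladd[OF g_bil[OF z]] bilinear_radd[OF g_bil[OF z]] bilinear_lsub[OF g_bil[OF z]]
        bilinear_rsub[OF g_bil[OF z]] algebra_simps)
qed

lemma J_deriv: "z \<in> U \<Longrightarrow> ((\<lambda>z. J i j z a) has_derivative (\<lambda>u. J i j z (\<Gamma> z u a) - \<Gamma> z u (J i j z a)
    + (\<Sum>k\<in>UNIV. w z u k i *\<^sub>R J k j z a + w z u k j *\<^sub>R J i k z a))) (at z)"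
proof -
  assume z: "z \<in> U"
  have "frechet_derivative (\<lambda>z. J i j z a) (at z) u = J i j z (\<Gamma> z u a) - \<Gamma> z u (J i j z a)
    + (\<Sum>k\<in>UNIV. w z u k i *\<^sub>R J k j z a + w z u k j *\<^sub>R J i k z a)" for u
    unfolding parallel[OF z, symmetric] by simp
  then show ?thesis using smooth_on_has_derivative[OF J_smooth z, of i j a] by presburger
qed

definition W where "W i j z u a = (\<Sum>k\<in>UNIV. w z u k i *\<^sub>R J k j z a + w z u k j *\<^sub>R J i k z a)"

lemma J_deriv': "z \<in> U \<Longrightarrow> frechet_derivative (\<lambda>z. J i j z a) (at z) u = J i j z (\<Gamma> z u a) - \<Gamma> z u (J i j z a) + W i j z u a"
  unfolding W_def by (subst frechet_derivative_eq[OF J_deriv]) simp_all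

lemma w_deriv: "z \<in> U \<Longrightarrow> ((\<lambda>z. w z v i j) has_derivative (\<lambda>u. dw z u v i j)) (at z)"
  unfolding dw_def by (rule smooth_on_has_derivative[OF w_smooth])

text \<open>The result of differentiating the condition that \<open>J\<close> is parallel once more and replacing first
derivatives of \<open>J\<close> by that same condition.\<close>
lemma second_J:
  assumes z: "z \<in> U"
  shows "frechet_derivative (\<lambda>z. frechet_derivative (\<lambda>z. J i j z a) (at z) v) (at z) u
    = J i j z (\<Gamma> z u (\<Gamma> z v a)) - \<Gamma> z u (J i j z (\<Gamma> z v a)) + W i j z u (\<Gamma> z v a) + J i j z (d\<Gamma> z u v a)
     - (d\<Gamma> z u v (J i j z a) + \<Gamma> z v (J i j z (\<Gamma> z u a) - \<Gamma> z u (J i j z a) + W i j z u a))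
     + (\<Sum>k\<in>UNIV. dw z u v k i *\<^sub>R J k j z a + dw z u v k j *\<^sub>R J i k z a
         + (w z v k i *\<^sub>R (J k j z (\<Gamma> z u a) - \<Gamma> z u (J k j z a) + W k j z u a)
         + w z v k j *\<^sub>R (J i k z (\<Gamma> z u a) - \<Gamma> z u (J i k z a) + W i k z u a)))"
proof -
  have D1: "((\<lambda>z. J i j z (\<Gamma> z v a)) has_derivative (\<lambda>u. J i j z (\<Gamma> z u (\<Gamma> z v a)) - \<Gamma> z u (J i j z (\<Gamma> z v a)) + W i j z u (\<Gamma> z v a)
      + J i j z (d\<Gamma> z u v a))) (at z)"
    using has_derivative_linear_family[OF U z J_lin J_smooth \<Gamma>_deriv[OF z]] unfolding J_deriv'[OF z] .
  have D2: "((\<lambda>z. \<Gamma> z v (J i j z a)) has_derivative (\<lambda>u. d\<Gamma> z u v (J i j z a) + \<Gamma> z v (J i j z (\<Gamma> z u a) - \<Gamma> z u (J i j z a) + W i j z u a))) (at z)"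
    using has_derivative_linear_family[OF U z \<Gamma>_lin(1) \<Gamma>_smooth J_deriv[OF z]] unfolding d\<Gamma>_def W_def .
  have D3: "((\<lambda>z. w z v k i *\<^sub>R J l m z a) has_derivative (\<lambda>u. w z v k i *\<^sub>R (J l m z (\<Gamma> z u a) - \<Gamma> z u (J l m z a) + W l m z u a) + dw z u v k i *\<^sub>R J l m z a)) (at z)" for i k l m
    using has_derivative_scaleR[OF w_deriv[OF z] J_deriv[OF z]] unfolding W_def .
  have D4: "((\<lambda>z. \<Sum>k\<in>UNIV. w z v k i *\<^sub>R J k j z a + w z v k j *\<^sub>R J i k z a) has_derivative
     (\<lambda>u. \<Sum>k\<in>UNIV. (w z v k i *\<^sub>R (J k j z (\<Gamma> z u a) - \<Gamma> z u (J k j z a) + W k j z u a) + dw z u v k i *\<^sub>R J k j z a)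
         + (w z v k j *\<^sub>R (J i k z (\<Gamma> z u a) - \<Gamma> z u (J i k z a) + W i k z u a) + dw z u v k j *\<^sub>R J i k z a))) (at z)"
    by (rule has_derivative_sum, rule has_derivative_add[OF D3 D3])
  have "frechet_derivative (\<lambda>z. frechet_derivative (\<lambda>z. J i j z a) (at z) v) (at z)
      = frechet_derivative (\<lambda>z. J i j z (\<Gamma> z v a) - \<Gamma> z v (J i j z a) + (\<Sum>k\<in>UNIV. w z v k i *\<^sub>R J k j z a + w z v k j *\<^sub>R J i k z a)) (at z)"
    by (rule frechet_derivative_cong_open[OF U z], unfold parallel[symmetric], simp)
  then show ?thesis
    unfolding frechet_derivative_eq[OF has_derivative_add[OF has_derivative_diff[OF D1 D2] D4]]
    by (simp add: algebra_simps sum.distrib)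
qed

text \<open>The antisymmetric part of \<open>second_J\<close>. The terms that mix \<open>\<Gamma>\<close> with \<open>w\<close> cancel, and the terms quadratic in
\<open>w\<close> combine with the derivatives of \<open>w\<close> to the curvature \<open>\<Omega>\<close>.\<close>
lemma Riem_bracket:
  assumes z: "z \<in> U"
  shows "Riem z u v (J i j z a) - J i j z (Riem z u v a) = (\<Sum>k\<in>UNIV. \<Omega> z k i u v *\<^sub>R J k j z a + \<Omega> z k j u v *\<^sub>R J i k z a)"
proof -
  define Q where "Q u v = (\<Sum>k\<in>UNIV. w z v k i *\<^sub>R W k j z u a + w z v k j *\<^sub>R W i k z u a)" for u v
  define E where "E u v = (\<Sum>k\<in>UNIV. dw z u v k i *\<^sub>R J k j z a + dw z u v k j *\<^sub>R J i k z a)" for u v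
  define S where "S u v = J i j z (\<Gamma> z u (\<Gamma> z v a)) - \<Gamma> z u (J i j z (\<Gamma> z v a)) + W i j z u (\<Gamma> z v a) + J i j z (d\<Gamma> z u v a)
     - (d\<Gamma> z u v (J i j z a) + \<Gamma> z v (J i j z (\<Gamma> z u a)) - \<Gamma> z v (\<Gamma> z u (J i j z a)) + \<Gamma> z v (W i j z u a))
     + (E u v + W i j z v (\<Gamma> z u a) - \<Gamma> z u (W i j z v a) + Q u v)" for u v
  have S: "frechet_derivative (\<lambda>z. frechet_derivative (\<lambda>z. J i j z a) (at z) v) (at z) u = S u v" for u v
  proof -
    have "\<Gamma> z u (W i j z v a) = (\<Sum>k\<in>UNIV. w z v k i *\<^sub>R \<Gamma> z u (J k j z a) + w z v k j *\<^sub>R \<Gamma> z u (J i k z a))"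
      unfolding W_def by (simp add: linear_sum[OF \<Gamma>_lin(1)[OF z]] linear_add[OF \<Gamma>_lin(1)[OF z]] linear_scale[OF \<Gamma>_lin(1)[OF z]])
    then show ?thesis unfolding second_J[OF z] S_def E_def Q_def W_def[of i j z v "\<Gamma> z u a"]
      by (simp add: linear_add[OF \<Gamma>_lin(1)[OF z]] linear_diff[OF \<Gamma>_lin(1)[OF z]] sum.distrib sum_subtractf algebra_simps)
  qed
  have SS: "S u v = S v u"
    unfolding S[symmetric] by (rule symmetric_second_derivative[OF U z J_smooth])
  have QE: "Q u v - Q v u + (E u v - E v u) = (\<Sum>k\<in>UNIV. \<Omega> z k i u v *\<^sub>R J k j z a + \<Omega> z k j u v *\<^sub>R J i k z a)"
  proof -
    \<comment> \<open>These mixed products contribute symmetrically in \<open>u\<close> and \<open>v\<close>, so they drop out of \<open>Q u v - Q v u\<close>.\<close>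
    define M where "M u v = (\<Sum>k\<in>UNIV. \<Sum>l\<in>UNIV. (w z v k i * w z u l j) *\<^sub>R J k l z a)" for u v
    have Q: "Q u v = (\<Sum>l\<in>UNIV. (\<Sum>k\<in>UNIV. w z u l k * w z v k i) *\<^sub>R J l j z a) + M u v + M v u
        + (\<Sum>l\<in>UNIV. (\<Sum>k\<in>UNIV. w z u l k * w z v k j) *\<^sub>R J i l z a)" for u v
    proof -
      have "Q u v = (\<Sum>k\<in>UNIV. \<Sum>l\<in>UNIV. (w z u l k * w z v k i) *\<^sub>R J l j z a) + M u v
        + (\<Sum>k\<in>UNIV. \<Sum>l\<in>UNIV. (w z v k j * w z u l i) *\<^sub>R J l k z a)
        + (\<Sum>k\<in>UNIV. \<Sum>l\<in>UNIV. (w z u l k * w z v k j) *\<^sub>R J i l z a)"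
        unfolding Q_def W_def M_def by (simp add: scaleR_sum_right sum.distrib algebra_simps)
      moreover have "(\<Sum>k\<in>UNIV. \<Sum>l\<in>UNIV. (w z v k j * w z u l i) *\<^sub>R J l k z a) = M v u"
        unfolding M_def by (subst sum.swap) (simp add: mult.commute)
      moreover have "(\<Sum>k\<in>UNIV. \<Sum>l\<in>UNIV. (w z u l k * w z v k i) *\<^sub>R J l j z a) = (\<Sum>l\<in>UNIV. (\<Sum>k\<in>UNIV. w z u l k * w z v k i) *\<^sub>R J l j z a)"
        by (subst sum.swap) (simp add: scaleR_sum_left)
      moreover have "(\<Sum>k\<in>UNIV. \<Sum>l\<in>UNIV. (w z u l k * w z v k j) *\<^sub>R J i l z a) = (\<Sum>l\<in>UNIV. (\<Sum>k\<in>UNIV. w z u l k * w z v k j) *\<^sub>R J i l z a)"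
        by (subst sum.swap) (simp add: scaleR_sum_left)
      ultimately show ?thesis by simp
    qed
    show ?thesis unfolding Q E_def \<Omega>_def
      by (simp add: sum.distrib sum_subtractf scaleR_add_left scaleR_diff_left)
  qed
  have "Riem z u v (J i j z a) - J i j z (Riem z u v a) = (Q u v - Q v u + (E u v - E v u)) - (S u v - S v u)"
    unfolding S_def Riem_def
    by (simp add: linear_add[OF J_lin[OF z]] linear_diff[OF J_lin[OF z]] algebra_simps)
  then show ?thesis unfolding SS QE by simp
qed

definition JE where "JE z i j = Abs_endo (J i j z)"

lemma JE: "z \<in> U \<Longrightarrow> Rep_endo (JE z i j) = J i j z"
  unfolding JE_def using Abs_endo_inverse J_lin by blast

lemma JE_family: "z \<in> U \<Longrightarrow> even_clifford_family endo_tr UNIV (JE z) 1"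
proof -
  assume z: "z \<in> U"
  show ?thesis
  proof
    show "JE z i j * JE z j k = - JE z i k" for i j k
      by (rule endo_eqI) (simp add: endo_simps JE[OF z] J_mul[OF z])
    show "JE z j i = - JE z i j" if "i \<noteq> j" for i j
      by (rule endo_eqI) (simp add: endo_simps JE[OF z] J_anti[OF z that])
    show "JE z i i = - 1" for i
      by (rule endo_eqI) (simp add: endo_simps JE[OF z] J_diag[OF z])
  qed simp
qed

text \<open>The volume element is parallel, so its derivative is its commutator with the Christoffel
endomorphism, which has trace zero.\<close>
lemma volume_trace_derivative:
  assumes z: "z \<in> U" and d: "distinct [a, b, c, d]" and r: "UNIV = {a, b, c, d}"
  shows "((\<lambda>z. endo_tr (JE z a b * JE z c d)) has_derivative (\<lambda>u. 0)) (at z)"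
proof -
  interpret even_clifford_family endo_tr UNIV "JE z" 1 by (rule JE_family[OF z])
  define K where "K u = Abs_endo (\<Gamma> z u)" for u
  have K: "Rep_endo (K u) = \<Gamma> z u" for u
    unfolding K_def using Abs_endo_inverse \<Gamma>_lin(1)[OF z] by blast
  define V where "V u i j = (\<Sum>k\<in>UNIV. w z u k i *\<^sub>R JE z k j + w z u k j *\<^sub>R JE z i k)" for u i j
  have V: "Rep_endo (V u i j) x = W i j z u x" for u i j x
    unfolding V_def W_def by (simp add: Rep_endo_sum endo_simps JE[OF z])
  have V_red: "V u i j = (\<Sum>k\<in>UNIV - {i,j}. w z u k i *\<^sub>R JE z k j + w z u k j *\<^sub>R JE z i k)" if "i \<noteq> j" for u i j
  proof -
    have w0: "w z u k k = 0" for k using w_anti[OF z, of u k k] by linarith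
    have "V u i j = (\<Sum>k\<in>UNIV - {i,j}. w z u k i *\<^sub>R JE z k j + w z u k j *\<^sub>R JE z i k)
         + (\<Sum>k\<in>{i,j}. w z u k i *\<^sub>R JE z k j + w z u k j *\<^sub>R JE z i k)"
      unfolding V_def by (rule sum.subset_diff) auto
    also have "(\<Sum>k\<in>{i,j}. w z u k i *\<^sub>R JE z k j + w z u k j *\<^sub>R JE z i k) = 0"
      using that w0 w_anti[OF z, of u i j] by (simp add: diag)
    finally show ?thesis by simp
  qed
  have D: "((\<lambda>z. J a b z (J c d z x)) has_derivative (\<lambda>u. Rep_endo (endo.comm (JE z a b * JE z c d) (K u)) x)) (at z)" for x
  proof -
    have zero: "V u a b * JE z c d + JE z a b * V u c d = 0" for u
    proof -
      have "a \<noteq> b" "c \<noteq> d" using d by auto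
      then show ?thesis unfolding V_red[OF \<open>a \<noteq> b\<close>] V_red[OF \<open>c \<noteq> d\<close>]
        by (intro volume_derivation[OF d r] w_anti[OF z])
    qed
    have zero': "W a b z u (J c d z x) + J a b z (W c d z u x) = 0" for u
      using arg_cong[OF zero[of u], of "\<lambda>f. Rep_endo f x"] by (simp add: endo_simps JE[OF z] V)
    have D0: "((\<lambda>z. J a b z (J c d z x)) has_derivative (\<lambda>u. frechet_derivative (\<lambda>z'. J a b z' (J c d z x)) (at z) u
        + J a b z (J c d z (\<Gamma> z u x) - \<Gamma> z u (J c d z x) + W c d z u x))) (at z)"
      using has_derivative_linear_family[OF U z J_lin J_smooth J_deriv[OF z], of a b c d x] unfolding W_def .
    have e: "frechet_derivative (\<lambda>z'. J a b z' (J c d z x)) (at z) u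
        + J a b z (J c d z (\<Gamma> z u x) - \<Gamma> z u (J c d z x) + W c d z u x) = Rep_endo (endo.comm (JE z a b * JE z c d) (K u)) x" for u
    proof -
      have "frechet_derivative (\<lambda>z'. J a b z' (J c d z x)) (at z) u
        + J a b z (J c d z (\<Gamma> z u x) - \<Gamma> z u (J c d z x) + W c d z u x)
        = (J a b z (J c d z (\<Gamma> z u x)) - \<Gamma> z u (J a b z (J c d z x))) + (W a b z u (J c d z x) + J a b z (W c d z u x))"
        unfolding J_deriv'[OF z] linear_add[OF J_lin[OF z]] linear_diff[OF J_lin[OF z]] by simp
      then show ?thesis unfolding zero' endo.comm_def by (simp add: endo_simps JE[OF z] K)
    qed
    show ?thesis using D0 unfolding e .
  qed
  have "((\<lambda>z. \<Sum>x\<in>Basis. J a b z (J c d z x) \<bullet> x) has_derivative (\<lambda>u. \<Sum>x\<in>Basis. Rep_endo (endo.comm (JE z a b * JE z c d) (K u)) x \<bullet> x)) (at z)"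
    by (rule has_derivative_sum, rule has_derivative_inner_left[OF D])
  then have "((\<lambda>z. \<Sum>x\<in>Basis. J a b z (J c d z x) \<bullet> x) has_derivative (\<lambda>u. 0)) (at z)"
    unfolding endo_tr_def[symmetric] by (simp add: endo.comm_def endo.tr_simps endo.tr_commute)
  then show ?thesis
    by (rule has_derivative_transform_within_open[OF _ U z]) (simp add: endo_tr_def endo_simps JE)
qed

lemma volume_trace_constant:
  assumes d: "distinct [a, b, c, d]" and r: "UNIV = {a, b, c, d}" and S: "convex S" "S \<subseteq> U" "x \<in> S" "y \<in> S"
  shows "endo_tr (JE x a b * JE x c d) = endo_tr (JE y a b * JE y c d)"
proof -
  have "\<exists>c'. \<forall>z\<in>S. endo_tr (JE z a b * JE z c d) = c'"
    by (rule has_derivative_zero_constant[OF S(1)])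
      (use volume_trace_derivative[OF _ d r] S(2) in \<open>blast intro: has_derivative_at_withinI\<close>)
  then show ?thesis using S(3,4) by metis
qed

lemma \<Omega>_form:
  assumes z: "z \<in> U"
  shows "bilinear (\<Omega> z i j)" "\<Omega> z i j v u = - \<Omega> z i j u v" "\<Omega> z j i u v = - \<Omega> z i j u v"
proof -
  have l1: "linear (\<lambda>u. dw z u v i j)" for v i j
    unfolding dw_def by (rule linear_frechet_derivative[OF smooth_on_differentiable[OF w_smooth z]])
  have l2: "linear (\<lambda>v. dw z u v i j)" for u i j
    unfolding dw_def by (rule linear_derivative_of_family[OF U z w_lin w_smooth])
  have dw_anti: "dw z u v j i = - dw z u v i j" for u v i j
  proof -
    have "frechet_derivative (\<lambda>z. w z v j i) (at z) = frechet_derivative (\<lambda>z. - w z v i j) (at z)"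
      by (rule frechet_derivative_cong_open[OF U z w_anti])
    then show ?thesis unfolding dw_def
      using frechet_derivative_eq[OF has_derivative_minus[OF smooth_on_has_derivative[OF w_smooth z]]] by simp
  qed
  note lin = linear_add[OF l1] linear_add[OF l2] linear_scale[OF l1] linear_scale[OF l2]
    linear_add[OF w_lin[OF z]] linear_scale[OF w_lin[OF z]]
  show "bilinear (\<Omega> z i j)"
    unfolding bilinear_def \<Omega>_def
    by (auto intro!: linearI simp: lin algebra_simps sum.distrib sum_subtractf sum_distrib_left)
  show "\<Omega> z i j v u = - \<Omega> z i j u v"
    unfolding \<Omega>_def by (simp add: sum_subtractf)
  have "(\<Sum>k\<in>UNIV. w z u j k * w z v k i - w z v j k * w z u k i) = - (\<Sum>k\<in>UNIV. w z u i k * w z v k j - w z v i k * w z u k j)"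
    unfolding sum_negf[symmetric]
  proof (rule sum.cong[OF refl])
    fix k
    show "w z u j k * w z v k i - w z v j k * w z u k i = - (w z u i k * w z v k j - w z v i k * w z u k j)"
      using w_anti[OF z, of u j k] w_anti[OF z, of v k i] w_anti[OF z, of v j k] w_anti[OF z, of u k i]
      by (simp add: mult.commute)
  qed
  then show "\<Omega> z j i u v = - \<Omega> z i j u v"
    unfolding \<Omega>_def dw_anti[of u v j i] dw_anti[of v u j i] by simp
qed

lemma d\<theta>_bilinear: "z \<in> U \<Longrightarrow> bilinear (d\<theta> z)"
proof -
  assume z: "z \<in> U"
  have l1: "linear (\<lambda>u. frechet_derivative (\<lambda>z. \<theta> z v) (at z) u)" for v
    using linear_frechet_derivative[OF smooth_on_differentiable[OF \<theta>_smooth z]] by simp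
  have l2: "linear (\<lambda>v. frechet_derivative (\<lambda>z. \<theta> z v) (at z) u)" for u
    by (rule linear_derivative_of_family[OF U z \<theta>_lin \<theta>_smooth])
  show "bilinear (d\<theta> z)"
    unfolding bilinear_def d\<theta>_def
    by (auto intro!: linear_compose_sub l1 l2)
qed

text \<open>Transport of all data at the point \<open>z\<close> to a frame that is orthonormal for \<open>g z\<close>, where the algebraic
theorems apply to the standard inner product.\<close>
lemma orthonormal_data:
  assumes z: "z \<in> U"
  obtains B B' :: "'e \<Rightarrow> 'e" where "linear B" "linear B'" "\<And>x. B (B' x) = x" "\<And>x. B' (B x) = x"
    "clifford_weyl_curvature (\<lambda>X Y. Abs_endo (\<lambda>x. B' (Riem z (B X) (B Y) (B x)))) (\<lambda>X Y. d\<theta> z (B X) (B Y))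
       (\<lambda>i j. Abs_endo B' * JE z i j * Abs_endo B) (\<lambda>i j X Y. \<Omega> z i j (B X) (B Y))"
proof (rule orthonormal_frame[OF g_bil[OF z] g_sym[OF z] g_pos[OF z]])
  fix B B' :: "'e \<Rightarrow> 'e"
  assume B: "linear B" "linear B'" "\<And>x. B (B' x) = x" "\<And>x. B' (B x) = x" "\<And>u v. g z (B u) (B v) = u \<bullet> v"
  have eB: "Rep_endo (Abs_endo B) = B" "Rep_endo (Abs_endo B') = B'"
    using Abs_endo_inverse B by blast+
  have BB: "Abs_endo B * Abs_endo B' = 1" "Abs_endo B' * Abs_endo B = 1"
    by (rule endo_eqI, simp add: endo_simps eB B)+
  define R where "R X Y = Abs_endo (\<lambda>x. B' (Riem z (B X) (B Y) (B x)))" for X Y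
  have R: "Rep_endo (R X Y) x = B' (Riem z (B X) (B Y) (B x))" for X Y x
  proof -
    have "linear (\<lambda>x. B' (Riem z (B X) (B Y) (B x)))"
      by (rule linearI) (simp_all add: linear_add[OF B(1)] linear_add[OF B(2)] linear_add[OF Riem_lin[OF z]]
        linear_scale[OF B(1)] linear_scale[OF B(2)] linear_scale[OF Riem_lin[OF z]])
    then show ?thesis unfolding R_def by (simp add: Abs_endo_inverse)
  qed
  have move: "B' x \<bullet> y = g z x (B y)" "y \<bullet> B' x = g z (B y) x" for x y
    using B(5)[of "B' x" y] B(5)[of y "B' x"] B(3)[of x] by simp_all
  interpret fam: even_clifford_family endo_tr UNIV "JE z" 1 by (rule JE_family[OF z])
  define K where "K i j = Abs_endo B' * JE z i j * Abs_endo B" for i j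
  have K: "Rep_endo (K i j) x = B' (J i j z (B x))" for i j x
    unfolding K_def by (simp add: endo_simps eB JE[OF z])
  have famK: "even_clifford_family endo_tr UNIV K 1"
  proof
    show "K i j * K j k = - K i k" for i j k
      by (rule endo_eqI) (simp add: endo_simps K B(3) J_mul[OF z] linear_neg[OF B(2)])
    show "K j i = - K i j" if "i \<noteq> j" for i j
      by (rule endo_eqI) (simp add: endo_simps K J_anti[OF z that] linear_neg[OF B(2)])
    show "K i i = - 1" for i
      by (rule endo_eqI) (simp add: endo_simps K J_diag[OF z] linear_neg[OF B(2)] B(4))
  qed simp
  have bil2: "bilinear (\<lambda>X Y. \<beta> (B X) (B Y))" if "bilinear \<beta>" for \<beta> :: "'e \<Rightarrow> 'e \<Rightarrow> real"
    unfolding bilinear_def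
    by (auto intro!: linearI simp: linear_add[OF B(1)] linear_scale[OF B(1)] bilinear_ladd[OF that] bilinear_radd[OF that]
      bilinear_lmul[OF that] bilinear_rmul[OF that])
  have \<Omega>0: "\<Omega> z k k X Y = 0" for k X Y using \<Omega>_form(3)[OF z, of k k X Y] by linarith
  have "clifford_weyl_curvature R (\<lambda>X Y. d\<theta> z (B X) (B Y)) K (\<lambda>i j X Y. \<Omega> z i j (B X) (B Y))"
  proof (intro clifford_weyl_curvature.intro weyl_curvature.intro clifford_endos.intro clifford_endos_axioms.intro
      clifford_weyl_curvature_axioms.intro famK)
    show "R Y X = - R X Y" for X Y
      by (rule endo_eqI) (simp add: R endo_simps Riem_anti[of z "B Y"] linear_neg[OF B(2)])
    show "Rep_endo (R X Y) Z + Rep_endo (R Y Z) X + Rep_endo (R Z X) Y = 0" for X Y Z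
      unfolding R linear_add[OF B(2), symmetric] Riem_bianchi[OF z] by (rule linear_0[OF B(2)])
    show "Rep_endo (R X Y) u \<bullet> v + u \<bullet> Rep_endo (R X Y) v = 2 * d\<theta> z (B X) (B Y) * (u \<bullet> v)" for X Y u v
      unfolding R move Riem_metric[OF z] B(5) ..
    show "bilinear (\<lambda>X Y. d\<theta> z (B X) (B Y))" by (rule bil2[OF d\<theta>_bilinear[OF z]])
    show "skew (K i j)" if "i \<noteq> j" for i j
      unfolding skew_def K move using J_skew[OF z that] by simp
    show "bilinear (\<lambda>X Y. \<Omega> z i j (B X) (B Y))" for i j by (rule bil2[OF \<Omega>_form(1)[OF z]])
    show "\<Omega> z i j (B Y) (B X) = - \<Omega> z i j (B X) (B Y)" for i j X Y by (rule \<Omega>_form(2)[OF z])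
    show "\<Omega> z j i (B X) (B Y) = - \<Omega> z i j (B X) (B Y)" for i j X Y by (rule \<Omega>_form(3)[OF z])
    show "endo.comm (R X Y) (K i j) = (\<Sum>k\<in>UNIV - {i, j}. \<Omega> z k i (B X) (B Y) *\<^sub>R K k j + \<Omega> z k j (B X) (B Y) *\<^sub>R K i k)"
      if ij: "i \<noteq> j" for i j X Y
    proof -
      let ?h = "\<lambda>k. \<Omega> z k i (B X) (B Y) *\<^sub>R K k j + \<Omega> z k j (B X) (B Y) *\<^sub>R K i k"
      have "(\<Sum>k\<in>UNIV. ?h k) = (\<Sum>k\<in>UNIV - {i, j}. ?h k) + (\<Sum>k\<in>{i, j}. ?h k)"
        by (rule sum.subset_diff) auto
      also have "(\<Sum>k\<in>{i, j}. ?h k) = 0"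
        using ij even_clifford_family.diag[OF famK] \<Omega>_form(3)[OF z, of i j "B X" "B Y"] by (simp add: \<Omega>0)
      finally have red: "(\<Sum>k\<in>UNIV - {i, j}. ?h k) = (\<Sum>k\<in>UNIV. ?h k)" by simp
      show ?thesis unfolding red
      proof (rule endo_eqI)
        fix x
        have "Rep_endo (endo.comm (R X Y) (K i j)) x = B' (Riem z (B X) (B Y) (J i j z (B x)) - J i j z (Riem z (B X) (B Y) (B x)))"
          by (simp add: endo.comm_def endo_simps R K B(3) linear_diff[OF B(2)])
        also have "\<dots> = Rep_endo (\<Sum>k\<in>UNIV. ?h k) x"
          unfolding Riem_bracket[OF z]
          by (simp add: linear_sum[OF B(2)] linear_add[OF B(2)] linear_scale[OF B(2)] Rep_endo_sum endo_simps K)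
        finally show "Rep_endo (endo.comm (R X Y) (K i j)) x = Rep_endo (\<Sum>k\<in>UNIV. ?h k) x" .
      qed
    qed
  qed
  then show ?thesis unfolding R_def K_def by (rule that[OF B(1-4)])
qed

lemma tr_frame:
  assumes "linear B" "linear B'" "\<And>x. B (B' x) = x"
  shows "endo_tr ((Abs_endo B' * X * Abs_endo B) * (Abs_endo B' * Y * Abs_endo B)) = endo_tr (X * Y)"
proof -
  have BB: "Abs_endo B * Abs_endo B' = 1"
    by (rule endo_eqI) (simp add: endo_simps Abs_endo_inverse assms)
  have "endo_tr ((Abs_endo B' * X * Abs_endo B) * (Abs_endo B' * Y * Abs_endo B))
     = endo_tr (Abs_endo B' * (X * (Abs_endo B * Abs_endo B') * Y * Abs_endo B))" by (simp add: mult.assoc)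
  also have "\<dots> = endo_tr ((X * (Abs_endo B * Abs_endo B') * Y * Abs_endo B) * Abs_endo B')" by (rule endo.tr_commute)
  also have "\<dots> = endo_tr (X * Y)" by (simp add: mult.assoc BB)
  finally show ?thesis .
qed

theorem d\<theta>_zero:
  assumes z: "z \<in> U" and r: "CARD('r) \<ge> 2"
    and n: "(DIM('e), CARD('r)) \<notin> {(2,2), (4,2), (4,3), (4,4), (8,8), (8,4)} \<or>
      (DIM('e), CARD('r)) = (8, 4) \<and> (\<exists>a b c d. distinct [a, b, c, d] \<and> endo_tr (JE z a b * JE z c d) \<noteq> 0)"
  shows "d\<theta> z u v = 0"
proof (rule orthonormal_data[OF z])
  fix B B' :: "'e \<Rightarrow> 'e"
  assume B: "linear B" "linear B'" "\<And>x. B (B' x) = x" "\<And>x. B' (B x) = x"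
    and c: "clifford_weyl_curvature (\<lambda>X Y. Abs_endo (\<lambda>x. B' (Riem z (B X) (B Y) (B x)))) (\<lambda>X Y. d\<theta> z (B X) (B Y))
       (\<lambda>i j. Abs_endo B' * JE z i j * Abs_endo B) (\<lambda>i j X Y. \<Omega> z i j (B X) (B Y))"
  have "d\<theta> z (B (B' u)) (B (B' v)) = 0"
    by (rule clifford_weyl_curvature.faraday_zero[OF c r]) (unfold tr_frame[OF B(1-3)], rule n)
  then show ?thesis unfolding B(3) .
qed

lemma volume_trace_of_relation:
  assumes z: "z \<in> U" and r: "CARD('r) = 4"
    and rel: "(\<Sum>i\<in>UNIV. \<Sum>j\<in>UNIV. \<kappa> i j *\<^sub>R JE z i j) = 0" "\<And>i j. \<kappa> j i = - \<kappa> i j" "\<kappa> k l \<noteq> 0"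
  shows "\<exists>m p. distinct [k, l, m, p] \<and> (endo_tr (JE z k l * JE z m p))\<^sup>2 = (real DIM('e))\<^sup>2"
proof (rule orthonormal_data[OF z])
  fix B B' :: "'e \<Rightarrow> 'e"
  assume B: "linear B" "linear B'" "\<And>x. B (B' x) = x" "\<And>x. B' (B x) = x"
    and c: "clifford_weyl_curvature (\<lambda>X Y. Abs_endo (\<lambda>x. B' (Riem z (B X) (B Y) (B x)))) (\<lambda>X Y. d\<theta> z (B X) (B Y))
       (\<lambda>i j. Abs_endo B' * JE z i j * Abs_endo B) (\<lambda>i j X Y. \<Omega> z i j (B X) (B Y))"
  have "(\<Sum>i\<in>UNIV. \<Sum>j\<in>UNIV. \<kappa> i j *\<^sub>R (Abs_endo B' * JE z i j * Abs_endo B))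
      = Abs_endo B' * (\<Sum>i\<in>UNIV. \<Sum>j\<in>UNIV. \<kappa> i j *\<^sub>R JE z i j) * Abs_endo B"
    by (simp only: sum_distrib_left sum_distrib_right mult_scaleR_left mult_scaleR_right)
  then have "(\<Sum>i\<in>UNIV. \<Sum>j\<in>UNIV. \<kappa> i j *\<^sub>R (Abs_endo B' * JE z i j * Abs_endo B)) = 0"
    unfolding rel(1) by simp
  from clifford_endos.volume_trace_of_relation[where c = \<kappa> and k = k and l = l, OF clifford_weyl_curvature.axioms(2)[OF c] r this rel(2,3)]
  show ?thesis unfolding tr_frame[OF B(1-3)] .
qed

lemma relation_of_volume_trace:
  assumes z: "z \<in> U" and d: "distinct [a, b, c, d]" and t: "(endo_tr (JE z a b * JE z c d))\<^sup>2 = (real DIM('e))\<^sup>2"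
  shows "\<exists>s. s\<^sup>2 = 1 \<and> JE z c d + s *\<^sub>R JE z a b = 0"
proof (rule orthonormal_data[OF z])
  fix B B' :: "'e \<Rightarrow> 'e"
  assume B: "linear B" "linear B'" "\<And>x. B (B' x) = x" "\<And>x. B' (B x) = x"
    and cw: "clifford_weyl_curvature (\<lambda>X Y. Abs_endo (\<lambda>x. B' (Riem z (B X) (B Y) (B x)))) (\<lambda>X Y. d\<theta> z (B X) (B Y))
       (\<lambda>i j. Abs_endo B' * JE z i j * Abs_endo B) (\<lambda>i j X Y. \<Omega> z i j (B X) (B Y))"
  have BB: "Abs_endo B * Abs_endo B' = 1"
    by (rule endo_eqI) (simp add: endo_simps Abs_endo_inverse B)
  have "(endo_tr ((Abs_endo B' * JE z a b * Abs_endo B) * (Abs_endo B' * JE z c d * Abs_endo B)))\<^sup>2 = (real DIM('e))\<^sup>2"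
    unfolding tr_frame[OF B(1-3)] by (rule t)
  from clifford_endos.relation_of_volume_trace[OF clifford_weyl_curvature.axioms(2)[OF cw] d this]
  obtain s where s: "s\<^sup>2 = 1" "(Abs_endo B' * JE z c d * Abs_endo B) + s *\<^sub>R (Abs_endo B' * JE z a b * Abs_endo B) = 0"
    by blast
  have "JE z c d + s *\<^sub>R JE z a b = (Abs_endo B * Abs_endo B') * (JE z c d + s *\<^sub>R JE z a b) * (Abs_endo B * Abs_endo B')"
    unfolding BB by simp
  also have "\<dots> = Abs_endo B * ((Abs_endo B' * JE z c d * Abs_endo B) + s *\<^sub>R (Abs_endo B' * JE z a b * Abs_endo B)) * Abs_endo B'"
    by (simp only: distrib_left distrib_right mult_scaleR_left mult_scaleR_right mult.assoc)
  finally show ?thesis using s by auto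
qed

end

section \<open>Tangent vectors and connections in a chart\<close>

lemma chart_at_euclidean: "chart_at euclidean_atlas x = (UNIV, id)"
  unfolding chart_at_def euclidean_atlas_def by (rule some_equality) auto

locale smooth_manifold =
  fixes A :: "('x::{t2_space, second_countable_topology}, 'e::euclidean_space) chart set"
  assumes atlas: "smooth_atlas A"
begin

lemma chart_open: "c \<in> A \<Longrightarrow> open (fst c)" "c \<in> A \<Longrightarrow> open (snd c ` fst c)"
  and chart_homeo: "c \<in> A \<Longrightarrow> homeomorphism (fst c) (snd c ` fst c) (snd c) (chart_inv c)"
  and transition: "c \<in> A \<Longrightarrow> d \<in> A \<Longrightarrow> smooth_on (snd c ` (fst c \<inter> fst d)) (snd d \<circ> chart_inv c)"
  using atlas unfolding smooth_atlas_def by blast+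

lemma chart_at: "chart_at A x \<in> A" "x \<in> fst (chart_at A x)"
proof -
  have "\<exists>c. c \<in> A \<and> x \<in> fst c" using atlas unfolding smooth_atlas_def by blast
  from someI_ex[OF this] show "chart_at A x \<in> A" "x \<in> fst (chart_at A x)" unfolding chart_at_def by auto
qed

lemma chart_inv [simp]: "c \<in> A \<Longrightarrow> y \<in> fst c \<Longrightarrow> chart_inv c (snd c y) = y"
  using chart_homeo[of c] by (simp add: homeomorphism_def)

lemma chart_image_open: "c \<in> A \<Longrightarrow> open W \<Longrightarrow> W \<subseteq> fst c \<Longrightarrow> open (snd c ` W)"
proof -
  assume c: "c \<in> A" and W: "open W" "W \<subseteq> fst c"
  have "openin (top_of_set (fst c)) W" using W by (simp add: openin_open_eq chart_open[OF c])
  then have "openin (top_of_set (snd c ` fst c)) (snd c ` W)"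
    by (rule homeomorphism_imp_open_map[OF chart_homeo[OF c]])
  then show "open (snd c ` W)" using chart_open(2)[OF c] by (simp add: openin_open_eq)
qed

lemma chart_continuous: "c \<in> A \<Longrightarrow> continuous_on (fst c) (snd c)"
  using chart_homeo[of c] by (simp add: homeomorphism_def)

text \<open>Vectors at \<open>y\<close> are given by their components in the chart selected at \<open>y\<close>. The maps \<open>\<Phi> c y\<close> and \<open>\<Psi> c y\<close>
convert these components to and from the components in the chart \<open>c\<close>.\<close>
definition \<Phi> where "\<Phi> c y = dfun A (snd c) y"
definition \<Psi> where "\<Psi> c y = frechet_derivative (snd (chart_at A y) \<circ> chart_inv c) (at (snd c y))"

lemma dfun_eq: "dfun A f y = frechet_derivative (f \<circ> chart_inv (chart_at A y)) (at (snd (chart_at A y) y))"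
  unfolding tangent_map_def chart_at_euclidean by simp

lemma transition_has_derivative:
  assumes "c \<in> A" "d \<in> A" "y \<in> fst c" "y \<in> fst d"
  shows "(snd d \<circ> chart_inv c has_derivative frechet_derivative (snd d \<circ> chart_inv c) (at (snd c y))) (at (snd c y))"
  using smooth_on_has_derivative[OF transition[OF assms(1,2)]] assms by blast

lemma chart_change:
  assumes c: "c \<in> A" "y \<in> fst c" and h: "(h \<circ> chart_inv c) differentiable (at (snd c y))"
  shows "frechet_derivative (h \<circ> chart_inv (chart_at A y)) (at (snd (chart_at A y) y)) v
       = frechet_derivative (h \<circ> chart_inv c) (at (snd c y)) (\<Phi> c y v)"
proof -
  let ?a = "chart_at A y"
  have a: "?a \<in> A" "y \<in> fst ?a" by (rule chart_at)+
  have D: "((h \<circ> chart_inv c) \<circ> (snd c \<circ> chart_inv ?a) has_derivative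
     frechet_derivative (h \<circ> chart_inv c) (at (snd c y)) \<circ> \<Phi> c y) (at (snd ?a y))"
  proof (rule diff_chain_at)
    show "(snd c \<circ> chart_inv ?a has_derivative \<Phi> c y) (at (snd ?a y))"
      unfolding \<Phi>_def dfun_eq by (rule transition_has_derivative[OF a(1) c(1) a(2) c(2)])
    show "(h \<circ> chart_inv c has_derivative frechet_derivative (h \<circ> chart_inv c) (at (snd c y))) (at ((snd c \<circ> chart_inv ?a) (snd ?a y)))"
      using h a by (simp add: frechet_derivative_works)
  qed
  have "frechet_derivative (h \<circ> chart_inv ?a) (at (snd ?a y)) = frechet_derivative ((h \<circ> chart_inv c) \<circ> (snd c \<circ> chart_inv ?a)) (at (snd ?a y))"
  proof (rule frechet_derivative_cong_open)
    show "open (snd ?a ` (fst ?a \<inter> fst c))" by (rule chart_image_open[OF a(1) open_Int[OF chart_open(1)[OF a(1)] chart_open(1)[OF c(1)]]]) auto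
    show "snd ?a y \<in> snd ?a ` (fst ?a \<inter> fst c)" using a c by auto
    show "(h \<circ> chart_inv ?a) z = ((h \<circ> chart_inv c) \<circ> (snd c \<circ> chart_inv ?a)) z" if "z \<in> snd ?a ` (fst ?a \<inter> fst c)" for z
      using that a c by auto
  qed
  then show ?thesis using frechet_derivative_eq[OF D] by simp
qed

lemma \<Psi>_\<Phi>: assumes "c \<in> A" "y \<in> fst c" shows "\<Psi> c y (\<Phi> c y v) = v"
proof -
  let ?a = "chart_at A y"
  have a: "?a \<in> A" "y \<in> fst ?a" by (rule chart_at)+
  have "frechet_derivative (snd ?a \<circ> chart_inv ?a) (at (snd ?a y)) = frechet_derivative (\<lambda>z. z) (at (snd ?a y))"
    by (rule frechet_derivative_cong_open[OF chart_open(2)[OF a(1)]]) (use a in auto)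
  then have "frechet_derivative (snd ?a \<circ> chart_inv ?a) (at (snd ?a y)) v = v"
    using frechet_derivative_eq[OF has_derivative_ident] by metis
  then show ?thesis
    using chart_change[OF assms, of "snd ?a" v] differentiableI[OF transition_has_derivative[OF assms(1) a(1) assms(2) a(2)]]
    unfolding \<Psi>_def by simp
qed

lemma \<Phi>_linear: "c \<in> A \<Longrightarrow> y \<in> fst c \<Longrightarrow> linear (\<Phi> c y)"
  unfolding \<Phi>_def dfun_eq
  by (intro linear_frechet_derivative differentiableI[OF transition_has_derivative] chart_at)

lemma \<Psi>_linear: "c \<in> A \<Longrightarrow> y \<in> fst c \<Longrightarrow> linear (\<Psi> c y)"
  unfolding \<Psi>_def
  by (intro linear_frechet_derivative differentiableI[OF transition_has_derivative] chart_at)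

lemma \<Phi>_\<Psi>: assumes "c \<in> A" "y \<in> fst c" shows "\<Phi> c y (\<Psi> c y v) = v"
proof -
  have "\<Psi> c y \<circ> \<Phi> c y = id" using \<Psi>_\<Phi>[OF assms] by auto
  then have "\<Phi> c y \<circ> \<Psi> c y = id"
    using linear_inverse_left[OF \<Psi>_linear[OF assms] \<Phi>_linear[OF assms]] by simp
  then show ?thesis by (metis comp_apply id_apply)
qed

lemma \<Phi>_chart_at: "\<Phi> (chart_at A x) x v = v"
proof -
  have "frechet_derivative (snd (chart_at A x) \<circ> chart_inv (chart_at A x)) (at (snd (chart_at A x) x)) = frechet_derivative (\<lambda>z. z) (at (snd (chart_at A x) x))"
    by (rule frechet_derivative_cong_open[OF chart_open(2)[OF chart_at(1)]]) (use chart_at in auto)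
  then show ?thesis unfolding \<Phi>_def dfun_eq using frechet_derivative_eq[OF has_derivative_ident] by metis
qed

lemma smooth_fun_iff: "smooth_fun A W f \<longleftrightarrow> open W \<and> continuous_on W f \<and> (\<forall>c\<in>A. smooth_on (snd c ` (fst c \<inter> W)) (f \<circ> chart_inv c))"
  unfolding smooth_map_def euclidean_atlas_def by (simp add: Int_def)

lemma smooth_fun_coord: "smooth_fun A W f \<Longrightarrow> c \<in> A \<Longrightarrow> smooth_on (snd c ` (fst c \<inter> W)) (\<lambda>z. f (chart_inv c z))"
  unfolding smooth_fun_iff o_def by blast

text \<open>Inside the domain of one chart, smoothness need only be tested in that chart.\<close>
lemma smooth_funI:
  fixes f :: "'x \<Rightarrow> 'b::euclidean_space"
  assumes c: "c \<in> A" and W: "open W" "W \<subseteq> fst c" and h: "smooth_on (snd c ` W) h" and f: "\<And>y. y \<in> W \<Longrightarrow> f y = h (snd c y)"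
  shows "smooth_fun A W f"
  unfolding smooth_fun_iff
proof (intro conjI ballI W)
  have "continuous_on W (\<lambda>y. h (snd c y))"
    using continuous_on_compose2[OF smooth_on_continuous[OF h] continuous_on_subset[OF chart_continuous[OF c] W(2)]] by blast
  then show "continuous_on W f" using f continuous_on_cong[of W W f] by auto
  fix d assume d: "d \<in> A"
  let ?S = "snd d ` (fst d \<inter> W)"
  have S: "open ?S" by (rule chart_image_open[OF d]) (use W chart_open[OF d] in auto)
  show "smooth_on ?S (f \<circ> chart_inv d)"
  proof (rule smooth_on_cong[OF S])
    show "smooth_on ?S (\<lambda>z. h ((snd c \<circ> chart_inv d) z))"
    proof (rule smooth_on_compose[OF S chart_image_open[OF c W] _ h])
      show "smooth_on ?S (snd c \<circ> chart_inv d)" by (rule smooth_on_subset[OF transition[OF d c]]) (use W in auto)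
      show "(snd c \<circ> chart_inv d) ` ?S \<subseteq> snd c ` W" using d by auto
    qed
    show "h ((snd c \<circ> chart_inv d) z) = (f \<circ> chart_inv d) z" if "z \<in> ?S" for z
      using that d f by auto
  qed
qed

lemma dfun_coord:
  fixes f :: "'x \<Rightarrow> 'b::euclidean_space"
  assumes f: "smooth_fun A W f" and c: "c \<in> A" "y \<in> fst c" and y: "y \<in> W"
  shows "dfun A f y v = frechet_derivative (\<lambda>z. f (chart_inv c z)) (at (snd c y)) (\<Phi> c y v)"
proof -
  have "(f \<circ> chart_inv c) differentiable (at (snd c y))"
    using smooth_on_differentiable[OF smooth_fun_coord[OF f c(1)]] c y by (auto simp: o_def)
  then show ?thesis using chart_change[OF c, of f v] unfolding dfun_eq by (simp add: o_def)
qed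

lemma vector_field_coord:
  assumes X: "smooth_vector_field A W X" and c: "c \<in> A"
  shows "smooth_on (snd c ` (fst c \<inter> W)) (\<lambda>z. \<Phi> c (chart_inv c z) (X (chart_inv c z)))"
proof -
  have "smooth_fun A (fst c \<inter> W) (\<lambda>x. \<Phi> c x (X x))" using X c unfolding smooth_vector_field_def \<Phi>_def by blast
  from smooth_fun_coord[OF this c] show ?thesis by (simp add: Int_absorb1 flip: Int_assoc)
qed

text \<open>The analogue of \<open>smooth_funI\<close> for vector fields, given by their components \<open>h\<close> in the chart \<open>c\<close>.\<close>
lemma vector_fieldI:
  assumes c: "c \<in> A" and W: "open W" "W \<subseteq> fst c" and h: "smooth_on (snd c ` W) h"
    and X: "\<And>y. y \<in> W \<Longrightarrow> X y = \<Psi> c y (h (snd c y))"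
  shows "smooth_vector_field A W X"
  unfolding smooth_vector_field_def
proof (intro conjI ballI W(1))
  fix d assume d: "d \<in> A"
  have W': "open (fst d \<inter> W)" "fst d \<inter> W \<subseteq> fst c" using W chart_open[OF d] by auto
  show "smooth_fun A (fst d \<inter> W) (\<lambda>x. dfun A (snd d) x (X x))"
  proof (rule smooth_funI[OF c W'])
    show "smooth_on (snd c ` (fst d \<inter> W)) (\<lambda>z. frechet_derivative (snd d \<circ> chart_inv c) (at z) (h z))"
    proof (rule smooth_on_frechet_derivative_apply[OF chart_image_open[OF c W']])
      show "smooth_on (snd c ` (fst d \<inter> W)) (snd d \<circ> chart_inv c)"
        by (rule smooth_on_subset[OF transition[OF c d]]) (use W in auto)
      show "smooth_on (snd c ` (fst d \<inter> W)) h" by (rule smooth_on_subset[OF h]) auto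
    qed
    fix y assume y: "y \<in> fst d \<inter> W"
    then have yc: "y \<in> fst c" using W by auto
    have "dfun A (snd d) y (X y) = frechet_derivative (snd d \<circ> chart_inv c) (at (snd c y)) (\<Phi> c y (X y))"
      unfolding dfun_eq by (rule chart_change[OF c yc differentiableI[OF transition_has_derivative[OF c d yc]]]) (use y in auto)
    then show "dfun A (snd d) y (X y) = frechet_derivative (snd d \<circ> chart_inv c) (at (snd c y)) (h (snd c y))"
      using X[of y] \<Phi>_\<Psi>[OF c yc] y by simp
  qed
qed

lemma coordinate_field: "c \<in> A \<Longrightarrow> open W \<Longrightarrow> W \<subseteq> fst c \<Longrightarrow> smooth_vector_field A W (\<lambda>y. \<Psi> c y b)"
  by (rule vector_fieldI[where h = "\<lambda>z. b"]) (auto simp: smooth_on_const)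

text \<open>Symmetry of the second derivatives of a chart transition.\<close>
lemma lie_bracket_coordinate_fields:
  assumes c: "c \<in> A" "y \<in> fst c"
  shows "lie_bracket A (\<lambda>y. \<Psi> c y v) (\<lambda>y. \<Psi> c y w) y = 0"
proof -
  let ?a = "chart_at A y"
  have a: "?a \<in> A" "y \<in> fst ?a" by (rule chart_at)+
  let ?W = "fst ?a \<inter> fst c"
  have W: "open ?W" "?W \<subseteq> fst c" using open_Int[OF chart_open(1)[OF a(1)] chart_open(1)[OF c(1)]] by auto
  have sm: "smooth_on (snd c ` ?W) (snd ?a \<circ> chart_inv c)"
    by (rule smooth_on_subset[OF transition[OF c(1) a(1)]]) auto
  have eq: "dfun A (snd ?a) y' (\<Psi> c y' w) = frechet_derivative (snd ?a \<circ> chart_inv c) (at (snd c y')) w" if "y' \<in> ?W" for y' w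
  proof -
    have y': "y' \<in> fst c" "y' \<in> fst ?a" using that by auto
    show ?thesis unfolding dfun_eq
      using chart_change[OF c(1) y'(1) differentiableI[OF transition_has_derivative[OF c(1) a(1) y']], of "\<Psi> c y' w"]
      by (simp add: \<Phi>_\<Psi>[OF c(1) y'(1)])
  qed
  have D: "dfun A (\<lambda>y'. dfun A (snd ?a) y' (\<Psi> c y' w)) y (\<Psi> c y v)
     = frechet_derivative (\<lambda>z. frechet_derivative (snd ?a \<circ> chart_inv c) (at z) w) (at (snd c y)) v" for v w
  proof -
    have f: "smooth_fun A ?W (\<lambda>y'. dfun A (snd ?a) y' (\<Psi> c y' w))"
      by (rule smooth_funI[OF c(1) W smooth_on_frechet_derivative[OF sm]]) (rule eq)
    have "dfun A (\<lambda>y'. dfun A (snd ?a) y' (\<Psi> c y' w)) y (\<Psi> c y v)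
       = frechet_derivative (\<lambda>z. dfun A (snd ?a) (chart_inv c z) (\<Psi> c (chart_inv c z) w)) (at (snd c y)) v"
      using dfun_coord[OF f c IntI[OF a(2) c(2)], of "\<Psi> c y v"] unfolding \<Phi>_\<Psi>[OF c] .
    also have "\<dots> = frechet_derivative (\<lambda>z. frechet_derivative (snd ?a \<circ> chart_inv c) (at z) w) (at (snd c y)) v"
    proof -
      have "snd c y \<in> snd c ` ?W" using a(2) c(2) by blast
      moreover have "dfun A (snd ?a) (chart_inv c z) (\<Psi> c (chart_inv c z) w) = frechet_derivative (snd ?a \<circ> chart_inv c) (at z) w"
        if "z \<in> snd c ` ?W" for z
        using that eq chart_inv[OF c(1)] by auto
      ultimately have "frechet_derivative (\<lambda>z. dfun A (snd ?a) (chart_inv c z) (\<Psi> c (chart_inv c z) w)) (at (snd c y))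
         = frechet_derivative (\<lambda>z. frechet_derivative (snd ?a \<circ> chart_inv c) (at z) w) (at (snd c y))"
        by (rule frechet_derivative_cong_open[OF chart_image_open[OF c(1) W]])
      then show ?thesis by (rule arg_cong[of _ _ "\<lambda>f. f v"])
    qed
    finally show ?thesis .
  qed
  have "snd c y \<in> snd c ` ?W" using a(2) c(2) by blast
  from symmetric_second_derivative[OF chart_image_open[OF c(1) W] this sm, of w v]
  show ?thesis unfolding lie_bracket_def Let_def D by simp
qed

context
  fixes D :: "('x, 'e) cov_deriv" and c
  assumes D: "linear_connection A D" and c: "c \<in> A"
begin

text \<open>The Christoffel symbols of \<open>D\<close> in the chart \<open>c\<close>, contracted with the direction \<open>v\<close> and the vector \<open>a\<close>.
Expanding \<open>a\<close> in a basis makes linearity in \<open>a\<close> immediate.\<close>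
definition \<Gamma> where
  "\<Gamma> z v a = (\<Sum>b\<in>Basis. (a \<bullet> b) *\<^sub>R \<Phi> c (chart_inv c z) (D (\<lambda>y. \<Psi> c y b) (chart_inv c z) (\<Psi> c (chart_inv c z) v)))"

lemma D_linear: "smooth_vector_field A W Y \<Longrightarrow> y \<in> W \<Longrightarrow> linear (D Y y)"
  and D_smooth: "smooth_vector_field A W Y \<Longrightarrow> smooth_vector_field A W X \<Longrightarrow> smooth_vector_field A W (\<lambda>x. D Y x (X x))"
  and D_add: "smooth_vector_field A W Y \<Longrightarrow> smooth_vector_field A W Z \<Longrightarrow> y \<in> W \<Longrightarrow> D (\<lambda>y. Y y + Z y) y v = D Y y v + D Z y v"
  and D_leibniz: "smooth_vector_field A W Y \<Longrightarrow> smooth_fun A W f \<Longrightarrow> y \<in> W \<Longrightarrow>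
      D (\<lambda>y. f y *\<^sub>R Y y) y v = dfun A f y v *\<^sub>R Y y + f y *\<^sub>R D Y y v"
  and D_cong: "smooth_vector_field A W Y \<Longrightarrow> (\<And>y. y \<in> W \<Longrightarrow> Z y = Y y) \<Longrightarrow> y \<in> W \<Longrightarrow> D Z y v = D Y y v"
  using D unfolding linear_connection_def by blast+

lemma D_sum:
  assumes W: "open W" "W \<subseteq> fst c" and y: "y \<in> W" and f: "\<And>b. b \<in> B \<Longrightarrow> smooth_on (snd c ` W) (f b)"
    and fin: "finite B"
  shows "D (\<lambda>y. \<Sum>b\<in>B. f b (snd c y) *\<^sub>R \<Psi> c y b) y v
     = (\<Sum>b\<in>B. dfun A (\<lambda>y. f b (snd c y)) y v *\<^sub>R \<Psi> c y b + f b (snd c y) *\<^sub>R D (\<lambda>y. \<Psi> c y b) y v)"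
  using fin f
proof (induction B rule: finite_induct)
  case empty
  have f0: "smooth_fun A W (\<lambda>y. 0 :: real)"
    by (rule smooth_funI[OF c W smooth_on_const[of _ 0]]) simp
  have "dfun A (\<lambda>y. 0 :: real) y v = 0"
    unfolding dfun_coord[OF f0 c subsetD[OF W(2) y] y] by (simp add: frechet_derivative_const)
  then show ?case using D_leibniz[OF coordinate_field[OF c W] f0 y, of 0 v] by simp
next
  case (insert b B)
  have sf: "smooth_fun A W (\<lambda>y. f b (snd c y))"
    by (rule smooth_funI[OF c W, of "f b"]) (use insert.prems in auto)
  have sv: "smooth_vector_field A W (\<lambda>y. f b (snd c y) *\<^sub>R \<Psi> c y b)"
  proof (rule vector_fieldI[OF c W])
    show "smooth_on (snd c ` W) (\<lambda>z. f b z *\<^sub>R b)"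
      by (rule smooth_on_scaleR[OF chart_image_open[OF c W]]) (use insert.prems smooth_on_const in auto)
    show "f b (snd c y) *\<^sub>R \<Psi> c y b = \<Psi> c y (f b (snd c y) *\<^sub>R b)" if "y \<in> W" for y
      using linear_scale[OF \<Psi>_linear[OF c subsetD[OF W(2) that]]] by simp
  qed
  have sB: "smooth_vector_field A W (\<lambda>y. \<Sum>b\<in>B. f b (snd c y) *\<^sub>R \<Psi> c y b)"
  proof (rule vector_fieldI[OF c W])
    show "smooth_on (snd c ` W) (\<lambda>z. \<Sum>b\<in>B. f b z *\<^sub>R b)"
      by (rule smooth_on_sum[OF chart_image_open[OF c W]], rule smooth_on_scaleR[OF chart_image_open[OF c W]])
        (use insert.prems smooth_on_const in auto)
    show "(\<Sum>b\<in>B. f b (snd c y) *\<^sub>R \<Psi> c y b) = \<Psi> c y (\<Sum>b\<in>B. f b (snd c y) *\<^sub>R b)" if "y \<in> W" for y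
      by (simp only: linear_scale[OF \<Psi>_linear[OF c subsetD[OF W(2) that]]] linear_sum[OF \<Psi>_linear[OF c subsetD[OF W(2) that]]])
  qed
  show ?case
    using D_add[OF sv sB y, of v] D_leibniz[OF coordinate_field[OF c W] sf y, of b v] insert by simp
qed

text \<open>The Leibniz rule, applied to the expansion of the field in the coordinate fields.\<close>
lemma D_coord:
  assumes W: "open W" "W \<subseteq> fst c" and y: "y \<in> W" and h: "smooth_on (snd c ` W) h"
    and X: "\<And>y. y \<in> W \<Longrightarrow> X y = \<Psi> c y (h (snd c y))"
  shows "D X y (\<Psi> c y v) = \<Psi> c y (frechet_derivative h (at (snd c y)) v + \<Gamma> (snd c y) v (h (snd c y)))"
proof -
  have yc: "y \<in> fst c" using W y by auto
  have S: "open (snd c ` W)" by (rule chart_image_open[OF c W])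
  have hb: "smooth_on (snd c ` W) (\<lambda>z. h z \<bullet> b)" for b
    by (rule smooth_on_bounded_linear[OF bounded_linear_inner_left S h])
  note \<Psi>_lin = linear_scale[OF \<Psi>_linear[OF c yc]] linear_sum[OF \<Psi>_linear[OF c yc]] linear_add[OF \<Psi>_linear[OF c yc]]
  have sf: "smooth_vector_field A W (\<lambda>y. \<Sum>b\<in>Basis. (h (snd c y) \<bullet> b) *\<^sub>R \<Psi> c y b)"
    and expand: "X y' = (\<Sum>b\<in>Basis. (h (snd c y') \<bullet> b) *\<^sub>R \<Psi> c y' b)" if "y' \<in> W" for y'
  proof -
    have e: "(\<Sum>b\<in>Basis. (h (snd c y) \<bullet> b) *\<^sub>R \<Psi> c y b) = \<Psi> c y (h (snd c y))" if "y \<in> W" for y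
    proof -
      have l: "linear (\<Psi> c y)" using \<Psi>_linear[OF c] W that by auto
      have "\<Psi> c y (h (snd c y)) = \<Psi> c y (\<Sum>b\<in>Basis. (h (snd c y) \<bullet> b) *\<^sub>R b)" by (simp add: euclidean_representation)
      then show ?thesis by (simp add: linear_sum[OF l] linear_scale[OF l])
    qed
    show "smooth_vector_field A W (\<lambda>y. \<Sum>b\<in>Basis. (h (snd c y) \<bullet> b) *\<^sub>R \<Psi> c y b)"
      by (rule vector_fieldI[OF c W h e])
    show "X y' = (\<Sum>b\<in>Basis. (h (snd c y') \<bullet> b) *\<^sub>R \<Psi> c y' b)" using e X that by simp
  qed
  have df: "dfun A (\<lambda>y. h (snd c y) \<bullet> b) y (\<Psi> c y v) = frechet_derivative h (at (snd c y)) v \<bullet> b" for b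
  proof -
    have s: "smooth_fun A W (\<lambda>y. h (snd c y) \<bullet> b)" by (rule smooth_funI[OF c W hb[of b]]) simp
    have "dfun A (\<lambda>y. h (snd c y) \<bullet> b) y (\<Psi> c y v) = frechet_derivative (\<lambda>z. h (snd c (chart_inv c z)) \<bullet> b) (at (snd c y)) v"
      unfolding dfun_coord[OF s c yc y] \<Phi>_\<Psi>[OF c yc] ..
    also have "\<dots> = frechet_derivative (\<lambda>z. h z \<bullet> b) (at (snd c y)) v"
    proof -
      have "snd c y \<in> snd c ` W" using y by blast
      moreover have "h (snd c (chart_inv c z)) \<bullet> b = h z \<bullet> b" if "z \<in> snd c ` W" for z
        using that chart_inv[OF c subsetD[OF W(2)]] by auto
      ultimately have "frechet_derivative (\<lambda>z. h (snd c (chart_inv c z)) \<bullet> b) (at (snd c y)) = frechet_derivative (\<lambda>z. h z \<bullet> b) (at (snd c y))"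
        by (rule frechet_derivative_cong_open[OF S])
      then show ?thesis by (rule arg_cong[of _ _ "\<lambda>f. f v"])
    qed
    also have "\<dots> = frechet_derivative h (at (snd c y)) v \<bullet> b"
      using frechet_derivative_eq[OF has_derivative_inner_left[OF smooth_on_has_derivative[OF h]]] y by simp
    finally show ?thesis .
  qed
  have "D X y (\<Psi> c y v) = D (\<lambda>y. \<Sum>b\<in>Basis. (h (snd c y) \<bullet> b) *\<^sub>R \<Psi> c y b) y (\<Psi> c y v)"
    by (rule D_cong[OF sf[OF y] expand y])
  also have "\<dots> = (\<Sum>b\<in>Basis. (frechet_derivative h (at (snd c y)) v \<bullet> b) *\<^sub>R \<Psi> c y b
      + (h (snd c y) \<bullet> b) *\<^sub>R D (\<lambda>y. \<Psi> c y b) y (\<Psi> c y v))"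
    unfolding D_sum[OF W y hb finite_Basis] df ..
  also have "\<dots> = \<Psi> c y (\<Sum>b\<in>Basis. (frechet_derivative h (at (snd c y)) v \<bullet> b) *\<^sub>R b)
      + \<Psi> c y (\<Sum>b\<in>Basis. (h (snd c y) \<bullet> b) *\<^sub>R \<Phi> c y (D (\<lambda>y. \<Psi> c y b) y (\<Psi> c y v)))"
    by (simp add: \<Psi>_lin sum.distrib \<Psi>_\<Phi>[OF c yc])
  also have "\<dots> = \<Psi> c y (frechet_derivative h (at (snd c y)) v + \<Gamma> (snd c y) v (h (snd c y)))"
    unfolding \<Gamma>_def using c yc by (simp add: \<Psi>_lin(3) euclidean_representation)
  finally show ?thesis .
qed

lemma D_coord_field: "y \<in> fst c \<Longrightarrow> D (\<lambda>y. \<Psi> c y a) y (\<Psi> c y v) = \<Psi> c y (\<Gamma> (snd c y) v a)"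
  using D_coord[OF chart_open(1)[OF c] order_refl _ smooth_on_const[of _ a], of y "\<lambda>y. \<Psi> c y a" v]
  by (simp add: frechet_derivative_const)

lemma \<Gamma>_smooth: "smooth_on (snd c ` fst c) (\<lambda>z. \<Gamma> z v a)"
proof -
  have "smooth_on (snd c ` fst c) (\<lambda>z. \<Phi> c (chart_inv c z) (D (\<lambda>y. \<Psi> c y b) (chart_inv c z) (\<Psi> c (chart_inv c z) v)))" for b
    using vector_field_coord[OF D_smooth[OF coordinate_field[OF c chart_open(1)[OF c] order_refl, of b]
      coordinate_field[OF c chart_open(1)[OF c] order_refl, of v]] c] by simp
  then show ?thesis unfolding \<Gamma>_def
    by (intro smooth_on_sum smooth_on_scaleR chart_open(2)[OF c] smooth_on_const)
qed

lemma \<Gamma>_bilinear: "z \<in> snd c ` fst c \<Longrightarrow> bilinear (\<Gamma> z)"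
proof -
  assume "z \<in> snd c ` fst c"
  then obtain y where y: "y \<in> fst c" "z = snd c y" by blast
  have l: "linear (\<lambda>v. \<Phi> c y (D (\<lambda>y. \<Psi> c y b) y (\<Psi> c y v)))" for b
    using linear_compose[OF linear_compose[OF \<Psi>_linear[OF c y(1)] D_linear[OF coordinate_field[OF c chart_open(1)[OF c] order_refl] y(1)]] \<Phi>_linear[OF c y(1)]]
    by (simp add: o_def)
  show ?thesis
    unfolding bilinear_def \<Gamma>_def y(2) chart_inv[OF c y(1)]
    by (auto intro!: linearI simp: linear_add[OF l] linear_scale[OF l] inner_add_left algebra_simps sum.distrib scaleR_sum_right)
qed

lemma \<Gamma>_symmetric:
  assumes tf: "torsion_free A D" and z: "z \<in> snd c ` fst c"
  shows "\<Gamma> z v a = \<Gamma> z a v"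
proof -
  obtain y where y: "y \<in> fst c" "z = snd c y" using z by blast
  have "D (\<lambda>y. \<Psi> c y a) y (\<Psi> c y v) - D (\<lambda>y. \<Psi> c y v) y (\<Psi> c y a) = lie_bracket A (\<lambda>y. \<Psi> c y v) (\<lambda>y. \<Psi> c y a) y"
    using tf coordinate_field[OF c chart_open(1)[OF c] order_refl] y(1) unfolding torsion_free_def by blast
  then have "\<Psi> c y (\<Gamma> z v a) = \<Psi> c y (\<Gamma> z a v)"
    unfolding lie_bracket_coordinate_fields[OF c y(1)] D_coord_field[OF y(1)] y(2) by simp
  then show ?thesis by (metis \<Phi>_\<Psi>[OF c y(1)])
qed

end

end

section \<open>The even Clifford algebra and its frames\<close>

definition cl2 :: "'r::{finite, linorder} \<Rightarrow> 'r \<Rightarrow> 'r cl" where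
  "cl2 i j = cl_vec (axis i 1) \<odot> cl_vec (axis j 1)"

lemma cl2_axis: "cl2 i j = blade_sign {i} {j} *\<^sub>R axis (sym_diff {i} {j}) 1"
  by (simp add: cl2_def cl_vec_axis cl_mult_axis)

lemma cl2_diag: "cl2 i i = - cl_one"
  by (simp add: cl2_axis blade_sign_def cl_one_def)

lemma cl2_anti: "i \<noteq> j \<Longrightarrow> cl2 j i = - cl2 i j"
  using cl_vec_anticommute[of "axis i 1" "axis j 1"]
  by (simp add: cl2_def inner_axis_axis eq_neg_iff_add_eq_0 add.commute)

lemma cl2_mult: "cl2 i j \<odot> cl2 j k = - cl2 i k"
proof -
  have "cl2 i j \<odot> cl2 j k = cl_vec (axis i 1) \<odot> (cl2 j j \<odot> cl_vec (axis k 1))"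
    by (simp add: cl2_def cl_mult_assoc)
  then show ?thesis unfolding cl2_diag
    by (simp add: cl_mult_minus_left cl_mult_one linear_neg[OF cl_mult_linear_right] cl2_def)
qed

lemma subspace_cl_even: "subspace cl_even"
  unfolding subspace_def cl_even_def by simp

lemma cl2_even: "cl2 i j \<in> cl_even"
proof -
  have "even (card (sym_diff {i} {j}))" by (cases "i = j") auto
  then show ?thesis unfolding cl_even_def cl2_axis by (auto simp: axis_def)
qed

lemma cl2_Lambda2: "i \<noteq> j \<Longrightarrow> cl2 i j \<in> cl_Lambda2"
proof -
  assume "i \<noteq> j"
  then have "cl2 i j = cl_vec (axis i 1) \<odot> cl_vec (axis j 1) + (axis i 1 \<bullet> axis j (1::real)) *\<^sub>R cl_one"
    by (simp add: cl2_def inner_axis_axis)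
  then show ?thesis unfolding cl_Lambda2_def by (intro span_base) blast
qed

lemma vec_expand: "(v :: real ^ 'r) = (\<Sum>k\<in>UNIV. v $ k *\<^sub>R axis k 1)"
  using basis_expansion[of v] by (simp add: scalar_mult_eq_scaleR)

lemma cl_der_cl2:
  assumes "transpose B = - B"
  shows "cl_der B (cl2 i j) = (\<Sum>k\<in>UNIV. B $ k $ i *\<^sub>R cl2 k j + B $ k $ j *\<^sub>R cl2 i k)"
proof -
  have col: "cl_vec (B *v axis i 1) = (\<Sum>k\<in>UNIV. B $ k $ i *\<^sub>R cl_vec (axis k 1))" for i
  proof -
    have "B *v axis i 1 = (\<Sum>k\<in>UNIV. B $ k $ i *\<^sub>R axis k 1)"
      by (subst vec_expand) (simp add: matrix_vector_mult_basis column_def)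
    then show ?thesis by (simp add: linear_sum[OF cl_vec_linear] linear_cmul[OF cl_vec_linear])
  qed
  show ?thesis unfolding cl2_def cl_der_mult[OF assms] cl_der_vec col
    by (simp add: cl_mult_left_simps cl_mult_right_simps sum.distrib)
qed

text \<open>The antisymmetric coefficients of \<open>\<xi> \<and> \<eta>\<close> are \<open>(\<xi>\<^sub>i \<eta>\<^sub>j - \<eta>\<^sub>i \<xi>\<^sub>j) / 2\<close>, because every \<open>e\<^sub>i e\<^sub>j\<close> with
\<open>i \<noteq> j\<close> occurs twice in the double sum.\<close>
lemma Lambda2_expand:
  fixes a :: "'a::{finite, linorder} cl"
  assumes "a \<in> cl_Lambda2"
  shows "\<exists>\<kappa>. (\<forall>i j. \<kappa> j i = - \<kappa> i j) \<and> a = (\<Sum>i\<in>UNIV. \<Sum>j\<in>UNIV. \<kappa> i j *\<^sub>R cl2 i j)"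
proof -
  define V where "V = {a. \<exists>\<kappa>. (\<forall>i j. \<kappa> j i = - \<kappa> i j) \<and> a = (\<Sum>i\<in>UNIV. \<Sum>j\<in>UNIV. \<kappa> i j *\<^sub>R cl2 i (j :: 'a))}"
  have "subspace V"
  proof (rule subspaceI)
    show "0 \<in> V" unfolding V_def by (intro CollectI exI[of _ "\<lambda>i j. 0"]) simp
    show "x + y \<in> V" if "x \<in> V" "y \<in> V" for x y
    proof -
      obtain \<kappa> \<mu> where k: "\<forall>i j. \<kappa> j i = - \<kappa> i j" "x = (\<Sum>i\<in>UNIV. \<Sum>j\<in>UNIV. \<kappa> i j *\<^sub>R cl2 i j)"
        "\<forall>i j. \<mu> j i = - \<mu> i j" "y = (\<Sum>i\<in>UNIV. \<Sum>j\<in>UNIV. \<mu> i j *\<^sub>R cl2 i j)"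
        using \<open>x \<in> V\<close> \<open>y \<in> V\<close> unfolding V_def by blast
      have "\<kappa> j i + \<mu> j i = - (\<kappa> i j + \<mu> i j)" for i j
        using k(1)[rule_format, of j i] k(3)[rule_format, of j i] by linarith
      moreover have "x + y = (\<Sum>i\<in>UNIV. \<Sum>j\<in>UNIV. (\<kappa> i j + \<mu> i j) *\<^sub>R cl2 i j)"
        unfolding k(2,4) by (simp add: scaleR_add_left sum.distrib)
      ultimately show ?thesis unfolding V_def by (intro CollectI exI[of _ "\<lambda>i j. \<kappa> i j + \<mu> i j"] conjI allI)
    qed
    show "t *\<^sub>R x \<in> V" if "x \<in> V" for t x
    proof -
      obtain \<kappa> where k: "\<forall>i j. \<kappa> j i = - \<kappa> i j" "x = (\<Sum>i\<in>UNIV. \<Sum>j\<in>UNIV. \<kappa> i j *\<^sub>R cl2 i j)"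
        using \<open>x \<in> V\<close> unfolding V_def by blast
      have "t * \<kappa> j i = - (t * \<kappa> i j)" for i j
        using k(1)[rule_format, of j i] by simp
      moreover have "t *\<^sub>R x = (\<Sum>i\<in>UNIV. \<Sum>j\<in>UNIV. (t * \<kappa> i j) *\<^sub>R cl2 i j)"
        unfolding k(2) by (simp add: scaleR_sum_right)
      ultimately show ?thesis unfolding V_def by (intro CollectI exI[of _ "\<lambda>i j. t * \<kappa> i j"] conjI allI)
    qed
  qed
  moreover have "cl_vec \<xi> \<odot> cl_vec \<eta> + (\<xi> \<bullet> \<eta>) *\<^sub>R cl_one \<in> V" for \<xi> \<eta> :: "real ^ 'a::{finite,linorder}"
  proof -
    have p: "cl_vec v \<odot> cl_vec w = (\<Sum>i\<in>UNIV. \<Sum>j\<in>UNIV. (v $ i * w $ j) *\<^sub>R cl2 i j)" for v w :: "real ^ 'a::{finite,linorder}"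
    proof -
      have e: "cl_vec v = (\<Sum>i\<in>UNIV. v $ i *\<^sub>R cl_vec (axis i 1))" for v :: "real ^ 'a::{finite,linorder}"
        unfolding cl_vec_axis by (rule cl_vec_def)
      have l: "cl_vec v \<odot> x = (\<Sum>i\<in>UNIV. v $ i *\<^sub>R (cl_vec (axis i 1) \<odot> x))" for x
        by (subst e[of v]) (simp only: cl_mult_left_simps)
      have r: "x \<odot> cl_vec w = (\<Sum>j\<in>UNIV. w $ j *\<^sub>R (x \<odot> cl_vec (axis j 1)))" for x
        by (subst e[of w]) (simp only: cl_mult_right_simps)
      show ?thesis unfolding l by (subst r) (simp add: cl2_def scaleR_sum_right)
    qed
    have "2 *\<^sub>R (cl_vec \<xi> \<odot> cl_vec \<eta> + (\<xi> \<bullet> \<eta>) *\<^sub>R cl_one) = cl_vec \<xi> \<odot> cl_vec \<eta> - cl_vec \<eta> \<odot> cl_vec \<xi>"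
    proof -
      have "cl_vec \<eta> \<odot> cl_vec \<xi> = (- 2 * (\<xi> \<bullet> \<eta>)) *\<^sub>R cl_one - cl_vec \<xi> \<odot> cl_vec \<eta>"
        using cl_vec_anticommute[of \<xi> \<eta>] by (simp only: eq_diff_eq add.commute)
      then show ?thesis
        by (simp only: scaleR_2 scaleR_add_right scaleR_scaleR) (simp add: scaleR_2)
    qed
    also have "\<dots> = 2 *\<^sub>R (\<Sum>i\<in>UNIV. \<Sum>j\<in>UNIV. ((\<xi> $ i * \<eta> $ j - \<eta> $ i * \<xi> $ j) / 2) *\<^sub>R cl2 i j)"
    proof -
      have "2 *\<^sub>R (((x - y) / 2) *\<^sub>R C) = x *\<^sub>R C - y *\<^sub>R C" for x y and C :: "'a cl"
      proof -
        have h: "2 * ((x - y) / 2) = x - y" by simp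
        show ?thesis unfolding scaleR_scaleR h by (rule scaleR_left_diff_distrib)
      qed
      then show ?thesis unfolding p scaleR_sum_right by (simp only: sum_subtractf)
    qed
    finally have "cl_vec \<xi> \<odot> cl_vec \<eta> + (\<xi> \<bullet> \<eta>) *\<^sub>R cl_one = (\<Sum>i\<in>UNIV. \<Sum>j\<in>UNIV. ((\<xi> $ i * \<eta> $ j - \<eta> $ i * \<xi> $ j) / 2) *\<^sub>R cl2 i j)"
      by (rule scaleR_left_imp_eq[rotated]) simp
    moreover have "(\<xi> $ j * \<eta> $ i - \<eta> $ j * \<xi> $ i) / 2 = - ((\<xi> $ i * \<eta> $ j - \<eta> $ i * \<xi> $ j) / 2)" for i j
      unfolding mult.commute[of "\<xi> $ j" "\<eta> $ i"] mult.commute[of "\<eta> $ j" "\<xi> $ i"]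
      by (simp only: minus_divide_left minus_diff_eq)
    ultimately show ?thesis unfolding V_def
      by (intro CollectI exI[of _ "\<lambda>i j. (\<xi> $ i * \<eta> $ j - \<eta> $ i * \<xi> $ j) / 2"] conjI allI)
  qed
  ultimately have "cl_Lambda2 \<subseteq> V" unfolding cl_Lambda2_def by (intro span_minimal) auto
  then show ?thesis using assms unfolding V_def by blast
qed

lemma Lambda2_even: "cl_Lambda2 \<subseteq> cl_even"
proof
  fix a assume "a \<in> (cl_Lambda2 :: 'r::{finite, linorder} cl set)"
  then obtain \<kappa> where "a = (\<Sum>i\<in>UNIV. \<Sum>j\<in>UNIV. \<kappa> i j *\<^sub>R cl2 i j)" using Lambda2_expand by blast
  then show "a \<in> cl_even"
    by (simp add: subspace_sum subspace_cl_even subspace_scale cl2_even)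
qed

lemma cl_act_compose:
  assumes "orthogonal_matrix g"
  shows "cl_act g (cl_act h a) = cl_act (g ** h) a"
proof -
  have "cl_act g (cl_act_list h is) = cl_act_list (g ** h) is" for "is"
    by (induction "is") (simp_all add: cl_act_one cl_act_mult[OF assms] cl_act_vec matrix_vector_mul_assoc)
  then show ?thesis
    unfolding cl_act_def[of h] cl_act_def[of "g ** h"]
    by (simp add: linear_sum[OF cl_act_linear] linear_cmul[OF cl_act_linear])
qed

lemma cl_act_identity: "cl_act (mat 1) a = a"
  unfolding cl_act_def blade by (rule cl_expand[symmetric])

lemma cl_act_Lambda2:
  fixes g :: "'a::{finite, linorder} sqmat"
  assumes g: "orthogonal_matrix g" and a: "a \<in> cl_Lambda2"
  shows "cl_act g a \<in> cl_Lambda2"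
proof -
  have "cl_act g ` cl_Lambda2 \<subseteq> cl_Lambda2"
    unfolding cl_Lambda2_def linear_span_image[OF cl_act_linear, symmetric]
  proof (rule span_mono, safe)
    fix \<xi> \<eta> :: "real ^ 'a::{finite,linorder}"
    have i: "(g *v \<xi>) \<bullet> (g *v \<eta>) = \<xi> \<bullet> \<eta>"
    proof -
      have "orthogonal_transformation ((*v) g)"
        using g by (simp add: orthogonal_transformation_matrix matrix_of_matrix_vector_mul)
      then show ?thesis unfolding orthogonal_transformation_def by blast
    qed
    show "\<exists>\<xi>' \<eta>'. cl_act g (cl_vec \<xi> \<odot> cl_vec \<eta> + (\<xi> \<bullet> \<eta>) *\<^sub>R cl_one) = cl_vec \<xi>' \<odot> cl_vec \<eta>' + (\<xi>' \<bullet> \<eta>') *\<^sub>R cl_one \<and> True"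
      by (rule exI[of _ "g *v \<xi>"], rule exI[of _ "g *v \<eta>"])
        (simp add: linear_add[OF cl_act_linear] linear_cmul[OF cl_act_linear] cl_act_mult[OF g] cl_act_vec cl_act_one i)
  qed
  then show ?thesis using a by blast
qed

lemma SO_simps [simp]: "carrier SO = {g. orthogonal_matrix g \<and> det g = 1}" "x \<otimes>\<^bsub>SO\<^esub> y = x ** y" "\<one>\<^bsub>SO\<^esub> = mat 1"
  by (simp_all add: SO_def)

lemma SO_transpose: "g \<in> carrier SO \<Longrightarrow> transpose g \<in> carrier SO"
  by (simp add: orthogonal_matrix_transpose)

lemma group_SO: "group SO"
proof (rule groupI)
  show "\<exists>y\<in>carrier SO. y \<otimes>\<^bsub>SO\<^esub> x = \<one>\<^bsub>SO\<^esub>" if "x \<in> carrier SO" for x :: "'r::finite sqmat"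
    using that SO_transpose[OF that] by (intro bexI[of _ "transpose x"]) (simp_all add: orthogonal_matrix)
qed (simp_all add: orthogonal_matrix_mul det_mul orthogonal_matrix_id matrix_mul_assoc)

text \<open>\<open>- 1\<close> is central, and it has determinant \<open>1\<close> exactly if the rank is even.\<close>
lemma normal_SO_pm: "SO_pm \<lhd> (SO :: 'r::finite sqmat monoid)"
proof -
  interpret group "SO :: 'r sqmat monoid" by (rule group_SO)
  have mm: "(- mat 1 :: 'r sqmat) ** x = - x" "x ** (- mat 1) = - x" for x :: "'r sqmat"
  proof -
    have "(\<Sum>k\<in>UNIV. - (if i = k then 1 else 0) * x $ k $ j) = (\<Sum>k\<in>UNIV. if i = k then - x $ k $ j else 0)" for i j
      by (rule sum.cong) auto
    then show "(- mat 1 :: 'r sqmat) ** x = - x" by (simp add: vec_eq_iff matrix_matrix_mult_def mat_def)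
    have "(\<Sum>k\<in>UNIV. x $ i $ k * - (if k = j then 1 else 0)) = (\<Sum>k\<in>UNIV. if k = j then - x $ i $ k else 0)" for i j
      by (rule sum.cong) auto
    then show "x ** (- mat 1) = - x" by (simp add: vec_eq_iff matrix_matrix_mult_def mat_def)
  qed
  have minus: "- mat 1 \<in> carrier (SO :: 'r sqmat monoid)" if "even CARD('r)"
  proof -
    have "det (- mat 1 :: 'r sqmat) = (\<Prod>i\<in>UNIV. (- mat 1 :: 'r sqmat) $ i $ i)"
      by (rule det_diagonal) (simp add: mat_def)
    also have "\<dots> = 1" using that by (simp add: mat_def)
    finally have "det (- mat 1 :: 'r sqmat) = 1" .
    moreover have "orthogonal_matrix (- mat 1 :: 'r sqmat)"
    proof -
      have "transpose (- mat 1 :: 'r sqmat) = - mat 1" by (auto simp: transpose_def mat_def vec_eq_iff)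
      then show ?thesis unfolding orthogonal_matrix_def by (simp add: mm)
    qed
    ultimately show ?thesis by simp
  qed
  have sub: "(SO_pm :: 'r sqmat set) \<subseteq> carrier SO"
    using minus one_closed unfolding SO_pm_def by (auto split: if_splits)
  have inv: "inv\<^bsub>SO\<^esub> h = h" if "h \<in> (SO_pm :: 'r sqmat set)" for h
    by (rule inv_equality) (use that sub in \<open>auto simp: SO_pm_def mm split: if_splits\<close>)
  show ?thesis
    unfolding normal_inv_iff
  proof (intro conjI ballI)
    show "subgroup (SO_pm :: 'r sqmat set) SO"
    proof (rule subgroupI[OF sub])
      show "(SO_pm :: 'r sqmat set) \<noteq> {}" by (simp add: SO_pm_def)
      show "inv\<^bsub>SO\<^esub> a \<in> SO_pm" if "a \<in> SO_pm" for a :: "'r sqmat" using inv[OF that] that by simp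
      show "a \<otimes>\<^bsub>SO\<^esub> b \<in> SO_pm" if "a \<in> SO_pm" "b \<in> SO_pm" for a b :: "'r sqmat"
        using that by (auto simp: SO_pm_def mm split: if_splits)
    qed
    fix x h :: "'r sqmat" assume x: "x \<in> carrier SO" and h: "h \<in> SO_pm"
    have "x ** h = h ** x" using h by (auto simp: SO_pm_def mm split: if_splits)
    then have "x ** h ** inv\<^bsub>SO\<^esub> x = h ** (x ** inv\<^bsub>SO\<^esub> x)" by (simp add: matrix_mul_assoc)
    also have "x ** inv\<^bsub>SO\<^esub> x = mat 1" using r_inv[OF x] by simp
    finally show "x \<otimes>\<^bsub>SO\<^esub> h \<otimes>\<^bsub>SO\<^esub> inv\<^bsub>SO\<^esub> x \<in> SO_pm" using h by simp
  qed
qed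

lemma PSO_class_mult:
  assumes "g \<in> carrier SO" "h \<in> carrier SO"
  shows "PSO_class g \<otimes>\<^bsub>PSO\<^esub> PSO_class h = PSO_class (g ** h)"
  unfolding PSO_class_def PSO_def
  using normal.rcos_sum[OF normal_SO_pm assms] by (simp add: FactGroup_def)

lemma PSO_class_carrier: "g \<in> carrier SO \<Longrightarrow> PSO_class g \<in> carrier PSO"
  unfolding PSO_class_def PSO_def FactGroup_def RCOSETS_def by auto

lemma carrier_PSO_E:
  assumes "k \<in> carrier PSO" obtains g where "g \<in> carrier SO" "k = PSO_class g"
  using assms unfolding PSO_class_def PSO_def FactGroup_def RCOSETS_def by auto

text \<open>Elements of the associated bundle are orbits: \<open>[p g, a] = [p, g a]\<close>.\<close>
lemma assoc_cl_shift:
  assumes act: "\<And>p k l. k \<in> carrier PSO \<Longrightarrow> l \<in> carrier PSO \<Longrightarrow> act (act p k) l = act p (k \<otimes>\<^bsub>PSO\<^esub> l)"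
    and g: "g \<in> carrier SO"
  shows "assoc_cl act (act p (PSO_class g)) a = assoc_cl act p (cl_act g a)"
proof -
  interpret group "SO :: 'b sqmat monoid" by (rule group_SO)
  have gt: "g ** transpose g = mat 1" "transpose g ** g = mat 1" using g by (auto simp: orthogonal_matrix_def)
  have 1: "act (act p (PSO_class g)) (PSO_class h) = act p (PSO_class (g ** h))" if "h \<in> carrier SO" for h
    using act[of "PSO_class g" "PSO_class h"] PSO_class_carrier[OF g] PSO_class_carrier[OF that] PSO_class_mult[OF g that] by simp
  have 2: "cl_act (transpose (g ** h)) (cl_act g a) = cl_act (transpose h) a" if "h \<in> carrier SO" for h
  proof -
    have "orthogonal_matrix (transpose (g ** h))"
      using m_closed[OF g that] by (simp add: orthogonal_matrix_transpose)
    then have "cl_act (transpose (g ** h)) (cl_act g a) = cl_act (transpose (g ** h) ** g) a" by (rule cl_act_compose)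
    also have "transpose (g ** h) ** g = transpose h"
      by (simp add: matrix_transpose_mul gt flip: matrix_mul_assoc)
    finally show ?thesis .
  qed
  show ?thesis
  proof
    show "assoc_cl act (act p (PSO_class g)) a \<subseteq> assoc_cl act p (cl_act g a)"
    proof
      fix q assume "q \<in> assoc_cl act (act p (PSO_class g)) a"
      then obtain h where h: "h \<in> carrier SO" "q = (act (act p (PSO_class g)) (PSO_class h), cl_act (transpose h) a)"
        unfolding assoc_cl_def by blast
      have "q = (act p (PSO_class (g ** h)), cl_act (transpose (g ** h)) (cl_act g a))" using h 1 2 by simp
      moreover have "g ** h \<in> carrier SO" using m_closed[OF g h(1)] by simp
      ultimately show "q \<in> assoc_cl act p (cl_act g a)" unfolding assoc_cl_def by blast
    qed
    show "assoc_cl act p (cl_act g a) \<subseteq> assoc_cl act (act p (PSO_class g)) a"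
    proof
      fix q assume "q \<in> assoc_cl act p (cl_act g a)"
      then obtain k where k: "k \<in> carrier SO" "q = (act p (PSO_class k), cl_act (transpose k) (cl_act g a))"
        unfolding assoc_cl_def by blast
      define h where "h = transpose g ** k"
      have h: "h \<in> carrier SO" using m_closed[OF SO_transpose[OF g] k(1)] by (simp add: h_def)
      have gh: "g ** h = k" unfolding h_def by (simp add: matrix_mul_assoc gt)
      have "q = (act (act p (PSO_class g)) (PSO_class h), cl_act (transpose h) a)"
        using k(2) 1[OF h] 2[OF h] unfolding gh by simp
      then show "q \<in> assoc_cl act (act p (PSO_class g)) a" using h unfolding assoc_cl_def by blast
    qed
  qed
qed

context smooth_manifold
begin

lemma smooth_section_subset:
  assumes s: "smooth_section A P \<pi> W s" and N: "open N" "N \<subseteq> W"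
  shows "smooth_section A P \<pi> N s"
proof -
  have "smooth_on (snd c ` {x \<in> fst c \<inter> N. s x \<in> fst d}) (snd d \<circ> s \<circ> chart_inv c)" if "c \<in> A" "d \<in> P" for c d
    using s that N(2) unfolding smooth_section_def smooth_map_def by (auto intro: smooth_on_subset)
  then show ?thesis
    using s N unfolding smooth_section_def smooth_map_def by (auto intro: continuous_on_subset)
qed

text \<open>In the chart at \<open>x\<close> the terms with derivatives of \<open>X\<close> and \<open>Y\<close> cancel against the Lie bracket.\<close>
lemma ext_deriv_coord:
  assumes \<theta>: "one_form A \<theta>" and X: "smooth_vector_field A W X" and Y: "smooth_vector_field A W Y" and x: "x \<in> W"
  defines "cc \<equiv> chart_at A x"
  shows "ext_deriv A \<theta> X Y x
    = frechet_derivative (\<lambda>z. \<theta> (chart_inv cc z) (\<Psi> cc (chart_inv cc z) (Y x))) (at (snd cc x)) (X x)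
    - frechet_derivative (\<lambda>z. \<theta> (chart_inv cc z) (\<Psi> cc (chart_inv cc z) (X x))) (at (snd cc x)) (Y x)"
proof -
  have c: "cc \<in> A" "x \<in> fst cc" unfolding cc_def by (rule chart_at)+
  have oW: "open W" using X unfolding smooth_vector_field_def by blast
  let ?U = "snd cc ` (fst cc \<inter> W)"
  have U: "open ?U" "snd cc x \<in> ?U"
    using chart_image_open[OF c(1) open_Int[OF chart_open(1)[OF c(1)] oW]] c x by auto
  have \<Phi>x: "\<Phi> cc x v = v" for v unfolding cc_def by (rule \<Phi>_chart_at)
  have \<Psi>x: "\<Psi> cc x v = v" for v using \<Psi>_\<Phi>[OF c, of v] unfolding \<Phi>x .
  have th_lin: "linear (\<lambda>v. \<theta> (chart_inv cc z) (\<Psi> cc (chart_inv cc z) v))" if "z \<in> ?U" for z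
  proof -
    have "linear (\<theta> (chart_inv cc z))" using \<theta> unfolding one_form_def by blast
    moreover have "linear (\<Psi> cc (chart_inv cc z))" using that by (auto simp: \<Psi>_linear[OF c(1)] chart_inv[OF c(1)])
    ultimately show ?thesis using linear_compose[of "\<Psi> cc (chart_inv cc z)" "\<theta> (chart_inv cc z)"] by (simp add: o_def)
  qed
  have th_smooth: "smooth_on ?U (\<lambda>z. \<theta> (chart_inv cc z) (\<Psi> cc (chart_inv cc z) v))" for v
  proof -
    have "smooth_fun A (fst cc) (\<lambda>y. \<theta> y (\<Psi> cc y v))"
      using \<theta> coordinate_field[OF c(1) chart_open(1)[OF c(1)] order_refl, of v] unfolding one_form_def by blast
    from smooth_fun_coord[OF this c(1)] show ?thesis by (rule smooth_on_subset) auto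
  qed
  have main: "dfun A (\<lambda>y. \<theta> y (Z y)) x v
      = frechet_derivative (\<lambda>z. \<theta> (chart_inv cc z) (\<Psi> cc (chart_inv cc z) (Z x))) (at (snd cc x)) v
        + \<theta> x (dfun A (\<lambda>y. dfun A (snd cc) y (Z y)) x v)" if Z: "smooth_vector_field A W Z" for Z v
  proof -
    define h where "h z = \<Phi> cc (chart_inv cc z) (Z (chart_inv cc z))" for z
    have h: "smooth_on ?U h" unfolding h_def[abs_def] by (rule vector_field_coord[OF Z c(1)])
    have hx: "h (snd cc x) = Z x" unfolding h_def chart_inv[OF c] \<Phi>x ..
    have "smooth_fun A (fst cc \<inter> W) (\<lambda>y. dfun A (snd cc) y (Z y))" using Z c(1) unfolding smooth_vector_field_def by blast
    then have dh: "dfun A (\<lambda>y. dfun A (snd cc) y (Z y)) x v = frechet_derivative h (at (snd cc x)) v"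
      using dfun_coord[OF _ c, of "fst cc \<inter> W" "\<lambda>y. dfun A (snd cc) y (Z y)" v] x c(2) unfolding \<Phi>x unfolding h_def[abs_def] \<Phi>_def by simp
    have sf: "smooth_fun A W (\<lambda>y. \<theta> y (Z y))" using \<theta> Z unfolding one_form_def by blast
    have "dfun A (\<lambda>y. \<theta> y (Z y)) x v = frechet_derivative (\<lambda>z. \<theta> (chart_inv cc z) (Z (chart_inv cc z))) (at (snd cc x)) v"
      using dfun_coord[OF sf c x] unfolding \<Phi>x .
    also have "frechet_derivative (\<lambda>z. \<theta> (chart_inv cc z) (Z (chart_inv cc z))) (at (snd cc x))
       = frechet_derivative (\<lambda>z. \<theta> (chart_inv cc z) (\<Psi> cc (chart_inv cc z) (h z))) (at (snd cc x))"
      by (rule frechet_derivative_cong_open[OF U]) (auto simp: h_def \<Psi>_\<Phi>[OF c(1)] chart_inv[OF c(1)])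
    also have "\<dots> = (\<lambda>v. frechet_derivative (\<lambda>z. \<theta> (chart_inv cc z) (\<Psi> cc (chart_inv cc z) (h (snd cc x)))) (at (snd cc x)) v
          + \<theta> (chart_inv cc (snd cc x)) (\<Psi> cc (chart_inv cc (snd cc x)) (frechet_derivative h (at (snd cc x)) v)))"
      by (rule frechet_derivative_eq[OF has_derivative_linear_family[OF U th_lin th_smooth smooth_on_has_derivative[OF h U(2)]]])
    finally show ?thesis unfolding hx dh chart_inv[OF c] \<Psi>x .
  qed
  have "\<theta> x (a - b) = \<theta> x a - \<theta> x b" for a b using \<theta> linear_diff unfolding one_form_def by blast
  then show ?thesis
    unfolding ext_deriv_def lie_bracket_def Let_def cc_def[symmetric] main[OF X] main[OF Y] by simp
qed

end

lemma riemannian_metric_conformal: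
  assumes A: "smooth_atlas A" and g: "riemannian_metric A g" and f: "smooth_fun A UNIV f"
  shows "riemannian_metric A (\<lambda>x u v. exp (2 * f x) * g x u v)"
proof -
  interpret smooth_manifold A by standard (rule A)
  have b: "bilinear (g x)" "g x u v = g x v u" "v \<noteq> 0 \<Longrightarrow> g x v v > 0" for x u v
    using g unfolding riemannian_metric_def by blast+
  have s: "smooth_fun A W (\<lambda>x. exp (2 * f x) * g x (X x) (Y x))"
    if X: "smooth_vector_field A W X" and Y: "smooth_vector_field A W Y" for W X Y
    unfolding smooth_fun_iff
  proof (intro conjI ballI)
    have sg: "smooth_fun A W (\<lambda>x. g x (X x) (Y x))" using g X Y unfolding riemannian_metric_def by blast
    then show W: "open W" unfolding smooth_fun_iff by blast
    have "continuous_on W f" using f continuous_on_subset unfolding smooth_fun_iff by blast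
    moreover have "continuous_on W (\<lambda>x. g x (X x) (Y x))" using sg unfolding smooth_fun_iff by blast
    ultimately show "continuous_on W (\<lambda>x. exp (2 * f x) * g x (X x) (Y x))"
      by (intro continuous_intros)
    fix c assume c: "c \<in> A"
    let ?S = "snd c ` (fst c \<inter> W)"
    have S: "open ?S" by (rule chart_image_open[OF c]) (use W chart_open(1)[OF c] in auto)
    have fs: "smooth_on ?S (\<lambda>z. f (chart_inv c z))"
      by (rule smooth_on_subset[OF smooth_fun_coord[OF f c]]) auto
    have "smooth_on ?S (\<lambda>z. 2 * f (chart_inv c z))"
      by (rule smooth_on_bounded_linear[OF bounded_linear_mult_right S fs])
    then have "smooth_on ?S (\<lambda>z. exp (2 * f (chart_inv c z)))"
      by (rule smooth_on_compose[OF S open_UNIV _ smooth_on_exp]) auto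
    from smooth_on_scaleR[OF S this smooth_fun_coord[OF sg c]]
    show "smooth_on ?S ((\<lambda>x. exp (2 * f x) * g x (X x) (Y x)) \<circ> chart_inv c)" by (simp add: o_def)
  qed
  have "bilinear (\<lambda>u v. exp (2 * f x) * g x u v)" for x
    unfolding bilinear_def
    by (auto intro!: linearI simp: bilinear_ladd[OF b(1)] bilinear_radd[OF b(1)] bilinear_lmul[OF b(1)] bilinear_rmul[OF b(1)] algebra_simps)
  then show ?thesis unfolding riemannian_metric_def using b s by (simp add: b(2)[symmetric]) 
qed

section \<open>Clifford-Weyl structures in local frames\<close>

locale clifford_weyl_manifold =
  fixes A :: "('m::{t2_space, second_countable_topology}, 'e::euclidean_space) chart set"
    and c :: "('m \<Rightarrow> 'e \<Rightarrow> 'e \<Rightarrow> real) set"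
    and P :: "('p::{t2_space, second_countable_topology}, 'f::euclidean_space) chart set"
    and \<pi> :: "'p \<Rightarrow> 'm"
    and act :: "'p \<Rightarrow> 'r::{finite, linorder} sqmat set \<Rightarrow> 'p"
    and \<phi> :: "('p \<times> 'r cl) set \<Rightarrow> 'e \<Rightarrow> 'e"
    and \<omega> :: "'p \<Rightarrow> 'f \<Rightarrow> 'r sqmat"
    and D :: "('m, 'e) cov_deriv"
  assumes conf: "conformal_manifold A c" and CW: "Clifford_Weyl_structure A c P \<pi> act \<phi> \<omega> D"
begin

sublocale M: smooth_manifold A
  by standard (use conf conformal_manifold_def in blast)

lemma parts: "principal_PSO_bundle A P \<pi> act" "principal_connection P act \<omega>" "Weyl_connection A c D"
    "Clifford_morphism A c P \<pi> act \<phi>" "parallel_morphism A P \<pi> act \<phi> \<omega> D"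
  using CW unfolding Clifford_Weyl_structure_def by blast+

sublocale B: smooth_manifold P
  by standard (use parts(1) principal_PSO_bundle_def in blast)

lemma D_props: "linear_connection A D" "torsion_free A D"
  using parts(3) unfolding Weyl_connection_def by blast+

lemma metric_in_class: "g \<in> c \<Longrightarrow> riemannian_metric A g"
  using conf riemannian_metric_conformal[OF M.atlas] unfolding conformal_manifold_def conformal_class_def by blast

abbreviation "\<rho> p a \<equiv> \<phi> (assoc_cl act p a)"

text \<open>The clauses that define a Clifford morphism, read in the frame \<open>p\<close>.\<close>
lemma \<rho>_linear: "a \<in> cl_even \<Longrightarrow> linear (\<rho> p a)"
  and \<rho>_add: "a \<in> cl_even \<Longrightarrow> b \<in> cl_even \<Longrightarrow> \<rho> p (a + b) v = \<rho> p a v + \<rho> p b v"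
  and \<rho>_scale: "a \<in> cl_even \<Longrightarrow> \<rho> p (t *\<^sub>R a) v = t *\<^sub>R \<rho> p a v"
  and \<rho>_one: "\<rho> p cl_one v = v"
  and \<rho>_mult: "a \<in> cl_even \<Longrightarrow> b \<in> cl_even \<Longrightarrow> \<rho> p (a \<odot> b) v = \<rho> p a (\<rho> p b v)"
  and \<rho>_skew: "a \<in> cl_Lambda2 \<Longrightarrow> g \<in> c \<Longrightarrow> g (\<pi> p) (\<rho> p a u) v = - g (\<pi> p) u (\<rho> p a v)"
  and \<rho>_smooth: "smooth_section A P \<pi> W s \<Longrightarrow> smooth_fun A W a' \<Longrightarrow> a' ` W \<subseteq> cl_even \<Longrightarrow> smooth_vector_field A W X \<Longrightarrow>
      smooth_vector_field A W (\<lambda>x. \<rho> (s x) (a' x) (X x))"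
proof -
  note m = parts(4)[unfolded Clifford_morphism_def]
  note m1 = conjunct1[OF m] and m' = conjunct2[OF m]
  note m2 = conjunct1[OF m'] and m' = conjunct2[OF m']
  note m3 = conjunct1[OF m'] and m' = conjunct2[OF m']
  note m4 = conjunct1[OF m'] and m' = conjunct2[OF m']
  note m5 = conjunct1[OF m'] and m' = conjunct2[OF m']
  note m6 = conjunct1[OF m'] and m7 = conjunct2[OF m']
  show "linear (\<rho> p a)" if "a \<in> cl_even" using m1 that by blast
  show "\<rho> p (a + b) v = \<rho> p a v + \<rho> p b v" if "a \<in> cl_even" "b \<in> cl_even" using m2 that by blast
  show "\<rho> p (t *\<^sub>R a) v = t *\<^sub>R \<rho> p a v" if "a \<in> cl_even" using m3 that by blast
  show "\<rho> p cl_one v = v" using m4 by blast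
  show "\<rho> p (a \<odot> b) v = \<rho> p a (\<rho> p b v)" if "a \<in> cl_even" "b \<in> cl_even" using m5 that by blast
  show "g (\<pi> p) (\<rho> p a u) v = - g (\<pi> p) u (\<rho> p a v)" if "a \<in> cl_Lambda2" "g \<in> c" using m6 that by blast
  show "smooth_vector_field A W (\<lambda>x. \<rho> (s x) (a' x) (X x))"
    if "smooth_section A P \<pi> W s" "smooth_fun A W a'" "a' ` W \<subseteq> cl_even" "smooth_vector_field A W X"
    by (rule m7[rule_format, OF that])
qed

lemma cl_one_even: "cl_one \<in> cl_even"
  unfolding cl_even_def cl_one_def by (auto simp: axis_def)

lemma \<rho>_minus: "a \<in> cl_even \<Longrightarrow> \<rho> p (- a) v = - \<rho> p a v"
  using \<rho>_scale[of a p "- 1" v] by simp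

lemma \<rho>_sum:
  assumes "finite K" "\<And>k. k \<in> K \<Longrightarrow> a k \<in> cl_even"
  shows "\<rho> p (\<Sum>k\<in>K. a k) v = (\<Sum>k\<in>K. \<rho> p (a k) v)"
  using assms
proof (induction K rule: finite_induct)
  case empty show ?case using \<rho>_scale[OF cl_one_even, of p 0 v] by simp
next
  case (insert k K)
  have "(\<Sum>k\<in>K. a k) \<in> cl_even" using insert.prems by (intro subspace_sum subspace_cl_even) auto
  then show ?case using insert \<rho>_add[of "a k" "\<Sum>k\<in>K. a k"] by simp
qed

lemma \<rho>_cl2_sum: "\<rho> p (\<Sum>k\<in>UNIV. \<alpha> k *\<^sub>R cl2 k j + \<beta> k *\<^sub>R cl2 i k) v = (\<Sum>k\<in>UNIV. \<alpha> k *\<^sub>R \<rho> p (cl2 k j) v + \<beta> k *\<^sub>R \<rho> p (cl2 i k) v)"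
proof -
  have ev: "\<alpha> k *\<^sub>R cl2 k j \<in> cl_even" "\<beta> k *\<^sub>R cl2 i k \<in> cl_even" for k
    by (intro subspace_scale subspace_cl_even cl2_even)+
  have "\<rho> p (\<Sum>k\<in>UNIV. \<alpha> k *\<^sub>R cl2 k j + \<beta> k *\<^sub>R cl2 i k) v = (\<Sum>k\<in>UNIV. \<rho> p (\<alpha> k *\<^sub>R cl2 k j + \<beta> k *\<^sub>R cl2 i k) v)"
    by (rule \<rho>_sum) (use ev subspace_add[OF subspace_cl_even] in auto)
  then show ?thesis by (simp add: \<rho>_add[OF ev] \<rho>_scale[OF cl2_even])
qed

context
  fixes g \<theta> cc d W s
  assumes g: "g \<in> c" and \<theta>: "Lee_form A D g \<theta>" and cc: "cc \<in> A" and d: "d \<in> P" and s: "smooth_section A P \<pi> W s"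
begin

text \<open>The part of the base that the chart \<open>cc\<close> and the section \<open>s\<close>, followed by the chart \<open>d\<close> of the total space,
describe at the same time.\<close>
definition N where "N = {y \<in> fst cc \<inter> W. s y \<in> fst d}"

lemma N: "open N" "N \<subseteq> fst cc" "N \<subseteq> W" "open (snd cc ` N)" "snd cc ` N \<subseteq> snd cc ` fst cc"
proof -
  have W: "open W" "continuous_on W s" using s unfolding smooth_section_def smooth_map_def by blast+
  have "N = fst cc \<inter> (W \<inter> s -` fst d)" unfolding N_def by auto
  then show o: "open N"
    using continuous_open_preimage[OF W(2,1) B.chart_open(1)[OF d]] M.chart_open(1)[OF cc] by auto
  show "N \<subseteq> fst cc" "N \<subseteq> W" unfolding N_def by auto
  show "open (snd cc ` N)" by (rule M.chart_image_open[OF cc o \<open>N \<subseteq> fst cc\<close>])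
  show "snd cc ` N \<subseteq> snd cc ` fst cc" using \<open>N \<subseteq> fst cc\<close> by (rule image_mono)
qed

lemma sN: "smooth_section A P \<pi> N s" by (rule M.smooth_section_subset[OF s N(1,3)])

abbreviation "ci \<equiv> chart_inv cc"
abbreviation "gc z a b \<equiv> g (ci z) (M.\<Psi> cc (ci z) a) (M.\<Psi> cc (ci z) b)"
abbreviation "thc z v \<equiv> \<theta> (ci z) (M.\<Psi> cc (ci z) v)"
abbreviation "Jc i j z a \<equiv> M.\<Phi> cc (ci z) (\<rho> (s (ci z)) (cl2 i j) (M.\<Psi> cc (ci z) a))"
abbreviation "wc z v i j \<equiv> \<omega> (s (ci z)) (tangent_map A P s (ci z) (M.\<Psi> cc (ci z) v)) $ i $ j"

lemma coordinate_field: "smooth_vector_field A (fst cc) (\<lambda>y. M.\<Psi> cc y a)"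
  by (rule M.coordinate_field[OF cc M.chart_open(1)[OF cc] order_refl])

lemma coordinate_field_N: "smooth_vector_field A N (\<lambda>y. M.\<Psi> cc y a)"
  by (rule M.coordinate_field[OF cc N(1,2)])

lemma gc_smooth: "smooth_on (snd cc ` N) (\<lambda>z. gc z a b)"
proof -
  have "smooth_fun A (fst cc) (\<lambda>y. g y (M.\<Psi> cc y a) (M.\<Psi> cc y b))"
    using metric_in_class[OF g] coordinate_field unfolding riemannian_metric_def by blast
  from M.smooth_fun_coord[OF this cc] show ?thesis by (rule smooth_on_subset) (use N(2) in auto)
qed

lemma thc_smooth: "smooth_on (snd cc ` N) (\<lambda>z. thc z a)"
proof -
  have "smooth_fun A (fst cc) (\<lambda>y. \<theta> y (M.\<Psi> cc y a))"
    using \<theta> coordinate_field unfolding Lee_form_def one_form_def by blast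
  from M.smooth_fun_coord[OF this cc] show ?thesis by (rule smooth_on_subset) (use N(2) in auto)
qed

lemma J_field: "smooth_vector_field A N (\<lambda>y. \<rho> (s y) (cl2 i j) (M.\<Psi> cc y a))"
proof (rule \<rho>_smooth[OF sN _ _ coordinate_field_N])
  show "smooth_fun A N (\<lambda>y. cl2 i j)"
    by (rule M.smooth_funI[OF cc N(1,2) smooth_on_const[of _ "cl2 i j"]]) simp
  show "(\<lambda>y. cl2 i j) ` N \<subseteq> cl_even" using cl2_even by blast
qed

lemma Jc_smooth: "smooth_on (snd cc ` N) (\<lambda>z. Jc i j z a)"
  using M.vector_field_coord[OF J_field[of i j a] cc] N(2) by (simp add: Int_absorb1)

definition \<sigma> where "\<sigma> = snd d \<circ> s \<circ> ci"

lemma \<sigma>_smooth: "smooth_on (snd cc ` N) \<sigma>"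
  using s cc d unfolding smooth_section_def smooth_map_def \<sigma>_def N_def by blast

lemma \<sigma>_val: "y \<in> N \<Longrightarrow> \<sigma> (snd cc y) = snd d (s y)"
  using N(2) M.chart_inv[OF cc] unfolding \<sigma>_def by auto

text \<open>The section is differentiated in the charts \<open>cc\<close> and \<open>d\<close>; the tangent map itself refers to charts that
change from point to point.\<close>
lemma tangent_section:
  assumes y: "y \<in> N"
  shows "tangent_map A P s y (M.\<Psi> cc y v) = B.\<Psi> d (s y) (frechet_derivative \<sigma> (at (snd cc y)) v)"
proof -
  let ?a = "chart_at P (s y)"
  have a: "?a \<in> P" "s y \<in> fst ?a" by (rule B.chart_at)+
  have yc: "y \<in> fst cc" "s y \<in> fst d" using y unfolding N_def by auto
  have z: "snd cc y \<in> snd cc ` N" using y by blast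
  have D: "(snd ?a \<circ> s \<circ> ci has_derivative B.\<Psi> d (s y) \<circ> frechet_derivative \<sigma> (at (snd cc y))) (at (snd cc y))"
  proof (rule has_derivative_transform_within_open[OF _ N(4) z])
    show "((snd ?a \<circ> chart_inv d) \<circ> \<sigma> has_derivative B.\<Psi> d (s y) \<circ> frechet_derivative \<sigma> (at (snd cc y))) (at (snd cc y))"
    proof (rule diff_chain_at[OF smooth_on_has_derivative[OF \<sigma>_smooth z]])
      show "(snd ?a \<circ> chart_inv d has_derivative B.\<Psi> d (s y)) (at (\<sigma> (snd cc y)))"
        unfolding \<sigma>_val[OF y] B.\<Psi>_def by (rule B.transition_has_derivative[OF d a(1) yc(2) a(2)])
    qed
    show "((snd ?a \<circ> chart_inv d) \<circ> \<sigma>) z = (snd ?a \<circ> s \<circ> ci) z" if "z \<in> snd cc ` N" for z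
      using that B.chart_inv[OF d] M.chart_inv[OF cc] unfolding \<sigma>_def N_def by auto
  qed
  have "tangent_map A P s y (M.\<Psi> cc y v) = frechet_derivative ((snd ?a \<circ> s) \<circ> ci) (at (snd cc y)) (M.\<Phi> cc y (M.\<Psi> cc y v))"
    unfolding tangent_map_def by (rule M.chart_change[OF cc yc(1) differentiableI[OF D]])
  then show ?thesis unfolding M.\<Phi>_\<Psi>[OF cc yc(1)] frechet_derivative_eq[OF D] by simp
qed

lemma wc_val: "y \<in> N \<Longrightarrow> wc (snd cc y) v i j = \<omega> (s y) (B.\<Psi> d (s y) (frechet_derivative \<sigma> (at (snd cc y)) v)) $ i $ j"
  using tangent_section[of y v] N(2) M.chart_inv[OF cc] by auto

lemma \<omega>_form: "one_form P \<omega>" "transpose (\<omega> p v) = - \<omega> p v"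
  using parts(2) unfolding principal_connection_def by blast+

lemma wc_linear: "y \<in> N \<Longrightarrow> linear (\<lambda>v. wc (snd cc y) v i j)"
proof -
  assume y: "y \<in> N"
  have l1: "linear (\<omega> (s y))" using \<omega>_form(1) unfolding one_form_def by blast
  have l2: "linear (B.\<Psi> d (s y))" using B.\<Psi>_linear[OF d] y unfolding N_def by blast
  have l3: "linear (frechet_derivative \<sigma> (at (snd cc y)))"
    using smooth_on_differentiable[OF \<sigma>_smooth] y by (intro linear_frechet_derivative) blast
  show ?thesis unfolding wc_val[OF y]
    by (rule linearI) (simp_all add: linear_add[OF l1] linear_add[OF l2] linear_add[OF l3] linear_scale[OF l1] linear_scale[OF l2] linear_scale[OF l3])
qed

text \<open>Smoothness of a one-form is known along fields of the total space, so the derivative of the section is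
expanded in the coordinate fields of \<open>d\<close>.\<close>
lemma wc_smooth: "smooth_on (snd cc ` N) (\<lambda>z. wc z v i j)"
proof -
  let ?q = "\<lambda>\<zeta> b. \<omega> (chart_inv d \<zeta>) (B.\<Psi> d (chart_inv d \<zeta>) b)"
  have q: "smooth_on (snd d ` fst d) (\<lambda>\<zeta>. ?q \<zeta> b)" for b
  proof -
    have "smooth_fun P (fst d) (\<lambda>p. \<omega> p (B.\<Psi> d p b))"
      using \<omega>_form(1) B.coordinate_field[OF d B.chart_open(1)[OF d] order_refl, of b] unfolding one_form_def by blast
    from B.smooth_fun_coord[OF this d] show ?thesis by simp
  qed
  have bl: "bounded_linear (\<lambda>M :: 'r sqmat. M $ i $ j)"
    using bounded_linear_compose[OF bounded_linear_vec_nth bounded_linear_vec_nth] .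
  have comp: "smooth_on (snd cc ` N) (\<lambda>z. ?q (\<sigma> z) b $ i $ j)" for b
  proof (rule smooth_on_bounded_linear[OF bl N(4)], rule smooth_on_compose[OF N(4) B.chart_open(2)[OF d] \<sigma>_smooth q])
    show "\<sigma> ` snd cc ` N \<subseteq> snd d ` fst d" using \<sigma>_val unfolding N_def by auto
  qed
  have fr: "smooth_on (snd cc ` N) (\<lambda>z. frechet_derivative \<sigma> (at z) v \<bullet> b)" for b
    by (rule smooth_on_bounded_linear[OF bounded_linear_inner_left N(4) smooth_on_frechet_derivative[OF \<sigma>_smooth]])
  show ?thesis
  proof (rule smooth_on_cong[OF N(4)])
    show "smooth_on (snd cc ` N) (\<lambda>z. \<Sum>b\<in>Basis. (frechet_derivative \<sigma> (at z) v \<bullet> b) *\<^sub>R (?q (\<sigma> z) b $ i $ j))"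
      by (rule smooth_on_sum[OF N(4)], rule smooth_on_scaleR[OF N(4) fr comp])
    fix z assume "z \<in> snd cc ` N"
    then obtain y where y: "y \<in> N" "z = snd cc y" by blast
    have yd: "s y \<in> fst d" using y unfolding N_def by blast
    have l1: "linear (\<omega> (s y))" using \<omega>_form(1) unfolding one_form_def by blast
    have l2: "linear (B.\<Psi> d (s y))" by (rule B.\<Psi>_linear[OF d yd])
    let ?f = "frechet_derivative \<sigma> (at z) v"
    have "\<omega> (s y) (B.\<Psi> d (s y) ?f) = \<omega> (s y) (B.\<Psi> d (s y) (\<Sum>b\<in>Basis. (?f \<bullet> b) *\<^sub>R b))"
      by (simp only: euclidean_representation)
    also have "\<dots> = (\<Sum>b\<in>Basis. (?f \<bullet> b) *\<^sub>R \<omega> (s y) (B.\<Psi> d (s y) b))"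
      by (simp only: linear_sum[OF l2] linear_scale[OF l2] linear_sum[OF l1] linear_scale[OF l1])
    finally have e: "\<omega> (s y) (B.\<Psi> d (s y) ?f) = (\<Sum>b\<in>Basis. (?f \<bullet> b) *\<^sub>R \<omega> (s y) (B.\<Psi> d (s y) b))" .
    show "(\<Sum>b\<in>Basis. (?f \<bullet> b) *\<^sub>R (?q (\<sigma> z) b $ i $ j)) = wc z v i j"
      unfolding y(2) wc_val[OF y(1)] unfolding y(2)[symmetric] e
      unfolding y(2) \<sigma>_val[OF y(1)] B.chart_inv[OF d yd] by simp
  qed
qed

text \<open>Each condition is the corresponding clause of the definition of a Clifford-Weyl structure, evaluated on
coordinate fields of the chart and on the constant sections \<open>e\<^sub>i \<cdot> e\<^sub>j\<close> of the frame \<open>s\<close>.\<close>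
lemma coordinates: "clifford_weyl_coordinates (snd cc ` N) (\<lambda>z a b. gc z a b) (M.\<Gamma> D cc) (\<lambda>z v. thc z v) (\<lambda>i j z a. Jc i j z a) (\<lambda>z v i j. wc z v i j)"
proof (rule clifford_weyl_coordinates.intro)
  have pt: "\<exists>y. y \<in> N \<and> y \<in> fst cc \<and> z = snd cc y \<and> ci z = y \<and> \<pi> (s y) = y" if "z \<in> snd cc ` N" for z
    using that N(2) M.chart_inv[OF cc] sN unfolding smooth_section_def by auto
  have gb: "bilinear (g x)" "g x u v = g x v u" "v \<noteq> 0 \<Longrightarrow> g x v v > 0" for x u v
    using metric_in_class[OF g] unfolding riemannian_metric_def by blast+
  have G: "z \<in> snd cc ` N \<Longrightarrow> z \<in> snd cc ` fst cc" for z using N(5) by blast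
  note Pl = linear_add[OF M.\<Psi>_linear[OF cc]] linear_scale[OF M.\<Psi>_linear[OF cc]] linear_neg[OF M.\<Psi>_linear[OF cc]] linear_0[OF M.\<Psi>_linear[OF cc]]
  note Fl = linear_add[OF M.\<Phi>_linear[OF cc]] linear_scale[OF M.\<Phi>_linear[OF cc]] linear_neg[OF M.\<Phi>_linear[OF cc]]
  show "open (snd cc ` N)" by (rule N(4))
  show "smooth_on (snd cc ` N) (\<lambda>z. gc z a b)" for a b by (rule gc_smooth)
  show "smooth_on (snd cc ` N) (\<lambda>z. thc z v)" for v by (rule thc_smooth)
  show "smooth_on (snd cc ` N) (\<lambda>z. Jc i j z a)" for i j a by (rule Jc_smooth)
  show "smooth_on (snd cc ` N) (\<lambda>z. wc z v i j)" for v i j by (rule wc_smooth)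
  show "smooth_on (snd cc ` N) (\<lambda>z. M.\<Gamma> D cc z v a)" for v a
    by (rule smooth_on_subset[OF M.\<Gamma>_smooth[OF D_props(1) cc] N(5)])
  fix z assume z: "z \<in> snd cc ` N"
  obtain y where y: "y \<in> N" "y \<in> fst cc" "z = snd cc y" "ci z = y" "\<pi> (s y) = y" using pt[OF z] by blast
  note PF = M.\<Phi>_\<Psi>[OF cc y(2)] M.\<Psi>_\<Phi>[OF cc y(2)]
  show "bilinear (M.\<Gamma> D cc z)" by (rule M.\<Gamma>_bilinear[OF D_props(1) cc G[OF z]])
  show "M.\<Gamma> D cc z v a = M.\<Gamma> D cc z a v" for v a by (rule M.\<Gamma>_symmetric[OF D_props(1) cc D_props(2) G[OF z]])
  show "bilinear (\<lambda>a b. gc z a b)"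
    unfolding y(4) bilinear_def
    by (auto intro!: linearI simp: Pl[OF y(2)] bilinear_ladd[OF gb(1)] bilinear_radd[OF gb(1)] bilinear_lmul[OF gb(1)] bilinear_rmul[OF gb(1)])
  show "gc z a b = gc z b a" for a b by (rule gb(2))
  show "gc z a a > 0" if "a \<noteq> 0" for a
  proof (unfold y(4), rule gb(3))
    show "M.\<Psi> cc y a \<noteq> 0" using that PF(1)[of a] linear_0[OF M.\<Phi>_linear[OF cc y(2)]] by metis
  qed
  show "linear (\<lambda>v. thc z v)"
  proof -
    have "linear (\<theta> y)" using \<theta> unfolding Lee_form_def one_form_def by blast
    from linear_compose[OF M.\<Psi>_linear[OF cc y(2)] this] show ?thesis unfolding y(4) by (simp add: o_def)
  qed
  have rl: "linear (\<rho> p (cl2 i j))" for p i j by (rule \<rho>_linear[OF cl2_even])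
  show "linear (\<lambda>a. Jc i j z a)" for i j
    using linear_compose[OF linear_compose[OF M.\<Psi>_linear[OF cc y(2)] rl] M.\<Phi>_linear[OF cc y(2)]] unfolding y(4) by (simp add: o_def)
  show "Jc i j z (Jc j k z a) = - Jc i k z a" for i j k a
    unfolding y(4) PF \<rho>_mult[OF cl2_even cl2_even, symmetric] cl2_mult \<rho>_minus[OF cl2_even] by (rule Fl(3)[OF y(2)])
  show "Jc i i z a = - a" for i a
    unfolding y(4) cl2_diag \<rho>_minus[OF cl_one_even] \<rho>_one Fl(3)[OF y(2)] PF ..
  show "Jc j i z a = - Jc i j z a" if "i \<noteq> j" for i j a
    unfolding y(4) cl2_anti[OF that] \<rho>_minus[OF cl2_even] by (rule Fl(3)[OF y(2)])
  show "gc z (Jc i j z a) b = - gc z a (Jc i j z b)" if "i \<noteq> j" for i j a b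
    unfolding y(4) PF using \<rho>_skew[OF cl2_Lambda2[OF that] g, of "s y"] unfolding y(5) by blast
  show "linear (\<lambda>v. wc z v i j)" for i j unfolding y(3) by (rule wc_linear[OF y(1)])
  show "wc z v j i = - wc z v i j" for v i j
    using arg_cong[OF \<omega>_form(2)[of "s (ci z)" "tangent_map A P s (ci z) (M.\<Psi> cc (ci z) v)"], of "\<lambda>M. M $ i $ j"] by (simp add: transpose_def)
  show "frechet_derivative (\<lambda>z. gc z a b) (at z) v = gc z (M.\<Gamma> D cc z v a) b + gc z a (M.\<Gamma> D cc z v b) - 2 * thc z v * gc z a b" for a b v
  proof -
    have sf: "smooth_fun A (fst cc) (\<lambda>y. g y (M.\<Psi> cc y a) (M.\<Psi> cc y b))"
      using metric_in_class[OF g] coordinate_field unfolding riemannian_metric_def by blast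
    have df: "dfun A (\<lambda>y. g y (M.\<Psi> cc y a) (M.\<Psi> cc y b)) y (M.\<Psi> cc y v) = frechet_derivative (\<lambda>z. gc z a b) (at z) v"
      using M.dfun_coord[OF sf cc y(2) y(2), of "M.\<Psi> cc y v"] unfolding PF y(3)[symmetric] .
    have "dfun A (\<lambda>y. g y (M.\<Psi> cc y a) (M.\<Psi> cc y b)) y (M.\<Psi> cc y v)
        - g y (D (\<lambda>y. M.\<Psi> cc y a) y (M.\<Psi> cc y v)) (M.\<Psi> cc y b) - g y (M.\<Psi> cc y a) (D (\<lambda>y. M.\<Psi> cc y b) y (M.\<Psi> cc y v))
       = - 2 * \<theta> y (M.\<Psi> cc y v) * g y (M.\<Psi> cc y a) (M.\<Psi> cc y b)"
      using \<theta> coordinate_field[of a] coordinate_field[of b] y(2) unfolding Lee_form_def by blast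
    then show ?thesis
      unfolding df M.D_coord_field[OF D_props(1) cc y(2)] y(4) y(3)[symmetric] by simp
  qed
  show "frechet_derivative (\<lambda>z. Jc i j z a) (at z) v + M.\<Gamma> D cc z v (Jc i j z a) - Jc i j z (M.\<Gamma> D cc z v a)
       = (\<Sum>k\<in>UNIV. wc z v k i *\<^sub>R Jc k j z a + wc z v k j *\<^sub>R Jc i k z a)" for i j a v
  proof -
    let ?B = "\<omega> (s y) (tangent_map A P s y (M.\<Psi> cc y v))"
    have sc: "smooth_fun A N (\<lambda>y. cl2 i j)"
      by (rule M.smooth_funI[OF cc N(1,2) smooth_on_const[of _ "cl2 i j"]]) simp
    have ce: "(\<lambda>y. cl2 i j) ` N \<subseteq> cl_even" using cl2_even by blast
    have "D (\<lambda>y. \<rho> (s y) (cl2 i j) (M.\<Psi> cc y a)) y (M.\<Psi> cc y v) - \<rho> (s y) (cl2 i j) (D (\<lambda>y. M.\<Psi> cc y a) y (M.\<Psi> cc y v))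
        = \<rho> (s y) (nabla_cl A P \<omega> s (\<lambda>y. cl2 i j) y (M.\<Psi> cc y v)) (M.\<Psi> cc y a)"
      using parts(5) sN sc ce coordinate_field_N[of a] y(1) unfolding parallel_morphism_def by blast
    moreover have "D (\<lambda>y. \<rho> (s y) (cl2 i j) (M.\<Psi> cc y a)) y (M.\<Psi> cc y v)
        = M.\<Psi> cc y (frechet_derivative (\<lambda>z. Jc i j z a) (at (snd cc y)) v + M.\<Gamma> D cc (snd cc y) v (Jc i j (snd cc y) a))"
    proof (rule M.D_coord[OF D_props(1) cc N(1,2) y(1) Jc_smooth])
      fix x assume "x \<in> N"
      then have "x \<in> fst cc" using N(2) by blast
      then show "\<rho> (s x) (cl2 i j) (M.\<Psi> cc x a) = M.\<Psi> cc x (Jc i j (snd cc x) a)"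
        by (simp add: M.chart_inv[OF cc] M.\<Psi>_\<Phi>[OF cc])
    qed
    moreover have "nabla_cl A P \<omega> s (\<lambda>y. cl2 i j) y (M.\<Psi> cc y v) = (\<Sum>k\<in>UNIV. ?B $ k $ i *\<^sub>R cl2 k j + ?B $ k $ j *\<^sub>R cl2 i k)"
    proof -
      have "dfun A (\<lambda>y. cl2 i j) y (M.\<Psi> cc y v) = 0"
        unfolding M.dfun_coord[OF sc cc y(2) y(1)] by (simp add: frechet_derivative_const)
      then show ?thesis unfolding nabla_cl_def cl_der_cl2[OF \<omega>_form(2)] by simp
    qed
    ultimately have e: "M.\<Psi> cc y (frechet_derivative (\<lambda>z. Jc i j z a) (at z) v + M.\<Gamma> D cc z v (Jc i j z a))
        - \<rho> (s y) (cl2 i j) (M.\<Psi> cc y (M.\<Gamma> D cc z v a))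
        = (\<Sum>k\<in>UNIV. ?B $ k $ i *\<^sub>R \<rho> (s y) (cl2 k j) (M.\<Psi> cc y a) + ?B $ k $ j *\<^sub>R \<rho> (s y) (cl2 i k) (M.\<Psi> cc y a))"
      unfolding M.D_coord_field[OF D_props(1) cc y(2)] y(3)[symmetric] by (simp add: \<rho>_cl2_sum)
    note Fy = M.\<Phi>_linear[OF cc y(2)]
    from arg_cong[OF e, of "M.\<Phi> cc y"]
    show ?thesis
      unfolding linear_diff[OF Fy] linear_sum[OF Fy] linear_add[OF Fy] linear_scale[OF Fy] PF y(4) .
  qed
qed

end

end

section \<open>Fibres on which the Clifford morphism is not injective\<close>

context clifford_weyl_manifold
begin

lemma act_mult: "k \<in> carrier PSO \<Longrightarrow> l \<in> carrier PSO \<Longrightarrow> act (act p k) l = act p (k \<otimes>\<^bsub>PSO\<^esub> l)"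
  and fibre: "\<pi> p = \<pi> q \<Longrightarrow> \<exists>k\<in>carrier PSO. q = act p k"
  and local_section: "\<exists>W s. x \<in> W \<and> smooth_section A P \<pi> W s"
proof -
  note m = parts(1)[unfolded principal_PSO_bundle_def]
  note m' = m[THEN conjunct2, THEN conjunct2, THEN conjunct2]
  show "act (act p k) l = act p (k \<otimes>\<^bsub>PSO\<^esub> l)" if "k \<in> carrier PSO" "l \<in> carrier PSO"
    using m'[THEN conjunct1] that by blast
  note m'' = m'[THEN conjunct2, THEN conjunct2]
  show "\<exists>k\<in>carrier PSO. q = act p k" if "\<pi> p = \<pi> q" using m''[THEN conjunct1] that by blast
  show "\<exists>W s. x \<in> W \<and> smooth_section A P \<pi> W s" using m''[THEN conjunct2] by blast
qed

definition degenerate :: "'p \<Rightarrow> bool" where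
  "degenerate p \<longleftrightarrow> (\<exists>a\<in>cl_Lambda2. a \<noteq> 0 \<and> (\<forall>v. \<rho> p a v = 0))"

lemma degenerate_of_not_inj:
  assumes "\<not> inj_on (\<lambda>a. \<rho> p a) cl_Lambda2"
  shows "degenerate p"
proof -
  obtain a b where ab: "a \<in> cl_Lambda2" "b \<in> cl_Lambda2" "\<rho> p a = \<rho> p b" "a \<noteq> b"
    using assms unfolding inj_on_def by blast
  have L: "subspace (cl_Lambda2 :: 'r cl set)" unfolding cl_Lambda2_def by (rule subspace_span)
  have e: "a \<in> cl_even" "b \<in> cl_even" using ab Lambda2_even by blast+
  have "- b \<in> cl_even" using subspace_neg[OF subspace_cl_even e(2)] .
  then have "\<rho> p (a + - b) v = 0" for v using \<rho>_add[OF e(1), of "- b" p v] \<rho>_minus[OF e(2), of p v] ab(3) by simp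
  moreover have "a + - b \<in> cl_Lambda2" using subspace_diff[OF L ab(1,2)] by simp
  moreover have "a + - b \<noteq> 0" using ab(4) by simp
  ultimately show ?thesis unfolding degenerate_def by blast
qed

text \<open>Two frames over the same point differ by an element of \<open>SO\<close>, which maps \<open>\<Lambda>\<^sup>2\<close> to itself.\<close>
lemma degenerate_fibre:
  assumes "\<pi> p = \<pi> q" "degenerate p"
  shows "degenerate q"
proof -
  obtain k where k: "k \<in> carrier PSO" "p = act q k" using fibre[of q p] assms(1) by auto
  obtain h where h: "h \<in> carrier SO" "k = PSO_class h" using carrier_PSO_E[OF k(1)] .
  obtain a where a: "a \<in> cl_Lambda2" "a \<noteq> 0" "\<forall>v. \<rho> p a v = 0" using assms(2) unfolding degenerate_def by blast
  have sh: "assoc_cl act p a = assoc_cl act q (cl_act h a)"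
    unfolding k(2) h(2) by (rule assoc_cl_shift[OF act_mult h(1)])
  have o: "orthogonal_matrix h" "orthogonal_matrix (transpose h)" "transpose h ** h = mat 1"
    using h(1) SO_transpose[OF h(1)] by (auto simp: orthogonal_matrix_def)
  have "cl_act (transpose h) (cl_act h a) = a"
    unfolding cl_act_compose[OF o(2)] o(3) by (rule cl_act_identity)
  then have "cl_act h a \<noteq> 0" using a(2) linear_0[OF cl_act_linear] by metis
  then show ?thesis
    unfolding degenerate_def using cl_act_Lambda2[OF o(1) a(1)] a(3) unfolding sh by blast
qed

lemma degenerate_relation:
  assumes "degenerate p"
  shows "\<exists>\<kappa> k l. (\<forall>i j. \<kappa> j i = - \<kappa> i j) \<and> \<kappa> k l \<noteq> (0::real) \<and> (\<forall>v. (\<Sum>i\<in>UNIV. \<Sum>j\<in>UNIV. \<kappa> i j *\<^sub>R \<rho> p (cl2 i j) v) = 0)"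
proof -
  obtain a where a: "a \<in> cl_Lambda2" "a \<noteq> 0" "\<forall>v. \<rho> p a v = 0" using assms unfolding degenerate_def by blast
  obtain \<kappa> where \<kappa>: "\<forall>i j. \<kappa> j i = - \<kappa> i j" "a = (\<Sum>i\<in>UNIV. \<Sum>j\<in>UNIV. \<kappa> i j *\<^sub>R cl2 i j)"
    using Lambda2_expand[OF a(1)] by blast
  have "\<exists>k l. \<kappa> k l \<noteq> 0"
  proof (rule ccontr)
    assume "\<nexists>k l. \<kappa> k l \<noteq> 0"
    then show False using a(2) unfolding \<kappa>(2) by simp
  qed
  moreover have "(\<Sum>i\<in>UNIV. \<Sum>j\<in>UNIV. \<kappa> i j *\<^sub>R \<rho> p (cl2 i j) v) = 0" for v
  proof -
    have ev: "\<kappa> i j *\<^sub>R cl2 i j \<in> cl_even" for i j by (rule subspace_scale[OF subspace_cl_even cl2_even])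
    have "\<rho> p a v = (\<Sum>i\<in>UNIV. \<rho> p (\<Sum>j\<in>UNIV. \<kappa> i j *\<^sub>R cl2 i j) v)"
      unfolding \<kappa>(2) by (rule \<rho>_sum) (use subspace_sum[OF subspace_cl_even ev] in auto)
    also have "\<dots> = (\<Sum>i\<in>UNIV. \<Sum>j\<in>UNIV. \<kappa> i j *\<^sub>R \<rho> p (cl2 i j) v)"
    proof (rule sum.cong[OF refl])
      fix i
      have "\<rho> p (\<Sum>j\<in>UNIV. \<kappa> i j *\<^sub>R cl2 i j) v = (\<Sum>j\<in>UNIV. \<rho> p (\<kappa> i j *\<^sub>R cl2 i j) v)"
        by (rule \<rho>_sum) (use ev in auto)
      then show "\<rho> p (\<Sum>j\<in>UNIV. \<kappa> i j *\<^sub>R cl2 i j) v = (\<Sum>j\<in>UNIV. \<kappa> i j *\<^sub>R \<rho> p (cl2 i j) v)"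
        by (simp only: \<rho>_scale[OF cl2_even])
    qed
    finally show ?thesis using a(3) by simp
  qed
  ultimately show ?thesis using \<kappa>(1) by blast
qed

lemma degenerate_of_relation:
  assumes d: "distinct [a, b, c', d]" and rel: "\<And>v. \<rho> p (cl2 c' d) v + t *\<^sub>R \<rho> p (cl2 a b) v = 0"
  shows "degenerate p"
proof -
  let ?a = "cl2 c' d + t *\<^sub>R cl2 a b"
  have L: "subspace (cl_Lambda2 :: 'r cl set)" unfolding cl_Lambda2_def by (rule subspace_span)
  have "?a \<in> cl_Lambda2"
    using d by (intro subspace_add[OF L] subspace_scale[OF L] cl2_Lambda2) auto
  moreover have "?a \<noteq> 0"
  proof -
    have "sym_diff {c'} {d} = {c', d}" "sym_diff {a} {b} \<noteq> {c', d}" using d by auto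
    \<comment> \<open>The two bivectors are multiples of different basis elements of the Clifford algebra.\<close>
    then have "?a $ {c', d} = blade_sign {c'} {d}" unfolding cl2_axis by (simp add: axis_def)
    moreover have "blade_sign {c'} {d} \<noteq> 0" by (simp add: blade_sign_def)
    ultimately show ?thesis by (metis zero_index)
  qed
  moreover have "\<rho> p ?a v = 0" for v
    using rel[of v] \<rho>_add[OF cl2_even subspace_scale[OF subspace_cl_even cl2_even], of p c' d t a b v]
    by (simp only: \<rho>_scale[OF cl2_even])
  ultimately show ?thesis unfolding degenerate_def by blast
qed

context
  fixes g \<theta> cc d W s
  assumes g: "g \<in> c" and \<theta>: "Lee_form A D g \<theta>" and cc: "cc \<in> A" and d: "d \<in> P" and s: "smooth_section A P \<pi> W s"
begin

interpretation K: clifford_weyl_coordinates "snd cc ` N cc d W s" "gc g cc" "M.\<Gamma> D cc" "thc \<theta> cc" "Jc cc s" "wc cc s"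
  by (rule coordinates[OF g \<theta> cc d s])

abbreviation "NN \<equiv> N cc d W s"

lemma JE_apply: "y \<in> NN \<Longrightarrow> Rep_endo (K.JE (snd cc y) i j) v = M.\<Phi> cc y (\<rho> (s y) (cl2 i j) (M.\<Psi> cc y v))"
  using K.JE[of "snd cc y" i j] M.chart_inv[OF cc, of y] N(2)[OF g \<theta> cc d s] by auto

lemma trace_of_degenerate:
  assumes r: "CARD('r) = 4" and y: "y \<in> NN" and deg: "degenerate (s y)"
  shows "\<exists>a b c' d'. distinct [a, b, c', d'] \<and> (endo_tr (K.JE (snd cc y) a b * K.JE (snd cc y) c' d'))\<^sup>2 = (real DIM('e))\<^sup>2"
proof -
  have yc: "y \<in> fst cc" using y N(2)[OF g \<theta> cc d s] by blast
  note L = M.\<Phi>_linear[OF cc yc]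
  obtain \<kappa> k l where \<kappa>: "\<forall>i j. \<kappa> j i = - \<kappa> i j" "\<kappa> k l \<noteq> (0::real)"
    "\<forall>v. (\<Sum>i\<in>UNIV. \<Sum>j\<in>UNIV. \<kappa> i j *\<^sub>R \<rho> (s y) (cl2 i j) v) = 0" using degenerate_relation[OF deg] by blast
  have "(\<Sum>i\<in>UNIV. \<Sum>j\<in>UNIV. \<kappa> i j *\<^sub>R K.JE (snd cc y) i j) = 0"
  proof (rule endo_eqI)
    fix v
    have "Rep_endo (\<Sum>i\<in>UNIV. \<Sum>j\<in>UNIV. \<kappa> i j *\<^sub>R K.JE (snd cc y) i j) v
        = M.\<Phi> cc y (\<Sum>i\<in>UNIV. \<Sum>j\<in>UNIV. \<kappa> i j *\<^sub>R \<rho> (s y) (cl2 i j) (M.\<Psi> cc y v))"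
      by (simp only: Rep_endo_sum scaleR_endo.rep_eq JE_apply[OF y] linear_sum[OF L] linear_scale[OF L])
    then show "Rep_endo (\<Sum>i\<in>UNIV. \<Sum>j\<in>UNIV. \<kappa> i j *\<^sub>R K.JE (snd cc y) i j) v = Rep_endo 0 v"
      using \<kappa>(3) linear_0[OF L] by (simp only: zero_endo.rep_eq)
  qed
  from K.volume_trace_of_relation[OF _ r this _ \<kappa>(2)] y \<kappa>(1) show ?thesis by blast
qed

lemma degenerate_of_trace:
  assumes y: "y \<in> NN" and dis: "distinct [a, b, c', d']"
    and tr: "(endo_tr (K.JE (snd cc y) a b * K.JE (snd cc y) c' d'))\<^sup>2 = (real DIM('e))\<^sup>2"
  shows "degenerate (s y)"
proof -
  have yc: "y \<in> fst cc" using y N(2)[OF g \<theta> cc d s] by blast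
  note L = M.\<Psi>_linear[OF cc yc]
  obtain t where t: "K.JE (snd cc y) c' d' + t *\<^sub>R K.JE (snd cc y) a b = 0"
    using K.relation_of_volume_trace[OF _ dis tr] y by blast
  show ?thesis
  proof (rule degenerate_of_relation[OF dis])
    fix v
    have "Rep_endo (K.JE (snd cc y) c' d' + t *\<^sub>R K.JE (snd cc y) a b) (M.\<Phi> cc y v) = 0"
      unfolding t by (simp add: zero_endo.rep_eq)
    from arg_cong[OF this, of "M.\<Psi> cc y"]
    show "\<rho> (s y) (cl2 c' d') v + t *\<^sub>R \<rho> (s y) (cl2 a b) v = 0"
      by (simp only: plus_endo.rep_eq scaleR_endo.rep_eq JE_apply[OF y] linear_add[OF L] linear_scale[OF L] linear_0[OF L] M.\<Psi>_\<Phi>[OF cc yc])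
  qed
qed

text \<open>By \<open>trace_of_degenerate\<close> and \<open>degenerate_of_trace\<close>, degeneracy amounts to \<open>(tr (J\<^sub>a\<^sub>b J\<^sub>c\<^sub>d))\<^sup>2 = n\<^sup>2\<close>, and
this trace is constant on a ball of the chart.\<close>
lemma degenerate_locally_constant_section:
  assumes r: "CARD('r) = 4" and y: "y \<in> NN"
  shows "\<exists>V. open V \<and> y \<in> V \<and> V \<subseteq> NN \<and> (\<forall>x\<in>V. degenerate (s x) = degenerate (s y))"
proof -
  note N = N[OF g \<theta> cc d s]
  obtain e where e: "e > 0" "ball (snd cc y) e \<subseteq> snd cc ` NN"
    using N(4) y open_contains_ball by blast
  define V where "V = NN \<inter> snd cc -` ball (snd cc y) e"
  have "continuous_on (fst cc) (snd cc)" using M.chart_homeo[OF cc] by (simp add: homeomorphism_def)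
  then have "continuous_on NN (snd cc)" using N(2) by (rule continuous_on_subset)
  then have "open V" unfolding V_def using continuous_open_preimage[OF _ N(1) open_ball] by blast
  moreover have "y \<in> V" "V \<subseteq> NN" using y e(1) by (auto simp: V_def)
  moreover have *: "degenerate (s x)" if x': "x' \<in> V" and x: "x \<in> V" and deg: "degenerate (s x')" for x x'
  proof -
    have xN: "x \<in> NN" "x' \<in> NN" using x x' unfolding V_def by auto
    obtain a b c' d' where dis: "distinct [a, b, c', d']"
      and tr: "(endo_tr (K.JE (snd cc x') a b * K.JE (snd cc x') c' d'))\<^sup>2 = (real DIM('e))\<^sup>2"
      using trace_of_degenerate[OF r xN(2) deg] by blast
    have "card (set [a, b, c', d']) = CARD('r)" using distinct_card[OF dis] r by simp
    then have U: "UNIV = {a, b, c', d'}" using card_subset_eq[of UNIV "set [a, b, c', d']"] by simp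
    have "endo_tr (K.JE (snd cc x') a b * K.JE (snd cc x') c' d') = endo_tr (K.JE (snd cc x) a b * K.JE (snd cc x) c' d')"
      by (rule K.volume_trace_constant[OF dis U convex_ball e(2)]) (use x x' in \<open>auto simp: V_def\<close>)
    with tr show ?thesis using degenerate_of_trace[OF xN(1) dis] by simp
  qed
  ultimately show ?thesis using \<open>y \<in> V\<close> by blast
qed

lemma d\<theta>_coordinates_zero:
  assumes y: "y \<in> NN" and r2: "CARD('r) \<ge> 2"
    and n: "(DIM('e), CARD('r)) \<notin> {(2,2), (4,2), (4,3), (4,4), (8,8), (8,4)} \<or>
      (DIM('e), CARD('r)) = (8, 4) \<and> degenerate (s y)"
  shows "frechet_derivative (\<lambda>z. thc \<theta> cc z v) (at (snd cc y)) u = frechet_derivative (\<lambda>z. thc \<theta> cc z u) (at (snd cc y)) v"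
proof -
  have "\<exists>a b c' d'. distinct [a, b, c', d'] \<and> endo_tr (K.JE (snd cc y) a b * K.JE (snd cc y) c' d') \<noteq> 0"
    if n: "(DIM('e), CARD('r)) = (8, 4)" and deg: "degenerate (s y)"
  proof -
    obtain a b c' d' where t: "distinct [a, b, c', d']"
      "(endo_tr (K.JE (snd cc y) a b * K.JE (snd cc y) c' d'))\<^sup>2 = (real DIM('e))\<^sup>2"
      using trace_of_degenerate[OF _ y deg] n by blast
    have "endo_tr (K.JE (snd cc y) a b * K.JE (snd cc y) c' d') \<noteq> 0"
    proof
      assume "endo_tr (K.JE (snd cc y) a b * K.JE (snd cc y) c' d') = 0"
      then show False using t(2) by simp
    qed
    then show ?thesis using t(1) by blast
  qed
  then have "K.d\<theta> (snd cc y) u v = 0"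
    using n y by (intro K.d\<theta>_zero[OF _ r2]) blast+
  then show ?thesis unfolding K.d\<theta>_def by simp
qed

end

lemma Lee_form_exists: "\<exists>g\<in>c. \<exists>\<theta>. Lee_form A D g \<theta>"
proof -
  obtain g0 where c: "c = {(\<lambda>x u v. exp (2 * f x) * g0 x u v) | f. smooth_fun A UNIV f}"
    using conf unfolding conformal_manifold_def conformal_class_def by blast
  have "smooth_fun A UNIV (\<lambda>x. 0 :: real)"
    unfolding M.smooth_fun_iff o_def by (intro conjI ballI open_UNIV continuous_on_const smooth_on_const)
  then have "(\<lambda>x u v. exp (2 * (\<lambda>x. 0 :: real) x) * g0 x u v) \<in> c"
    unfolding c by (intro CollectI exI[of _ "\<lambda>x. 0 :: real"] conjI refl)
  then show ?thesis using parts(3) unfolding Weyl_connection_def by blast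
qed

lemma degenerate_locally_constant:
  assumes r: "CARD('r) = 4"
  shows "\<exists>V. open V \<and> x \<in> V \<and> (\<forall>p q. \<pi> p \<in> V \<longrightarrow> \<pi> q \<in> V \<longrightarrow> degenerate p \<longrightarrow> degenerate q)"
proof -
  obtain g \<theta> where g: "g \<in> c" and \<theta>: "Lee_form A D g \<theta>" using Lee_form_exists by blast
  obtain W s where s: "x \<in> W" "smooth_section A P \<pi> W s" using local_section by blast
  have x: "x \<in> N (chart_at A x) (chart_at P (s x)) W s"
    unfolding N_def[OF g \<theta> M.chart_at(1) B.chart_at(1) s(2)] using s(1) M.chart_at(2) B.chart_at(2) by blast
  from degenerate_locally_constant_section[OF g \<theta> M.chart_at(1) B.chart_at(1) s(2) r x]
  obtain V where V: "open V" "x \<in> V" "V \<subseteq> N (chart_at A x) (chart_at P (s x)) W s"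
    "\<forall>y\<in>V. degenerate (s y) = degenerate (s x)" by blast
  have sec: "\<pi> (s y) = y" if "y \<in> V" for y
    using that V(3) N(3)[OF g \<theta> M.chart_at(1) B.chart_at(1) s(2)] s(2) unfolding smooth_section_def by blast
  have "degenerate q" if "\<pi> p \<in> V" "\<pi> q \<in> V" "degenerate p" for p q
    using degenerate_fibre[of p "s (\<pi> p)"] degenerate_fibre[of "s (\<pi> q)" q] V(4) sec that by metis
  then show ?thesis using V(1,2) by blast
qed

text \<open>The points with degenerate fibre and the other points form two disjoint open sets.\<close>
lemma degenerate_everywhere:
  assumes r: "CARD('r) = 4" and deg: "degenerate p"
  shows "degenerate q"
proof (rule ccontr)
  assume nd: "\<not> degenerate q"
  let ?S = "{x. \<exists>p. \<pi> p = x \<and> degenerate p}" and ?T = "{x. \<exists>p. \<pi> p = x \<and> \<not> degenerate p}"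
  have sur: "\<exists>p. \<pi> p = x" for x using local_section[of x] unfolding smooth_section_def by blast
  have "open ?S"
  proof (subst open_subopen, intro ballI)
    fix x assume "x \<in> ?S"
    then obtain p where p: "\<pi> p = x" "degenerate p" by blast
    obtain V where V: "open V" "x \<in> V" "\<And>p q. \<pi> p \<in> V \<Longrightarrow> \<pi> q \<in> V \<Longrightarrow> degenerate p \<Longrightarrow> degenerate q"
      using degenerate_locally_constant[OF r, of x] by blast
    have "y \<in> ?S" if "y \<in> V" for y
    proof -
      obtain q where q: "\<pi> q = y" using sur by blast
      then show ?thesis using V(3)[of p q] V(2) p that by auto
    qed
    then show "\<exists>T. open T \<and> x \<in> T \<and> T \<subseteq> ?S" using V(1,2) by (intro exI[of _ V]) blast
  qed
  moreover have "open ?T"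
  proof (subst open_subopen, intro ballI)
    fix x assume "x \<in> ?T"
    then obtain p where p: "\<pi> p = x" "\<not> degenerate p" by blast
    obtain V where V: "open V" "x \<in> V" "\<And>p q. \<pi> p \<in> V \<Longrightarrow> \<pi> q \<in> V \<Longrightarrow> degenerate p \<Longrightarrow> degenerate q"
      using degenerate_locally_constant[OF r, of x] by blast
    have "y \<in> ?T" if "y \<in> V" for y
    proof -
      obtain q where q: "\<pi> q = y" using sur by blast
      then show ?thesis using V(3)[of q p] V(2) p that by auto
    qed
    then show "\<exists>T. open T \<and> x \<in> T \<and> T \<subseteq> ?T" using V(1,2) by (intro exI[of _ V]) blast
  qed
  moreover have "?S \<inter> ?T \<inter> UNIV = {}"
  proof (rule equals0I)
    fix x assume "x \<in> ?S \<inter> ?T \<inter> UNIV"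
    then obtain p q where "\<pi> p = x" "degenerate p" "\<pi> q = x" "\<not> degenerate q" by blast
    then show False using degenerate_fibre[of p q] by simp
  qed
  moreover have "UNIV \<subseteq> ?S \<union> ?T" using sur by blast
  moreover have "connected (UNIV :: 'm set)" using conf unfolding conformal_manifold_def by blast
  ultimately have "?S \<inter> UNIV = {} \<or> ?T \<inter> UNIV = {}" by (intro connectedD)
  then show False using deg nd by blast
qed

lemma closed_of_exceptions:
  assumes r2: "CARD('r) \<ge> 2"
    and n: "(DIM('e), CARD('r)) \<notin> {(2,2), (4,2), (4,3), (4,4), (8,8), (8,4)} \<or>
      (DIM('e), CARD('r)) = (8, 4) \<and> (\<exists>p. degenerate p)"
  shows "closed_Weyl A c D"
  unfolding closed_Weyl_def
proof (intro ballI allI impI)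
  fix g \<theta> W' X Y x
  assume g: "g \<in> c" and \<theta>: "Lee_form A D g \<theta>" and X: "smooth_vector_field A W' X" and Y: "smooth_vector_field A W' Y" and x: "x \<in> W'"
  obtain W s where s: "x \<in> W" "smooth_section A P \<pi> W s" using local_section by blast
  have xN: "x \<in> N (chart_at A x) (chart_at P (s x)) W s"
    unfolding N_def[OF g \<theta> M.chart_at(1) B.chart_at(1) s(2)] using s(1) M.chart_at(2) B.chart_at(2) by blast
  have "(DIM('e), CARD('r)) \<notin> {(2,2), (4,2), (4,3), (4,4), (8,8), (8,4)} \<or>
      (DIM('e), CARD('r)) = (8, 4) \<and> degenerate (s x)"
    using n degenerate_everywhere by blast
  from d\<theta>_coordinates_zero[OF g \<theta> M.chart_at(1) B.chart_at(1) s(2) xN r2 this, of "Y x" "X x"]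
  have "frechet_derivative (\<lambda>z. thc \<theta> (chart_at A x) z (Y x)) (at (snd (chart_at A x) x)) (X x)
     = frechet_derivative (\<lambda>z. thc \<theta> (chart_at A x) z (X x)) (at (snd (chart_at A x) x)) (Y x)" .
  moreover have "one_form A \<theta>" using \<theta> unfolding Lee_form_def by blast
  ultimately show "ext_deriv A \<theta> X Y x = 0" using M.ext_deriv_coord[OF _ X Y x] by simp
qed

end

theorem theorem1:
  fixes A :: "('m::{t2_space, second_countable_topology}, 'e::euclidean_space) chart set"
    and c :: "('m \<Rightarrow> 'e \<Rightarrow> 'e \<Rightarrow> real) set"
    and P :: "('p::{t2_space, second_countable_topology}, 'f::euclidean_space) chart set"
    and \<pi> :: "'p \<Rightarrow> 'm"
    and act :: "'p \<Rightarrow> 'r::{finite, linorder} sqmat set \<Rightarrow> 'p"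
    and \<phi> :: "('p \<times> 'r cl) set \<Rightarrow> 'e \<Rightarrow> 'e"
    and \<omega> :: "'p \<Rightarrow> 'f \<Rightarrow> 'r sqmat"
    and D :: "('m, 'e) cov_deriv"
  assumes "conformal_manifold A c"
    and "CARD('r) \<ge> 2"
    and "Clifford_Weyl_structure A c P \<pi> act \<phi> \<omega> D"
  shows "((DIM('e), CARD('r)) \<notin> {(2,2), (4,2), (4,3), (4,4), (8,8), (8,4)} \<longrightarrow> closed_Weyl A c D) \<and>
         ((DIM('e), CARD('r)) = (8,4) \<and> \<not> injective_on_Lambda2 act \<phi> \<longrightarrow> closed_Weyl A c D)"
proof -
  interpret clifford_weyl_manifold A c P \<pi> act \<phi> \<omega> D
    using assms(1,3) by (rule clifford_weyl_manifold.intro)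
  show ?thesis
  proof (intro conjI impI)
    assume "(DIM('e), CARD('r)) \<notin> {(2,2), (4,2), (4,3), (4,4), (8,8), (8,4)}"
    then show "closed_Weyl A c D" by (intro closed_of_exceptions[OF assms(2)] disjI1)
  next
    assume "(DIM('e), CARD('r)) = (8,4) \<and> \<not> injective_on_Lambda2 act \<phi>"
    then show "closed_Weyl A c D"
      unfolding injective_on_Lambda2_def using degenerate_of_not_inj by (intro closed_of_exceptions[OF assms(2)] disjI2) blast
  qed
qed

end
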